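(* Let $\Omega=\mathbb{T}_\tau\setminus\overline{D}$, $D=\bigcup_{j=1}^M D_j$, be a finitely-connected torus with $M$ holes satisfying the assumption described in the context, and let $g\in C_0(\partial\Omega)$. There exists a unique $\phi\in C_0(\partial\Omega)$ that satisfies $$\tfrac12\phi(z_0)+\mathrm{K}^*[\phi](z_0)=g(z_0),\qquad z_0\in\partial\Omega.$$ A solution to the Neumann boundary value problem $\Delta u=0$ in $\Omega$, $\partial_\nu u=g$ on $\partial\Omega$, is represented as $$u(z)=\mathcal{S}[\phi](z)+C,\qquad z\in\Omega,$$ for any $C\in\mathbb{R}$. The quantity $$\int_{\partial D_j}g(\xi)\,|d\xi|=\int_{\partial D_j}\phi(\xi)\,|d\xi|$$ can be interpreted as the flux across $\partial D_j$, for $j=1,2,\dots,M$.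
   Context: Torus and domain. Let $\tau=a+bi$ with $b>0$, $\Lambda_\tau=\mathbb{Z}+\mathbb{Z}\tau$, and let $\mathbb{T}_\tau=\mathbb{C}/\Lambda_\tau$ be the flat torus with area $b$; functions on $\mathbb{T}_\tau$ are doubly-periodic functions with periods $1$ and $\tau$, and $z=x+iy$ is identified with $(x,y)\in\mathbb{R}^2$. Assumption on the domain: the holes $D_j\subset\mathbb{C}$, $j=1,\dots,M$, removed from the torus are open, simply-connected sets with disjoint closures, and each has a $C^2$ boundary $\partial D_j$. Put $D=\bigcup_{j=1}^M D_j$ and $\Omega=\mathbb{T}_\tau\setminus\overline D$, so $\partial\Omega=\bigcup_{j=1}^M\partial D_j=\partial D$, positively oriented with respect to $\Omega$. The unit normal $\nu(z)$ at $z\in\partial\Omega$ points into $D$. $C(\partial\Omega)$ is the space of continuous real-valued functions on $\partial\Omega$, $|d\xi|$ denotes arc length, and $C_0(\partial\Omega)=\{g\in C(\partial\Omega):\int_{\partial\Omega}g(\xi)\,|d\xi|=0\}$. Green's function. With $q=e^{\pi i\tau}$ and $\vartheta_1(z)=-i\sum_{n\in\mathbb{Z}}(-1)^n q^{(n+1/2)^2}e^{(2n+1)\pi i z}$, set $$G(z)=-\frac1{2\pi}\log|\vartheta_1(z)|+\frac1{2b}(\Im z)^2,\qquad z\in\mathbb{T}_\tau.$$ $G$ is doubly-periodic and satisfies $\Delta G=\frac1b-\delta$ on $\mathbb{T}_\tau$, where $\delta$ is the Dirac delta. Layer potentials. For $\phi\in C(\partial\Omega)$, $$\mathcal{S}[\phi](z)=\int_{\partial\Omega}G(z-\xi)\phi(\xi)\,|d\xi|,\quad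 z\in\mathbb{T}_\tau,\qquad \mathrm{K}^*[\phi](z_0)=\mathrm{p.v.}\int_{\partial\Omega}\partial_{\nu_z}G(z_0-\xi)\phi(\xi)\,|d\xi|,\quad z_0\in\partial\Omega,$$ where p.v. denotes the Cauchy principal value and $\partial_{\nu_z}G(z_0-\xi)$ is the derivative of $z\mapsto G(z-\xi)$ at $z=z_0$ in the direction $\nu(z_0)$. Normal derivative and flux. The normal derivative of $u$ at $z_0\in\partial\Omega$, taken from $\Omega$, is $\partial_\nu u(z_0^+)=\lim_{\Omega\ni z\to z_0}\nu(z_0)\cdot\nabla u(z)$; the flux of $u$ across $\partial D_j$ refers to $\int_{\partial D_j}\partial_\nu u(z^+)\,|dz|$.
   Formalization: The normal derivative is the limit of ν(z₀)·∇u(z) as z→z₀ in Ω within every cone about the normal (non-tangential), not with unrestricted approach; for merely continuous g the unrestricted limit can fail to exist, so the claim as written is false. *)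

theory Defs
  imports "HOL-Analysis.Analysis"
begin

text \<open>
  The torus is treated through its universal cover: functions on (subsets of) the torus are
  functions on (lattice-invariant subsets of) the complex plane with periods 1 and \<open>\<tau>\<close>.
  The holes are given by representatives \<open>D j \<subseteq> \<complex>\<close> for \<open>j \<in> {1..M}\<close>, and the boundary of
  the domain is the union of the frontiers of these representatives.
\<close>

definition lattice :: "complex \<Rightarrow> complex set" where
  "lattice \<tau> = {of_int m + of_int n * \<tau> | m n. True}"

definition doubly_periodic_on :: "complex set \<Rightarrow> complex \<Rightarrow> (complex \<Rightarrow> 'a) \<Rightarrow> bool" where
  "doubly_periodic_on S \<tau> u \<longleftrightarrow> (\<forall>z\<in>S. u (z + 1) = u z \<and> u (z + \<tau>) = u z)"

subsection \<open>Domain\<close>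

text \<open>
  \<open>\<gamma>\<close> is a regular 1-periodic \<open>C\<^sup>2\<close> parametrisation, injective on a period, of the boundary of
  \<open>D\<close>. Its orientation is left free: arc length integrals and the normal do not depend on it.
\<close>

definition C2_boundary :: "complex set \<Rightarrow> (real \<Rightarrow> complex) \<Rightarrow> bool" where
  "C2_boundary D \<gamma> \<longleftrightarrow>
     frontier D = \<gamma> ` {0..1} \<and> (\<forall>t. \<gamma> (t + 1) = \<gamma> t) \<and> inj_on \<gamma> {0..<1} \<and>
     (\<exists>\<gamma>' \<gamma>''. (\<forall>t. (\<gamma> has_vector_derivative \<gamma>' t) (at t) \<and> \<gamma>' t \<noteq> 0) \<and>
              (\<forall>t. (\<gamma>' has_vector_derivative \<gamma>'' t) (at t)) \<and> continuous_on UNIV \<gamma>'')"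

definition boundary :: "nat \<Rightarrow> (nat \<Rightarrow> complex set) \<Rightarrow> complex set" where
  "boundary M D = (\<Union>j\<in>{1..M}. frontier (D j))"

text \<open>The preimage in the plane of the torus minus the closed holes.\<close>

definition Omega :: "complex \<Rightarrow> nat \<Rightarrow> (nat \<Rightarrow> complex set) \<Rightarrow> complex set" where
  "Omega \<tau> M D = - (\<Union>j\<in>{1..M}. \<Union>l\<in>lattice \<tau>. (\<lambda>z. z + l) ` closure (D j))"

text \<open>
  Disjointness of the closures in the torus; the case \<open>i = j\<close>, \<open>l \<noteq> 0\<close> says that
  each closed hole embeds in the torus.
\<close>

definition disjoint_closures :: "complex \<Rightarrow> nat \<Rightarrow> (nat \<Rightarrow> complex set) \<Rightarrow> bool" where
  "disjoint_closures \<tau> M D \<longleftrightarrow>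
     (\<forall>i\<in>{1..M}. \<forall>j\<in>{1..M}. \<forall>l\<in>lattice \<tau>.
        i \<noteq> j \<or> l \<noteq> 0 \<longrightarrow> closure (D i) \<inter> (\<lambda>z. z + l) ` closure (D j) = {})"

text \<open>The unit normal at a boundary point, pointing into the holes.\<close>

definition unit_normal ::
  "nat \<Rightarrow> (nat \<Rightarrow> complex set) \<Rightarrow> (nat \<Rightarrow> real \<Rightarrow> complex) \<Rightarrow> complex \<Rightarrow> complex" where
  "unit_normal M D \<gamma> z = (THE n. norm n = 1 \<and>
     (\<forall>j\<in>{1..M}. \<forall>t. \<gamma> j t = z \<longrightarrow> n \<bullet> vector_derivative (\<gamma> j) (at t) = 0) \<and>
     (\<forall>\<^sub>F s in at_right 0. z + of_real s * n \<in> (\<Union>j\<in>{1..M}. D j)))"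

subsection \<open>Arc length integrals\<close>

definition arc_integral :: "(real \<Rightarrow> complex) \<Rightarrow> (complex \<Rightarrow> real) \<Rightarrow> real" where
  "arc_integral \<gamma> f = integral {0..1} (\<lambda>t. f (\<gamma> t) * norm (vector_derivative \<gamma> (at t)))"

definition boundary_integral :: "nat \<Rightarrow> (nat \<Rightarrow> real \<Rightarrow> complex) \<Rightarrow> (complex \<Rightarrow> real) \<Rightarrow> real" where
  "boundary_integral M \<gamma> f = (\<Sum>j=1..M. arc_integral (\<gamma> j) f)"

definition mean_zero_functions ::
  "nat \<Rightarrow> (nat \<Rightarrow> complex set) \<Rightarrow> (nat \<Rightarrow> real \<Rightarrow> complex) \<Rightarrow> (complex \<Rightarrow> real) set" where
  "mean_zero_functions M D \<gamma> =
     {f. continuous_on (boundary M D) f \<and> boundary_integral M \<gamma> f = 0}"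

subsection \<open>Differential operators\<close>

definition dir_deriv :: "complex \<Rightarrow> (complex \<Rightarrow> real) \<Rightarrow> complex \<Rightarrow> real" where
  "dir_deriv v u z = deriv (\<lambda>s::real. u (z + of_real s * v)) 0"

definition grad :: "(complex \<Rightarrow> real) \<Rightarrow> complex \<Rightarrow> complex" where
  "grad u z = Complex (dir_deriv 1 u z) (dir_deriv \<i> u z)"

definition laplacian :: "(complex \<Rightarrow> real) \<Rightarrow> complex \<Rightarrow> real" where
  "laplacian u z = dir_deriv 1 (dir_deriv 1 u) z + dir_deriv \<i> (dir_deriv \<i> u) z"

definition C2_on :: "complex set \<Rightarrow> (complex \<Rightarrow> real) \<Rightarrow> bool" where
  "C2_on S u \<longleftrightarrow> u differentiable_on S \<and>
     (\<forall>v\<in>{1, \<i>}. dir_deriv v u differentiable_on S \<and>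
        (\<forall>w\<in>{1, \<i>}. continuous_on S (dir_deriv w (dir_deriv v u))))"

subsection \<open>Green's function and layer potentials\<close>

text \<open>
  \<open>q powr ((n + 1/2)\<^sup>2)\<close> with \<open>q = exp (\<pi> \<i> \<tau>)\<close> is read as \<open>exp (\<pi> \<i> \<tau> (n + 1/2)\<^sup>2)\<close>,
  which avoids the branch of the logarithm.
\<close>

definition theta1 :: "complex \<Rightarrow> complex \<Rightarrow> complex" where
  "theta1 \<tau> z = - \<i> * (\<Sum>\<^sub>\<infinity>n::int. (-1) powi n *
     exp (of_real pi * \<i> * \<tau> * (of_int n + 1/2)\<^sup>2) *
     exp (of_int (2 * n + 1) * of_real pi * \<i> * z))"

text \<open>On the lattice, where \<open>theta1\<close> vanishes, the value is irrelevant (\<open>ln 0 = 0\<close>).\<close>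

definition Green :: "complex \<Rightarrow> complex \<Rightarrow> real" where
  "Green \<tau> z = - 1 / (2 * pi) * ln (norm (theta1 \<tau> z)) + 1 / (2 * Im \<tau>) * (Im z)\<^sup>2"

definition single_layer ::
  "complex \<Rightarrow> nat \<Rightarrow> (nat \<Rightarrow> real \<Rightarrow> complex) \<Rightarrow> (complex \<Rightarrow> real) \<Rightarrow> complex \<Rightarrow> real" where
  "single_layer \<tau> M \<gamma> \<phi> z = boundary_integral M \<gamma> (\<lambda>\<xi>. Green \<tau> (z - \<xi>) * \<phi> \<xi>)"

definition Kstar_truncated ::
  "complex \<Rightarrow> nat \<Rightarrow> (nat \<Rightarrow> complex set) \<Rightarrow> (nat \<Rightarrow> real \<Rightarrow> complex) \<Rightarrow>
     (complex \<Rightarrow> real) \<Rightarrow> complex \<Rightarrow> real \<Rightarrow> real" where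
  "Kstar_truncated \<tau> M D \<gamma> \<phi> z\<^sub>0 \<epsilon> = boundary_integral M \<gamma> (\<lambda>\<xi>.
     if \<epsilon> < dist \<xi> z\<^sub>0
     then dir_deriv (unit_normal M D \<gamma> z\<^sub>0) (\<lambda>z. Green \<tau> (z - \<xi>)) z\<^sub>0 * \<phi> \<xi> else 0)"

definition Kstar ::
  "complex \<Rightarrow> nat \<Rightarrow> (nat \<Rightarrow> complex set) \<Rightarrow> (nat \<Rightarrow> real \<Rightarrow> complex) \<Rightarrow>
     (complex \<Rightarrow> real) \<Rightarrow> complex \<Rightarrow> real" where
  "Kstar \<tau> M D \<gamma> \<phi> z\<^sub>0 = Lim (at_right 0) (Kstar_truncated \<tau> M D \<gamma> \<phi> z\<^sub>0)"

text \<open>\<open>Lim\<close> is only meaningful when the limit exists, so this is tracked separately.\<close>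

definition Kstar_converges ::
  "complex \<Rightarrow> nat \<Rightarrow> (nat \<Rightarrow> complex set) \<Rightarrow> (nat \<Rightarrow> real \<Rightarrow> complex) \<Rightarrow>
     (complex \<Rightarrow> real) \<Rightarrow> complex \<Rightarrow> bool" where
  "Kstar_converges \<tau> M D \<gamma> \<phi> z\<^sub>0 \<longleftrightarrow>
     (\<exists>l. (Kstar_truncated \<tau> M D \<gamma> \<phi> z\<^sub>0 \<longlongrightarrow> l) (at_right 0))"

subsection \<open>Neumann problem and flux\<close>

text \<open>
  The limit of \<open>\<nu>(z\<^sub>0) \<bullet> grad u z\<close> as \<open>z \<rightarrow> z\<^sub>0\<close> in the domain is non-tangential: \<open>z\<close> ranges over
  the part of the domain in a cone with vertex \<open>z\<^sub>0\<close> about the normal direction, for every aperture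
  short of a half-plane. Tangential approach has to be excluded for merely continuous boundary data:
  the tangential derivative of a single layer potential may be unbounded near boundary points
  arbitrarily close to \<open>z\<^sub>0\<close>, and on a curved boundary it contributes to the component along the
  fixed vector \<open>\<nu>(z\<^sub>0)\<close>.
\<close>

definition has_normal_deriv ::
  "complex \<Rightarrow> nat \<Rightarrow> (nat \<Rightarrow> complex set) \<Rightarrow> (nat \<Rightarrow> real \<Rightarrow> complex) \<Rightarrow>
     (complex \<Rightarrow> real) \<Rightarrow> complex \<Rightarrow> real \<Rightarrow> bool" where
  "has_normal_deriv \<tau> M D \<gamma> u z\<^sub>0 d \<longleftrightarrow>
     (\<forall>c>0. ((\<lambda>z. unit_normal M D \<gamma> z\<^sub>0 \<bullet> grad u z) \<longlongrightarrow> d)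
        (at z\<^sub>0 within {z \<in> Omega \<tau> M D. c * dist z z\<^sub>0 \<le> unit_normal M D \<gamma> z\<^sub>0 \<bullet> (z\<^sub>0 - z)}))"

definition normal_deriv ::
  "complex \<Rightarrow> nat \<Rightarrow> (nat \<Rightarrow> complex set) \<Rightarrow> (nat \<Rightarrow> real \<Rightarrow> complex) \<Rightarrow>
     (complex \<Rightarrow> real) \<Rightarrow> complex \<Rightarrow> real" where
  "normal_deriv \<tau> M D \<gamma> u z\<^sub>0 = (THE d. has_normal_deriv \<tau> M D \<gamma> u z\<^sub>0 d)"

definition flux ::
  "complex \<Rightarrow> nat \<Rightarrow> (nat \<Rightarrow> complex set) \<Rightarrow> (nat \<Rightarrow> real \<Rightarrow> complex) \<Rightarrow>
     (complex \<Rightarrow> real) \<Rightarrow> nat \<Rightarrow> real" where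
  "flux \<tau> M D \<gamma> u j = arc_integral (\<gamma> j) (normal_deriv \<tau> M D \<gamma> u)"

definition neumann_solution ::
  "complex \<Rightarrow> nat \<Rightarrow> (nat \<Rightarrow> complex set) \<Rightarrow> (nat \<Rightarrow> real \<Rightarrow> complex) \<Rightarrow>
     (complex \<Rightarrow> real) \<Rightarrow> (complex \<Rightarrow> real) \<Rightarrow> bool" where
  "neumann_solution \<tau> M D \<gamma> g u \<longleftrightarrow>
     doubly_periodic_on (Omega \<tau> M D) \<tau> u \<and>
     C2_on (Omega \<tau> M D) u \<and> (\<forall>z\<in>Omega \<tau> M D. laplacian u z = 0) \<and>
     (\<forall>z\<^sub>0\<in>boundary M D. has_normal_deriv \<tau> M D \<gamma> u z\<^sub>0 (g z\<^sub>0))"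

end

theory Submission
  imports Defs "HOL-Complex_Analysis.Complex_Analysis"
begin

text \<open>
  By the Jacobi triple product \<open>\<theta>\<^sub>1\<close> vanishes exactly on the lattice, to first order,
  so \<open>G(z) + log |z| / (2\<pi>)\<close> is smooth near 0. On a \<open>C\<^sup>2\<close> curve the kernel of \<open>K\<^sup>*\<close> is therefore
  continuous, hence \<open>K\<^sup>*\<close> is a compact operator on continuous functions and the Fredholm
  alternative applies. For a mean-zero density \<open>S[\<phi>]\<close> is doubly periodic, continuous and harmonic
  off the boundary curves, and its normal derivative tends to \<open>\<plusminus>\<phi>/2 + K\<^sup>*[\<phi>]\<close> from the two sides,
  by comparison of the kernel with that of the tangent line. If the limit from \<open>\<Omega>\<close> vanishes,
  Hopf's boundary point lemma together with the strong maximum principle forces \<open>S[\<phi>]\<close> to be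
  constant; then the limit from the holes vanishes as well, and the difference of the two limits
  gives \<open>\<phi> = 0\<close>. Integrating the kernel over \<open>\<partial>D\<^sub>j\<close> shows that \<open>1/2 + K\<^sup>*\<close> preserves the integral
  over each \<open>\<partial>D\<^sub>j\<close> of a mean-zero density.
\<close>

subsection \<open>The theta function\<close>

text \<open>For a merely continuous density the gradient of the potential may be unbounded near the
  boundary, so an energy argument by Green's identities does not apply directly. What can be
  controlled are limits inside cones, and Hopf's lemma asks only for the limit along the normal. The
  maximum set of the potential is propagated through the whole plane instead of through components
  of \<Omega>: it crosses every curve by means of tangent balls of one uniform radius on both sides,
  and the maximum principle fills the hole.

  The constant background \<open>1/b\<close> in the Laplacian of G spoils conservation of mass: over
  one curve the left-hand side of the integral equation integrates to the integral of the density
  plus a multiple of its total mass. The Fredholm alternative is therefore used with a corrected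
  kernel on all continuous functions, where a mean-zero right-hand side forces mean-zero solutions,
  and not on the mean-zero functions themselves. The operator theory is set up for bounded
  continuous functions on one Euclidean space; this is why the family of curves is encoded as
  parallel lines in a plane.\<close>

definition theta_term :: "complex \<Rightarrow> complex \<Rightarrow> int \<Rightarrow> complex" where
  "theta_term \<tau> z n = (-1) powi n * exp (of_real pi * \<i> * (\<tau> * (of_int n + 1/2)\<^sup>2 + of_int (2 * n + 1) * z))"

lemma theta1_eq: "theta1 \<tau> z = - \<i> * (\<Sum>\<^sub>\<infinity>n. theta_term \<tau> z n)"
proof -
  have "(-1) powi n * exp (of_real pi * \<i> * \<tau> * (of_int n + 1/2)\<^sup>2) *
      exp (of_int (2 * n + 1) * of_real pi * \<i> * z) = theta_term \<tau> z n" for n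
    unfolding theta_term_def mult.assoc exp_add[symmetric] by (simp add: algebra_simps)
  thus ?thesis by (simp only: theta1_def)
qed

lemma norm_powi_minus_one: "norm ((-1::complex) powi n) = 1"
  by (simp add: norm_power_int)

lemma norm_theta_term:
  "norm (theta_term \<tau> z n) = exp (- pi * Im \<tau> * (of_int n + 1/2)\<^sup>2 - 2 * pi * (of_int n + 1/2) * Im z)"
proof -
  have sq: "(complex_of_int n + 1/2)\<^sup>2 = of_real ((of_int n + 1/2)\<^sup>2)" by simp
  have "Im (\<tau> * (complex_of_int n + 1/2)\<^sup>2) = Im \<tau> * (of_int n + 1/2)\<^sup>2"
    unfolding sq by (simp del: of_real_power of_real_add)
  moreover have "Im (complex_of_int (2 * n + 1) * z) = of_int (2 * n + 1) * Im z"
    by simp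
  ultimately show ?thesis
    unfolding theta_term_def norm_mult norm_powi_minus_one norm_exp_eq_Re
    by (simp add: algebra_simps)
qed

lemma summable_exp_neg_abs_int: "(\<lambda>n::int. exp (- \<bar>real_of_int n\<bar>)) summable_on UNIV"
proof -
  have s: "(\<lambda>n::nat. exp (- real n)) summable_on UNIV"
  proof -
    have "summable (\<lambda>n. exp (-1::real) ^ n)"
      by (rule summable_geometric) simp
    moreover have "exp (-1::real) ^ n = exp (- real n)" for n
      by (simp flip: exp_of_nat_mult)
    ultimately have "summable (\<lambda>n::nat. exp (- real n))" by simp
    thus ?thesis by (simp add: summable_on_UNIV_nonneg_real_iff)
  qed
  have "(\<lambda>n::int. exp (- \<bar>real_of_int n\<bar>)) summable_on range int"
    by (subst summable_on_reindex) (use s in \<open>auto simp: o_def\<close>)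
  moreover have "(\<lambda>n::int. exp (- \<bar>real_of_int n\<bar>)) summable_on range (\<lambda>n. - int n)"
    by (subst summable_on_reindex) (use s in \<open>auto simp: o_def inj_on_def\<close>)
  ultimately have "(\<lambda>n::int. exp (- \<bar>real_of_int n\<bar>)) summable_on (range int \<union> range (\<lambda>n. - int n))"
    by (rule summable_on_union)
  moreover have "range int \<union> range (\<lambda>n. - int n) = UNIV"
    by (auto simp: image_iff) (metis int_cases2)
  ultimately show ?thesis by simp
qed

text \<open>The exponent is a negative quadratic in \<open>n + 1/2\<close> plus a term linear in it.
  For bounded \<open>z\<close>, completing the square leaves room for a factor decaying like
  \<open>exp (- \<bar>n\<bar>)\<close>. The majorant serves both for holomorphy and for the Fourier
  coefficient that shows theta to be nontrivial.\<close>

lemma theta_term_bound: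
  assumes "Im \<tau> > 0"
  shows "\<exists>C. \<forall>z n. norm z \<le> R \<longrightarrow> norm (theta_term \<tau> z n) \<le> C * exp (- \<bar>real_of_int n\<bar>)"
proof -
  \<comment> \<open>In \<open>?d\<close> the part \<open>2 * pi * \<bar>R\<bar>\<close> absorbs the
    linear term and the extra 1 supplies the decay; the inequality is
    \<open>c x^2 - d x \<ge> - d^2 / (4 c)\<close>.\<close>
  let ?c = "pi * Im \<tau>" and ?d = "2 * pi * \<bar>R\<bar> + 1"
  have c: "?c > 0" using assms by simp
  have c0: "?c \<noteq> 0" using c by linarith
  have "norm (theta_term \<tau> z n) \<le> exp (?d\<^sup>2 / (4 * ?c) + 1/2) * exp (- \<bar>real_of_int n\<bar>)"
    if "norm z \<le> R" for z n
  proof -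
    define x where "x = \<bar>real_of_int n + 1/2\<bar>"
    have iz: "\<bar>Im z\<bar> \<le> \<bar>R\<bar>" using that abs_Im_le_cmod[of z] by linarith
    have "- (2 * pi * (of_int n + 1/2) * Im z) \<le> \<bar>2 * pi * (of_int n + 1/2) * Im z\<bar>" by linarith
    also have "\<dots> = 2 * pi * x * \<bar>Im z\<bar>" by (simp add: abs_mult x_def)
    also have "\<dots> \<le> 2 * pi * x * \<bar>R\<bar>" using iz by (intro mult_left_mono) (auto simp: x_def)
    finally have 1: "- (2 * pi * (of_int n + 1/2) * Im z) \<le> 2 * pi * x * \<bar>R\<bar>" .
    have "0 \<le> ?c * (x - ?d / (2 * ?c))\<^sup>2" using c by (simp only: less_imp_le mult_nonneg_nonneg zero_le_power2)
    also have "\<dots> = ?c * x\<^sup>2 - ?d * x + ?d\<^sup>2 / (4 * ?c)"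
    proof -
      have "c * (x - d / (2 * c))\<^sup>2 = c * x\<^sup>2 - d * x + d\<^sup>2 / (4 * c)" if "c \<noteq> 0" for c d :: real
        using that by (simp add: power2_eq_square field_simps)
      from this[OF c0] show ?thesis .
    qed
    finally have 2: "?d * x \<le> ?c * x\<^sup>2 + ?d\<^sup>2 / (4 * ?c)" by linarith
    have 3: "\<bar>real_of_int n\<bar> \<le> x + 1/2" unfolding x_def by linarith
    have x2: "x\<^sup>2 = (of_int n + 1/2)\<^sup>2" unfolding x_def by simp
    have 4: "- pi * Im \<tau> * (of_int n + 1/2)\<^sup>2 - 2 * pi * (of_int n + 1/2) * Im z
        \<le> ?d\<^sup>2 / (4 * ?c) + 1/2 - \<bar>real_of_int n\<bar>"
      using 1 2 3 unfolding x2[symmetric] by (simp add: algebra_simps)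
    show ?thesis unfolding norm_theta_term using 4 by (simp flip: exp_add add: algebra_simps)
  qed
  thus ?thesis by blast
qed

lemma theta_uniform_limit:
  assumes "Im \<tau> > 0"
  shows "uniform_limit (cball 0 R) (\<lambda>X z. \<Sum>n\<in>X. theta_term \<tau> z n)
           (\<lambda>z. \<Sum>\<^sub>\<infinity>n. theta_term \<tau> z n) (finite_subsets_at_top UNIV)"
proof -
  obtain C where C: "\<And>z n. norm z \<le> R \<Longrightarrow> norm (theta_term \<tau> z n) \<le> C * exp (- \<bar>real_of_int n\<bar>)"
    using theta_term_bound[OF assms] by blast
  show ?thesis
    by (rule Weierstrass_m_test_general[where M = "\<lambda>n. C * exp (- \<bar>real_of_int n\<bar>)"])
       (auto intro: C summable_on_cmult_right summable_exp_neg_abs_int)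
qed

lemma theta1_holomorphic:
  assumes "Im \<tau> > 0"
  shows "theta1 \<tau> holomorphic_on A"
proof -
  have "(\<lambda>z. \<Sum>\<^sub>\<infinity>n. theta_term \<tau> z n) field_differentiable at z" for z
  proof -
    have "\<forall>\<^sub>F X in finite_subsets_at_top UNIV.
        continuous_on (cball 0 (norm z + 1)) (\<lambda>z. \<Sum>n\<in>X. theta_term \<tau> z n) \<and>
        (\<lambda>z. \<Sum>n\<in>X. theta_term \<tau> z n) holomorphic_on ball 0 (norm z + 1)"
      unfolding theta_term_def
      by (intro always_eventually allI conjI continuous_intros holomorphic_intros)
    then have "(\<lambda>z. \<Sum>\<^sub>\<infinity>n. theta_term \<tau> z n) holomorphic_on ball 0 (norm z + 1)"
      by (rule holomorphic_uniform_limit[OF _ theta_uniform_limit[OF assms]]) auto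
    moreover have "z \<in> ball 0 (norm z + 1)" by simp
    ultimately show ?thesis
      by (metis holomorphic_on_imp_differentiable_at open_ball)
  qed
  hence "(\<lambda>z. \<Sum>\<^sub>\<infinity>n. theta_term \<tau> z n) holomorphic_on A"
    using holomorphic_on_def field_differentiable_at_within by blast
  hence "(\<lambda>z. - \<i> * (\<Sum>\<^sub>\<infinity>n. theta_term \<tau> z n)) holomorphic_on A"
    by (intro holomorphic_intros)
  thus ?thesis by (simp add: theta1_eq[abs_def])
qed

section \<open>Quasi-periodicity and parity of the theta function\<close>

lemma exp_odd_pi_i: "exp (of_real pi * \<i> * of_int (2 * n + 1)) = (-1 :: complex)"
proof -
  have "exp (of_real pi * \<i> * of_int (2 * n + 1)) = exp (2 * of_int n * of_real pi * \<i>) * exp (of_real pi * \<i>)"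
    by (simp add: algebra_simps flip: exp_add)
  also have "exp (2 * of_int n * of_real pi * \<i>) = 1"
    using exp_integer_2pi[of "of_int n"] by (simp add: mult_ac)
  finally show ?thesis by simp
qed

lemma theta1_add_1: "theta1 \<tau> (z + 1) = - theta1 \<tau> z"
proof -
  have "theta_term \<tau> (z + 1) n = - theta_term \<tau> z n" for n
  proof -
    have "theta_term \<tau> (z + 1) n = theta_term \<tau> z n * exp (of_real pi * \<i> * of_int (2 * n + 1))"
      unfolding theta_term_def mult.assoc exp_add[symmetric] by (simp add: algebra_simps)
    thus ?thesis by (simp add: exp_odd_pi_i del: of_int_add of_int_mult)
  qed
  thus ?thesis by (simp add: theta1_eq infsum_uminus)
qed

text \<open>Adding \<tau> completes the square from \<open>n + 1/2\<close> to
  \<open>n + 3/2\<close>, so the series is shifted by one index and the remaining exponential does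
  not depend on \<open>n\<close>.\<close>

lemma theta1_add_tau:
  "theta1 \<tau> (z + \<tau>) = - exp (- of_real pi * \<i> * (\<tau> + 2 * z)) * theta1 \<tau> z"
proof -
  let ?E = "exp (- of_real pi * \<i> * (\<tau> + 2 * z))"
  have e: "theta_term \<tau> (z + \<tau>) n = - exp (- of_real pi * \<i> * (\<tau> + 2 * z)) * theta_term \<tau> z (n + 1)" for n
  proof -
    have p: "(-1::complex) powi (n + 1) = - ((-1) powi n)"
      by (simp add: power_int_add)
    have "of_real pi * \<i> * (\<tau> * (of_int n + 1/2)\<^sup>2 + of_int (2 * n + 1) * (z + \<tau>)) =
      - of_real pi * \<i> * (\<tau> + 2 * z) + of_real pi * \<i> * (\<tau> * (of_int (n + 1) + 1/2)\<^sup>2 + of_int (2 * (n + 1) + 1) * z)"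
      by (simp add: power2_eq_square algebra_simps)
    thus ?thesis unfolding theta_term_def p by (simp only: exp_add) simp
  qed
  have "(\<Sum>\<^sub>\<infinity>n. theta_term \<tau> z (n + 1)) = (\<Sum>\<^sub>\<infinity>n. theta_term \<tau> z n)"
    by (rule infsum_reindex_bij_betw[where g = "\<lambda>n. n + 1"])
       (auto intro!: bij_betwI[where g = "\<lambda>n. n - 1"])
  hence "(\<Sum>\<^sub>\<infinity>n. theta_term \<tau> (z + \<tau>) n) = - ?E * (\<Sum>\<^sub>\<infinity>n. theta_term \<tau> z n)"
    unfolding e by (simp only: infsum_cmult_right')
  hence "- \<i> * (\<Sum>\<^sub>\<infinity>n. theta_term \<tau> (z + \<tau>) n) = - ?E * (- \<i> * (\<Sum>\<^sub>\<infinity>n. theta_term \<tau> z n))"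
    by (metis mult.left_commute)
  thus ?thesis unfolding theta1_eq .
qed

text \<open>The reflection of \<open>n\<close> to \<open>-1 - n\<close> preserves
  \<open>(n + 1/2)^2\<close>, negates \<open>2 n + 1\<close> and flips the sign of the coefficient.
  Oddness then yields the zero at the origin.\<close>

lemma theta1_minus: "theta1 \<tau> (- z) = - theta1 \<tau> z"
proof -
  have e: "theta_term \<tau> (- z) n = - theta_term \<tau> z (- 1 - n)" for n
  proof -
    have p: "(-1::complex) powi (- 1 - n) = - ((-1) powi n)"
    proof -
      have "(-1::complex) powi (- 1 - n) * (-1) powi n = -1"
        by (simp flip: power_int_add)
      moreover have "(-1::complex) powi n * (-1) powi n = 1"
        by (simp flip: power_int_mult_distrib)
      ultimately show ?thesis by (metis mult.assoc mult.right_neutral mult_minus1)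
    qed
    have "\<tau> * (of_int n + 1/2)\<^sup>2 + of_int (2 * n + 1) * (- z) =
      \<tau> * (of_int (- 1 - n) + 1/2)\<^sup>2 + of_int (2 * (- 1 - n) + 1) * z"
      by (simp add: power2_eq_square algebra_simps)
    thus ?thesis unfolding theta_term_def p by simp
  qed
  have "(\<Sum>\<^sub>\<infinity>n. theta_term \<tau> z (- 1 - n)) = (\<Sum>\<^sub>\<infinity>n. theta_term \<tau> z n)"
    by (rule infsum_reindex_bij_betw[where g = "\<lambda>n. - 1 - n"])
       (auto intro!: bij_betwI[where g = "\<lambda>n. - 1 - n"])
  thus ?thesis by (simp add: theta1_eq e infsum_uminus)
qed

lemma theta1_0: "theta1 \<tau> 0 = 0"
  using theta1_minus[of \<tau> 0] by (simp add: eq_neg_iff_add_eq_0)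

lemma exp_2pi_i_integral:
  assumes "n \<noteq> 0"
  shows "integral {0..1} (\<lambda>x. exp (2 * of_real pi * \<i> * of_int n * of_real x)) = (0 :: complex)"
proof -
  let ?c = "2 * of_real pi * \<i> * of_int n :: complex"
  have c: "?c \<noteq> 0" using assms by simp
  have "((\<lambda>x. exp (?c * of_real x)) has_integral (exp (?c * of_real 1) / ?c - exp (?c * of_real 0) / ?c)) {0..1}"
  proof (rule fundamental_theorem_of_calculus)
    fix x :: real
    have "((\<lambda>z. exp (?c * z) / ?c) has_field_derivative exp (?c * of_real x)) (at (of_real x))"
      by (rule derivative_eq_intros refl | use c in simp)+
    thus "((\<lambda>x. exp (?c * of_real x) / ?c) has_vector_derivative exp (?c * of_real x)) (at x within {0..1})"
      using has_vector_derivative_real_field has_vector_derivative_at_within by blast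
  qed simp
  moreover have "exp ?c = 1"
    using exp_integer_2pi[of "of_int n"] by (simp add: mult_ac)
  ultimately have "((\<lambda>x. exp (?c * of_real x)) has_integral 0) {0..1}"
    by simp
  thus ?thesis by (rule integral_unique)
qed

text \<open>On the real line the series has frequencies \<open>n + 1/2\<close>; integrating it
  against \<open>exp (- pi \<i> x)\<close> over a period isolates the term \<open>n = 0\<close>,
  which is \<open>exp (pi \<i> \<tau> / 4)\<close> and not zero. This excludes a vanishing constant
  in the comparison with the product.\<close>

lemma theta1_not_identically_0:
  assumes "Im \<tau> > 0"
  shows "\<exists>z. theta1 \<tau> z \<noteq> 0"
proof (rule ccontr)
  assume "\<nexists>z. theta1 \<tau> z \<noteq> 0"
  hence z: "(\<Sum>\<^sub>\<infinity>n. theta_term \<tau> z n) = 0" for z by (simp add: theta1_eq)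
  let ?e = "\<lambda>x::real. exp (- of_real pi * \<i> * of_real x)"
  let ?f = "\<lambda>X x. \<Sum>n\<in>X. theta_term \<tau> (of_real x) n * ?e x"
  obtain C where C: "\<And>z n. norm z \<le> 1 \<Longrightarrow> norm (theta_term \<tau> z n) \<le> C * exp (- \<bar>real_of_int n\<bar>)"
    using theta_term_bound[OF assms] by blast
  have "uniform_limit (cbox 0 1) ?f (\<lambda>x. \<Sum>\<^sub>\<infinity>n. theta_term \<tau> (of_real x) n * ?e x) (finite_subsets_at_top UNIV)"
    by (rule Weierstrass_m_test_general[where M = "\<lambda>n. C * exp (- \<bar>real_of_int n\<bar>)"])
       (auto intro!: C summable_on_cmult_right summable_exp_neg_abs_int simp: norm_mult)
  also have "(\<lambda>x. \<Sum>\<^sub>\<infinity>n. theta_term \<tau> (of_real x) n * ?e x) = (\<lambda>x. 0)"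
    by (simp add: infsum_cmult_left' z)
  finally have ul: "uniform_limit (cbox 0 1) ?f (\<lambda>x. 0) (finite_subsets_at_top UNIV)" .
  have cont: "continuous_on (cbox 0 1) (?f X)" for X
    unfolding theta_term_def by (intro continuous_intros)
  obtain I J where I: "\<And>X. (?f X has_integral I X) (cbox 0 1)" and J: "((\<lambda>x. 0) has_integral J) (cbox 0 1)"
    and lim: "(I \<longlongrightarrow> J) (finite_subsets_at_top UNIV)"
    by (rule uniform_limit_integral_cbox[OF ul cont]) auto
  have "J = 0" using J by (simp add: has_integral_is_0 has_integral_unique)
  have I_eq: "I X = exp (of_real pi * \<i> * \<tau> / 4)" if "finite X" "0 \<in> X" for X
  proof -
    have t: "integral {0..1} (\<lambda>x. theta_term \<tau> (of_real x) n * ?e x) =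
      (if n = 0 then exp (of_real pi * \<i> * \<tau> / 4) else 0)" for n
    proof -
      have "theta_term \<tau> (of_real x) n * ?e x = ((-1) powi n * exp (of_real pi * \<i> * (\<tau> * (of_int n + 1/2)\<^sup>2))) *
         exp (2 * of_real pi * \<i> * of_int n * of_real x)" for x
        unfolding theta_term_def mult.assoc exp_add[symmetric] by (simp add: algebra_simps)
      hence "integral {0..1} (\<lambda>x. theta_term \<tau> (of_real x) n * ?e x) =
        ((-1) powi n * exp (of_real pi * \<i> * (\<tau> * (of_int n + 1/2)\<^sup>2))) *
           integral {0..1} (\<lambda>x. exp (2 * of_real pi * \<i> * of_int n * of_real x))"
        by simp
      also have "\<dots> = (if n = 0 then exp (of_real pi * \<i> * \<tau> / 4) else 0)"
        using exp_2pi_i_integral[of n] by (simp add: power2_eq_square)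
      finally show ?thesis .
    qed
    have "I X = integral {0..1} (?f X)" using I[of X] by (simp add: integral_unique)
    also have "\<dots> = (\<Sum>n\<in>X. integral {0..1} (\<lambda>x. theta_term \<tau> (of_real x) n * ?e x))"
      using that unfolding theta_term_def
      by (intro integral_sum integrable_continuous_real continuous_intros)
    also have "\<dots> = exp (of_real pi * \<i> * \<tau> / 4)"
      using that by (simp only: t) simp
    finally show ?thesis .
  qed
  have "\<forall>\<^sub>F X in finite_subsets_at_top UNIV. I X = exp (of_real pi * \<i> * \<tau> / 4)"
    unfolding eventually_finite_subsets_at_top by (rule exI[of _ "{0}"]) (auto intro: I_eq)
  hence "(I \<longlongrightarrow> exp (of_real pi * \<i> * \<tau> / 4)) (finite_subsets_at_top UNIV)"
    by (rule tendsto_eventually)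
  with lim \<open>J = 0\<close> show False
    using tendsto_unique[OF _ lim] by fastforce
qed

subsection \<open>The lattice\<close>

lemma lattice_0 [simp]: "0 \<in> lattice \<tau>"
  unfolding lattice_def by (auto intro!: exI[of _ 0])

lemma lattice_add: "l \<in> lattice \<tau> \<Longrightarrow> k \<in> lattice \<tau> \<Longrightarrow> l + k \<in> lattice \<tau>"
proof -
  assume "l \<in> lattice \<tau>" "k \<in> lattice \<tau>"
  then obtain m n m' n' where "l = of_int m + of_int n * \<tau>" "k = of_int m' + of_int n' * \<tau>"
    unfolding lattice_def by auto
  hence "l + k = of_int (m + m') + of_int (n + n') * \<tau>" by (simp add: algebra_simps)
  thus ?thesis unfolding lattice_def by blast
qed

lemma lattice_minus: "l \<in> lattice \<tau> \<Longrightarrow> - l \<in> lattice \<tau>"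
proof -
  assume "l \<in> lattice \<tau>"
  then obtain m n where "l = of_int m + of_int n * \<tau>"
    unfolding lattice_def by auto
  hence "- l = of_int (- m) + of_int (- n) * \<tau>" by simp
  thus ?thesis unfolding lattice_def by blast
qed

lemma lattice_diff: "l \<in> lattice \<tau> \<Longrightarrow> k \<in> lattice \<tau> \<Longrightarrow> l - k \<in> lattice \<tau>"
  using lattice_add[of l \<tau> "- k"] lattice_minus[of k \<tau>] by simp

lemma lattice_1: "1 \<in> lattice \<tau>"
  unfolding lattice_def by (rule CollectI, rule exI[of _ 1], rule exI[of _ 0]) simp

lemma lattice_tau: "\<tau> \<in> lattice \<tau>"
  unfolding lattice_def by (rule CollectI, rule exI[of _ 0], rule exI[of _ 1]) simp

lemma lattice_add_iff: "l \<in> lattice \<tau> \<Longrightarrow> z + l \<in> lattice \<tau> \<longleftrightarrow> z \<in> lattice \<tau>"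
  using lattice_add[of z \<tau> l] lattice_diff[of "z + l" \<tau> l] by auto

lemma lattice_minus_iff: "- z \<in> lattice \<tau> \<longleftrightarrow> z \<in> lattice \<tau>"
  using lattice_minus[of z \<tau>] lattice_minus[of "- z" \<tau>] by auto

lemma lattice_norm_ge:
  assumes "l \<in> lattice \<tau>" "l \<noteq> 0" "Im \<tau> > 0"
  shows "norm l \<ge> min 1 (Im \<tau>)"
proof -
  obtain m n where l: "l = of_int m + of_int n * \<tau>" using assms by (auto simp: lattice_def)
  show ?thesis
  proof (cases "n = 0")
    case True
    hence "m \<noteq> 0" using l assms by auto
    hence "\<bar>real_of_int m\<bar> \<ge> 1" by linarith
    thus ?thesis using l True by (simp add: min_le_iff_disj flip: of_int_abs)
  next
    case False
    hence "\<bar>real_of_int n\<bar> \<ge> 1" by linarith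
    hence "Im \<tau> \<le> \<bar>real_of_int n\<bar> * Im \<tau>" using assms by (simp add: mult_le_cancel_right1)
    also have "\<dots> = \<bar>Im l\<bar>" using l assms by (simp add: abs_mult)
    also have "\<dots> \<le> norm l" by (rule abs_Im_le_cmod)
    finally show ?thesis by (simp add: min_le_iff_disj)
  qed
qed

lemma lattice_discrete:
  assumes "Im \<tau> > 0"
  shows "\<exists>r>0. \<forall>l\<in>lattice \<tau>. l \<noteq> 0 \<longrightarrow> r \<le> norm l"
  using lattice_norm_ge[of _ \<tau>] assms by (intro exI[of _ "min 1 (Im \<tau>)"]) auto

text \<open>All subsets of a uniformly discrete set are closed. Stated for subsets because the
  lattice without the origin occurs as well.\<close>

lemma closed_subset_lattice:
  assumes "Im \<tau> > 0" "S \<subseteq> lattice \<tau>"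
  shows "closed S"
proof -
  obtain r where r: "r > 0" "\<And>l. l \<in> lattice \<tau> \<Longrightarrow> l \<noteq> 0 \<Longrightarrow> r \<le> norm l"
    using lattice_discrete[OF assms(1)] by blast
  show ?thesis
  proof (rule discrete_imp_closed[OF r(1)], intro ballI impI)
    fix x y assume "x \<in> S" "y \<in> S" "dist y x < r"
    thus "y = x" using r(2)[of "y - x"] lattice_diff[of y \<tau> x] assms(2) by (force simp: dist_norm)
  qed
qed

lemma periodic_lattice:
  assumes "\<And>z. f (z + 1) = f z" "\<And>z. f (z + \<tau>) = f z" "l \<in> lattice \<tau>"
  shows "f (z + l) = f z"
proof -
  have 1: "f (z + of_int m) = f z" for z and m :: int
  proof (induction m rule: int_induct[where k = 0])
    case (step1 i)
    thus ?case using assms(1)[of "z + of_int i"] by (simp add: add.assoc)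
  next
    case (step2 i)
    thus ?case using assms(1)[of "z + of_int i - 1"] by (simp add: add_diff_eq)
  qed simp
  have 2: "f (z + of_int n * \<tau>) = f z" for z and n :: int
  proof (induction n rule: int_induct[where k = 0])
    case (step1 i)
    thus ?case using assms(2)[of "z + of_int i * \<tau>"] by (simp add: algebra_simps)
  next
    case (step2 i)
    thus ?case using assms(2)[of "z + of_int i * \<tau> - \<tau>"] by (simp add: algebra_simps)
  qed simp
  obtain m n where "l = of_int m + of_int n * \<tau>" using assms(3) by (auto simp: lattice_def)
  thus ?thesis using 1 2 by (metis add.assoc)
qed

text \<open>A disc that meets every coset is a compact substitute for the fundamental parallelogram:
  it bounds periodic functions for Liouville's theorem and provides the maximum of the
  potential.\<close>

lemma lattice_reduce:
  assumes "Im \<tau> > 0"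
  shows "\<exists>l\<in>lattice \<tau>. norm (z - l) \<le> 1 + norm \<tau>"
proof -
  define n where "n = \<lfloor>Im z / Im \<tau>\<rfloor>"
  define t where "t = Im z / Im \<tau> - of_int n"
  define m where "m = \<lfloor>Re (z - of_real (Im z / Im \<tau>) * \<tau>)\<rfloor>"
  define s where "s = Re (z - of_real (Im z / Im \<tau>) * \<tau>) - of_int m"
  have t: "0 \<le> t" "t \<le> 1" and s: "0 \<le> s" "s \<le> 1"
    unfolding t_def n_def s_def m_def by linarith+
  have "z - of_real (Im z / Im \<tau>) * \<tau> = of_real (of_int m + s)"
    using assms unfolding s_def by (intro complex_eqI) simp_all
  hence "z = of_real (of_int m + s) + of_real (Im z / Im \<tau>) * \<tau>"
    by (simp add: algebra_simps)
  also have "Im z / Im \<tau> = of_int n + t" unfolding t_def by simp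
  finally have z: "z = of_real (of_int m + s) + of_real (of_int n + t) * \<tau>" .
  have "z - (of_int m + of_int n * \<tau>) = of_real s + of_real t * \<tau>"
    by (subst z) (simp add: algebra_simps)
  hence "norm (z - (of_int m + of_int n * \<tau>)) \<le> norm (complex_of_real s) + norm (of_real t * \<tau>)"
    by (metis norm_triangle_ineq)
  also have "\<dots> \<le> 1 + norm \<tau>"
    using s t by (intro add_mono) (auto simp: norm_mult intro!: mult_left_le_one_le)
  finally show ?thesis unfolding lattice_def by blast
qed

subsection \<open>Zeros of the theta function\<close>

text \<open>The infinite q-Pochhammer symbol \<open>(w; Q)\<close>.\<close>

definition qpoch :: "complex \<Rightarrow> complex \<Rightarrow> complex" where
  "qpoch Q w = (\<Prod>n. 1 - Q ^ n * w)"

lemma convergent_qpoch: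
  fixes Q w :: complex
  assumes "norm Q < 1"
  shows "convergent_prod (\<lambda>n. 1 - Q ^ n * w)"
proof -
  have "summable (\<lambda>n. norm (Q ^ n * w))"
    using assms by (auto simp: norm_mult norm_power intro!: summable_mult2 summable_geometric)
  hence "abs_convergent_prod (\<lambda>n. 1 - Q ^ n * w)"
    by (intro summable_imp_abs_convergent_prod) (simp add: norm_minus_commute)
  thus ?thesis by (rule abs_convergent_prod_imp_convergent_prod)
qed

lemma qpoch_step:
  assumes "norm Q < 1"
  shows "qpoch Q w = (1 - w) * qpoch Q (Q * w)"
proof -
  have "(\<lambda>n. \<Prod>i\<le>n. 1 - Q ^ i * w) \<longlonglongrightarrow> qpoch Q w"
    unfolding qpoch_def by (rule convergent_prod_LIMSEQ[OF convergent_qpoch[OF assms]])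
  hence "(\<lambda>n. \<Prod>i\<le>Suc n. 1 - Q ^ i * w) \<longlonglongrightarrow> qpoch Q w"
    by (rule LIMSEQ_Suc)
  moreover have "(\<Prod>i\<le>Suc n. 1 - Q ^ i * w) = (1 - w) * (\<Prod>i\<le>n. 1 - Q ^ i * (Q * w))" for n
    by (subst prod.atMost_Suc_shift) (simp add: mult_ac)
  moreover have "(\<lambda>n. (1 - w) * (\<Prod>i\<le>n. 1 - Q ^ i * (Q * w))) \<longlonglongrightarrow> (1 - w) * qpoch Q (Q * w)"
    unfolding qpoch_def
    by (intro tendsto_intros convergent_prod_LIMSEQ convergent_qpoch assms)
  ultimately show ?thesis using LIMSEQ_unique by auto
qed

lemma qpoch_eq_0_iff:
  assumes "norm Q < 1"
  shows "qpoch Q w = 0 \<longleftrightarrow> (\<exists>n. Q ^ n * w = 1)"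
proof -
  have "(\<lambda>n. 1 - Q ^ n * w) has_prod qpoch Q w"
    unfolding qpoch_def using convergent_qpoch[OF assms] by (rule convergent_prod_has_prod)
  from has_prod_eq_0_iff[OF this] show ?thesis by (auto simp: image_iff)
qed

lemma qpoch_holomorphic:
  assumes "norm Q < 1"
  shows "qpoch Q holomorphic_on UNIV"
proof (rule holomorphic_uniform_sequence)
  show "(\<lambda>w. \<Prod>k<n. 1 - Q ^ k * w) holomorphic_on UNIV" for n
    by (intro holomorphic_intros)
  fix x :: complex
  have "uniformly_convergent_on (cball x 1) (\<lambda>n w. \<Prod>k<n. 1 + - (Q ^ k * w))"
  proof (rule uniformly_convergent_on_prod)
    show "uniformly_convergent_on (cball x 1) (\<lambda>N w. \<Sum>n<N. norm (- (Q ^ n * w)))"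
    proof (rule Weierstrass_m_test'[where M = "\<lambda>n. norm Q ^ n * (norm x + 1)"])
      fix n w assume "w \<in> cball x 1"
      hence "norm w \<le> norm x + 1" using norm_triangle_sub[of w x] by (simp add: dist_norm norm_minus_commute)
      thus "norm (norm (- (Q ^ n * w))) \<le> norm Q ^ n * (norm x + 1)"
        by (simp add: norm_mult norm_power mult_left_mono)
    qed (use assms in \<open>auto intro!: summable_mult2 summable_geometric\<close>)
  qed (auto intro!: continuous_intros)
  hence "uniform_limit (cball x 1) (\<lambda>n w. \<Prod>k<n. 1 - Q ^ k * w) (\<lambda>w. lim (\<lambda>n. \<Prod>k<n. 1 - Q ^ k * w)) sequentially"
    by (simp add: uniformly_convergent_uniform_limit_iff)
  moreover have "lim (\<lambda>n. \<Prod>k<n. 1 - Q ^ k * w) = qpoch Q w" for w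
  proof -
    have "(\<lambda>n. \<Prod>k\<le>n. 1 - Q ^ k * w) \<longlonglongrightarrow> qpoch Q w"
      unfolding qpoch_def by (rule convergent_prod_LIMSEQ[OF convergent_qpoch[OF assms]])
    hence "(\<lambda>n. \<Prod>k<Suc n. 1 - Q ^ k * w) \<longlonglongrightarrow> qpoch Q w"
      by (simp only: lessThan_Suc_atMost)
    hence "(\<lambda>n. \<Prod>k<n. 1 - Q ^ k * w) \<longlonglongrightarrow> qpoch Q w"
      by (rule LIMSEQ_imp_Suc)
    thus ?thesis by (rule limI)
  qed
  ultimately show "\<exists>d>0. cball x d \<subseteq> UNIV \<and> uniform_limit (cball x d) (\<lambda>n w. \<Prod>k<n. 1 - Q ^ k * w) (qpoch Q) sequentially"
    by (intro exI[of _ 1]) simp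
qed auto

text \<open>The right-hand side of the Jacobi triple product, up to a constant.\<close>

definition theta_product :: "complex \<Rightarrow> complex \<Rightarrow> complex" where
  "theta_product \<tau> z = (let Q = exp (2 * of_real pi * \<i> * \<tau>); E = exp (2 * of_real pi * \<i> * z)
     in exp (- of_real pi * \<i> * z) * qpoch Q E * qpoch Q (Q / E))"

lemma norm_nome:
  assumes "Im \<tau> > 0"
  shows "norm (exp (2 * of_real pi * \<i> * \<tau>)) < 1"
  using assms by (simp add: norm_exp_eq_Re)

lemma theta_product_holomorphic:
  assumes "Im \<tau> > 0"
  shows "theta_product \<tau> holomorphic_on A"
proof -
  define Q where "Q = exp (2 * of_real pi * \<i> * \<tau>)"
  have q: "qpoch Q holomorphic_on UNIV"
    unfolding Q_def by (intro qpoch_holomorphic norm_nome assms)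
  have c: "(\<lambda>z. qpoch Q (f z)) holomorphic_on A" if "f holomorphic_on A" for f
    using holomorphic_on_compose_gen[OF that q] by (simp add: o_def)
  show ?thesis
    unfolding theta_product_def Let_def Q_def[symmetric]
    by (intro holomorphic_intros c) auto
qed

lemma theta_product_add_1: "theta_product \<tau> (z + 1) = - theta_product \<tau> z"
proof -
  have "exp (2 * of_real pi * \<i> * (z + 1)) = exp (2 * of_real pi * \<i> * z)"
    by (simp add: distrib_left exp_add)
  moreover have "exp (- of_real pi * \<i> * (z + 1)) = - exp (- of_real pi * \<i> * z)"
  proof -
    have "exp (- of_real pi * \<i> * (z + 1)) = exp (- of_real pi * \<i> * z) * exp (- (of_real pi * \<i>))"
      unfolding exp_add[symmetric] by (simp add: algebra_simps)
    thus ?thesis by (simp only: exp_minus) simp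
  qed
  ultimately show ?thesis unfolding theta_product_def Let_def by simp
qed

text \<open>The shift multiplies \<open>E\<close> by \<open>Q\<close>: the factor
  \<open>1 - E\<close> leaves the first product and \<open>1 - 1 / E\<close> enters the second.
  Their quotient is \<open>- 1 / E\<close>, which accounts for the multiplier.\<close>

lemma theta_product_add_tau:
  assumes "Im \<tau> > 0"
  shows "theta_product \<tau> (z + \<tau>) = - exp (- of_real pi * \<i> * (\<tau> + 2 * z)) * theta_product \<tau> z"
proof -
  define Q where "Q = exp (2 * of_real pi * \<i> * \<tau>)"
  define E where "E = exp (2 * of_real pi * \<i> * z)"
  have Q: "norm Q < 1" "Q \<noteq> 0" unfolding Q_def by (intro norm_nome assms) simp
  have E: "E \<noteq> 0" by (simp add: E_def)
  have 1: "exp (2 * of_real pi * \<i> * (z + \<tau>)) = Q * E"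
    unfolding Q_def E_def exp_add[symmetric] by (simp add: algebra_simps)
  have 2: "exp (- of_real pi * \<i> * (z + \<tau>)) = exp (- of_real pi * \<i> * (\<tau> + 2 * z)) * E * exp (- of_real pi * \<i> * z)"
    unfolding E_def exp_add[symmetric] by (simp add: algebra_simps)
  have "E * qpoch Q (Q * E) * qpoch Q (1 / E) = E * qpoch Q (Q * E) * ((1 - 1 / E) * qpoch Q (Q / E))"
    by (subst qpoch_step[of Q "1 / E"]) (use Q in auto)
  also have "\<dots> = - ((1 - E) * qpoch Q (Q * E)) * qpoch Q (Q / E)"
    using E by (simp add: field_simps)
  also have "\<dots> = - qpoch Q E * qpoch Q (Q / E)"
    by (simp flip: qpoch_step[OF Q(1)])
  finally have 3: "E * qpoch Q (Q * E) * qpoch Q (1 / E) = - qpoch Q E * qpoch Q (Q / E)" .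
  have "theta_product \<tau> (z + \<tau>) = exp (- of_real pi * \<i> * (\<tau> + 2 * z)) * exp (- of_real pi * \<i> * z) *
     (E * qpoch Q (Q * E) * qpoch Q (1 / E))"
    unfolding theta_product_def Let_def Q_def[symmetric] 1 2 using Q E by simp
  also have "\<dots> = - exp (- of_real pi * \<i> * (\<tau> + 2 * z)) * theta_product \<tau> z"
    unfolding 3 unfolding theta_product_def Let_def Q_def E_def by simp
  finally show ?thesis .
qed

lemma exp_2pi_i_eq_1_iff: "exp (2 * of_real pi * \<i> * z) = 1 \<longleftrightarrow> (\<exists>m::int. z = of_int m)"
proof
  assume "exp (2 * of_real pi * \<i> * z) = 1"
  then obtain m :: int where m: "Re (2 * of_real pi * \<i> * z) = 0" "Im (2 * of_real pi * \<i> * z) = of_int (2 * m) * pi"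
    by (auto simp: exp_eq_1)
  hence "z = of_int m" by (intro complex_eqI) auto
  thus "\<exists>m::int. z = of_int m" by blast
next
  assume "\<exists>m::int. z = of_int m"
  thus "exp (2 * of_real pi * \<i> * z) = 1" using exp_integer_2pi by (auto simp: mult_ac)
qed

text \<open>The first product vanishes at the lattice points whose coefficient of \<tau> is
  nonpositive, the second at those where it is positive.\<close>

lemma theta_product_eq_0_iff:
  assumes "Im \<tau> > 0"
  shows "theta_product \<tau> z = 0 \<longleftrightarrow> z \<in> lattice \<tau>"
proof -
  define Q where "Q = exp (2 * of_real pi * \<i> * \<tau>)"
  define E where "E = exp (2 * of_real pi * \<i> * z)"
  have Q: "norm Q < 1" "Q \<noteq> 0" unfolding Q_def by (intro norm_nome assms) simp
  have 1: "Q ^ n * E = exp (2 * of_real pi * \<i> * (z + of_nat n * \<tau>))" for n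
    unfolding Q_def E_def exp_of_nat_mult[symmetric] exp_add[symmetric] by (simp add: algebra_simps)
  have 2: "Q ^ n * (Q / E) = exp (2 * of_real pi * \<i> * (of_nat (Suc n) * \<tau> - z))" for n
    unfolding Q_def E_def exp_of_nat_mult[symmetric] exp_add[symmetric] exp_diff[symmetric] by (simp add: algebra_simps)
  have "theta_product \<tau> z = 0 \<longleftrightarrow> (\<exists>n. Q ^ n * E = 1) \<or> (\<exists>n. Q ^ n * (Q / E) = 1)"
    unfolding theta_product_def Let_def Q_def[symmetric] E_def[symmetric]
    by (simp add: qpoch_eq_0_iff Q)
  also have "\<dots> \<longleftrightarrow> (\<exists>n m. z + of_nat n * \<tau> = of_int m) \<or> (\<exists>n m. of_nat (Suc n) * \<tau> - z = of_int m)"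
    unfolding 1 2 exp_2pi_i_eq_1_iff ..
  also have "\<dots> \<longleftrightarrow> z \<in> lattice \<tau>"
  proof
    assume "(\<exists>n m. z + of_nat n * \<tau> = of_int m) \<or> (\<exists>n m. of_nat (Suc n) * \<tau> - z = of_int m)"
    thus "z \<in> lattice \<tau>"
    proof (elim disjE exE)
      fix n m assume "z + of_nat n * \<tau> = of_int m"
      hence "z = of_int m + of_int (- int n) * \<tau>" by (simp add: algebra_simps)
      thus ?thesis unfolding lattice_def by blast
    next
      fix n m assume "of_nat (Suc n) * \<tau> - z = of_int m"
      hence "z = of_int (- m) + of_int (int (Suc n)) * \<tau>" by (simp add: algebra_simps)
      thus ?thesis unfolding lattice_def by blast
    qed
  next
    assume "z \<in> lattice \<tau>"
    then obtain m n where z: "z = of_int m + of_int n * \<tau>" by (auto simp: lattice_def)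
    show "(\<exists>n m. z + of_nat n * \<tau> = of_int m) \<or> (\<exists>n m. of_nat (Suc n) * \<tau> - z = of_int m)"
    proof (cases "n \<le> 0")
      case True
      then obtain k where "n = - int k" by (metis int_cases2 le_minus_iff minus_zero nonpos_int_cases)
      thus ?thesis using z by (intro disjI1 exI[of _ k] exI[of _ m]) simp
    next
      case False
      then obtain k where "n = int (Suc k)" by (metis Suc_pred' linorder_not_le nat_0_le of_nat_0_less_iff order_less_imp_le)
      thus ?thesis using z by (intro disjI2 exI[of _ k] exI[of _ "- m"]) simp
    qed
  qed
  finally show ?thesis .
qed

text \<open>The zero at the origin sits in the leading factor \<open>1 - E\<close> of the first
  product. Its cofactor \<open>B\<close> equals there the square of \<open>qpoch Q Q\<close>, which
  is nonzero because \<open>\<bar>Q\<bar> < 1\<close>.\<close>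

lemma deriv_theta_product_0:
  assumes "Im \<tau> > 0"
  shows "deriv (theta_product \<tau>) 0 \<noteq> 0"
proof -
  define Q where "Q = exp (2 * of_real pi * \<i> * \<tau>)"
  have Q: "norm Q < 1" "Q \<noteq> 0" unfolding Q_def by (intro norm_nome assms) simp
  have q: "qpoch Q holomorphic_on UNIV" by (intro qpoch_holomorphic Q)
  define B where "B z = exp (- of_real pi * \<i> * z) * qpoch Q (Q * exp (2 * of_real pi * \<i> * z)) * qpoch Q (Q / exp (2 * of_real pi * \<i> * z))" for z
  have c: "(\<lambda>z. qpoch Q (f z)) holomorphic_on UNIV" if "f holomorphic_on UNIV" for f
    using holomorphic_on_compose_gen[OF that q] by (simp add: o_def)
  have B: "B holomorphic_on UNIV" unfolding B_def by (intro holomorphic_intros c) auto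
  have P: "theta_product \<tau> z = (1 - exp (2 * of_real pi * \<i> * z)) * B z" for z
    unfolding theta_product_def Let_def Q_def[symmetric] B_def
    by (subst qpoch_step[OF Q(1)]) simp
  have dB: "(B has_field_derivative deriv B 0) (at 0)"
    using holomorphic_derivI[OF B] by auto
  have "((\<lambda>z. (1 - exp (2 * of_real pi * \<i> * z)) * B z) has_field_derivative - 2 * of_real pi * \<i> * B 0) (at 0)"
    by (rule derivative_eq_intros dB refl | simp)+
  hence "deriv (theta_product \<tau>) 0 = - 2 * of_real pi * \<i> * B 0"
    unfolding P[abs_def] by (rule DERIV_imp_deriv)
  moreover have "B 0 \<noteq> 0"
  proof -
    have "Q ^ n * Q \<noteq> 1" for n
    proof
      assume "Q ^ n * Q = 1"
      hence "norm Q ^ Suc n = 1" by (metis mult.commute norm_one norm_power power_Suc)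
      moreover have "norm Q ^ Suc n < 1" using Q by (intro power_Suc_less_one) simp_all
      ultimately show False by simp
    qed
    thus ?thesis by (simp add: B_def qpoch_eq_0_iff Q)
  qed
  ultimately show ?thesis by simp
qed

text \<open>Meant for functions vanishing at 0: one order of the zero is removed and an entire
  function stays entire.\<close>

definition div_id :: "(complex \<Rightarrow> complex) \<Rightarrow> complex \<Rightarrow> complex" where
  "div_id f z = (if z = 0 then deriv f 0 else f z / z)"

lemma div_id_holomorphic:
  assumes "f holomorphic_on UNIV" "f 0 = 0"
  shows "div_id f holomorphic_on A"
proof -
  have d: "(f has_field_derivative deriv f 0) (at 0)" using holomorphic_derivI[OF assms(1)] by auto
  hence "(\<lambda>z. f z / z) \<midarrow>0\<rightarrow> deriv f 0" using assms(2) by (simp add: has_field_derivative_iff)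
  moreover have "(\<lambda>z. f z / z) holomorphic_on UNIV - {0}"
    by (intro holomorphic_intros holomorphic_on_subset[OF assms(1)]) auto
  ultimately have "(\<lambda>z. if z = 0 then deriv f 0 else f z / z) holomorphic_on UNIV"
    by (intro removable_singularity) auto
  thus ?thesis unfolding div_id_def[abs_def] by (rule holomorphic_on_subset) simp
qed

lemma div_id_mult: "f 0 = 0 \<Longrightarrow> f z = z * div_id f z"
  by (simp add: div_id_def)

lemma theta1_lattice:
  assumes "z \<in> lattice \<tau>"
  shows "theta1 \<tau> z = 0"
proof -
  have "(theta1 \<tau> (0 + z) = 0) = (theta1 \<tau> 0 = 0)"
    by (rule periodic_lattice[where f = "\<lambda>z. theta1 \<tau> z = 0", OF _ _ assms])
       (simp_all add: theta1_add_1 theta1_add_tau)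
  thus ?thesis by (simp add: theta1_0)
qed

text \<open>Both functions have the same multipliers under 1 and \<tau>, so their quotient is doubly
  periodic. It is entire, since the denominator has simple zeros exactly on the lattice and the
  numerator vanishes there too; by Liouville's theorem it is constant.\<close>

lemma theta1_eq_product:
  assumes "Im \<tau> > 0"
  shows "\<exists>c. c \<noteq> 0 \<and> (\<forall>z. theta1 \<tau> z = c * theta_product \<tau> z)"
proof -
  let ?T = "theta1 \<tau>" and ?P = "theta_product \<tau>"
  have T: "?T holomorphic_on A" and P: "?P holomorphic_on A" for A
    using theta1_holomorphic theta_product_holomorphic assms by blast+
  have T0: "?T 0 = 0" and P0: "?P 0 = 0"
    by (simp_all add: theta1_0 theta_product_eq_0_iff assms)
  obtain r where r: "r > 0" "\<And>l. l \<in> lattice \<tau> \<Longrightarrow> l \<noteq> 0 \<Longrightarrow> r \<le> norm l"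
    using lattice_discrete[OF assms] by blast
  \<comment> \<open>Every lattice point receives the value at 0. This keeps \<open>f\<close>
    periodic, so holomorphy has to be checked only off the lattice and near the origin, where
    \<open>f\<close> is a quotient of the two regularised functions.\<close>
  define f where "f z = (if z \<in> lattice \<tau> then div_id ?T 0 / div_id ?P 0 else ?T z / ?P z)" for z
  have per: "f (z + l) = f z" if "l \<in> lattice \<tau>" for z l
  proof (rule periodic_lattice[OF _ _ that])
    show "f (z + 1) = f z" for z
      by (simp add: f_def lattice_add_iff[OF lattice_1] theta1_add_1 theta_product_add_1)
    show "f (z + \<tau>) = f z" for z
      by (simp add: f_def lattice_add_iff[OF lattice_tau] theta1_add_tau theta_product_add_tau assms)
  qed
  have p_nz: "div_id ?P z \<noteq> 0" if "z \<in> ball 0 r" for z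
    using that r(2)[of z] theta_product_eq_0_iff[OF assms, of z] deriv_theta_product_0[OF assms]
    by (auto simp: div_id_def)
  have f_ball: "f z = div_id ?T z / div_id ?P z" if "z \<in> ball 0 r" for z
    using that r(2)[of z] by (cases "z = 0") (auto simp: f_def div_id_def)
  have "(\<lambda>z. div_id ?T z / div_id ?P z) holomorphic_on ball 0 r"
    by (intro holomorphic_intros div_id_holomorphic T P T0 P0 p_nz)
  hence hb: "f holomorphic_on ball 0 r"
    using f_ball by (metis (no_types, lifting) holomorphic_transform)
  have "(\<lambda>z. ?T z / ?P z) holomorphic_on - lattice \<tau>"
    by (intro holomorphic_intros T P) (auto simp: theta_product_eq_0_iff assms)
  hence hc: "f holomorphic_on - lattice \<tau>"
    by (rule holomorphic_transform) (auto simp: f_def)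
  have "f field_differentiable at z" for z
  proof (cases "z \<in> lattice \<tau>")
    case False
    thus ?thesis using hc closed_subset_lattice[OF assms order_refl]
      by (auto intro!: holomorphic_on_imp_differentiable_at)
  next
    case True
    have "f field_differentiable at 0"
      using hb r by (auto intro!: holomorphic_on_imp_differentiable_at)
    then obtain d where "(f has_field_derivative d) (at 0)" by (auto simp: field_differentiable_def)
    hence "((\<lambda>w. f (w + - z)) has_field_derivative d) (at z)"
      by (subst DERIV_shift[symmetric]) simp
    moreover have "(\<lambda>w. f (w + - z)) = f" by (intro ext per lattice_minus[OF True])
    ultimately show ?thesis by (auto simp: field_differentiable_def)
  qed
  hence hf: "f holomorphic_on UNIV" by (simp add: holomorphic_on_def field_differentiable_at_within)
  have "bounded (f ` cball 0 (1 + norm \<tau>))"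
    by (intro compact_imp_bounded compact_continuous_image holomorphic_on_imp_continuous_on
        holomorphic_on_subset[OF hf]) auto
  moreover have "range f \<subseteq> f ` cball 0 (1 + norm \<tau>)"
  proof
    fix y assume "y \<in> range f"
    then obtain z where z: "y = f z" by auto
    obtain l where l: "l \<in> lattice \<tau>" "norm (z - l) \<le> 1 + norm \<tau>" using lattice_reduce[OF assms] by blast
    have "f (z - l) = f z" using per[OF lattice_minus[OF l(1)], of z] by simp
    thus "y \<in> f ` cball 0 (1 + norm \<tau>)" using z l(2) by (auto intro!: image_eqI[of _ _ "z - l"])
  qed
  ultimately have "bounded (range f)" using bounded_subset by blast
  then obtain c where c: "\<And>z. f z = c" using Liouville_theorem[OF hf] by (auto simp: constant_on_def)
  have eq: "?T z = c * ?P z" for z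
    using c[of z] theta_product_eq_0_iff[OF assms, of z] theta1_lattice[of z \<tau>]
    by (auto simp: f_def split: if_splits)
  moreover have "c \<noteq> 0" using theta1_not_identically_0[OF assms] eq by auto
  ultimately show ?thesis by blast
qed

lemma theta1_eq_0_iff:
  assumes "Im \<tau> > 0"
  shows "theta1 \<tau> z = 0 \<longleftrightarrow> z \<in> lattice \<tau>"
  using theta1_eq_product[OF assms] theta_product_eq_0_iff[OF assms] by fastforce

lemma deriv_theta1_0:
  assumes "Im \<tau> > 0"
  shows "deriv (theta1 \<tau>) 0 \<noteq> 0"
proof -
  obtain c where c: "c \<noteq> 0" "\<And>z. theta1 \<tau> z = c * theta_product \<tau> z" using theta1_eq_product[OF assms] by blast
  have "(theta_product \<tau> has_field_derivative deriv (theta_product \<tau>) 0) (at 0)"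
    using holomorphic_derivI[OF theta_product_holomorphic[OF assms, of UNIV]] by auto
  hence "((\<lambda>z. c * theta_product \<tau> z) has_field_derivative c * deriv (theta_product \<tau>) 0) (at 0)"
    by (rule DERIV_cmult)
  hence "deriv (theta1 \<tau>) 0 = c * deriv (theta_product \<tau>) 0"
    unfolding c(2)[abs_def] by (rule DERIV_imp_deriv)
  thus ?thesis using c deriv_theta_product_0[OF assms] by simp
qed

subsection \<open>The logarithmic derivative of the theta function\<close>

text \<open>Up to a linear term this is the Weierstrass zeta function of the lattice.\<close>

definition zeta :: "complex \<Rightarrow> complex \<Rightarrow> complex" where
  "zeta \<tau> w = deriv (theta1 \<tau>) w / theta1 \<tau> w"

text \<open>What is left of \<open>zeta\<close> after removal of its pole \<open>1 / w\<close> at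
  the origin. The poles at the other lattice points remain, but differences of two points of one
  closed hole never meet them.\<close>

definition zeta_reg :: "complex \<Rightarrow> complex \<Rightarrow> complex" where
  "zeta_reg \<tau> w = deriv (div_id (theta1 \<tau>)) w / div_id (theta1 \<tau>) w"

abbreviation punctured_lattice :: "complex \<Rightarrow> complex set" where
  "punctured_lattice \<tau> \<equiv> lattice \<tau> - {0}"

context
  fixes \<tau> :: complex
  assumes tau: "Im \<tau> > 0"
begin

lemma div_theta1_holomorphic: "div_id (theta1 \<tau>) holomorphic_on A"
  by (intro div_id_holomorphic theta1_holomorphic tau theta1_0)

lemma div_theta1_eq_0_iff: "div_id (theta1 \<tau>) w = 0 \<longleftrightarrow> w \<in> punctured_lattice \<tau>"
  using theta1_eq_0_iff[OF tau, of w] deriv_theta1_0[OF tau] by (auto simp: div_id_def)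

lemma zeta_holomorphic: "zeta \<tau> holomorphic_on - lattice \<tau>"
  unfolding zeta_def[abs_def]
  by (intro holomorphic_intros theta1_holomorphic tau)
     (auto simp: theta1_eq_0_iff tau intro!: open_Compl closed_subset_lattice)

lemma zeta_reg_holomorphic: "zeta_reg \<tau> holomorphic_on - punctured_lattice \<tau>"
  unfolding zeta_reg_def[abs_def]
  by (intro holomorphic_intros div_theta1_holomorphic)
     (auto simp: div_theta1_eq_0_iff tau intro!: open_Compl closed_subset_lattice simp del: Compl_Diff_eq)

lemma zeta_eq:
  assumes "w \<notin> lattice \<tau>"
  shows "zeta \<tau> w = 1 / w + zeta_reg \<tau> w"
proof -
  let ?k = "div_id (theta1 \<tau>)"
  have w: "w \<noteq> 0" using assms by auto
  have k: "?k w \<noteq> 0" using assms by (simp add: div_theta1_eq_0_iff)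
  have "(?k has_field_derivative deriv ?k w) (at w)"
    using holomorphic_derivI[OF div_theta1_holomorphic[of UNIV]] by auto
  hence "((\<lambda>z. z * ?k z) has_field_derivative ?k w + w * deriv ?k w) (at w)"
    by (auto intro!: derivative_eq_intros)
  moreover have e: "(\<lambda>z. z * ?k z) = theta1 \<tau>" using div_id_mult[of "theta1 \<tau>"] theta1_0 by auto
  ultimately have "deriv (theta1 \<tau>) w = ?k w + w * deriv ?k w" by (simp add: DERIV_imp_deriv)
  moreover have "theta1 \<tau> w = w * ?k w" using e by metis
  ultimately show ?thesis using w k by (simp add: zeta_def zeta_reg_def field_simps)
qed

text \<open>The differential of \<open>ln \<bar>f\<bar>\<close> is \<open>Re (f' / f dz)\<close>.
  The second summand comes from the quadratic correction and is not of this holomorphic form; it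
  becomes constant after integration against a mean-zero density.\<close>

lemma Green_has_derivative:
  assumes "w \<notin> lattice \<tau>"
  shows "(Green \<tau> has_derivative (\<lambda>v. - Re (v * zeta \<tau> w) / (2 * pi) + Im w * Im v / Im \<tau>)) (at w)"
proof -
  let ?T = "theta1 \<tau>"
  have nz: "?T w \<noteq> 0" using assms by (simp add: theta1_eq_0_iff tau)
  have "(?T has_field_derivative deriv ?T w) (at w)"
    using holomorphic_derivI[OF theta1_holomorphic[OF tau, of UNIV]] by auto
  hence d: "(?T has_derivative (\<lambda>v. deriv ?T w * v)) (at w)" by (simp add: has_field_derivative_def)
  have n: "((\<lambda>z. norm (?T z)) has_derivative (\<lambda>v. ?T w \<bullet> (deriv ?T w * v) / norm (?T w))) (at w)"
    by (rule has_derivative_eq_rhs[OF has_derivative_compose[OF d has_derivative_norm[OF nz]]])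
       (simp add: fun_eq_iff sgn_div_norm inner_commute divide_inverse mult.commute)
  have "((\<lambda>z. ln (norm (?T z))) has_derivative (\<lambda>v. ?T w \<bullet> (deriv ?T w * v) / norm (?T w) / norm (?T w))) (at w)"
    using has_derivative_ln[OF _ n] nz by (simp add: divide_inverse)
  moreover have "?T w \<bullet> (deriv ?T w * v) / norm (?T w) / norm (?T w) = Re (v * zeta \<tau> w)" for v
  proof -
    have "v * zeta \<tau> w = cnj (?T w) * (deriv ?T w * v) / of_real (norm (?T w) * norm (?T w))"
    proof -
      have "complex_of_real (norm (?T w) * norm (?T w)) = ?T w * cnj (?T w)"
        by (simp add: complex_norm_square[symmetric] power2_eq_square)
      thus ?thesis using nz by (simp add: zeta_def field_simps)
    qed
    also have "Re \<dots> = Re (cnj (?T w) * (deriv ?T w * v)) / (norm (?T w) * norm (?T w))"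
      by (simp only: Re_divide_of_real)
    finally show ?thesis by (simp add: inner_complex_def)
  qed
  ultimately have L: "((\<lambda>z. ln (norm (?T z))) has_derivative (\<lambda>v. Re (v * zeta \<tau> w))) (at w)" by simp
  have I: "((\<lambda>z. (Im z)\<^sup>2) has_derivative (\<lambda>v. 2 * Im w * Im v)) (at w)"
    by (auto intro!: derivative_eq_intros bounded_linear_imp_has_derivative bounded_linear_Im)
  show ?thesis
    unfolding Green_def[abs_def]
    by (rule has_derivative_eq_rhs[OF has_derivative_add[OF has_derivative_mult_right[OF L] has_derivative_mult_right[OF I]]])
       (auto simp: fun_eq_iff diff_divide_distrib)
qed

text \<open>Under \<tau> the modulus of theta picks up \<open>exp (pi (Im \<tau> + 2 Im w))\<close>;
  the increment of \<open>(Im w)^2 / (2 Im \<tau>)\<close> is exactly what compensates its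
  logarithm.\<close>

lemma Green_lattice:
  assumes "w \<notin> lattice \<tau>" "l \<in> lattice \<tau>"
  shows "Green \<tau> (w + l) = Green \<tau> w"
proof -
  \<comment> \<open>At lattice points \<open>Green\<close> contains the default value
    \<open>ln 0 = 0\<close> and is not periodic. \<open>H\<close> masks them, so that the induction
    over the lattice can run through all points.\<close>
  define H where "H z = (if z \<in> lattice \<tau> then 0 else Green \<tau> z)" for z
  have "H (w + l) = H w"
  proof (rule periodic_lattice[OF _ _ assms(2)])
    show "H (z + 1) = H z" for z
      by (simp add: H_def lattice_add_iff[OF lattice_1] Green_def theta1_add_1)
    fix z
    show "H (z + \<tau>) = H z"
    proof (cases "z \<in> lattice \<tau>")
      case False
      hence nz: "theta1 \<tau> z \<noteq> 0" by (simp add: theta1_eq_0_iff tau)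
      have "norm (theta1 \<tau> (z + \<tau>)) = exp (pi * (Im \<tau> + 2 * Im z)) * norm (theta1 \<tau> z)"
        by (simp add: theta1_add_tau norm_mult norm_exp_eq_Re)
      hence "ln (norm (theta1 \<tau> (z + \<tau>))) = pi * (Im \<tau> + 2 * Im z) + ln (norm (theta1 \<tau> z))"
        using nz by (simp add: ln_mult)
      hence "Green \<tau> (z + \<tau>) = Green \<tau> z"
        using tau unfolding Green_def by (simp add: field_simps power2_eq_square)
      thus ?thesis using False by (simp add: H_def lattice_add_iff[OF lattice_tau])
    qed (simp add: H_def lattice_add_iff[OF lattice_tau])
  qed
  thus ?thesis using assms by (simp add: H_def lattice_add_iff)
qed

end

subsection \<open>Periodic functions of a real variable\<close>

lemma periodic_of_int:
  fixes f :: "real \<Rightarrow> 'a"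
  assumes "\<And>t. f (t + 1) = f t"
  shows "f (t + of_int n) = f t"
proof (induction n rule: int_induct[where k = 0])
  case (step1 i)
  thus ?case using assms[of "t + of_int i"] by (simp add: add.assoc)
next
  case (step2 i)
  thus ?case using assms[of "t + of_int i - 1"] by (simp add: add_diff_eq)
qed simp

lemma periodic_integral:
  fixes f :: "real \<Rightarrow> 'a::banach"
  assumes per: "\<And>t. f (t + 1) = f t" and int: "(f has_integral I) {0..1}"
  shows "(f has_integral I) {a..a + 1}"
proof -
  define n b where "n = \<lfloor>a\<rfloor>" and "b = a - of_int n"
  have b: "0 \<le> b" "b \<le> 1" unfolding b_def n_def by linarith+
  have f_int: "f integrable_on {0..1}" using int by blast
  have "f integrable_on {0..b}" "f integrable_on {b..1}"
    using integrable_subinterval_real[OF f_int] b by auto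
  then obtain I1 I2 where I: "(f has_integral I1) {0..b}" "(f has_integral I2) {b..1}" by blast
  have "(f has_integral (I1 + I2)) {0..1}" by (rule has_integral_combine[OF b I])
  hence I_eq: "I = I1 + I2" using int has_integral_unique by blast
  have shift: "f \<circ> (+) (of_int k) = f" for k :: int
    using periodic_of_int[of f _ k, OF per] by (auto simp: add.commute)
  have "(f has_integral I1) {0 + 1..b + 1}"
    using I(1) has_integral_shift_Icc_real[of f 1 I1 0 b] shift[of 1] by simp
  hence "(f has_integral (I2 + I1)) {b..b + 1}"
    using I(2) b by (intro has_integral_combine[of b 1]) auto
  hence "(f has_integral I) {b + of_int n..b + 1 + of_int n}"
    using has_integral_shift_Icc_real[of f "of_int n" I b "b + 1"] shift[of n] by (simp add: I_eq add.commute)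
  thus ?thesis by (simp add: b_def)
qed

text \<open>Moves a distinguished parameter \<open>s\<close> to the centre of the window, away from
  the ends of the period.\<close>

lemma periodic_integral_centred:
  fixes f :: "real \<Rightarrow> 'a::banach"
  assumes per: "\<And>t. f (t + 1) = f t" and int: "f integrable_on {0..1}"
  shows "integral {-1/2..1/2} (\<lambda>r. f (s + r)) = integral {0..1} f"
    and "(\<lambda>r. f (s + r)) integrable_on {-1/2..1/2}"
proof -
  have "(f has_integral integral {0..1} f) {s - 1/2..s - 1/2 + 1}"
    by (rule periodic_integral[OF per integrable_integral[OF int]])
  hence "(f has_integral integral {0..1} f) {-1/2 + s..1/2 + s}" by (simp add: algebra_simps)
  hence "((f \<circ> (+) s) has_integral integral {0..1} f) {-1/2..1/2}"
    by (simp only: has_integral_shift_Icc_real)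
  hence *: "((\<lambda>r. f (s + r)) has_integral integral {0..1} f) {-1/2..1/2}" by (simp add: o_def)
  thus "integral {-1/2..1/2} (\<lambda>r. f (s + r)) = integral {0..1} f" by (rule integral_unique)
  from * show "(\<lambda>r. f (s + r)) integrable_on {-1/2..1/2}" by blast
qed

lemma continuous_on_integral_snd:
  fixes f :: "'a::topological_space \<Rightarrow> real \<Rightarrow> 'b::banach"
  assumes "continuous_on (U \<times> {a..b}) (\<lambda>(x, t). f x t)"
  shows "continuous_on U (\<lambda>x. integral {a..b} (f x))"
  using integral_continuous_on_param[of U a b f] assms by simp

lemma real_reduce: "\<exists>n::int. t + of_int n \<in> {0..<1::real}"
  by (rule exI[of _ "- \<lfloor>t\<rfloor>"]) (simp, linarith)

lemma real_reduce_near: "\<exists>n::int. \<bar>t + of_int n - s\<bar> \<le> (1/2::real)"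
  by (rule exI[of _ "- round (t - s)"]) (use of_int_round_abs_le[of "t - s"] in \<open>simp add: abs_minus_commute algebra_simps\<close>)

subsection \<open>Closed curves of class \<open>C\<^sup>2\<close>\<close>

locale c2_curve =
  fixes \<gamma> \<gamma>' \<gamma>'' :: "real \<Rightarrow> complex"
  assumes per: "\<gamma> (t + 1) = \<gamma> t"
    and inj: "inj_on \<gamma> {0..<1}"
    and deriv: "(\<gamma> has_vector_derivative \<gamma>' t) (at t)"
    and regular: "\<gamma>' t \<noteq> 0"
    and deriv2: "(\<gamma>' has_vector_derivative \<gamma>'' t) (at t)"
    and cont2: "continuous_on UNIV \<gamma>''"
begin

lemma cont: "continuous_on A \<gamma>"
  by (meson deriv continuous_at_imp_continuous_on has_vector_derivative_continuous)

lemma cont1: "continuous_on A \<gamma>'"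
  by (meson deriv2 continuous_at_imp_continuous_on has_vector_derivative_continuous)

lemma cont2': "continuous_on A \<gamma>''"
  using cont2 continuous_on_subset by blast

lemmas curve_cont [continuous_intros] =
  continuous_on_compose2[OF cont _ subset_UNIV] continuous_on_compose2[OF cont1 _ subset_UNIV]
  continuous_on_compose2[OF cont2 _ subset_UNIV]

lemma periodic_derivative:
  fixes f :: "real \<Rightarrow> complex"
  assumes "\<And>t. f (t + 1) = f t" "\<And>t. (f has_vector_derivative f' t) (at t)"
  shows "f' (t + 1) = f' t"
proof -
  have "((f \<circ> (\<lambda>t. t + 1)) has_vector_derivative (1 *\<^sub>R f' (t + 1))) (at t)"
    by (rule vector_diff_chain_at) (auto intro!: derivative_eq_intros assms(2))
  moreover have "f \<circ> (\<lambda>t. t + 1) = f" using assms(1) by auto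
  ultimately show ?thesis using vector_derivative_unique_at[OF assms(2)[of t]] by simp
qed

lemma per1: "\<gamma>' (t + 1) = \<gamma>' t"
  by (rule periodic_derivative[OF per deriv])

lemma per2: "\<gamma>'' (t + 1) = \<gamma>'' t"
  by (rule periodic_derivative[OF per1 deriv2])

lemmas per_int = periodic_of_int[of \<gamma>, OF per] periodic_of_int[of \<gamma>', OF per1] periodic_of_int[of \<gamma>'', OF per2]

lemma eq_iff: "\<gamma> t = \<gamma> s \<longleftrightarrow> t - s \<in> \<int>"
proof
  assume eq: "\<gamma> t = \<gamma> s"
  obtain n m :: int where nm: "t + of_int n \<in> {0..<1}" "s + of_int m \<in> {0..<1}" using real_reduce by blast
  have "\<gamma> (t + of_int n) = \<gamma> (s + of_int m)" using eq by (simp add: per_int)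
  hence "t + of_int n = s + of_int m" using inj nm by (auto dest: inj_onD)
  hence "t - s = of_int (m - n)" by simp
  thus "t - s \<in> \<int>" by (metis Ints_of_int)
next
  assume "t - s \<in> \<int>"
  then obtain n where "t = s + of_int n" by (metis Ints_cases add.commute diff_add_cancel)
  thus "\<gamma> t = \<gamma> s" by (simp add: per_int)
qed

lemma image_eq: "range \<gamma> = \<gamma> ` {0..1}"
proof -
  have "\<gamma> t \<in> \<gamma> ` {0..1}" for t
  proof -
    obtain n :: int where n: "t + of_int n \<in> {0..<1}" using real_reduce by blast
    have "\<gamma> t = \<gamma> (t + of_int n)" by (simp add: per_int)
    thus ?thesis using n by (auto intro!: image_eqI[of _ _ "t + of_int n"])
  qed
  thus ?thesis by auto
qed

text \<open>
  Integral remainders: \<open>\<gamma> t - \<gamma> s = (t - s) quot s t\<close> and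
  \<open>\<gamma> t - \<gamma> s = (t - s) \<gamma>' s + (t - s)\<^sup>2 rem s t\<close>, with \<open>quot\<close> and \<open>rem\<close> jointly continuous.
\<close>

definition quot :: "real \<Rightarrow> real \<Rightarrow> complex" where
  "quot s t = integral {0..1} (\<lambda>r. \<gamma>' (s + r * (t - s)))"

definition rem :: "real \<Rightarrow> real \<Rightarrow> complex" where
  "rem s t = integral {0..1} (\<lambda>r. (1 - r) *\<^sub>R \<gamma>'' (s + r * (t - s)))"

lemma continuous_on_quot: "continuous_on A (\<lambda>x. quot (fst x) (snd x))"
proof -
  have "continuous_on (A \<times> {0..1}) (\<lambda>(x, r). \<gamma>' (fst x + r * (snd x - fst x)))"
    unfolding case_prod_unfold by (intro continuous_intros)
  from continuous_on_integral_snd[OF this] show ?thesis by (simp add: quot_def)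
qed

lemma continuous_on_rem: "continuous_on A (\<lambda>x. rem (fst x) (snd x))"
proof -
  have "continuous_on (A \<times> {0..1}) (\<lambda>(x, r). (1 - r) *\<^sub>R \<gamma>'' (fst x + r * (snd x - fst x)))"
    unfolding case_prod_unfold by (intro continuous_intros)
  from continuous_on_integral_snd[OF this] show ?thesis by (simp add: rem_def)
qed

lemma diff_eq_quot: "\<gamma> t - \<gamma> s = of_real (t - s) * quot s t"
proof -
  have "((\<lambda>r. (t - s) *\<^sub>R \<gamma>' (s + r * (t - s))) has_integral (\<gamma> (s + 1 * (t - s)) - \<gamma> (s + 0 * (t - s)))) {0..1}"
  proof (rule fundamental_theorem_of_calculus)
    fix r :: real
    have "((\<gamma> \<circ> (\<lambda>r. s + r * (t - s))) has_vector_derivative (t - s) *\<^sub>R \<gamma>' (s + r * (t - s))) (at r)"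
      by (rule vector_diff_chain_at) (auto intro!: derivative_eq_intros deriv)
    thus "((\<lambda>r. \<gamma> (s + r * (t - s))) has_vector_derivative (t - s) *\<^sub>R \<gamma>' (s + r * (t - s))) (at r within {0..1})"
      by (auto simp: o_def intro: has_vector_derivative_at_within)
  qed simp
  from integral_unique[OF this] have "integral {0..1} (\<lambda>r. (t - s) *\<^sub>R \<gamma>' (s + r * (t - s))) = \<gamma> t - \<gamma> s" by simp
  thus ?thesis by (simp add: quot_def scaleR_conv_of_real)
qed

lemma diff_eq_rem: "\<gamma> t - \<gamma> s = of_real (t - s) * \<gamma>' s + of_real ((t - s)\<^sup>2) * rem s t"
proof -
  let ?h = "t - s"
  let ?F = "\<lambda>r. ?h *\<^sub>R (1 - r) *\<^sub>R \<gamma>' (s + r * ?h) + \<gamma> (s + r * ?h)"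
  have "((\<lambda>r. ?h\<^sup>2 *\<^sub>R (1 - r) *\<^sub>R \<gamma>'' (s + r * ?h)) has_integral (?F 1 - ?F 0)) {0..1}"
  proof (rule fundamental_theorem_of_calculus)
    fix r :: real
    have "((\<gamma> \<circ> (\<lambda>r. s + r * ?h)) has_vector_derivative ?h *\<^sub>R \<gamma>' (s + r * ?h)) (at r)"
      by (rule vector_diff_chain_at) (auto intro!: derivative_eq_intros deriv)
    hence 1: "((\<lambda>r. \<gamma> (s + r * ?h)) has_vector_derivative ?h *\<^sub>R \<gamma>' (s + r * ?h)) (at r)" by (simp add: o_def)
    have "((\<gamma>' \<circ> (\<lambda>r. s + r * ?h)) has_vector_derivative ?h *\<^sub>R \<gamma>'' (s + r * ?h)) (at r)"
      by (rule vector_diff_chain_at) (auto intro!: derivative_eq_intros deriv2)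
    hence 2: "((\<lambda>r. \<gamma>' (s + r * ?h)) has_vector_derivative ?h *\<^sub>R \<gamma>'' (s + r * ?h)) (at r)" by (simp add: o_def)
    have 3: "((\<lambda>r. 1 - r) has_real_derivative -1) (at r)" by (auto intro!: derivative_eq_intros)
    have "((\<lambda>r. (1 - r) *\<^sub>R \<gamma>' (s + r * ?h)) has_vector_derivative
            (1 - r) *\<^sub>R (?h *\<^sub>R \<gamma>'' (s + r * ?h)) + (-1) *\<^sub>R \<gamma>' (s + r * ?h)) (at r)"
      by (rule has_vector_derivative_scaleR[OF 3 2])
    from has_vector_derivative_add[OF bounded_linear.has_vector_derivative[OF bounded_linear_scaleR_right this, of ?h] 1]
    have "((\<lambda>r. ?h *\<^sub>R (1 - r) *\<^sub>R \<gamma>' (s + r * ?h) + \<gamma> (s + r * ?h)) has_vector_derivative ?h\<^sup>2 *\<^sub>R (1 - r) *\<^sub>R \<gamma>'' (s + r * ?h)) (at r)"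
      by (simp add: scaleR_diff_right power2_eq_square mult_ac)
    thus "(?F has_vector_derivative ?h\<^sup>2 *\<^sub>R (1 - r) *\<^sub>R \<gamma>'' (s + r * ?h)) (at r within {0..1})"
      by (rule has_vector_derivative_at_within)
  qed simp
  from integral_unique[OF this]
  have "?h\<^sup>2 *\<^sub>R rem s t = \<gamma> t - ?h *\<^sub>R \<gamma>' s - \<gamma> s"
    unfolding rem_def integral_cmul[symmetric] by simp
  thus ?thesis by (simp only: scaleR_conv_of_real) (simp add: algebra_simps del: of_real_diff of_real_power)
qed

lemma quot_same [simp]: "quot s s = \<gamma>' s"
  by (simp add: quot_def)

lemma rem_same: "rem s s = \<gamma>'' s / 2"
proof -
  have "((\<lambda>r::real. (1 - r) *\<^sub>R \<gamma>'' s) has_integral ((1 - 1\<^sup>2 / 2) *\<^sub>R \<gamma>'' s - (0 - 0\<^sup>2 / 2) *\<^sub>R \<gamma>'' s)) {0..1}"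
    by (rule fundamental_theorem_of_calculus)
       (auto intro!: derivative_eq_intros has_vector_derivative_scaleR)
  from integral_unique[OF this] show ?thesis by (simp add: rem_def scaleR_conv_of_real)
qed

lemma not_Ints_near: "t \<noteq> s \<Longrightarrow> \<bar>t - s\<bar> < 1 \<Longrightarrow> t - s \<notin> \<int>" for t s :: real
proof
  assume "t \<noteq> s" "\<bar>t - s\<bar> < 1" "t - s \<in> \<int>"
  then obtain n :: int where n: "t - s = of_int n" by (auto elim!: Ints_cases)
  hence "\<bar>n\<bar> < 1" using \<open>\<bar>t - s\<bar> < 1\<close> by (metis of_int_abs of_int_less_1_iff)
  thus False using n \<open>t \<noteq> s\<close> by simp
qed

lemma quot_nonzero: "\<bar>t - s\<bar> < 1 \<Longrightarrow> quot s t \<noteq> 0"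
proof (cases "t = s")
  case False
  assume "\<bar>t - s\<bar> < 1"
  hence "t - s \<notin> \<int>" using False by (intro not_Ints_near)
  hence "\<gamma> t \<noteq> \<gamma> s" by (simp add: eq_iff)
  thus ?thesis using diff_eq_quot[of t s] by auto
qed (use regular in simp)

text \<open>The difference quotient \<open>quot\<close> is the nonzero derivative on the diagonal
  and is nonzero off it by injectivity; compactness bounds its modulus away from 0.\<close>

lemma chord_arc: "\<exists>m>0. \<forall>s t. \<bar>t - s\<bar> \<le> 1/2 \<longrightarrow> m * \<bar>t - s\<bar> \<le> norm (\<gamma> t - \<gamma> s)"
proof -
  \<comment> \<open>A common integer shift of both parameters changes nothing, so \<open>s\<close>
    may range over one period. The second parameter stays within half a period of \<open>s\<close>,
    where the chord cannot close up.\<close>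
  let ?K = "(\<lambda>x. (fst x, fst x + snd x)) ` ({0..1} \<times> {-1/2..1/2::real}) :: (real \<times> real) set"
  have K: "compact ?K" by (intro compact_continuous_image continuous_intros compact_Times) auto
  have ne: "?K \<noteq> {}" by simp
  have ck: "continuous_on ?K (\<lambda>x. norm (quot (fst x) (snd x)))"
    by (intro continuous_intros continuous_on_quot)
  obtain x where x: "x \<in> ?K" "\<And>y. y \<in> ?K \<Longrightarrow> norm (quot (fst x) (snd x)) \<le> norm (quot (fst y) (snd y))"
    using continuous_attains_inf[OF K ne ck] by blast
  define m where "m = norm (quot (fst x) (snd x))"
  have "m > 0" unfolding m_def using x(1) quot_nonzero by auto
  moreover have "m * \<bar>t - s\<bar> \<le> norm (\<gamma> t - \<gamma> s)" if "\<bar>t - s\<bar> \<le> 1/2" for s t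
  proof -
    obtain n :: int where n: "s + of_int n \<in> {0..<1}" using real_reduce by blast
    let ?s = "s + of_int n" and ?t = "t + of_int n"
    have "(?s, ?t) \<in> ?K" using n abs_le_D1[OF that] abs_le_D2[OF that] by (intro image_eqI[of _ _ "(?s, t - s)"]) auto
    hence "m \<le> norm (quot ?s ?t)" using x(2) unfolding m_def by fastforce
    hence "m * \<bar>t - s\<bar> \<le> norm (quot ?s ?t) * \<bar>?t - ?s\<bar>" by (simp add: mult_right_mono)
    also have "\<dots> = norm (\<gamma> ?t - \<gamma> ?s)" unfolding diff_eq_quot norm_mult norm_of_real by (rule mult.commute)
    finally show ?thesis by (simp add: per_int)
  qed
  ultimately show ?thesis by blast
qed

lemma deriv2_bounded: "\<exists>B\<ge>0. \<forall>t. norm (\<gamma>'' t) \<le> B"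
proof -
  have "bounded (\<gamma>'' ` {0..1})" by (intro compact_imp_bounded compact_continuous_image cont2') auto
  then obtain B where B: "\<And>t. t \<in> {0..1} \<Longrightarrow> norm (\<gamma>'' t) \<le> B" unfolding bounded_iff by blast
  have "norm (\<gamma>'' t) \<le> B" for t
  proof -
    obtain n :: int where n: "t + of_int n \<in> {0..<1}" using real_reduce by blast
    thus ?thesis using B[of "t + of_int n"] by (simp add: per_int)
  qed
  moreover have "B \<ge> 0" using B[of 0] norm_ge_zero[of "\<gamma>'' 0"] by (simp del: norm_ge_zero)
  ultimately show ?thesis by blast
qed

lemma quad_bound: "\<exists>C\<ge>0. \<forall>s t. norm (\<gamma> t - \<gamma> s - of_real (t - s) * \<gamma>' s) \<le> C * (t - s)\<^sup>2 \<and> norm (\<gamma>' t - \<gamma>' s) \<le> C * \<bar>t - s\<bar>"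
proof -
  obtain B where B: "B \<ge> 0" "\<And>t. norm (\<gamma>'' t) \<le> B" using deriv2_bounded by blast
  have "norm (rem s t) \<le> B" for s t
  proof -
    have "norm (rem s t) \<le> integral {0..1} (\<lambda>r::real. B)"
      unfolding rem_def
    proof (rule integral_norm_bound_integral)
      show "norm ((1 - r) *\<^sub>R \<gamma>'' (s + r * (t - s))) \<le> B" if "r \<in> {0..1}" for r
        using mult_mono[of "1 - r" 1 "norm (\<gamma>'' (s + r * (t - s)))" B] B that by simp
    qed (auto intro!: integrable_continuous_real continuous_intros)
    thus ?thesis by simp
  qed
  hence r: "norm (rem s t) \<le> B" for s t .
  have "norm (\<gamma> t - \<gamma> s - of_real (t - s) * \<gamma>' s) \<le> B * (t - s)\<^sup>2" for s t
  proof -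
    have "norm (\<gamma> t - \<gamma> s - of_real (t - s) * \<gamma>' s) = (t - s)\<^sup>2 * norm (rem s t)"
      unfolding diff_eq_rem[of t s] by (simp add: norm_mult del: of_real_diff of_real_power)
    also have "\<dots> \<le> (t - s)\<^sup>2 * B" using r by (rule mult_left_mono) simp
    finally show ?thesis by (simp add: mult.commute)
  qed
  moreover have "norm (\<gamma>' t - \<gamma>' s) \<le> B * \<bar>t - s\<bar>" for s t
  proof -
    have "norm (\<gamma>' t - \<gamma>' s) \<le> B * norm (t - s)"
    proof (rule differentiable_bound[of UNIV \<gamma>' "\<lambda>t h. h *\<^sub>R \<gamma>'' t"])
      show "(\<gamma>' has_derivative (\<lambda>h. h *\<^sub>R \<gamma>'' t)) (at t within UNIV)" for t
        using deriv2 by (simp add: has_vector_derivative_def)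
      show "onorm (\<lambda>h. h *\<^sub>R \<gamma>'' t) \<le> B" for t
        using B by (intro onorm_le) (simp add: mult.commute[of B] mult_left_mono)
    qed auto
    thus ?thesis by simp
  qed
  ultimately show ?thesis using B(1) by blast
qed

text \<open>Up to a constant and the speed, this is the normal derivative of the planar logarithm
  along the curve. The diagonal value, the limit of the other branch, is half the signed curvature
  times the speed.\<close>

definition tangent_kernel :: "real \<Rightarrow> real \<Rightarrow> real" where
  "tangent_kernel s t = (if t - s \<in> \<int> then Im (\<gamma>'' s / (2 * \<gamma>' s)) else Im (\<gamma>' s / (\<gamma> s - \<gamma> t)))"

text \<open>With \<open>h = t - s\<close> one has \<open>\<gamma>' s = quot s t - h rem s t\<close>.
  The singular part of the quotient is then \<open>- 1 / h\<close>, which is real and disappears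
  under \<open>Im\<close>.\<close>

lemma tangent_kernel_near: "\<bar>t - s\<bar> < 1 \<Longrightarrow> tangent_kernel s t = Im (rem s t / quot s t)"
proof -
  assume ts: "\<bar>t - s\<bar> < 1"
  show ?thesis
  proof (cases "t = s")
    case True
    thus ?thesis by (simp add: tangent_kernel_def rem_same)
  next
    case False
    hence ni: "t - s \<notin> \<int>" using ts by (intro not_Ints_near)
    let ?h = "complex_of_real (t - s)"
    have h: "?h \<noteq> 0" using False by simp
    have q: "quot s t \<noteq> 0" using quot_nonzero[OF ts] .
    have "?h * quot s t = ?h * (\<gamma>' s + ?h * rem s t)"
      using diff_eq_quot[of t s] diff_eq_rem[of t s] by (simp add: power2_eq_square algebra_simps)
    hence g: "\<gamma>' s = quot s t - ?h * rem s t" using h by (simp del: of_real_diff)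
    have "\<gamma> s - \<gamma> t = - (?h * quot s t)" using diff_eq_quot[of t s] by (simp add: algebra_simps)
    hence "\<gamma>' s / (\<gamma> s - \<gamma> t) = - ((quot s t - ?h * rem s t) / (?h * quot s t))" using g by simp
    also have "\<dots> = - (1 / ?h) + rem s t / quot s t" using h q by (simp add: diff_divide_distrib del: of_real_diff)
    also have "Im \<dots> = Im (rem s t / quot s t)"
      by (simp only: plus_complex.sel uminus_complex.sel) (simp add: Im_divide del: of_real_diff)
    finally show ?thesis using ni by (simp add: tangent_kernel_def)
  qed
qed

lemma Ints_add_of_int_iff: "x + of_int n \<in> \<int> \<longleftrightarrow> x \<in> \<int>" for x :: real
  by (metis Ints_add Ints_diff Ints_of_int add_diff_cancel_right')

lemma tangent_kernel_periodic: "tangent_kernel s (t + of_int n) = tangent_kernel s t"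
  "tangent_kernel (s + of_int n) t = tangent_kernel s t"
proof -
  have "t + of_int n - s \<in> \<int> \<longleftrightarrow> t - s \<in> \<int>" "t - (s + of_int n) \<in> \<int> \<longleftrightarrow> t - s \<in> \<int>"
    using Ints_add_of_int_iff[of "t - s" n] Ints_add_of_int_iff[of "t - (s + of_int n)" n] by (simp_all add: algebra_simps)
  thus "tangent_kernel s (t + of_int n) = tangent_kernel s t" "tangent_kernel (s + of_int n) t = tangent_kernel s t"
    by (simp_all add: tangent_kernel_def per_int)
qed

lemma tangent_kernel_continuous: "continuous_on UNIV (\<lambda>x. tangent_kernel (fst x) (snd x))"
proof (rule continuous_at_imp_continuous_on, rule ballI)
  fix x :: "real \<times> real"
  \<comment> \<open>An integer shift brings the second parameter within half a period of the first;
    in that neighbourhood the kernel is a quotient of jointly continuous functions whose denominator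
    has no zero.\<close>
  obtain n :: int where n: "\<bar>snd x + of_int n - fst x\<bar> \<le> 1/2" using real_reduce_near by blast
  let ?U = "{y :: real \<times> real. \<bar>snd y + of_int n - fst y\<bar> < 1}"
  have U: "open ?U" by (intro open_Collect_less continuous_intros)
  have xU: "x \<in> ?U" using n by simp
  have "continuous_on ?U (\<lambda>y. Im (rem (fst y) (snd y + of_int n) / quot (fst y) (snd y + of_int n)))"
  proof (intro continuous_intros ballI)
    show "continuous_on ?U (\<lambda>y. rem (fst y) (snd y + of_int n))"
      by (rule continuous_on_compose2[OF continuous_on_rem[of UNIV], of ?U "\<lambda>y. (fst y, snd y + of_int n)", simplified])
         (intro continuous_intros)
    show "continuous_on ?U (\<lambda>y. quot (fst y) (snd y + of_int n))"
      by (rule continuous_on_compose2[OF continuous_on_quot[of UNIV], of ?U "\<lambda>y. (fst y, snd y + of_int n)", simplified])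
         (intro continuous_intros)
  qed (use quot_nonzero in auto)
  moreover have "tangent_kernel (fst y) (snd y) = Im (rem (fst y) (snd y + of_int n) / quot (fst y) (snd y + of_int n))" if "y \<in> ?U" for y
    using tangent_kernel_near[of "snd y + of_int n" "fst y"] that by (simp add: tangent_kernel_periodic)
  ultimately have "continuous_on ?U (\<lambda>y. tangent_kernel (fst y) (snd y))"
    by (metis (no_types, lifting) continuous_on_cong)
  thus "isCont (\<lambda>x. tangent_kernel (fst x) (snd x)) x"
    using continuous_on_eq_continuous_at[OF U] xU by blast
qed

text \<open>A uniform ball condition. For \<open>d = \<gamma> t - \<gamma> s\<close> and
  \<open>h = t - s\<close>, expand \<open>\<bar>d - R n\<bar>^2 = \<bar>d\<bar>^2 - 2 R (n \<bullet>
  d) + R^2\<close>: the chord-arc bound gives \<open>\<bar>d\<bar>^2 \<ge> m^2 h^2\<close>, while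
  \<open>n \<bullet> d \<le> C h^2\<close> because \<open>n\<close> is orthogonal to the
  tangent.\<close>

lemma tangent_ball: "\<exists>R>0. \<forall>s t. \<forall>n. norm n = 1 \<longrightarrow> n \<bullet> \<gamma>' s = 0 \<longrightarrow>
    R \<le> norm (\<gamma> t - (\<gamma> s + of_real R * n)) \<and> (\<gamma> t \<noteq> \<gamma> s \<longrightarrow> R < norm (\<gamma> t - (\<gamma> s + of_real R * n)))"
proof -
  obtain m where m: "m > 0" "\<And>s t. \<bar>t - s\<bar> \<le> 1/2 \<Longrightarrow> m * \<bar>t - s\<bar> \<le> norm (\<gamma> t - \<gamma> s)" using chord_arc by blast
  obtain C where C: "C \<ge> 0" "\<And>s t. norm (\<gamma> t - \<gamma> s - of_real (t - s) * \<gamma>' s) \<le> C * (t - s)\<^sup>2" using quad_bound by blast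
  \<comment> \<open>Small enough for \<open>2 * R * C \<le> m^2 / 2\<close>; using
    \<open>C + 1\<close> avoids a vanishing denominator.\<close>
  define R where "R = m\<^sup>2 / (4 * (C + 1))"
  have R: "R > 0" using m C by (simp add: R_def)
  have "2 * R * C \<le> m\<^sup>2 / 2"
    using C by (simp add: R_def field_simps)
  moreover have "m\<^sup>2 / 2 < m\<^sup>2" using m by simp
  ultimately have RC: "2 * R * C < m\<^sup>2" by linarith
  have main: "R \<le> norm (\<gamma> t - (\<gamma> s + of_real R * n)) \<and> (\<gamma> t \<noteq> \<gamma> s \<longrightarrow> R < norm (\<gamma> t - (\<gamma> s + of_real R * n)))"
    if n: "norm n = 1" "n \<bullet> \<gamma>' s = 0" and ts: "\<bar>t - s\<bar> \<le> 1/2" for s t n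
  proof -
    let ?d = "\<gamma> t - \<gamma> s"
    have "n \<bullet> ?d = n \<bullet> (?d - of_real (t - s) * \<gamma>' s)"
      using n(2) by (simp add: inner_diff_right del: of_real_diff flip: scaleR_conv_of_real)
    also have "\<dots> \<le> norm n * norm (?d - of_real (t - s) * \<gamma>' s)" by (rule norm_cauchy_schwarz)
    also have "\<dots> \<le> C * (t - s)\<^sup>2" using C(2)[of t s] n by simp
    finally have 1: "2 * R * (n \<bullet> ?d) \<le> 2 * R * (C * (t - s)\<^sup>2)" using R by (intro mult_left_mono) auto
    have "(m * \<bar>t - s\<bar>)\<^sup>2 \<le> (norm ?d)\<^sup>2" using m ts by (intro power_mono) auto
    hence 2: "m\<^sup>2 * (t - s)\<^sup>2 \<le> (norm ?d)\<^sup>2" by (simp add: power_mult_distrib)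
    have "(norm (\<gamma> t - (\<gamma> s + of_real R * n)))\<^sup>2 = (norm (?d - R *\<^sub>R n))\<^sup>2"
      by (simp add: scaleR_conv_of_real algebra_simps)
    also have "\<dots> = (norm ?d)\<^sup>2 - 2 * R * (n \<bullet> ?d) + R\<^sup>2"
      unfolding power2_norm_eq_inner using n(1)
      by (simp add: inner_diff_left inner_diff_right inner_commute power2_eq_square norm_eq_1 algebra_simps)
    finally have 3: "(norm (\<gamma> t - (\<gamma> s + of_real R * n)))\<^sup>2 \<ge> R\<^sup>2 + (m\<^sup>2 - 2 * R * C) * (t - s)\<^sup>2"
      using 1 2 by (simp add: algebra_simps)
    have ge: "R\<^sup>2 \<le> (norm (\<gamma> t - (\<gamma> s + of_real R * n)))\<^sup>2"
      using 3 RC by (smt (verit) mult_nonneg_nonneg zero_le_power2)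
    moreover have "R\<^sup>2 < (norm (\<gamma> t - (\<gamma> s + of_real R * n)))\<^sup>2" if "\<gamma> t \<noteq> \<gamma> s"
    proof -
      have "(t - s)\<^sup>2 > 0" using that by auto
      hence "(m\<^sup>2 - 2 * R * C) * (t - s)\<^sup>2 > 0" using RC by simp
      thus ?thesis using 3 by linarith
    qed
    ultimately show ?thesis using R
      by (meson norm_ge_zero power2_le_imp_le power_less_imp_less_base)
  qed
  have "R \<le> norm (\<gamma> t - (\<gamma> s + of_real R * n)) \<and> (\<gamma> t \<noteq> \<gamma> s \<longrightarrow> R < norm (\<gamma> t - (\<gamma> s + of_real R * n)))"
    if n: "norm n = 1" "n \<bullet> \<gamma>' s = 0" for s t n
  proof -
    obtain k :: int where k: "\<bar>t + of_int k - s\<bar> \<le> 1/2" using real_reduce_near by blast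
    from main[OF n k] show ?thesis by (simp add: per_int)
  qed
  thus ?thesis using R by blast
qed

text \<open>The curve leaves its tangent quadratically, so for a curve point at displacement
  \<open>d\<close> the quantity \<open>Im (d / \<gamma>' s)\<close> is of order
  \<open>\<bar>d\<bar>^2\<close>, whereas in the cone it is at least
  \<open>\<kappa> \<bar>d\<bar>\<close>. Close to the vertex both cannot hold.\<close>

lemma cone_avoids:
  assumes "\<kappa> > 0"
  shows "\<exists>\<delta>>0. \<forall>z. z \<noteq> \<gamma> s \<and> norm (z - \<gamma> s) < \<delta> \<and> \<kappa> * norm (z - \<gamma> s) \<le> \<bar>Im ((z - \<gamma> s) / \<gamma>' s)\<bar> \<longrightarrow> z \<notin> range \<gamma>"
proof -
  obtain m where m: "m > 0" "\<And>s t. \<bar>t - s\<bar> \<le> 1/2 \<Longrightarrow> m * \<bar>t - s\<bar> \<le> norm (\<gamma> t - \<gamma> s)" using chord_arc by blast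
  obtain C where C: "C \<ge> 0" "\<And>s t. norm (\<gamma> t - \<gamma> s - of_real (t - s) * \<gamma>' s) \<le> C * (t - s)\<^sup>2" using quad_bound by blast
  let ?a = "\<gamma>' s"
  have a: "norm ?a > 0" using regular by simp
  define \<delta> where "\<delta> = \<kappa> * norm ?a * m\<^sup>2 / (C + 1)"
  have \<delta>: "\<delta> > 0" using m a C assms by (simp add: \<delta>_def)
  have "\<not> (\<kappa> * norm (\<gamma> t - \<gamma> s) \<le> \<bar>Im ((\<gamma> t - \<gamma> s) / ?a)\<bar>)" if ne: "\<gamma> t \<noteq> \<gamma> s" and less: "norm (\<gamma> t - \<gamma> s) < \<delta>" and ts: "\<bar>t - s\<bar> \<le> 1/2" for t
  proof
    let ?d = "\<gamma> t - \<gamma> s"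
    assume "\<kappa> * norm ?d \<le> \<bar>Im (?d / ?a)\<bar>"
    also have "Im (?d / ?a) = Im ((?d - of_real (t - s) * ?a) / ?a)"
      using a by (simp add: diff_divide_distrib del: of_real_diff)
    also have "\<bar>\<dots>\<bar> \<le> norm ((?d - of_real (t - s) * ?a) / ?a)" by (rule abs_Im_le_cmod)
    also have "\<dots> \<le> C * (t - s)\<^sup>2 / norm ?a" unfolding norm_divide using C(2)[of t s] by (intro divide_right_mono) auto
    finally have "\<kappa> * norm ?d * norm ?a \<le> C * (t - s)\<^sup>2" using a by (simp add: field_simps)
    hence "\<kappa> * norm ?d * norm ?a * m\<^sup>2 \<le> C * (m * \<bar>t - s\<bar>)\<^sup>2"
      using mult_right_mono[of _ _ "m\<^sup>2"] by (fastforce simp: power_mult_distrib mult_ac)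
    also have "\<dots> \<le> C * (norm ?d)\<^sup>2" using m ts C by (intro mult_left_mono power_mono) auto
    also have "\<dots> \<le> (C + 1) * norm ?d * norm ?d" by (simp add: power2_eq_square algebra_simps)
    finally have "\<kappa> * norm ?a * m\<^sup>2 * norm ?d \<le> ((C + 1) * norm ?d) * norm ?d" by (simp add: mult_ac)
    hence "\<kappa> * norm ?a * m\<^sup>2 \<le> (C + 1) * norm ?d" using ne by simp
    hence "\<delta> \<le> norm ?d" using C by (simp add: \<delta>_def field_simps)
    thus False using less by simp
  qed
  moreover have "\<exists>t'. \<gamma> t' = \<gamma> t \<and> \<bar>t' - s\<bar> \<le> 1/2" for t
    using real_reduce_near[of t s] per_int(1) by metis
  ultimately show ?thesis using \<delta> by (metis rangeE)
qed

end

subsection \<open>The jump of a Cauchy-type integral\<close>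

lemma poisson_kernel_has_integral:
  fixes x y :: real
  assumes "y > 0" "a \<le> b"
  shows "((\<lambda>r. y / ((r - x)\<^sup>2 + y\<^sup>2)) has_integral (arctan ((b - x) / y) - arctan ((a - x) / y))) {a..b}"
proof (rule fundamental_theorem_of_calculus[OF assms(2)])
  fix r :: real
  have "((\<lambda>r. arctan ((r - x) / y)) has_real_derivative (1 / y) * inverse (1 + ((r - x) / y)\<^sup>2)) (at r)"
    using assms by (auto intro!: derivative_eq_intros)
  moreover have "(1 / y) * inverse (1 + ((r - x) / y)\<^sup>2) = y / ((r - x)\<^sup>2 + y\<^sup>2)"
  proof -
    have "1 + ((r - x) / y)\<^sup>2 = ((r - x)\<^sup>2 + y\<^sup>2) / y\<^sup>2"
      using assms by (simp add: power_divide add_divide_distrib)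
    thus ?thesis using assms by (simp add: power2_eq_square)
  qed
  ultimately show "((\<lambda>r. arctan ((r - x) / y)) has_vector_derivative y / ((r - x)\<^sup>2 + y\<^sup>2)) (at r within {a..b})"
    by (simp add: has_real_derivative_iff_has_vector_derivative has_vector_derivative_at_within)
qed

text \<open>An approximate identity of mass \<pi>. The centre \<open>x\<close> may tend to 0 at any
  rate relative to the height \<open>y\<close>: measured in units of \<open>y\<close>, both ends of
  the fixed window recede to infinity.\<close>

lemma poisson_kernel_tendsto:
  fixes \<psi> :: "real \<Rightarrow> real"
  assumes \<psi>: "continuous_on {-1/2..1/2} \<psi>"
    and x: "(x \<longlongrightarrow> 0) F" and y: "(y \<longlongrightarrow> 0) F" and ypos: "\<forall>\<^sub>F i in F. y i > 0"
  shows "((\<lambda>i. integral {-1/2..1/2} (\<lambda>r. \<psi> r * (y i / ((r - x i)\<^sup>2 + (y i)\<^sup>2)))) \<longlongrightarrow> pi * \<psi> 0) F"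
proof -
  let ?I = "{-1/2..1/2::real}"
  let ?P = "\<lambda>i r. y i / ((r - x i)\<^sup>2 + (y i)\<^sup>2)"
  have Pc: "continuous_on ?I (?P i)" if "y i > 0" for i
    using that by (intro continuous_intros) (auto simp: add_nonneg_eq_0_iff)
  have IP: "integral ?I (?P i) = arctan ((1/2 - x i) / y i) - arctan ((-1/2 - x i) / y i)" if "y i > 0" for i
    using poisson_kernel_has_integral[OF that, of "-1/2" "1/2" "x i"] by (simp add: integral_unique)
  have inv: "filterlim (\<lambda>i. inverse (y i)) at_top F"
    using y ypos by (rule filterlim_inverse_at_top)
  have f1: "filterlim (\<lambda>i. (1/2 - x i) * inverse (y i)) at_top F"
    by (rule filterlim_tendsto_pos_mult_at_top[OF _ _ inv, of _ "1/2"]) (use x in \<open>auto intro!: tendsto_eq_intros\<close>)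
  have 1: "((\<lambda>i. arctan ((1/2 - x i) / y i)) \<longlongrightarrow> pi / 2) F"
    using filterlim_compose[OF tendsto_arctan_at_top f1] by (simp only: divide_inverse)
  have f2: "filterlim (\<lambda>i. (-1/2 - x i) * inverse (y i)) at_bot F"
    by (rule filterlim_tendsto_neg_mult_at_bot[OF _ _ inv, of _ "-1/2"]) (use x in \<open>auto intro!: tendsto_eq_intros\<close>)
  have 2: "((\<lambda>i. arctan ((-1/2 - x i) / y i)) \<longlongrightarrow> - (pi / 2)) F"
    using filterlim_compose[OF tendsto_arctan_at_bot f2] by (simp only: divide_inverse)
  have lim0: "((\<lambda>i. arctan ((1/2 - x i) / y i) - arctan ((-1/2 - x i) / y i)) \<longlongrightarrow> pi / 2 - - (pi / 2)) F"
    by (intro tendsto_diff 1 2)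
  have lim1: "((\<lambda>i. \<psi> 0 * integral ?I (?P i)) \<longlongrightarrow> \<psi> 0 * pi) F"
  proof (rule Lim_transform_eventually)
    show "((\<lambda>i. \<psi> 0 * (arctan ((1/2 - x i) / y i) - arctan ((-1/2 - x i) / y i))) \<longlongrightarrow> \<psi> 0 * pi) F"
      using tendsto_mult_left[OF lim0, of "\<psi> 0"] by simp
    show "\<forall>\<^sub>F i in F. \<psi> 0 * (arctan ((1/2 - x i) / y i) - arctan ((-1/2 - x i) / y i)) = \<psi> 0 * integral ?I (?P i)"
      using ypos by eventually_elim (simp only: IP)
  qed
  define E where "E i = integral ?I (\<lambda>r. (\<psi> r - \<psi> 0) * ?P i r)" for i
  have "bounded ((\<lambda>r. \<psi> r - \<psi> 0) ` ?I)"
    by (intro compact_imp_bounded compact_continuous_image continuous_intros \<psi>) auto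
  then obtain B where B: "B > 0" "\<And>r. r \<in> ?I \<Longrightarrow> \<bar>\<psi> r - \<psi> 0\<bar> \<le> B"
    unfolding bounded_pos by (metis image_eqI real_norm_def)
  have "(E \<longlongrightarrow> 0) F"
  proof (rule tendstoI)
    fix e :: real assume e: "e > 0"
    \<comment> \<open>The part near 0 costs at most \<open>e' * pi < 4 * e'\<close> and the tail
      less than \<open>e'\<close>.\<close>
    define e' where "e' = e / 5"
    have e': "e' > 0" using e by (simp add: e'_def)
    have "\<exists>d>0. \<forall>r\<in>?I. dist r 0 < d \<longrightarrow> dist (\<psi> r) (\<psi> 0) < e'"
      using \<psi> e' unfolding continuous_on_iff by (metis (no_types, lifting) atLeastAtMost_iff divide_nonpos_pos divide_nonneg_nonneg neg_le_0_iff_le zero_le_numeral zero_le_one zero_less_numeral minus_divide_left)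
    then obtain d where d: "d > 0" "\<And>r. r \<in> ?I \<Longrightarrow> \<bar>r\<bar> < d \<Longrightarrow> \<bar>\<psi> r - \<psi> 0\<bar> < e'"
      by (auto simp: dist_real_def)
    have e1: "\<forall>\<^sub>F i in F. \<bar>x i\<bar> < d / 2"
      using tendstoD[OF x, of "d/2"] d by (simp add: dist_real_def)
    have "((\<lambda>i. B * (4 * y i / d\<^sup>2)) \<longlongrightarrow> 0) F" using y d(1) by (auto intro!: tendsto_eq_intros)
    from tendstoD[OF this e'] have e2: "\<forall>\<^sub>F i in F. \<bar>B * (4 * y i / d\<^sup>2)\<bar> < e'" by (simp add: dist_real_def)
    show "\<forall>\<^sub>F i in F. dist (E i) 0 < e"
      using e1 e2 ypos
    proof eventually_elim
      case (elim i)
      have bd: "norm ((\<psi> r - \<psi> 0) * ?P i r) \<le> e' * ?P i r + B * (4 * y i / d\<^sup>2)" if r: "r \<in> ?I" for r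
      proof (cases "\<bar>r\<bar> < d")
        case True
        have "norm ((\<psi> r - \<psi> 0) * ?P i r) = \<bar>\<psi> r - \<psi> 0\<bar> * ?P i r"
          using elim(3) by (simp add: abs_mult)
        also have "\<dots> \<le> e' * ?P i r" using d(2)[OF r True] elim(3) by (intro mult_right_mono) auto
        finally show ?thesis using B(1) elim(3) d(1) by (smt (verit) divide_nonneg_nonneg mult_nonneg_nonneg zero_le_power2)
      next
        case False
        hence "(d/2)\<^sup>2 \<le> (r - x i)\<^sup>2" using elim(1) d(1) by (intro abs_le_square_iff[THEN iffD1]) linarith
        hence "(d/2)\<^sup>2 \<le> (r - x i)\<^sup>2 + (y i)\<^sup>2" by (smt (verit) zero_le_power2)
        hence "?P i r \<le> y i / (d/2)\<^sup>2" using elim(3) d(1) by (intro divide_left_mono) (auto intro!: mult_pos_pos simp: add_nonneg_pos)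
        hence P: "?P i r \<le> 4 * y i / d\<^sup>2" by (simp add: power_divide mult.commute)
        have "norm ((\<psi> r - \<psi> 0) * ?P i r) = \<bar>\<psi> r - \<psi> 0\<bar> * ?P i r"
          using elim(3) by (simp add: abs_mult)
        also have "\<dots> \<le> B * (4 * y i / d\<^sup>2)" using B(2)[OF r] P elim(3) B(1) by (intro mult_mono) auto
        finally show ?thesis using e' elim(3) by (smt (verit) divide_nonneg_nonneg mult_nonneg_nonneg zero_le_power2)
      qed
      have int: "(\<lambda>r. e' * ?P i r + B * (4 * y i / d\<^sup>2)) integrable_on ?I"
        by (intro integrable_continuous_real continuous_intros Pc elim)
      have "norm (E i) \<le> integral ?I (\<lambda>r. e' * ?P i r + B * (4 * y i / d\<^sup>2))"
        unfolding E_def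
        by (intro integral_norm_bound_integral bd int integrable_continuous_real continuous_intros Pc \<psi> elim)
      also have "\<dots> = e' * integral ?I (?P i) + B * (4 * y i / d\<^sup>2)"
      proof -
        have "integral ?I (\<lambda>r. e' * ?P i r + B * (4 * y i / d\<^sup>2)) = integral ?I (\<lambda>r. e' * ?P i r) + integral ?I (\<lambda>r. B * (4 * y i / d\<^sup>2))"
          by (intro integral_add integrable_continuous_real continuous_intros Pc elim)
        also have "integral ?I (\<lambda>r. e' * ?P i r) = e' * integral ?I (?P i)"
          by (rule integral_mult_right)
        finally show ?thesis by simp
      qed
      also have "integral ?I (?P i) \<le> pi"
        unfolding IP[OF elim(3)] using arctan_ubound[of "(1/2 - x i) / y i"] arctan_lbound[of "(-1/2 - x i) / y i"] by linarith
      also have "e' * pi + B * (4 * y i / d\<^sup>2) < e' * 4 + e'"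
        using elim(2) e' pi_less_4 by (intro add_less_le_mono mult_strict_left_mono) linarith+
      finally show "dist (E i) 0 < e" using e' by (simp add: e'_def)
    qed
  qed
  hence "((\<lambda>i. E i + \<psi> 0 * integral ?I (?P i)) \<longlongrightarrow> 0 + \<psi> 0 * pi) F"
    by (intro tendsto_add lim1)
  moreover have "\<forall>\<^sub>F i in F. E i + \<psi> 0 * integral ?I (?P i) = integral ?I (\<lambda>r. \<psi> r * ?P i r)"
    using ypos
  proof eventually_elim
    case (elim i)
    have "E i + \<psi> 0 * integral ?I (?P i) = integral ?I (\<lambda>r. (\<psi> r - \<psi> 0) * ?P i r + \<psi> 0 * ?P i r)"
      unfolding E_def integral_mult_right[symmetric]
      by (intro integral_add[symmetric] integrable_continuous_real continuous_intros Pc \<psi> elim)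
    thus ?case by (simp only: left_diff_distrib diff_add_cancel)
  qed
  ultimately have "((\<lambda>i. integral ?I (\<lambda>r. \<psi> r * ?P i r)) \<longlongrightarrow> 0 + \<psi> 0 * pi) F"
    using Lim_transform_eventually by fast
  thus ?thesis by (simp add: mult.commute)
qed

text \<open>
  The kernel \<open>\<rho> / (c - z)\<close> is compared with the one of the tangent line, \<open>\<i> \<psi> / (r - w)\<close> with
  \<open>w = (z - c 0) / a\<close>, whose real part is a Poisson kernel; in a cone the difference is bounded.
\<close>

lemma cauchy_integral_jump:
  fixes c \<rho> :: "real \<Rightarrow> complex" and \<psi> :: "real \<Rightarrow> real"
  assumes c: "continuous_on {-1/2..1/2} c" and a: "a \<noteq> 0"
    and quad: "\<And>r. r \<in> {-1/2..1/2} \<Longrightarrow> norm (c r - c 0 - of_real r * a) \<le> C * r\<^sup>2"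
    and chord: "\<And>r. r \<in> {-1/2..1/2} \<Longrightarrow> m * \<bar>r\<bar> \<le> norm (c r - c 0)" and m: "m > 0"
    and \<rho>: "continuous_on {-1/2..1/2} \<rho>" and \<psi>: "continuous_on {-1/2..1/2} \<psi>"
    and \<rho>\<psi>: "\<And>r. r \<in> {-1/2..1/2} \<Longrightarrow> norm (\<rho> r - \<i> * a * of_real (\<psi> r)) \<le> C' * \<bar>r\<bar>"
    and \<kappa>: "\<kappa> > 0" and \<sigma>: "\<sigma> = 1 \<or> \<sigma> = -1"
  shows "((\<lambda>z. integral {-1/2..1/2} (\<lambda>r. Re (\<rho> r / (c r - z)))) \<longlongrightarrow>
           integral {-1/2..1/2} (\<lambda>r. Re (\<rho> r / (c r - c 0))) - \<sigma> * pi * \<psi> 0)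
         (at (c 0) within {z. \<kappa> * norm (z - c 0) \<le> \<sigma> * Im ((z - c 0) / a)})"
  unfolding tendsto_at_iff_sequentially
proof (intro allI impI)
  let ?I = "{-1/2..1/2::real}"
  fix X assume X: "\<forall>i. X i \<in> {z. \<kappa> * norm (z - c 0) \<le> \<sigma> * Im ((z - c 0) / a)} - {c 0}"
    and Xlim: "X \<longlonglongrightarrow> c 0"
  define w where "w n = (X n - c 0) / a" for n
  \<comment> \<open>\<open>w n\<close> is the approaching point in coordinates where the tangent is
    the real axis with unit speed, and \<open>k\<close> is the aperture in these coordinates, capped
    at 1 for the estimate \<open>d1\<close>.\<close>
  define k where "k = min 1 (\<kappa> * norm a)"
  have k: "0 < k" "k \<le> 1" using \<kappa> a by (auto simp: k_def)
  have w_nz: "w n \<noteq> 0" for n using X a by (auto simp: w_def)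
  have Xw: "X n = c 0 + a * w n" for n using a by (simp add: w_def)
  have wlim: "w \<longlonglongrightarrow> 0" unfolding w_def using Xlim a by (auto intro!: tendsto_eq_intros)
  have cone: "k * norm (w n) \<le> \<sigma> * Im (w n)" for n
  proof -
    have "k * norm (w n) \<le> \<kappa> * norm a * norm (w n)" unfolding k_def by (intro mult_right_mono) auto
    also have "\<dots> = \<kappa> * norm (X n - c 0)" by (simp add: w_def norm_divide a)
    also have "\<dots> \<le> \<sigma> * Im (w n)" using X by (simp add: w_def)
    finally show ?thesis .
  qed
  hence ypos: "\<sigma> * Im (w n) > 0" for n
    using less_le_trans[OF mult_pos_pos[OF k(1)] cone] w_nz by simp
  have C: "C \<ge> 0"
    using norm_ge_zero[THEN order_trans, OF quad[of "1/2"]] by (simp add: zero_le_mult_iff)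
  have C': "C' \<ge> 0"
    using norm_ge_zero[THEN order_trans, OF \<rho>\<psi>[of "1/2"]] by (simp add: zero_le_mult_iff)
  \<comment> \<open>If \<open>\<bar>w\<bar>\<close> is at most \<open>\<bar>r\<bar> / 2\<close>, the
    triangle inequality suffices. Otherwise the cone keeps \<open>w\<close> at distance at least
    \<open>k \<bar>w\<bar>\<close> from the real axis.\<close>
  have d1: "(k / 2) * \<bar>r\<bar> \<le> norm (of_real r - w n)" for r n
  proof (cases "norm (w n) \<le> \<bar>r\<bar> / 2")
    case True
    have "(k/2) * \<bar>r\<bar> \<le> (1/2) * \<bar>r\<bar>" using k by (intro mult_right_mono) auto
    also have "\<dots> \<le> \<bar>r\<bar> - norm (w n)" using True by simp
    also have "\<dots> \<le> norm (of_real r - w n)" by (metis norm_of_real norm_triangle_ineq2)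
    finally show ?thesis .
  next
    case False
    hence "(k / 2) * \<bar>r\<bar> \<le> k * norm (w n)" using k by simp
    also have "\<dots> \<le> \<bar>Im (w n)\<bar>" using cone[of n] \<sigma> by auto
    also have "\<dots> \<le> norm (of_real r - w n)" using abs_Im_le_cmod[of "of_real r - w n"] by simp
    finally show ?thesis .
  qed
  \<comment> \<open>For \<open>\<bar>r\<bar> \<le> \<delta>\<close> the quadratic deviation from the
    tangent uses up at most half of the bound that \<open>d1\<close> provides. For larger
    \<open>\<bar>r\<bar>\<close> the chord bound takes over, once \<open>X n\<close> is within
    \<open>m * \<delta> / 2\<close> of \<open>c 0\<close>.\<close>
  define \<delta> where "\<delta> = norm a * k / (4 * C + 4)"
  have \<delta>: "\<delta> > 0" unfolding \<delta>_def using C a k by (intro divide_pos_pos mult_pos_pos) auto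
  define m' where "m' = min (norm a * k / 4) (m / 2)"
  have m': "m' > 0" unfolding m'_def using a k m by simp
  have "\<forall>\<^sub>F n in sequentially. dist (X n) (c 0) < m * \<delta> / 2"
    using tendstoD[OF Xlim, of "m * \<delta> / 2"] m \<delta> by simp
  then obtain N where N: "\<And>n. n \<ge> N \<Longrightarrow> dist (X n) (c 0) < m * \<delta> / 2"
    unfolding eventually_sequentially by blast
  have d2: "m' * \<bar>r\<bar> \<le> norm (c r - X n)" if r: "r \<in> ?I" and n: "n \<ge> N" for r n
  proof (cases "\<bar>r\<bar> \<le> \<delta>")
    case True
    have "C * \<bar>r\<bar> \<le> C * \<delta>" using True C by (rule mult_left_mono)
    also have "\<dots> \<le> norm a * k / 4" unfolding \<delta>_def using C a k by (simp add: field_simps)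
    finally have "C * \<bar>r\<bar> * \<bar>r\<bar> \<le> norm a * k / 4 * \<bar>r\<bar>" by (rule mult_right_mono) simp
    hence 1: "C * r\<^sup>2 \<le> norm a * k / 4 * \<bar>r\<bar>" by (simp add: power2_eq_square mult.assoc)
    have "norm a * ((k/2) * \<bar>r\<bar>) \<le> norm a * norm (of_real r - w n)" by (intro mult_left_mono d1) simp
    also have "\<dots> = norm (a * (of_real r - w n))" by (simp add: norm_mult)
    also have "a * (of_real r - w n) = (c r - X n) - (c r - c 0 - of_real r * a)"
      by (simp add: Xw algebra_simps)
    also have "norm \<dots> \<le> norm (c r - X n) + norm (c r - c 0 - of_real r * a)" by (rule norm_triangle_ineq4)
    also have "\<dots> \<le> norm (c r - X n) + norm a * k / 4 * \<bar>r\<bar>" using quad[OF r] 1 by simp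
    finally have "norm a * k / 4 * \<bar>r\<bar> \<le> norm (c r - X n)" by (simp add: algebra_simps)
    moreover have "m' * \<bar>r\<bar> \<le> norm a * k / 4 * \<bar>r\<bar>" unfolding m'_def by (intro mult_right_mono) auto
    ultimately show ?thesis by linarith
  next
    case False
    have "m' * \<bar>r\<bar> \<le> m / 2 * \<bar>r\<bar>" unfolding m'_def by (intro mult_right_mono) auto
    also have "m / 2 * \<bar>r\<bar> = m * \<bar>r\<bar> - m / 2 * \<bar>r\<bar>" by simp
    also have "m / 2 * \<bar>r\<bar> \<ge> m / 2 * \<delta>" using False m by (intro mult_left_mono) auto
    hence "m * \<bar>r\<bar> - m / 2 * \<bar>r\<bar> \<le> norm (c r - c 0) - norm (X n - c 0)"
      using chord[OF r] N[OF n] by (simp add: dist_norm)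
    also have "\<dots> \<le> norm (c r - X n)" using norm_triangle_ineq2[of "c r - c 0" "X n - c 0"] by simp
    finally show ?thesis .
  qed
  have cX: "c r - X n \<noteq> 0" if "r \<in> ?I" "n \<ge> N" for r n
  proof (cases "r = 0")
    case True thus ?thesis using X by auto
  next
    case False
    thus ?thesis using d2[OF that] mult_pos_pos[OF m', of "\<bar>r\<bar>"] by auto
  qed
  have rw: "of_real r - w n \<noteq> 0" for r n
    using ypos[of n] \<sigma> by (auto simp: complex_eq_iff)
  \<comment> \<open>The first summand replaces the curve by its tangent line, a quadratic error over
    a product of two distances. The second replaces the numerator by its tangential value, a linear
    error over one distance. Both stay bounded, and what remains of the kernel is a Poisson
    kernel.\<close>
  define g where "g n r = Re (\<rho> r * (1 / (c r - X n) - 1 / (a * (of_real r - w n)))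
      + (\<rho> r - \<i> * a * of_real (\<psi> r)) / (a * (of_real r - w n)))" for n r
  have split: "Re (\<rho> r / (c r - X n)) = g n r + (- \<sigma>) * (\<psi> r * (\<sigma> * Im (w n) / ((r - Re (w n))\<^sup>2 + (\<sigma> * Im (w n))\<^sup>2)))" for n r
  proof -
    have "\<rho> r / (c r - X n) = \<rho> r * (1 / (c r - X n) - 1 / (a * (of_real r - w n)))
      + (\<rho> r - \<i> * a * of_real (\<psi> r)) / (a * (of_real r - w n)) + \<i> * of_real (\<psi> r) / (of_real r - w n)"
    proof -
      have "\<i> * a * of_real (\<psi> r) / (a * (of_real r - w n)) = \<i> * of_real (\<psi> r) / (of_real r - w n)"
        using a by (simp add: mult.assoc mult.left_commute[of _ a])
      thus ?thesis by (simp only: diff_divide_distrib right_diff_distrib) (simp add: right_diff_distrib)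
    qed
    hence "Re (\<rho> r / (c r - X n)) = g n r + Re (\<i> * of_real (\<psi> r) / (of_real r - w n))"
      by (simp only: g_def plus_complex.sel)
    also have "Re (\<i> * of_real (\<psi> r) / (of_real r - w n)) = - (\<psi> r * Im (w n)) / ((r - Re (w n))\<^sup>2 + (Im (w n))\<^sup>2)"
      by (simp add: Re_divide)
    also have "\<dots> = (- \<sigma>) * (\<psi> r * (\<sigma> * Im (w n) / ((r - Re (w n))\<^sup>2 + (\<sigma> * Im (w n))\<^sup>2)))"
      using \<sigma> by auto
    finally show ?thesis .
  qed
  obtain R where R: "\<And>r. r \<in> ?I \<Longrightarrow> norm (\<rho> r) \<le> R" "R > 0"
    using compact_imp_bounded[OF compact_continuous_image[OF \<rho> compact_Icc]] unfolding bounded_pos by (metis image_eqI)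
  define H where "H = R * (C / (m' * norm a * (k / 2))) + C' / (norm a * (k / 2))"
  have gH: "norm (g n r) \<le> H" if r: "r \<in> ?I" and n: "n \<ge> N" for r n
  proof (cases "r = 0")
    case True
    have "\<rho> 0 = \<i> * a * of_real (\<psi> 0)" using \<rho>\<psi>[of 0] by simp
    moreover have "c 0 - X n = a * (of_real 0 - w n)" by (simp add: Xw)
    ultimately have "g n r = 0" unfolding g_def True by simp
    thus ?thesis unfolding H_def using C C' R m' a k by simp
  next
    case False
    hence r0: "\<bar>r\<bar> > 0" by simp
    have n1: "m' * norm a * (k / 2) * r\<^sup>2 \<le> norm ((c r - X n) * (a * (of_real r - w n)))"
    proof -
      have "m' * norm a * (k / 2) * r\<^sup>2 = (m' * \<bar>r\<bar>) * (norm a * ((k / 2) * \<bar>r\<bar>))"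
        by (simp add: power2_eq_square)
      also have "\<dots> \<le> norm (c r - X n) * (norm a * norm (of_real r - w n))"
        using m' k by (intro mult_mono d1 d2 r n) auto
      finally show ?thesis by (simp add: norm_mult)
    qed
    have p1: "m' * norm a * (k / 2) * r\<^sup>2 > 0" using m' a k False by simp
    have "1 / (c r - X n) - 1 / (a * (of_real r - w n)) = (a * (of_real r - w n) - (c r - X n)) / ((c r - X n) * (a * (of_real r - w n)))"
      using cX[OF r n] a rw[of r n] by (simp add: diff_frac_eq)
    also have "a * (of_real r - w n) - (c r - X n) = - (c r - c 0 - of_real r * a)" by (simp add: Xw algebra_simps)
    finally have "norm (1 / (c r - X n) - 1 / (a * (of_real r - w n))) = norm (c r - c 0 - of_real r * a) / norm ((c r - X n) * (a * (of_real r - w n)))"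
      by (simp only: norm_divide norm_minus_cancel)
    also have "\<dots> \<le> C * r\<^sup>2 / (m' * norm a * (k / 2) * r\<^sup>2)"
      using quad[OF r] n1 p1 C by (intro frac_le) auto
    also have "\<dots> = C / (m' * norm a * (k / 2))" using False by simp
    finally have b1: "norm (1 / (c r - X n) - 1 / (a * (of_real r - w n))) \<le> C / (m' * norm a * (k / 2))" .
    have n2: "norm a * (k / 2) * \<bar>r\<bar> \<le> norm (a * (of_real r - w n))"
      using mult_left_mono[OF d1[of r n], of "norm a"] by (simp add: norm_mult)
    have p2: "norm a * (k / 2) * \<bar>r\<bar> > 0" using a k r0 by simp
    have "norm ((\<rho> r - \<i> * a * of_real (\<psi> r)) / (a * (of_real r - w n))) \<le> C' * \<bar>r\<bar> / (norm a * (k / 2) * \<bar>r\<bar>)"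
      unfolding norm_divide using \<rho>\<psi>[OF r] n2 p2 C' by (intro frac_le) auto
    also have "\<dots> = C' / (norm a * (k / 2))" using r0 by simp
    finally have b2: "norm ((\<rho> r - \<i> * a * of_real (\<psi> r)) / (a * (of_real r - w n))) \<le> C' / (norm a * (k / 2))" .
    have "norm (g n r) \<le> norm (\<rho> r * (1 / (c r - X n) - 1 / (a * (of_real r - w n)))
      + (\<rho> r - \<i> * a * of_real (\<psi> r)) / (a * (of_real r - w n)))"
      unfolding g_def real_norm_def by (rule abs_Re_le_cmod)
    also have "\<dots> \<le> norm (\<rho> r * (1 / (c r - X n) - 1 / (a * (of_real r - w n)))) + C' / (norm a * (k / 2))"
      using b2 by (intro order_trans[OF norm_triangle_ineq]) simp
    also have "norm (\<rho> r * (1 / (c r - X n) - 1 / (a * (of_real r - w n)))) \<le> R * (C / (m' * norm a * (k / 2)))"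
      unfolding norm_mult[of "\<rho> r"] using R b1 r by (intro mult_mono) auto
    finally show ?thesis unfolding H_def by simp
  qed
  have gcont: "continuous_on ?I (g n)" if "n \<ge> N" for n
    unfolding g_def using cX[OF _ that] rw a
    by (intro continuous_intros c \<rho> \<psi>) auto
  have glim: "(\<lambda>n. g (n + N) r) \<longlonglongrightarrow> Re (\<rho> r / (c r - c 0))" if r: "r \<in> ?I" for r
  proof (cases "r = 0")
    case True
    have "\<rho> 0 = \<i> * a * of_real (\<psi> 0)" using \<rho>\<psi>[of 0] by simp
    moreover have "c 0 - X n = a * (of_real 0 - w n)" for n by (simp add: Xw)
    ultimately have "g n r = 0" for n unfolding g_def True by simp
    thus ?thesis using True by simp
  next
    case False
    have cr: "c r - c 0 \<noteq> 0" using chord[OF r] mult_pos_pos[OF m, of "\<bar>r\<bar>"] False by auto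
    have "(\<lambda>n. g n r) \<longlonglongrightarrow> Re (\<rho> r * (1 / (c r - c 0) - 1 / (a * (of_real r - 0)))
      + (\<rho> r - \<i> * a * of_real (\<psi> r)) / (a * (of_real r - 0)))"
      unfolding g_def using cr a False by (intro tendsto_intros Xlim wlim) auto
    \<comment> \<open>In the limit the kernel of the tangent line leaves only \<i> times the real
      number \<open>\<psi> r / r\<close>; it is purely imaginary, so its singularity is invisible in
      the real part.\<close>
    also have "\<rho> r * (1 / (c r - c 0) - 1 / (a * (of_real r - 0))) + (\<rho> r - \<i> * a * of_real (\<psi> r)) / (a * (of_real r - 0))
      = \<rho> r / (c r - c 0) - \<i> * of_real (\<psi> r / r)"
      using a False by (simp add: diff_divide_distrib right_diff_distrib)
    also have "Re \<dots> = Re (\<rho> r / (c r - c 0))" by (simp only: minus_complex.sel Re_i_times) simp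
    finally show ?thesis by (rule LIMSEQ_ignore_initial_segment)
  qed
  have "(\<lambda>n. integral ?I (g (n + N))) \<longlonglongrightarrow> integral ?I (\<lambda>r. Re (\<rho> r / (c r - c 0)))"
  proof (rule dominated_convergence[where h = "\<lambda>_. H"])
    show "g (n + N) integrable_on ?I" for n by (intro integrable_continuous_real gcont) simp
    show "norm (g (n + N) r) \<le> H" if "r \<in> ?I" for n r by (intro gH that) simp
  qed (auto intro: glim integrable_continuous_real)
  hence L1: "(\<lambda>n. integral ?I (g n)) \<longlonglongrightarrow> integral ?I (\<lambda>r. Re (\<rho> r / (c r - c 0)))"
    by (rule LIMSEQ_offset)
  have L2: "(\<lambda>n. integral ?I (\<lambda>r. \<psi> r * (\<sigma> * Im (w n) / ((r - Re (w n))\<^sup>2 + (\<sigma> * Im (w n))\<^sup>2)))) \<longlonglongrightarrow> pi * \<psi> 0"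
    by (rule poisson_kernel_tendsto[OF \<psi>]) (use wlim ypos in \<open>auto intro!: tendsto_eq_intros\<close>)
  have "(\<lambda>n. integral ?I (g n) + (- \<sigma>) * integral ?I (\<lambda>r. \<psi> r * (\<sigma> * Im (w n) / ((r - Re (w n))\<^sup>2 + (\<sigma> * Im (w n))\<^sup>2))))
     \<longlonglongrightarrow> integral ?I (\<lambda>r. Re (\<rho> r / (c r - c 0))) + (- \<sigma>) * (pi * \<psi> 0)"
    by (intro tendsto_add tendsto_mult_left L1 L2)
  moreover have "\<forall>\<^sub>F n in sequentially. integral ?I (g n) + (- \<sigma>) * integral ?I (\<lambda>r. \<psi> r * (\<sigma> * Im (w n) / ((r - Re (w n))\<^sup>2 + (\<sigma> * Im (w n))\<^sup>2)))
     = integral ?I (\<lambda>r. Re (\<rho> r / (c r - X n)))"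
    using eventually_ge_at_top[of N]
  proof eventually_elim
    case (elim n)
    have nz: "(r - Re (w n))\<^sup>2 + (\<sigma> * Im (w n))\<^sup>2 \<noteq> 0" for r
      using ypos[of n] by (metis add_nonneg_eq_0_iff less_irrefl power_eq_0_iff zero_le_power2)
    show ?case
      unfolding split integral_mult_right[symmetric]
      by (intro integral_add[symmetric] integrable_continuous_real gcont elim continuous_intros \<psi>) (use nz in auto)
  qed
  ultimately have "(\<lambda>n. integral ?I (\<lambda>r. Re (\<rho> r / (c r - X n)))) \<longlonglongrightarrow> integral ?I (\<lambda>r. Re (\<rho> r / (c r - c 0))) + (- \<sigma>) * (pi * \<psi> 0)"
    by (rule Lim_transform_eventually)
  thus "((\<lambda>z. integral ?I (\<lambda>r. Re (\<rho> r / (c r - z)))) \<circ> X) \<longlonglongrightarrow> integral ?I (\<lambda>r. Re (\<rho> r / (c r - c 0))) - \<sigma> * pi * \<psi> 0"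
    by (simp add: o_def mult.assoc)
qed

subsection \<open>Harmonic functions as local real parts\<close>

text \<open>Only local conjugates are asked for, since around a hole a single-valued one may fail to
  exist. The definition makes \<open>S\<close> open, and regularity, the Laplace equation and the
  maximum principle are inherited from holomorphic functions.\<close>

definition locally_Re :: "complex set \<Rightarrow> (complex \<Rightarrow> real) \<Rightarrow> bool" where
  "locally_Re S u \<longleftrightarrow> (\<forall>z\<in>S. \<exists>r>0. \<exists>f. ball z r \<subseteq> S \<and> f holomorphic_on ball z r \<and> (\<forall>w\<in>ball z r. u w = Re (f w)))"

lemma locally_ReE:
  assumes "locally_Re S u" "z \<in> S"
  obtains r f where "r > 0" "ball z r \<subseteq> S" "f holomorphic_on ball z r" "\<And>w. w \<in> ball z r \<Longrightarrow> u w = Re (f w)"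
  using assms unfolding locally_Re_def by blast

lemma locally_Re_open: "locally_Re S u \<Longrightarrow> open S"
  unfolding locally_Re_def open_contains_ball by blast

lemma locally_Re_subset:
  assumes "locally_Re S u" "T \<subseteq> S" "open T"
  shows "locally_Re T u"
  unfolding locally_Re_def
proof
  fix z assume z: "z \<in> T"
  then obtain r f where r: "r > 0" "f holomorphic_on ball z r" "\<And>w. w \<in> ball z r \<Longrightarrow> u w = Re (f w)"
    using locally_ReE[OF assms(1)] assms(2) by (metis subset_iff)
  obtain s where s: "s > 0" "ball z s \<subseteq> T" using z assms(3) open_contains_ball by blast
  have "ball z (min r s) \<subseteq> ball z r" "ball z (min r s) \<subseteq> T" using s(2) by auto
  thus "\<exists>r>0. \<exists>f. ball z r \<subseteq> T \<and> f holomorphic_on ball z r \<and> (\<forall>w\<in>ball z r. u w = Re (f w))"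
    using r s by (intro exI[of _ "min r s"] conjI exI[of _ f]) (auto intro: holomorphic_on_subset)
qed

lemma locally_Re_add:
  assumes "locally_Re S u" "locally_Re S v"
  shows "locally_Re S (\<lambda>z. u z + v z)"
  unfolding locally_Re_def
proof
  fix z assume z: "z \<in> S"
  obtain r f where r: "r > 0" "ball z r \<subseteq> S" "f holomorphic_on ball z r" "\<And>w. w \<in> ball z r \<Longrightarrow> u w = Re (f w)"
    using locally_ReE[OF assms(1) z] by metis
  obtain s g where s: "s > 0" "g holomorphic_on ball z s" "\<And>w. w \<in> ball z s \<Longrightarrow> v w = Re (g w)"
    using locally_ReE[OF assms(2) z] by metis
  have "ball z (min r s) \<subseteq> ball z r" "ball z (min r s) \<subseteq> ball z s" by auto
  thus "\<exists>r>0. \<exists>f. ball z r \<subseteq> S \<and> f holomorphic_on ball z r \<and> (\<forall>w\<in>ball z r. u w + v w = Re (f w))"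
    using r s by (intro exI[of _ "min r s"] conjI exI[of _ "\<lambda>w. f w + g w"] holomorphic_intros)
      (auto intro: holomorphic_on_subset)
qed

lemma locally_Re_cmult:
  assumes "locally_Re S u"
  shows "locally_Re S (\<lambda>z. c * u z)"
  unfolding locally_Re_def
proof
  fix z assume z: "z \<in> S"
  obtain r f where r: "r > 0" "ball z r \<subseteq> S" "f holomorphic_on ball z r" "\<And>w. w \<in> ball z r \<Longrightarrow> u w = Re (f w)"
    using locally_ReE[OF assms(1) z] by metis
  thus "\<exists>r>0. \<exists>f. ball z r \<subseteq> S \<and> f holomorphic_on ball z r \<and> (\<forall>w\<in>ball z r. c * u w = Re (f w))"
    by (intro exI[of _ r] conjI exI[of _ "\<lambda>w. of_real c * f w"] holomorphic_intros) auto
qed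

lemma locally_Re_const: "open S \<Longrightarrow> locally_Re S (\<lambda>z. c)"
  unfolding locally_Re_def open_contains_ball
proof
  fix z assume "\<forall>x\<in>S. \<exists>e>0. ball x e \<subseteq> S" "z \<in> S"
  then obtain r where "r > 0" "ball z r \<subseteq> S" by blast
  thus "\<exists>r>0. \<exists>f. ball z r \<subseteq> S \<and> f holomorphic_on ball z r \<and> (\<forall>w\<in>ball z r. c = Re (f w))"
    by (intro exI[of _ r] conjI exI[of _ "\<lambda>_. of_real c"]) auto
qed

lemma has_derivative_Re_holomorphic:
  assumes "f holomorphic_on ball z r" "w \<in> ball z r" "\<And>w. w \<in> ball z r \<Longrightarrow> u w = Re (f w)"
  shows "(u has_derivative (\<lambda>v. Re (v * deriv f w))) (at w)"
proof -
  have "(f has_derivative (\<lambda>v. deriv f w * v)) (at w)"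
    using holomorphic_derivI[OF assms(1) _ assms(2)] by (simp add: has_field_derivative_def)
  hence "((\<lambda>x. Re (f x)) has_derivative (\<lambda>v. Re (deriv f w * v))) (at w)"
    by (rule bounded_linear.has_derivative[OF bounded_linear_Re])
  hence "((\<lambda>x. Re (f x)) has_derivative (\<lambda>v. Re (v * deriv f w))) (at w)"
    by (simp only: mult.commute)
  thus ?thesis
    by (rule has_derivative_transform_within_open[OF _ open_ball assms(2)]) (simp add: assms(3))
qed

lemma has_derivative_dir_deriv:
  assumes "(u has_derivative u') (at z)"
  shows "((\<lambda>s::real. u (z + of_real s * v)) has_real_derivative u' v) (at 0)" "dir_deriv v u z = u' v"
proof -
  have "((\<lambda>s::real. z + of_real s * v) has_derivative (\<lambda>s. of_real s * v)) (at 0)"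
    by (auto intro!: derivative_eq_intros)
  moreover have "(u has_derivative u') (at (z + of_real 0 * v))" using assms by simp
  ultimately have "((\<lambda>s::real. u (z + of_real s * v)) has_derivative (\<lambda>s. u' (of_real s * v))) (at 0)"
    by (rule has_derivative_compose)
  moreover have "u' (of_real s * v) = s * u' v" for s
    using linear_scale[OF has_derivative_linear[OF assms], of s v] by (simp add: scaleR_conv_of_real)
  ultimately show 1: "((\<lambda>s::real. u (z + of_real s * v)) has_real_derivative u' v) (at 0)"
    unfolding has_field_derivative_def
    by (metis (no_types, lifting) ext has_derivative_eq_rhs mult.commute)
  show "dir_deriv v u z = u' v" unfolding dir_deriv_def by (rule DERIV_imp_deriv[OF 1])
qed

lemma dir_deriv_Re_holomorphic:
  assumes "f holomorphic_on ball z r" "w \<in> ball z r" "\<And>w. w \<in> ball z r \<Longrightarrow> u w = Re (f w)"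
  shows "dir_deriv v u w = Re (v * deriv f w)"
  by (rule has_derivative_dir_deriv(2)[OF has_derivative_Re_holomorphic[OF assms]])

lemma locally_Re_dir_deriv:
  assumes "locally_Re S u"
  shows "locally_Re S (dir_deriv v u)"
  unfolding locally_Re_def
proof
  fix z assume z: "z \<in> S"
  obtain r f where r: "r > 0" "ball z r \<subseteq> S" "f holomorphic_on ball z r" "\<And>w. w \<in> ball z r \<Longrightarrow> u w = Re (f w)"
    using locally_ReE[OF assms(1) z] by metis
  have "(\<lambda>w. v * deriv f w) holomorphic_on ball z r"
    by (intro holomorphic_intros holomorphic_deriv r) auto
  moreover have "dir_deriv v u w = Re (v * deriv f w)" if "w \<in> ball z r" for w
    by (rule dir_deriv_Re_holomorphic[OF r(3) that r(4)])
  ultimately show "\<exists>r>0. \<exists>f. ball z r \<subseteq> S \<and> f holomorphic_on ball z r \<and> (\<forall>w\<in>ball z r. dir_deriv v u w = Re (f w))"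
    using r(1,2) by blast
qed

lemma locally_Re_has_derivative:
  assumes "locally_Re S u" "z \<in> S"
  shows "\<exists>d. (u has_derivative (\<lambda>v. Re (v * d))) (at z)"
proof -
  obtain r f where "r > 0" "f holomorphic_on ball z r" "\<And>w. w \<in> ball z r \<Longrightarrow> u w = Re (f w)"
    using locally_ReE[OF assms] by metis
  thus ?thesis using has_derivative_Re_holomorphic[of f z r z u] by auto
qed

lemma locally_Re_differentiable_on: "locally_Re S u \<Longrightarrow> u differentiable_on S"
  unfolding differentiable_on_def
  by (meson locally_Re_has_derivative differentiableI differentiable_at_withinI)

lemma locally_Re_continuous_on: "locally_Re S u \<Longrightarrow> continuous_on S u"
  by (intro differentiable_imp_continuous_on locally_Re_differentiable_on)

lemma locally_Re_C2_on: "locally_Re S u \<Longrightarrow> C2_on S u"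
  unfolding C2_on_def
  by (intro conjI ballI locally_Re_differentiable_on locally_Re_continuous_on locally_Re_dir_deriv)

lemma locally_Re_laplacian:
  assumes "locally_Re S u" "z \<in> S"
  shows "laplacian u z = 0"
proof -
  obtain r f where r: "r > 0" "ball z r \<subseteq> S" "f holomorphic_on ball z r" "\<And>w. w \<in> ball z r \<Longrightarrow> u w = Re (f w)"
    using locally_ReE[OF assms] by metis
  have f': "deriv f holomorphic_on ball z r" by (intro holomorphic_deriv r) auto
  have d: "dir_deriv v (dir_deriv v u) z = Re (v * (v * deriv (deriv f) z))" for v
  proof -
    have "(\<lambda>w. v * deriv f w) holomorphic_on ball z r" by (intro holomorphic_intros f')
    hence "dir_deriv v (dir_deriv v u) z = Re (v * deriv (\<lambda>w. v * deriv f w) z)"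
      by (rule dir_deriv_Re_holomorphic) (use r dir_deriv_Re_holomorphic[OF r(3) _ r(4)] in auto)
    also have "deriv (\<lambda>w. v * deriv f w) z = v * deriv (deriv f) z"
      using f' r(1) by (intro deriv_cmult holomorphic_on_imp_differentiable_at) auto
    finally show ?thesis .
  qed
  show ?thesis unfolding laplacian_def d by simp
qed

lemma grad_eq:
  assumes "(u has_derivative (\<lambda>v. Re (v * d))) (at z)"
  shows "n \<bullet> grad u z = Re (n * d)"
  unfolding grad_def has_derivative_dir_deriv(2)[OF assms] by (simp add: inner_complex_def)

subsection \<open>Maximum principles\<close>

text \<open>Since \<open>\<bar>exp f\<bar> = exp (Re f)\<close>, the exponential turns a maximum of
  the real part into a maximum of a modulus.\<close>

lemma locally_Re_local_max:
  assumes "locally_Re S u" "z \<in> S" "\<And>w. w \<in> S \<Longrightarrow> u w \<le> u z"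
  shows "\<exists>r>0. ball z r \<subseteq> S \<and> (\<forall>w\<in>ball z r. u w = u z)"
proof -
  obtain r f where r: "r > 0" "ball z r \<subseteq> S" "f holomorphic_on ball z r" "\<And>w. w \<in> ball z r \<Longrightarrow> u w = Re (f w)"
    using locally_ReE[OF assms(1,2)] by metis
  have "(\<lambda>w. exp (f w)) constant_on ball z r"
  proof (rule maximum_modulus_principle[where U = "ball z r" and \<xi> = z])
    fix w assume "w \<in> ball z r"
    thus "norm (exp (f w)) \<le> norm (exp (f z))" using assms(3)[of w] r by (auto simp: subset_iff)
  qed (use r in \<open>auto intro!: holomorphic_intros\<close>)
  then obtain k where k: "\<And>w. w \<in> ball z r \<Longrightarrow> exp (f w) = k" unfolding constant_on_def by blast
  have "u w = u z" if "w \<in> ball z r" for w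
  proof -
    have "exp (u w) = norm k" "exp (u z) = norm k"
      using k[OF that] k[of z] r that by (metis norm_exp_eq_Re centre_in_ball)+
    thus ?thesis by (metis exp_inj_iff)
  qed
  thus ?thesis using r by blast
qed

lemma locally_Re_strong_max:
  assumes "locally_Re S u" "connected S" "z \<in> S" "\<And>w. w \<in> S \<Longrightarrow> u w \<le> u z" "w \<in> S"
  shows "u w = u z"
proof -
  let ?A = "{x \<in> S. u x = u z}"
  have "openin (top_of_set S) ?A"
  proof (rule open_subset, force)
    show "open ?A"
      unfolding open_contains_ball
    proof
      fix x assume x: "x \<in> ?A"
      have "\<exists>r>0. ball x r \<subseteq> S \<and> (\<forall>w\<in>ball x r. u w = u x)"
        by (rule locally_Re_local_max[OF assms(1)]) (use x assms(4) in auto)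
      then obtain r where "r > 0" "ball x r \<subseteq> S" "\<forall>w\<in>ball x r. u w = u x" by blast
      moreover from this have "w \<in> ?A" if "w \<in> ball x r" for w
        using that x by (metis (mono_tags, lifting) mem_Collect_eq subsetD)
      ultimately show "\<exists>e>0. ball x e \<subseteq> ?A" by blast
    qed
  qed
  moreover have "closedin (top_of_set S) ?A"
    using continuous_closedin_preimage_constant[OF locally_Re_continuous_on[OF assms(1)]] .
  ultimately have "?A = {} \<or> ?A = S" using assms(2) connected_clopen by blast
  thus ?thesis using assms(3,5) by blast
qed

text \<open>The rightmost point of the set where the maximum is attained lies on the frontier.\<close>

lemma locally_Re_weak_max:
  assumes u: "locally_Re S u" and c: "continuous_on (closure S) u" and S: "bounded S"
    and B: "\<And>z. z \<in> frontier S \<Longrightarrow> u z \<le> B" and z: "z \<in> S"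
  shows "u z \<le> B"
proof -
  have cp: "compact (closure S)" using S by (simp add: compact_eq_bounded_closed bounded_closure)
  have ne: "closure S \<noteq> {}" using z by auto
  obtain x where x: "x \<in> closure S" "\<And>y. y \<in> closure S \<Longrightarrow> u y \<le> u x"
    using continuous_attains_sup[OF cp ne c] by blast
  let ?A = "{y \<in> closure S. u y = u x}"
  have "closed ?A" using continuous_closed_preimage_constant[OF c closed_closure] .
  hence "compact ?A" using cp by (metis (no_types, lifting) closed_closure closure_subset compact_Int_closed inf.absorb_iff2 mem_Collect_eq subsetI)
  moreover have "?A \<noteq> {}" using x(1) by auto
  moreover have "continuous_on ?A Re" by (intro continuous_intros)
  ultimately obtain y where y: "y \<in> ?A" "\<And>w. w \<in> ?A \<Longrightarrow> Re w \<le> Re y"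
    using continuous_attains_sup[of ?A Re] by blast
  have "y \<notin> S"
  proof
    assume "y \<in> S"
    then obtain r where r: "r > 0" "ball y r \<subseteq> S" "\<forall>w\<in>ball y r. u w = u y"
    proof -
      have "u w \<le> u y" if "w \<in> S" for w using x(2)[of w] y(1) that closure_subset[of S] by auto
      from locally_Re_local_max[OF u \<open>y \<in> S\<close> this] show ?thesis using that by blast
    qed
    have m: "y + of_real (r / 2) \<in> ball y r" using r(1) by (simp add: dist_norm)
    hence "u (y + of_real (r / 2)) = u x" using r(3) y(1) by simp
    moreover have "y + of_real (r / 2) \<in> closure S" using m r(2) closure_subset by blast
    ultimately have "Re (y + of_real (r / 2)) \<le> Re y" by (intro y(2)) simp
    thus False using r(1) by simp
  qed
  hence "y \<in> frontier S" using y(1) locally_Re_open[OF u] by (simp add: frontier_def interior_open)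
  hence "u x \<le> B" using B y(1) by fastforce
  thus ?thesis using x(2)[of z] z closure_subset by fastforce
qed

text \<open>Near \<open>z\<close> the quotient \<open>(w - c) / (z - c)\<close> stays within
  distance 1 of 1, hence in the right half-plane, where the principal branch of the logarithm is
  holomorphic.\<close>

lemma locally_Re_ln_norm:
  "locally_Re (- {c}) (\<lambda>z. ln (norm (z - c)))"
  unfolding locally_Re_def
proof
  fix z assume z: "z \<in> - {c}"
  define f where "f w = Ln ((w - c) / (z - c)) + of_real (ln (norm (z - c)))" for w
  have nb: "norm ((w - c) / (z - c) - 1) < 1" if "w \<in> ball z (norm (z - c))" for w
  proof -
    have "(w - c) / (z - c) - 1 = (w - z) / (z - c)" using z by (simp add: field_simps)
    thus ?thesis using that z by (simp add: norm_divide dist_norm norm_minus_commute)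
  qed
  have pos: "Re ((w - c) / (z - c)) > 0" if "w \<in> ball z (norm (z - c))" for w
    using nb[OF that] abs_Re_le_cmod[of "(w - c) / (z - c) - 1"] by simp
  have "f holomorphic_on ball z (norm (z - c))"
    unfolding f_def
    by (intro holomorphic_intros) (use z pos complex_nonpos_Reals_iff in force)+
  moreover have "ln (norm (w - c)) = Re (f w)" if "w \<in> ball z (norm (z - c))" for w
  proof -
    have nz: "(w - c) / (z - c) \<noteq> 0" using pos[OF that] by force
    hence "Re (f w) = ln (norm (w - c) / norm (z - c)) + ln (norm (z - c))"
      by (simp add: f_def norm_divide)
    also have "\<dots> = ln (norm (w - c))" using nz z by (simp add: ln_div)
    finally show ?thesis by simp
  qed
  moreover have "ball z (norm (z - c)) \<subseteq> - {c}" by (auto simp: dist_norm)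
  ultimately show "\<exists>r>0. \<exists>f. ball z r \<subseteq> - {c} \<and> f holomorphic_on ball z r \<and> (\<forall>w\<in>ball z r. ln (norm (w - c)) = Re (f w))"
    using z by (intro exI[of _ "norm (z - c)"]) auto
qed

text \<open>Hopf's boundary point lemma, by comparison with a logarithm on an annulus.\<close>

lemma hopf:
  assumes u: "locally_Re (ball c R) u" and cont: "continuous_on (cball c R) u" and R: "R > 0"
    and less: "\<And>z. z \<in> ball c R \<Longrightarrow> u z < m" and n: "norm n = 1" and p: "u (c + of_real R * n) = m"
    and lim: "((\<lambda>s::real. n \<bullet> grad u (c + of_real (R - s) * n)) \<longlongrightarrow> 0) (at_right 0)"
  shows False
proof -
  have le: "u z \<le> m" if "z \<in> cball c R" for z
  proof (rule continuous_le_on_closure[of "ball c R" u])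
    show "continuous_on (closure (ball c R)) u" "z \<in> closure (ball c R)" using cont that R by simp_all
    show "u x \<le> m" if "x \<in> ball c R" for x using less[OF that] by simp
  qed
  have sph: "compact (sphere c (R / 2))" "sphere c (R/2) \<noteq> {}" "continuous_on (sphere c (R / 2)) u"
    using R by (auto intro!: continuous_on_subset[OF cont])
  obtain x where x: "x \<in> sphere c (R / 2)" "\<And>y. y \<in> sphere c (R / 2) \<Longrightarrow> u y \<le> u x"
    using continuous_attains_sup[OF sph] by blast
  define \<epsilon> where "\<epsilon> = m - u x"
  have \<epsilon>: "\<epsilon> > 0" using less[of x] x(1) R by (simp add: \<epsilon>_def)
  let ?S = "ball c R - cball c (R / 2)"
  \<comment> \<open>The barrier vanishes on the outer circle and equals
    \<open>\<epsilon> * ln 2 < \<epsilon>\<close> on the inner one, where \<open>u\<close> stays at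
    least \<epsilon> below \<open>m\<close>. So \<open>v\<close> is at most \<open>m\<close> on both
    circles.\<close>
  define v where "v z = u z + \<epsilon> * (ln R + (-1) * ln (norm (z - c)))" for z
  have So: "open ?S" by (intro open_Diff) auto
  have v: "locally_Re ?S v"
    unfolding v_def
    by (intro locally_Re_add locally_Re_cmult locally_Re_const So locally_Re_subset[OF u] locally_Re_subset[OF locally_Re_ln_norm])
       (use R in auto)
  have clS: "closure ?S \<subseteq> cball c R - ball c (R / 2)"
    by (rule closure_minimal) (auto intro!: closed_Diff)
  have vc: "continuous_on (closure ?S) v"
    unfolding v_def using clS R
    by (intro continuous_intros continuous_on_subset[OF cont]) (auto simp: subset_iff)
  have v_le: "v z \<le> m" if z: "z \<in> ?S" for z
  proof (rule locally_Re_weak_max[OF v vc _ _ z])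
    fix w assume "w \<in> frontier ?S"
    hence "w \<in> closure ?S" "w \<notin> ?S" using So by (simp_all add: frontier_def interior_open)
    hence "w \<in> sphere c R \<or> w \<in> sphere c (R / 2)" using clS by force
    thus "v w \<le> m"
    proof
      assume w: "w \<in> sphere c R"
      hence "norm (w - c) = R" by (simp add: dist_norm norm_minus_commute)
      thus ?thesis using le[of w] w by (simp add: v_def)
    next
      assume w: "w \<in> sphere c (R / 2)"
      hence nw: "norm (w - c) = R / 2" by (simp add: dist_norm norm_minus_commute)
      have "ln (R / 2) = ln R - ln 2" using R by (simp add: ln_div)
      hence "v w = u w + \<epsilon> * ln 2" unfolding v_def nw by simp
      also have "\<dots> \<le> u x + \<epsilon> * 1" using x(2)[OF w] \<epsilon> ln_2_less_1 by (intro add_mono mult_left_mono) auto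
      finally show ?thesis by (simp add: \<epsilon>_def)
    qed
  qed (auto intro: bounded_subset[OF bounded_ball])
  let ?p = "\<lambda>s::real. c + of_real (R - s) * n"
  \<comment> \<open>Along the radius the barrier forces \<open>u\<close> to fall below
    \<open>m\<close> at least with slope \<open>\<epsilon> / R\<close>;
    \<open>ln x \<le> x - 1\<close> makes the logarithm linear.\<close>
  have drop: "\<epsilon> * s / R \<le> m - u (?p s)" if s: "0 < s" "s < R / 2" for s
  proof -
    have d: "norm (?p s - c) = R - s" using s n by (simp add: norm_mult del: of_real_diff)
    hence "?p s \<in> ?S" using s by (simp add: dist_norm norm_minus_commute)
    from v_le[OF this] have "u (?p s) + \<epsilon> * (ln R - ln (R - s)) \<le> m" using d by (simp add: v_def)
    moreover have "s / R \<le> ln R - ln (R - s)"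
    proof -
      have "ln ((R - s) / R) \<le> (R - s) / R - 1" using s by (intro ln_le_minus_one) auto
      moreover have "ln ((R - s) / R) = ln (R - s) - ln R" using s by (intro ln_divide_pos) auto
      moreover have "(R - s) / R - 1 = - (s / R)" using s by (simp add: diff_divide_distrib)
      ultimately show ?thesis by linarith
    qed
    hence "\<epsilon> * (s / R) \<le> \<epsilon> * (ln R - ln (R - s))" using \<epsilon> by (intro mult_left_mono) auto
    ultimately show ?thesis by simp
  qed
  have inb: "?p s \<in> ball c R" if "0 < s" "s < R" for s using that n by (simp add: dist_norm norm_mult del: of_real_diff)
  have der: "((\<lambda>s. u (?p s)) has_real_derivative - (n \<bullet> grad u (?p s))) (at s)" if s: "0 < s" "s < R" for s
  proof -
    obtain d where d: "(u has_derivative (\<lambda>v. Re (v * d))) (at (?p s))"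
      using locally_Re_has_derivative[OF u inb[OF s]] by blast
    have "((\<lambda>s. ?p s) has_derivative (\<lambda>h. - (of_real h * n))) (at s)"
      by (auto intro!: derivative_eq_intros)
    from has_derivative_compose[OF this d] show ?thesis
      unfolding grad_eq[OF d] has_field_derivative_def
      by (rule has_derivative_eq_rhs) (simp add: fun_eq_iff algebra_simps)
  qed
  have "\<forall>\<^sub>F s in at_right 0. dist (n \<bullet> grad u (?p s)) 0 < \<epsilon> / R"
    using lim by (rule tendstoD) (use \<epsilon> R in auto)
  then obtain b where b: "b > 0" "\<And>s. 0 < s \<Longrightarrow> s < b \<Longrightarrow> \<bar>n \<bullet> grad u (?p s)\<bar> < \<epsilon> / R"
    unfolding eventually_at_right_field by (auto simp: dist_real_def)
  define s where "s = min b R / 4"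
  have s: "0 < s" "s < b" "s < R / 2" using b R by (auto simp: s_def)
  have cs: "continuous_on {0..s} (\<lambda>s. u (?p s))"
  proof (rule continuous_on_compose2[OF cont])
    show "?p ` {0..s} \<subseteq> cball c R" using s n by (auto simp: dist_norm norm_mult simp del: of_real_diff)
  qed (intro continuous_intros)
  have ds: "((\<lambda>s. u (?p s)) has_derivative (*) (- (n \<bullet> grad u (?p x)))) (at x)" if "0 < x" "x < s" for x
  proof -
    have "x < R" using that s R by linarith
    from der[OF that(1) this] show ?thesis unfolding has_field_derivative_def .
  qed
  \<comment> \<open>By the mean value theorem the same drop is \<open>s\<close> times a radial
    derivative, and close to the boundary point this derivative is already smaller than
    \<open>\<epsilon> / R\<close>.\<close>
  obtain t where t: "0 < t" "t < s" "u (?p s) - u (?p 0) = - (n \<bullet> grad u (?p t)) * (s - 0)"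
    using mvt[OF s(1) cs ds] by blast
  have "m - u (?p s) = s * (n \<bullet> grad u (?p t))" using t(3) p by (simp add: mult.commute)
  also have "\<dots> < s * (\<epsilon> / R)" using b(2)[of t] t s by (intro mult_strict_left_mono) auto
  finally show False using drop[of s] s by (simp add: mult.commute)
qed

subsection \<open>The Fredholm alternative\<close>

lemma riesz_lemma:
  fixes S :: "'a::real_normed_vector set"
  assumes "subspace S" "closed S" "z \<notin> S"
  shows "\<exists>s\<in>S. \<exists>c. norm (c *\<^sub>R (z - s)) = 1 \<and> (\<forall>s'\<in>S. 1/2 \<le> norm (c *\<^sub>R (z - s) - s'))"
proof -
  have ne: "S \<noteq> {}" using subspace_0[OF assms(1)] by auto
  define d where "d = infdist z S"
  have d: "d > 0" unfolding d_def using assms ne by (simp add: infdist_pos_not_in_closed)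
  \<comment> \<open>Twice the infimum of the distances is attained or undercut by some point; this
    factor 2 becomes the 1/2 of the conclusion.\<close>
  have "\<exists>s\<in>S. dist z s < 2 * d"
  proof (rule ccontr)
    assume "\<not> (\<exists>s\<in>S. dist z s < 2 * d)"
    hence "2 * d \<le> infdist z S" using ne by (auto simp: infdist_notempty intro!: cINF_greatest)
    thus False using d d_def by simp
  qed
  then obtain s where s: "s \<in> S" "dist z s < 2 * d" by blast
  have zs: "norm (z - s) > 0" using s assms(3) by auto
  have "1/2 \<le> norm ((1 / norm (z - s)) *\<^sub>R (z - s) - s')" if "s' \<in> S" for s'
  proof -
    have "s + norm (z - s) *\<^sub>R s' \<in> S" using assms(1) s that by (intro subspace_add subspace_scale)
    hence "d \<le> dist z (s + norm (z - s) *\<^sub>R s')" unfolding d_def by (rule infdist_le)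
    also have "\<dots> = norm (norm (z - s) *\<^sub>R ((1 / norm (z - s)) *\<^sub>R (z - s) - s'))"
      using zs by (simp add: dist_norm scaleR_diff_right algebra_simps)
    also have "\<dots> = norm (z - s) * norm ((1 / norm (z - s)) *\<^sub>R (z - s) - s')" by simp
    also have "\<dots> \<le> (2 * d) * norm ((1 / norm (z - s)) *\<^sub>R (z - s) - s')"
      using s(2) by (intro mult_right_mono) (auto simp: dist_norm)
    finally show ?thesis using d by simp
  qed
  moreover have "norm ((1 / norm (z - s)) *\<^sub>R (z - s)) = 1" using zs by simp
  ultimately show ?thesis using s(1) by blast
qed

text \<open>Riesz's argument. Injectivity and compactness make \<open>T = id - K\<close> bounded
  below, so all iterated ranges are closed. Were \<open>T\<close> not onto, the ranges would
  decrease strictly, and unit vectors that keep away from the next range would have images under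
  \<open>K\<close> without a convergent subsequence.\<close>

theorem fredholm_surjective:
  fixes K :: "'a::banach \<Rightarrow> 'a"
  assumes K: "bounded_linear K"
    and compact: "\<And>f :: nat \<Rightarrow> 'a. (\<And>n. norm (f n) \<le> 1) \<Longrightarrow> \<exists>r l. strict_mono r \<and> (\<lambda>n. K (f (r n))) \<longlonglongrightarrow> l"
    and inj: "\<And>x. x - K x = 0 \<Longrightarrow> x = 0"
  shows "\<exists>x. x - K x = y"
proof -
  define T where "T x = x - K x" for x
  have T: "bounded_linear T" unfolding T_def[abs_def] by (intro bounded_linear_sub bounded_linear_ident K)
  interpret T: bounded_linear T by fact
  interpret K: bounded_linear K by fact
  \<comment> \<open>Otherwise there are unit vectors with \<open>T (f n)\<close> tending to 0. Along
    a subsequence they converge to the limit of \<open>K (f n)\<close>, which is then a unit vector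
    in the kernel of \<open>T\<close>.\<close>
  have bb: "\<exists>c>0. \<forall>x. c * norm x \<le> norm (T x)"
  proof (rule ccontr)
    assume *: "\<not> ?thesis"
    have "\<exists>x. norm x = 1 \<and> norm (T x) < 1 / real (Suc n)" for n
    proof -
      obtain x where x: "norm (T x) < 1 / real (Suc n) * norm x"
        using * by (metis not_le of_nat_0_less_iff zero_less_Suc zero_less_divide_1_iff)
      hence "x \<noteq> 0" by auto
      thus ?thesis using x by (intro exI[of _ "(1 / norm x) *\<^sub>R x"]) (simp add: T.scaleR field_simps)
    qed
    then obtain f where f: "\<And>n. norm (f n) = 1" "\<And>n. norm (T (f n)) < 1 / real (Suc n)" by metis
    obtain r l where r: "strict_mono r" "(\<lambda>n. K (f (r n))) \<longlonglongrightarrow> l"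
      using compact[of f] f(1) by (metis order_refl)
    have "(\<lambda>n. T (f n)) \<longlonglongrightarrow> 0"
      by (rule Lim_null_comparison[OF _ LIMSEQ_inverse_real_of_nat])
         (use f(2) in \<open>auto intro!: always_eventually less_imp_le simp: inverse_eq_divide\<close>)
    hence T0: "(\<lambda>n. T (f (r n))) \<longlonglongrightarrow> 0" using LIMSEQ_subseq_LIMSEQ[OF _ r(1)] by (auto simp: o_def)
    have "(\<lambda>n. T (f (r n)) + K (f (r n))) \<longlonglongrightarrow> 0 + l" by (intro tendsto_add T0 r(2))
    hence fl: "(\<lambda>n. f (r n)) \<longlonglongrightarrow> l" by (simp add: T_def)
    have "T l = 0" using LIMSEQ_unique[OF T.tendsto[OF fl] T0] .
    hence "l = 0" using inj by (simp add: T_def)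
    moreover have "norm l = 1" using LIMSEQ_unique[OF tendsto_norm[OF fl]] f(1) by simp
    ultimately show False by simp
  qed
  then obtain c where c: "c > 0" "\<And>x. c * norm x \<le> norm (T x)" by blast
  have Tinj: "x = x'" if "T x = T x'" for x x'
    using inj[of "x - x'"] that by (simp add: T_def K.diff algebra_simps)
  define S where "S n = (T ^^ n) ` UNIV" for n
  have S_Suc: "S (Suc n) = T ` S n" for n by (auto simp: S_def image_comp)
  have sub: "subspace (S n)" for n
  proof (induction n)
    case (Suc n)
    thus ?case unfolding S_Suc using T.linear_axioms by (intro linear_subspace_image) (auto simp: linear_def)
  qed (simp add: S_def)
  have cl: "complete (S n)" for n
  proof (induction n)
    case 0
    thus ?case by (simp add: S_def complete_UNIV)
  next
    case (Suc n)
    show ?case unfolding S_Suc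
      by (rule complete_isometric_image[OF c(1) sub T _ Suc]) (use c(2) in simp)
  qed
  have dec: "S (Suc n) \<subseteq> S n" for n
  proof (induction n)
    case (Suc n)
    thus ?case unfolding S_Suc[of n] S_Suc[of "Suc n"] by (rule image_mono)
  qed (simp add: S_def)
  have mono: "S m \<subseteq> S n" if "n \<le> m" for m n
    using lift_Suc_antimono_le[of S, OF dec that] .
  show ?thesis
  proof (rule ccontr)
    assume "\<nexists>x. x - K x = y"
    hence y: "T x \<noteq> y" for x by (simp add: T_def)
    have Tn_inj: "x = x'" if "(T ^^ n) x = (T ^^ n) x'" for n x x'
      using that by (induction n) (auto dest: Tinj)
    \<comment> \<open>Powers of \<open>T\<close> are injective, so membership in the next range
      could be cancelled down to \<open>y\<close> lying in the range of \<open>T\<close>.\<close>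
    have notin: "(T ^^ n) y \<notin> S (Suc n)" for n
    proof
      assume "(T ^^ n) y \<in> S (Suc n)"
      then obtain w where "(T ^^ n) y = (T ^^ n) (T w)" by (auto simp: S_def funpow_swap1)
      thus False using Tn_inj y by metis
    qed
    have "\<exists>x\<in>S n. norm x = 1 \<and> (\<forall>s'\<in>S (Suc n). 1/2 \<le> norm (x - s'))" for n
    proof -
      obtain s c where s: "s \<in> S (Suc n)" "norm (c *\<^sub>R ((T ^^ n) y - s)) = 1"
        "\<forall>s'\<in>S (Suc n). 1/2 \<le> norm (c *\<^sub>R ((T ^^ n) y - s) - s')"
        using riesz_lemma[OF sub complete_imp_closed[OF cl] notin] by blast
      have "c *\<^sub>R ((T ^^ n) y - s) \<in> S n"
        using s(1) dec by (intro subspace_scale subspace_diff sub) (auto simp: S_def)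
      with s show ?thesis by blast
    qed
    then obtain f where f: "\<And>n. f n \<in> S n" "\<And>n. norm (f n) = 1" "\<And>n s. s \<in> S (Suc n) \<Longrightarrow> 1/2 \<le> norm (f n - s)"
      by metis
    obtain r l where r: "strict_mono r" "(\<lambda>n. K (f (r n))) \<longlonglongrightarrow> l"
      using compact[of f] f(2) by (metis order_refl)
    \<comment> \<open>As \<open>K = id - T\<close>, the difference \<open>K (f n) - K (f m)\<close>
      is \<open>f n\<close> minus an element of \<open>S (Suc n)\<close>, from which
      \<open>f n\<close> has distance at least 1/2.\<close>
    have sep: "1/2 \<le> norm (K (f n) - K (f m))" if "n < m" for n m
    proof -
      have "T (f n) \<in> S (Suc n)" using f(1) unfolding S_Suc by blast
      moreover have "f m \<in> S (Suc n)" using f(1)[of m] mono[of "Suc n" m] that by auto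
      moreover have "T (f m) \<in> S (Suc n)" using f(1)[of m] mono[of "Suc n" "Suc m"] that unfolding S_Suc[of m] by auto
      ultimately have "T (f n) + f m - T (f m) \<in> S (Suc n)"
        by (intro subspace_diff subspace_add sub)
      from f(3)[OF this] show ?thesis by (simp add: T_def algebra_simps)
    qed
    have "Cauchy (\<lambda>n. K (f (r n)))" using r(2) by (rule LIMSEQ_imp_Cauchy)
    then obtain N where "norm (K (f (r N)) - K (f (r (Suc N)))) < 1/2"
      by (metis CauchyD le_Suc_eq order_refl zero_less_divide_1_iff zero_less_numeral)
    with sep[of "r N" "r (Suc N)"] r(1) show False by (simp add: strict_mono_def)
  qed
qed

subsection \<open>The two sides of a hole\<close>

context c2_curve
begin

lemma simple_path: "simple_path \<gamma>" and path_loop: "pathfinish \<gamma> = pathstart \<gamma>"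
  and valid_path: "valid_path \<gamma>" and path_image_eq: "path_image \<gamma> = range \<gamma>"
proof -
  have "x = y \<or> x = 0 \<and> y = 1 \<or> x = 1 \<and> y = 0" if xy: "x \<in> {0..1}" "y \<in> {0..1}" "\<gamma> x = \<gamma> y" for x y
  proof -
    obtain n :: int where n: "x - y = of_int n" using xy(3) eq_iff by (metis Ints_cases)
    have "\<bar>of_int n :: real\<bar> \<le> 1" unfolding n[symmetric] using xy(1,2) by auto
    hence "\<bar>n\<bar> \<le> 1" by (metis of_int_abs of_int_le_1_iff)
    hence "n = -1 \<or> n = 0 \<or> n = 1" by linarith
    thus ?thesis using n xy(1,2) by auto
  qed
  thus "simple_path \<gamma>" unfolding simple_path_def loop_free_def path_def using cont by blast
  show "pathfinish \<gamma> = pathstart \<gamma>" using per[of 0] by (simp add: pathfinish_def pathstart_def)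
  have "\<gamma> C1_differentiable_on {0..1}"
    unfolding C1_differentiable_on_def using deriv cont1 by blast
  thus "valid_path \<gamma>"
    unfolding valid_path_def by (rule C1_differentiable_imp_piecewise)
  show "path_image \<gamma> = range \<gamma>" by (simp add: path_image_def image_eq)
qed

lemma vector_derivative_eq: "vector_derivative \<gamma> (at t) = \<gamma>' t"
  by (rule vector_derivative_at[OF deriv])

text \<open>Off the curve this is \<open>- 2 \<pi>\<close> times the winding number. The factor \<i>
  brings it into the form of the jump relation with constant density 1.\<close>

definition angle_integral :: "complex \<Rightarrow> real" where
  "angle_integral z = integral {0..1} (\<lambda>t. Re (\<i> * \<gamma>' t / (\<gamma> t - z)))"

lemma angle_integral_eq:
  assumes "z \<notin> range \<gamma>"
  shows "angle_integral z = - 2 * pi * Re (winding_number \<gamma> z)"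
proof -
  have "((\<lambda>w. 1 / (w - z)) has_contour_integral (2 * pi * \<i> * winding_number \<gamma> z)) \<gamma>"
    by (rule has_contour_integral_winding_number[OF valid_path]) (use assms in \<open>simp add: path_image_eq\<close>)
  hence "((\<lambda>t. 1 / (\<gamma> t - z) * \<gamma>' t) has_integral (2 * pi * \<i> * winding_number \<gamma> z)) {0..1}"
    by (simp add: has_contour_integral vector_derivative_eq)
  hence "((\<lambda>t. \<i> * (1 / (\<gamma> t - z) * \<gamma>' t)) has_integral (\<i> * (2 * pi * \<i> * winding_number \<gamma> z))) {0..1}"
    by (rule has_integral_mult_right)
  from has_integral_linear[OF this bounded_linear_Re]
  have "((\<lambda>t. Re (\<i> * (1 / (\<gamma> t - z) * \<gamma>' t))) has_integral Re (\<i> * (2 * pi * \<i> * winding_number \<gamma> z))) {0..1}"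
    by (simp only: o_def)
  thus ?thesis unfolding angle_integral_def by (simp add: integral_unique mult_ac)
qed

text \<open>Division by the tangent vector makes the tangent the real axis; \<sigma> selects the
  left (1) or right (-1) side of the oriented curve, and \<kappa> the aperture.\<close>

definition side_cone :: "real \<Rightarrow> real \<Rightarrow> real \<Rightarrow> complex set" where
  "side_cone \<sigma> \<kappa> s = {z. \<kappa> * norm (z - \<gamma> s) \<le> \<sigma> * Im ((z - \<gamma> s) / \<gamma>' s)}"

text \<open>Near its vertex the cone lies off the curve; there the integrand is continuous and
  periodic, so a full period may be exchanged for the window centred at \<open>s\<close>, where the
  local jump relation applies.\<close>

lemma cauchy_jump:
  assumes \<rho>: "continuous_on UNIV \<rho>" "\<And>t. \<rho> (t + 1) = \<rho> t"
    and \<psi>: "continuous_on UNIV \<psi>"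
    and \<rho>\<psi>: "\<And>t. \<bar>t - s\<bar> \<le> 1/2 \<Longrightarrow> norm (\<rho> t - \<i> * \<gamma>' s * of_real (\<psi> t)) \<le> C' * \<bar>t - s\<bar>"
    and \<kappa>: "\<kappa> > 0" and \<sigma>: "\<sigma> = 1 \<or> \<sigma> = -1"
  shows "((\<lambda>z. integral {0..1} (\<lambda>t. Re (\<rho> t / (\<gamma> t - z)))) \<longlongrightarrow>
           integral {-1/2..1/2} (\<lambda>r. Re (\<rho> (s + r) / (\<gamma> (s + r) - \<gamma> s))) - \<sigma> * pi * \<psi> s)
         (at (\<gamma> s) within side_cone \<sigma> \<kappa> s)"
proof -
  obtain m where m: "m > 0" "\<And>s t. \<bar>t - s\<bar> \<le> 1/2 \<Longrightarrow> m * \<bar>t - s\<bar> \<le> norm (\<gamma> t - \<gamma> s)" using chord_arc by blast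
  obtain C where C: "C \<ge> 0" "\<And>s t. norm (\<gamma> t - \<gamma> s - of_real (t - s) * \<gamma>' s) \<le> C * (t - s)\<^sup>2" using quad_bound by blast
  have "((\<lambda>z. integral {-1/2..1/2} (\<lambda>r. Re (\<rho> (s + r) / (\<gamma> (s + r) - z)))) \<longlongrightarrow>
           integral {-1/2..1/2} (\<lambda>r. Re (\<rho> (s + r) / (\<gamma> (s + r) - \<gamma> (s + 0)))) - \<sigma> * pi * \<psi> (s + 0))
         (at (\<gamma> (s + 0)) within {z. \<kappa> * norm (z - \<gamma> (s + 0)) \<le> \<sigma> * Im ((z - \<gamma> (s + 0)) / \<gamma>' s)})"
  proof (rule cauchy_integral_jump[where C = C and m = m and C' = C' and c = "\<lambda>r. \<gamma> (s + r)"
        and \<rho> = "\<lambda>r. \<rho> (s + r)" and \<psi> = "\<lambda>r. \<psi> (s + r)"])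
    show "continuous_on {-1/2..1/2} (\<lambda>r. \<gamma> (s + r))" by (intro continuous_intros)
    show "continuous_on {-1/2..1/2} (\<lambda>r. \<rho> (s + r))"
      by (rule continuous_on_compose2[OF \<rho>(1)]) (auto intro!: continuous_intros)
    show "continuous_on {-1/2..1/2} (\<lambda>r. \<psi> (s + r))"
      by (rule continuous_on_compose2[OF \<psi>]) (auto intro!: continuous_intros)
    show "norm (\<gamma> (s + r) - \<gamma> (s + 0) - of_real r * \<gamma>' s) \<le> C * r\<^sup>2" for r
      using C(2)[of "s + r" s] by simp
    show "m * \<bar>r\<bar> \<le> norm (\<gamma> (s + r) - \<gamma> (s + 0))" if "r \<in> {-1/2..1/2}" for r
      using m(2)[of "s + r" s] that by (auto simp: abs_le_iff)
    show "norm (\<rho> (s + r) - \<i> * \<gamma>' s * of_real (\<psi> (s + r))) \<le> C' * \<bar>r\<bar>" if "r \<in> {-1/2..1/2}" for r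
      using \<rho>\<psi>[of "s + r"] that by (auto simp: abs_le_iff)
  qed (use m \<kappa> \<sigma> regular in auto)
  hence L: "((\<lambda>z. integral {-1/2..1/2} (\<lambda>r. Re (\<rho> (s + r) / (\<gamma> (s + r) - z)))) \<longlongrightarrow>
           integral {-1/2..1/2} (\<lambda>r. Re (\<rho> (s + r) / (\<gamma> (s + r) - \<gamma> s))) - \<sigma> * pi * \<psi> s)
         (at (\<gamma> s) within side_cone \<sigma> \<kappa> s)" by (simp add: side_cone_def)
  obtain \<delta> where \<delta>: "\<delta> > 0" "\<And>z. z \<noteq> \<gamma> s \<Longrightarrow> norm (z - \<gamma> s) < \<delta> \<Longrightarrow> \<kappa> * norm (z - \<gamma> s) \<le> \<bar>Im ((z - \<gamma> s) / \<gamma>' s)\<bar> \<Longrightarrow> z \<notin> range \<gamma>"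
    using cone_avoids[OF \<kappa>] by blast
  have "\<forall>\<^sub>F z in at (\<gamma> s) within side_cone \<sigma> \<kappa> s. integral {-1/2..1/2} (\<lambda>r. Re (\<rho> (s + r) / (\<gamma> (s + r) - z)))
     = integral {0..1} (\<lambda>t. Re (\<rho> t / (\<gamma> t - z)))"
    unfolding eventually_at
  proof (intro exI[of _ \<delta>] conjI ballI impI)
    fix z assume z: "z \<in> side_cone \<sigma> \<kappa> s" "z \<noteq> \<gamma> s \<and> dist z (\<gamma> s) < \<delta>"
    have "z \<notin> range \<gamma>" by (rule \<delta>(2)) (use z \<sigma> in \<open>auto simp: dist_norm side_cone_def\<close>)
    hence nz: "\<gamma> t - z \<noteq> 0" for t by auto
    have "(\<lambda>t. Re (\<rho> t / (\<gamma> t - z))) integrable_on {0..1}"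
      by (intro integrable_continuous_real continuous_intros continuous_on_subset[OF \<rho>(1)]) (use nz in auto)
    thus "integral {-1/2..1/2} (\<lambda>r. Re (\<rho> (s + r) / (\<gamma> (s + r) - z))) = integral {0..1} (\<lambda>t. Re (\<rho> t / (\<gamma> t - z)))"
      by (intro periodic_integral_centred(1)[where f = "\<lambda>t. Re (\<rho> t / (\<gamma> t - z))"]) (simp_all add: \<rho> per)
  qed (use \<delta> in auto)
  thus ?thesis using L by (rule Lim_transform_eventually[rotated])
qed

lemma cauchy_jump_derivative:
  assumes "\<kappa> > 0" "\<sigma> = 1 \<or> \<sigma> = -1"
  shows "(angle_integral \<longlongrightarrow>
           integral {-1/2..1/2} (\<lambda>r. Re (\<i> * \<gamma>' (s + r) / (\<gamma> (s + r) - \<gamma> s))) - \<sigma> * pi)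
         (at (\<gamma> s) within side_cone \<sigma> \<kappa> s)"
proof -
  obtain C where C: "C \<ge> 0" "\<And>s t. norm (\<gamma>' t - \<gamma>' s) \<le> C * \<bar>t - s\<bar>" using quad_bound by blast
  have "((\<lambda>z. integral {0..1} (\<lambda>t. Re (\<i> * \<gamma>' t / (\<gamma> t - z)))) \<longlongrightarrow>
           integral {-1/2..1/2} (\<lambda>r. Re (\<i> * \<gamma>' (s + r) / (\<gamma> (s + r) - \<gamma> s))) - \<sigma> * pi * 1)
         (at (\<gamma> s) within side_cone \<sigma> \<kappa> s)"
  proof (rule cauchy_jump[where C' = C])
    show "norm (\<i> * \<gamma>' t - \<i> * \<gamma>' s * of_real 1) \<le> C * \<bar>t - s\<bar>" for t
      using C(2)[of t s] by (simp add: norm_mult flip: right_diff_distrib)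
  qed (use assms in \<open>auto intro!: continuous_intros simp: per1\<close>)
  thus ?thesis by (simp add: angle_integral_def[abs_def])
qed

definition normal_ray :: "real \<Rightarrow> real \<Rightarrow> real \<Rightarrow> complex" where
  "normal_ray \<sigma> s \<epsilon> = \<gamma> s + of_real (\<sigma> * \<epsilon>) * \<i> * \<gamma>' s / of_real (norm (\<gamma>' s))"

lemma normal_ray_cone:
  assumes "\<sigma> = 1 \<or> \<sigma> = -1" "\<kappa> * norm (\<gamma>' s) \<le> 1" "\<epsilon> \<ge> 0"
  shows "normal_ray \<sigma> s \<epsilon> \<in> side_cone \<sigma> \<kappa> s" "norm (normal_ray \<sigma> s \<epsilon> - \<gamma> s) = \<epsilon>"
proof -
  have n: "norm (\<gamma>' s) > 0" using regular by simp
  show 1: "norm (normal_ray \<sigma> s \<epsilon> - \<gamma> s) = \<epsilon>"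
    using assms n by (auto simp: normal_ray_def norm_mult norm_divide)
  have "(normal_ray \<sigma> s \<epsilon> - \<gamma> s) / \<gamma>' s = \<i> * of_real (\<sigma> * \<epsilon> / norm (\<gamma>' s))"
    using regular by (simp add: normal_ray_def)
  hence "\<sigma> * Im ((normal_ray \<sigma> s \<epsilon> - \<gamma> s) / \<gamma>' s) = \<epsilon> / norm (\<gamma>' s)"
    using assms(1) by auto
  moreover have "\<kappa> * \<epsilon> \<le> \<epsilon> / norm (\<gamma>' s)"
    using mult_right_mono[OF assms(2,3)] n by (simp add: field_simps)
  ultimately show "normal_ray \<sigma> s \<epsilon> \<in> side_cone \<sigma> \<kappa> s" using 1 by (simp add: side_cone_def)
qed

lemma normal_ray_filterlim:
  assumes "\<sigma> = 1 \<or> \<sigma> = -1" "\<kappa> * norm (\<gamma>' s) \<le> 1"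
  shows "filterlim (normal_ray \<sigma> s) (at (\<gamma> s) within side_cone \<sigma> \<kappa> s) (at_right 0)"
  unfolding filterlim_at
proof
  have "(normal_ray \<sigma> s \<longlongrightarrow> \<gamma> s + of_real (\<sigma> * 0) * \<i> * \<gamma>' s / of_real (norm (\<gamma>' s))) (at_right 0)"
    unfolding normal_ray_def by (intro tendsto_intros) (use regular in auto)
  thus "(normal_ray \<sigma> s \<longlongrightarrow> \<gamma> s) (at_right 0)" by simp
  show "\<forall>\<^sub>F x in at_right 0. normal_ray \<sigma> s x \<in> side_cone \<sigma> \<kappa> s \<and> normal_ray \<sigma> s x \<noteq> \<gamma> s"
    unfolding eventually_at_right_field
  proof (intro exI[of _ 1] conjI allI impI)
    fix x :: real assume "0 < x"
    thus "normal_ray \<sigma> s x \<in> side_cone \<sigma> \<kappa> s" "normal_ray \<sigma> s x \<noteq> \<gamma> s"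
      using normal_ray_cone[OF assms, of x] by auto
  qed simp
qed

text \<open>Makes limits in the cone unique: for the aperture
  \<open>1 / \<bar>\<gamma>' s\<bar>\<close> the normal ray itself runs inside the cone.\<close>

lemma cone_nontrivial:
  assumes "\<sigma> = 1 \<or> \<sigma> = -1"
  shows "\<exists>\<kappa>>0. at (\<gamma> s) within side_cone \<sigma> \<kappa> s \<noteq> bot"
proof (intro exI conjI)
  have n: "norm (\<gamma>' s) > 0" using regular by simp
  show "1 / norm (\<gamma>' s) > 0" using n by simp
  show "at (\<gamma> s) within side_cone \<sigma> (1 / norm (\<gamma>' s)) s \<noteq> bot"
    using normal_ray_filterlim[OF assms, of "1 / norm (\<gamma>' s)" s] n
    by (metis bot.extremum_uniqueI filterlim_def filtermap_bot_iff nonzero_eq_divide_eq order_less_irrefl order_refl trivial_limit_at_right_real)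
qed

end

locale c2_hole = c2_curve +
  fixes D :: "complex set"
  assumes open_D: "open D" and connected_D: "connected D" and frontier_D: "frontier D = range \<gamma>"
    and bounded_D: "bounded D"
begin

text \<open>The frontier is a Jordan curve. A connected set that meets \<open>D\<close> and avoids
  the frontier is contained in \<open>D\<close>; applied to the unbounded outside this contradicts
  boundedness, and applied to the inside it gives equality.\<close>

lemma D_inside: "D = inside (path_image \<gamma>)" and compl_closure_D: "- closure D = outside (path_image \<gamma>)"
proof -
  let ?K = "path_image \<gamma>"
  have K: "frontier D = ?K" using frontier_D path_image_eq by simp
  note J = Jordan_inside_outside[OF simple_path path_loop]
  have D_K: "D \<inter> ?K = {}" using K open_D by (metis frontier_disjoint_eq inf_commute)
  have ne: "D \<noteq> {}" using K path_image_nonempty[of \<gamma>] by auto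
  have io: "D \<subseteq> inside ?K \<union> outside ?K" using J D_K by blast
  have sub: "A \<subseteq> D" if "connected A" "A \<inter> D \<noteq> {}" "A \<inter> ?K = {}" for A
    using connected_Int_frontier[OF that(1,2)] that(3) K by auto
  have ik: "inside ?K \<inter> ?K = {}" "outside ?K \<inter> ?K = {}"
    using inside_no_overlap outside_no_overlap by blast+
  have "D \<inter> outside ?K = {}"
  proof (rule ccontr)
    assume "D \<inter> outside ?K \<noteq> {}"
    hence "outside ?K \<subseteq> D" using sub[of "outside ?K"] J ik by blast
    thus False using bounded_D J bounded_subset by blast
  qed
  hence D_in: "D \<subseteq> inside ?K" using io by blast
  moreover have "inside ?K \<subseteq> D" by (intro sub) (use J ik D_in ne in auto)
  ultimately show "D = inside ?K" by blast
  thus "- closure D = outside ?K"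
    unfolding closure_Un_frontier K outside_inside by blast
qed

lemma winding_D: "(\<forall>z\<in>D. winding_number \<gamma> z = 1) \<or> (\<forall>z\<in>D. winding_number \<gamma> z = -1)"
proof (rule simple_closed_path_winding_number_inside[OF simple_path])
qed (simp_all add: D_inside)

lemma winding_outside: "z \<notin> closure D \<Longrightarrow> winding_number \<gamma> z = 0"
  using compl_closure_D by (intro winding_number_zero_in_outside simple_path_imp_path simple_path path_loop) blast

text \<open>Compensates for the free orientation of the parametrisation: 1 if the curve runs
  counterclockwise around \<open>D\<close>.\<close>

definition orient :: real where
  "orient = (if \<forall>z\<in>D. winding_number \<gamma> z = 1 then 1 else -1)"

lemma orient_cases: "orient = 1 \<or> orient = -1"
  by (simp add: orient_def)

lemma winding_orient: "z \<in> D \<Longrightarrow> winding_number \<gamma> z = of_real orient"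
proof (cases "\<forall>z\<in>D. winding_number \<gamma> z = 1")
  case False
  assume "z \<in> D"
  hence "winding_number \<gamma> z = -1" using False winding_D by blast
  thus ?thesis unfolding orient_def if_not_P[OF False] by simp
qed (simp add: orient_def)

lemma closure_D: "closure D = D \<union> range \<gamma>" "D \<inter> range \<gamma> = {}"
proof -
  show "closure D = D \<union> range \<gamma>" by (simp only: closure_Un_frontier frontier_D)
  show "D \<inter> range \<gamma> = {}" using frontier_disjoint_eq[of D] open_D frontier_D by (metis inf_commute)
qed

text \<open>
  The angle integral is constant on \<open>D\<close> and on its exterior and jumps by \<open>2 \<pi>\<close>
  across the curve, so exactly one side of the curve belongs to \<open>D\<close>.
\<close>

lemma sides:
  assumes "\<kappa> > 0"
  shows "\<forall>\<^sub>F z in at (\<gamma> s) within side_cone orient \<kappa> s. z \<in> D"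
    and "\<forall>\<^sub>F z in at (\<gamma> s) within side_cone (- orient) \<kappa> s. z \<notin> closure D"
proof -
  define V where "V = integral {-1/2..1/2} (\<lambda>r. Re (\<i> * \<gamma>' (s + r) / (\<gamma> (s + r) - \<gamma> s)))"
  let ?S = "{- 2 * pi * orient, 0} :: real set"
  have off: "\<forall>\<^sub>F z in at (\<gamma> s) within side_cone \<sigma> \<kappa> s. z \<notin> range \<gamma>" if \<kappa>: "\<kappa> > 0" and \<sigma>: "\<sigma> = 1 \<or> \<sigma> = -1" for \<sigma> \<kappa>
  proof -
    obtain \<delta> where \<delta>: "\<delta> > 0" "\<And>z. z \<noteq> \<gamma> s \<Longrightarrow> norm (z - \<gamma> s) < \<delta> \<Longrightarrow> \<kappa> * norm (z - \<gamma> s) \<le> \<bar>Im ((z - \<gamma> s) / \<gamma>' s)\<bar> \<Longrightarrow> z \<notin> range \<gamma>"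
      using cone_avoids[OF \<kappa>] by blast
    show ?thesis unfolding eventually_at
      by (intro exI[of _ \<delta>] conjI ballI impI \<delta>) (use \<delta>(1) \<sigma> in \<open>auto simp: dist_norm side_cone_def\<close>)
  qed
  have val: "angle_integral z = (if z \<in> D then - 2 * pi * orient else 0)" if "z \<notin> range \<gamma>" for z
    using that closure_D winding_orient[of z] winding_outside[of z] by (auto simp: angle_integral_eq)
  \<comment> \<open>One-sided limits of the angle integral remain in the closed two-point set of its
    values. The two limits differ by \<open>2 \<pi>\<close>, so both values occur and
    \<open>V\<close> lies halfway between them.\<close>
  have inS: "V - \<sigma> * pi \<in> ?S" if \<sigma>: "\<sigma> = 1 \<or> \<sigma> = -1" for \<sigma>
  proof -
    obtain \<kappa> where \<kappa>: "\<kappa> > 0" "at (\<gamma> s) within side_cone \<sigma> \<kappa> s \<noteq> bot" using cone_nontrivial[OF \<sigma>] by blast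
    have cl: "closed ?S" by simp
    have ev: "\<forall>\<^sub>F z in at (\<gamma> s) within side_cone \<sigma> \<kappa> s. angle_integral z \<in> ?S"
      using off[OF \<kappa>(1) \<sigma>] by eventually_elim (simp add: val)
    show ?thesis
      by (rule Lim_in_closed_set[OF cl ev \<kappa>(2)]) (use cauchy_jump_derivative[OF \<kappa>(1) \<sigma>, of s] in \<open>simp add: V_def\<close>)
  qed
  have V: "V = - pi * orient"
    using inS[of 1] inS[of "-1"] orient_cases pi_gt_zero by auto
  have L: "(angle_integral \<longlongrightarrow> V - \<sigma> * pi) (at (\<gamma> s) within side_cone \<sigma> \<kappa> s)" if \<sigma>: "\<sigma> = 1 \<or> \<sigma> = -1" for \<sigma>
    using cauchy_jump_derivative[OF assms \<sigma>, of s] by (simp add: V_def)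
  have o': "- orient = 1 \<or> - orient = -1" using orient_cases by auto
  have e1: "V - orient * pi = - 2 * pi * orient" and e2: "V - - orient * pi = 0" by (simp_all add: V)
  have "\<forall>\<^sub>F z in at (\<gamma> s) within side_cone orient \<kappa> s. dist (angle_integral z) (- 2 * pi * orient) < pi"
    using tendstoD[OF L[OF orient_cases] pi_gt_zero] unfolding e1 .
  thus "\<forall>\<^sub>F z in at (\<gamma> s) within side_cone orient \<kappa> s. z \<in> D"
    using off[OF assms orient_cases]
  proof eventually_elim
    case (elim z)
    thus ?case using val[of z] orient_cases pi_gt_zero by (auto simp: dist_real_def split: if_splits)
  qed
  have "\<forall>\<^sub>F z in at (\<gamma> s) within side_cone (- orient) \<kappa> s. dist (angle_integral z) 0 < pi"
    using tendstoD[OF L[OF o'] pi_gt_zero] unfolding e2 .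
  thus "\<forall>\<^sub>F z in at (\<gamma> s) within side_cone (- orient) \<kappa> s. z \<notin> closure D"
    using off[OF assms o']
  proof eventually_elim
    case (elim z)
    thus ?case using val[of z] orient_cases pi_gt_zero closure_D by (auto simp: dist_real_def split: if_splits)
  qed
qed

definition normal :: "real \<Rightarrow> complex" where
  "normal s = of_real orient * \<i> * \<gamma>' s / of_real (norm (\<gamma>' s))"

lemma norm_normal: "norm (normal s) = 1"
  using orient_cases regular[of s] by (auto simp: normal_def norm_mult norm_divide)

lemma normal_orthogonal: "normal s \<bullet> \<gamma>' s = 0"
proof -
  have "normal s = (orient / norm (\<gamma>' s)) *\<^sub>R (\<i> * \<gamma>' s)"
    by (simp add: normal_def scaleR_conv_of_real)
  moreover have "(\<i> * \<gamma>' s) \<bullet> \<gamma>' s = 0" by (simp add: inner_complex_def)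
  ultimately show ?thesis by simp
qed

lemma normal_ray_normal: "normal_ray (\<sigma> * orient) s \<epsilon> = \<gamma> s + of_real (\<sigma> * \<epsilon>) * normal s"
  by (simp add: normal_ray_def normal_def)

text \<open>Identifies the approach cone in the definition of the normal derivative with a side
  cone; division by \<open>\<gamma>' s\<close> rescales the aperture by the speed.\<close>

lemma normal_cone: "{z. c * dist z (\<gamma> s) \<le> normal s \<bullet> (\<gamma> s - z)} = side_cone (- orient) (c / norm (\<gamma>' s)) s"
proof -
  have "normal s \<bullet> (\<gamma> s - z) = - orient * Im ((z - \<gamma> s) / \<gamma>' s) * norm (\<gamma>' s)" for z
  proof -
    let ?w = "(z - \<gamma> s) / \<gamma>' s"
    have w: "\<gamma> s - z = - (?w * \<gamma>' s)" using regular[of s] by simp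
    have n: "normal s = (orient / norm (\<gamma>' s)) *\<^sub>R (\<i> * \<gamma>' s)"
      by (simp add: normal_def scaleR_conv_of_real)
    have i: "(\<i> * g) \<bullet> (- (w * g)) = - Im w * (norm g)\<^sup>2" for g w
      unfolding cmod_power2 by (simp add: inner_complex_def power2_eq_square algebra_simps)
    have "normal s \<bullet> (\<gamma> s - z) = (orient / norm (\<gamma>' s)) * (- Im ?w * (norm (\<gamma>' s))\<^sup>2)"
      unfolding n inner_scaleR_left by (subst w, subst i) simp
    thus ?thesis using regular[of s] by (simp add: power2_eq_square)
  qed
  thus ?thesis using regular[of s] by (auto simp: side_cone_def dist_norm field_simps)
qed

lemma eventually_normal_D: "\<forall>\<^sub>F \<epsilon> in at_right 0. \<gamma> s + of_real \<epsilon> * normal s \<in> D"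
proof -
  have k: "1 / norm (\<gamma>' s) > 0" "1 / norm (\<gamma>' s) * norm (\<gamma>' s) \<le> 1" using regular[of s] by auto
  show ?thesis
    using filterlim_compose[OF _ normal_ray_filterlim[OF orient_cases k(2)], unfolded filterlim_def]
      eventually_compose_filterlim[OF sides(1)[OF k(1)] normal_ray_filterlim[OF orient_cases k(2)]]
      normal_ray_normal[of 1 s] by simp
qed

lemma eventually_normal_outside: "\<forall>\<^sub>F \<epsilon> in at_right 0. \<gamma> s - of_real \<epsilon> * normal s \<notin> closure D"
proof -
  have k: "1 / norm (\<gamma>' s) > 0" "1 / norm (\<gamma>' s) * norm (\<gamma>' s) \<le> 1" using regular[of s] by auto
  have o': "- orient = 1 \<or> - orient = -1" using orient_cases by auto
  show ?thesis
    using eventually_compose_filterlim[OF sides(2)[OF k(1)] normal_ray_filterlim[OF o' k(2)]]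
      normal_ray_normal[of "-1" s] by simp
qed

text \<open>A tangent ball is connected and avoids the curve, so it lies on one side; the normal
  ray, whose side is known, decides on which. All smaller radii are included so that one radius can
  later serve all holes.\<close>

lemma balls:
  "\<exists>R>0. \<forall>s. \<forall>r. 0 < r \<and> r \<le> R \<longrightarrow>
     ball (\<gamma> s + of_real r * normal s) r \<subseteq> D \<and> ball (\<gamma> s - of_real r * normal s) r \<inter> closure D = {}"
proof -
  obtain R where R: "R > 0" "\<And>s t n. norm n = 1 \<Longrightarrow> n \<bullet> \<gamma>' s = 0 \<Longrightarrow> R \<le> norm (\<gamma> t - (\<gamma> s + of_real R * n))"
    using tangent_ball by blast
  have sub: "ball (\<gamma> s + of_real r * n) r \<subseteq> ball (\<gamma> s + of_real R * n) R" if "0 < r" "r \<le> R" "norm n = 1" for s r n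
  proof
    fix z assume "z \<in> ball (\<gamma> s + of_real r * n) r"
    hence "norm (z - (\<gamma> s + of_real r * n)) < r" by (simp add: dist_norm norm_minus_commute)
    moreover have "norm (z - (\<gamma> s + of_real R * n)) \<le> norm (z - (\<gamma> s + of_real r * n)) + norm (of_real (R - r) * n)"
      using norm_triangle_ineq4[of "z - (\<gamma> s + of_real r * n)" "of_real (R - r) * n"] by (simp add: algebra_simps)
    ultimately have "norm (z - (\<gamma> s + of_real R * n)) < R" using that by (simp add: norm_mult del: of_real_diff)
    thus "z \<in> ball (\<gamma> s + of_real R * n) R" by (simp add: dist_norm norm_minus_commute)
  qed
  have avoid: "ball (\<gamma> s + of_real R * n) R \<inter> range \<gamma> = {}" if "norm n = 1" "n \<bullet> \<gamma>' s = 0" for s n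
  proof (rule ccontr)
    assume "ball (\<gamma> s + of_real R * n) R \<inter> range \<gamma> \<noteq> {}"
    then obtain t where "\<gamma> t \<in> ball (\<gamma> s + of_real R * n) R" by auto
    thus False using R(2)[OF that, of t] by (simp add: dist_norm norm_minus_commute)
  qed
  have mem: "\<gamma> s + of_real \<epsilon> * n \<in> ball (\<gamma> s + of_real R * n) R" if "0 < \<epsilon>" "\<epsilon> < R" "norm n = 1" for s \<epsilon> n
  proof -
    have "\<gamma> s + of_real R * n - (\<gamma> s + of_real \<epsilon> * n) = of_real (R - \<epsilon>) * n" by (simp add: algebra_simps)
    thus ?thesis using that by (simp add: dist_norm norm_mult del: of_real_diff)
  qed
  have ex: "\<exists>\<epsilon>. 0 < \<epsilon> \<and> \<epsilon> < R \<and> P \<epsilon>" if ev: "\<forall>\<^sub>F \<epsilon> in at_right 0. P \<epsilon>" for P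
  proof -
    obtain b where b: "b > 0" "\<And>y. 0 < y \<Longrightarrow> y < b \<Longrightarrow> P y" using ev unfolding eventually_at_right_field by auto
    show ?thesis using R(1) b by (intro exI[of _ "min b R / 2"]) auto
  qed
  have "ball (\<gamma> s + of_real R * normal s) R \<subseteq> D" for s
  proof -
    obtain \<epsilon> where \<epsilon>: "0 < \<epsilon>" "\<epsilon> < R" "\<gamma> s + of_real \<epsilon> * normal s \<in> D" using ex[OF eventually_normal_D] by blast
    let ?B = "ball (\<gamma> s + of_real R * normal s) R"
    have "?B \<inter> D \<noteq> {}" using mem[OF \<epsilon>(1,2) norm_normal] \<epsilon>(3) by blast
    moreover have "?B \<inter> frontier D = {}" unfolding frontier_D by (rule avoid[OF norm_normal normal_orthogonal])
    ultimately show ?thesis using connected_Int_frontier[of ?B D] by blast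
  qed
  moreover have "ball (\<gamma> s + of_real R * (- normal s)) R \<inter> closure D = {}" for s
  proof -
    obtain \<epsilon> where \<epsilon>: "0 < \<epsilon>" "\<epsilon> < R" "\<gamma> s - of_real \<epsilon> * normal s \<notin> closure D" using ex[OF eventually_normal_outside] by blast
    let ?B = "ball (\<gamma> s + of_real R * (- normal s)) R"
    have "\<gamma> s - of_real \<epsilon> * normal s \<in> ?B" using mem[OF \<epsilon>(1,2), of "- normal s" s] norm_normal by simp
    hence ne: "?B - D \<noteq> {}" using \<epsilon>(3) closure_subset by blast
    have fr: "?B \<inter> frontier D = {}"
      unfolding frontier_D by (rule avoid) (simp_all add: norm_normal normal_orthogonal)
    hence "?B \<inter> D = {}" using connected_Int_frontier[of ?B D] ne by blast
    thus ?thesis using fr by (auto simp: closure_Un_frontier)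
  qed
  moreover have "ball (\<gamma> s - of_real r * normal s) r \<subseteq> ball (\<gamma> s + of_real R * (- normal s)) R" if "0 < r" "r \<le> R" for s r
    using sub[OF that, of "- normal s" s] norm_normal by simp
  ultimately have "ball (\<gamma> s + of_real r * normal s) r \<subseteq> D \<and> ball (\<gamma> s - of_real r * normal s) r \<inter> closure D = {}"
    if "0 < r" "r \<le> R" for s r
    using sub[OF that norm_normal, of s] that by blast
  thus ?thesis using R(1) by blast
qed

end

subsection \<open>The domain\<close>

locale torus_domain =
  fixes \<tau> :: complex and M :: nat and D :: "nat \<Rightarrow> complex set" and \<gamma> :: "nat \<Rightarrow> real \<Rightarrow> complex"
  assumes tau: "Im \<tau> > 0"
    and holes: "\<forall>j\<in>{1..M}. open (D j) \<and> simply_connected (D j) \<and> C2_boundary (D j) (\<gamma> j)"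
    and disj: "disjoint_closures \<tau> M D"
begin

abbreviation J :: "nat set" where "J \<equiv> {1..M}"
abbreviation \<Omega> :: "complex set" where "\<Omega> \<equiv> Omega \<tau> M D"
abbreviation \<Lambda> :: "complex set" where "\<Lambda> \<equiv> lattice \<tau>"

text \<open>\<open>C2_boundary\<close> only asserts that derivatives exist.
  \<open>vector_derivative\<close> recovers them without a choice and is also the speed that occurs
  in \<open>arc_integral\<close>.\<close>

definition d\<gamma> :: "nat \<Rightarrow> real \<Rightarrow> complex" where
  "d\<gamma> j t = vector_derivative (\<gamma> j) (at t)"

definition dd\<gamma> :: "nat \<Rightarrow> real \<Rightarrow> complex" where
  "dd\<gamma> j t = vector_derivative (d\<gamma> j) (at t)"

section \<open>Boundedness and separation of the holes\<close>

lemma curve: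
  assumes "j \<in> J"
  shows "c2_curve (\<gamma> j) (d\<gamma> j) (dd\<gamma> j)"
proof -
  obtain \<gamma>' \<gamma>'' where *: "\<And>t. \<gamma> j (t + 1) = \<gamma> j t" "inj_on (\<gamma> j) {0..<1}"
    "\<And>t. (\<gamma> j has_vector_derivative \<gamma>' t) (at t)" "\<And>t. \<gamma>' t \<noteq> 0"
    "\<And>t. (\<gamma>' has_vector_derivative \<gamma>'' t) (at t)" "continuous_on UNIV \<gamma>''"
  proof -
    have "C2_boundary (D j) (\<gamma> j)" using holes assms by blast
    thus ?thesis using that unfolding C2_boundary_def by blast
  qed
  have 1: "d\<gamma> j = \<gamma>'" using *(3) by (auto simp: d\<gamma>_def vector_derivative_at)
  have 2: "dd\<gamma> j = \<gamma>''" using *(5) by (auto simp: dd\<gamma>_def 1 vector_derivative_at)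
  show ?thesis unfolding 1 2 by unfold_locales (use * in auto)
qed

lemma frontier_D: "j \<in> J \<Longrightarrow> frontier (D j) = range (\<gamma> j)"
  using holes c2_curve.image_eq[OF curve] by (simp add: C2_boundary_def)

lemma boundary_eq: "boundary M D = (\<Union>j\<in>J. range (\<gamma> j))"
  by (simp add: boundary_def frontier_D)

text \<open>The frontier is compact, so an unbounded hole would contain the complement of a disc. It
  would then overlap with its own translate by 1, against the disjointness of closures in the
  torus.\<close>

lemma bounded_hole:
  assumes j: "j \<in> J"
  shows "bounded (D j)"
proof (rule ccontr)
  assume unb: "\<not> bounded (D j)"
  interpret c2_curve "\<gamma> j" "d\<gamma> j" "dd\<gamma> j" by (rule curve[OF j])
  have "bounded (range (\<gamma> j))"
    unfolding image_eq by (intro compact_imp_bounded compact_continuous_image cont) auto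
  then obtain r where r: "range (\<gamma> j) \<subseteq> ball 0 r" using bounded_subset_ballD by blast
  have "connected (- ball 0 r :: complex set)"
    by (rule connected_complement_bounded_convex) auto
  moreover have "- ball 0 r \<inter> D j \<noteq> {}"
  proof
    assume "- ball 0 r \<inter> D j = {}"
    hence "D j \<subseteq> ball 0 r" by blast
    thus False using unb bounded_subset bounded_ball by blast
  qed
  moreover have "- ball 0 r \<inter> frontier (D j) = {}" using r frontier_D[OF j] by blast
  ultimately have out: "- ball 0 r \<subseteq> D j" using connected_Int_frontier[of "- ball 0 r" "D j"] by blast
  have "complex_of_real \<bar>r\<bar> \<in> - ball 0 r" by simp
  hence 1: "complex_of_real \<bar>r\<bar> \<in> D j" using out by blast
  have "complex_of_real (\<bar>r\<bar> + 1) \<in> - ball 0 r" by (simp del: of_real_add)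
  hence "complex_of_real (\<bar>r\<bar> + 1) \<in> D j" using out by blast
  hence 2: "complex_of_real \<bar>r\<bar> + 1 \<in> D j" by simp
  have "complex_of_real \<bar>r\<bar> + 1 \<in> closure (D j) \<inter> (\<lambda>z. z + 1) ` closure (D j)"
    using 1 2 closure_subset[of "D j"] by blast
  moreover have "closure (D j) \<inter> (\<lambda>z. z + 1) ` closure (D j) = {}"
    using disj j lattice_1[of \<tau>] unfolding disjoint_closures_def by (metis one_neq_zero)
  ultimately show False by blast
qed

lemma hole:
  assumes "j \<in> J"
  shows "c2_hole (\<gamma> j) (d\<gamma> j) (dd\<gamma> j) (D j)"
proof -
  have "open (D j)" "simply_connected (D j)" using holes assms by blast+
  thus ?thesis
    unfolding c2_hole_def c2_hole_axioms_def
    by (intro conjI curve frontier_D bounded_hole simply_connected_imp_connected assms)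
qed

text \<open>With \<open>nrm\<close>, a copy of the orientation and normal of a single hole that can
  be used for all holes simultaneously.\<close>

definition sg :: "nat \<Rightarrow> real" where
  "sg j = (if \<forall>z\<in>D j. winding_number (\<gamma> j) z = 1 then 1 else -1)"

definition nrm :: "nat \<Rightarrow> real \<Rightarrow> complex" where
  "nrm j s = of_real (sg j) * \<i> * d\<gamma> j s / of_real (norm (d\<gamma> j s))"

lemma sg_cases: "sg j = 1 \<or> sg j = -1" by (simp add: sg_def)

lemma orient_eq: "j \<in> J \<Longrightarrow> c2_hole.orient (\<gamma> j) (D j) = sg j"
  using c2_hole.orient_def[OF hole] by (simp add: sg_def)

lemma normal_eq: "j \<in> J \<Longrightarrow> c2_hole.normal (\<gamma> j) (d\<gamma> j) (D j) s = nrm j s"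
  using c2_hole.normal_def[OF hole] by (simp add: nrm_def orient_eq)

lemma norm_nrm: "j \<in> J \<Longrightarrow> norm (nrm j s) = 1"
  using c2_hole.norm_normal[OF hole] by (simp add: normal_eq)

lemma compact_closure_D: "j \<in> J \<Longrightarrow> compact (closure (D j))"
  using bounded_hole by (simp add: compact_eq_bounded_closed bounded_closure)

lemma range_closure: "j \<in> J \<Longrightarrow> \<gamma> j t \<in> closure (D j)"
  using frontier_D[of j] unfolding frontier_def by blast

text \<open>For one pair of holes, the set of differences of the closures is compact and disjoint
  from a closed part of the lattice, hence at positive distance from it. There are finitely many
  pairs.\<close>

lemma separation:
  "\<exists>d>0. \<forall>i\<in>J. \<forall>j\<in>J. \<forall>x\<in>closure (D i). \<forall>y\<in>closure (D j). \<forall>l\<in>\<Lambda>. i \<noteq> j \<or> l \<noteq> 0 \<longrightarrow> d \<le> norm (x - y - l)"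
proof -
  have pair: "\<exists>d>0. \<forall>x\<in>closure (D i). \<forall>y\<in>closure (D j). \<forall>l\<in>\<Lambda>. i \<noteq> j \<or> l \<noteq> 0 \<longrightarrow> d \<le> norm (x - y - l)"
    if ij: "i \<in> J" "j \<in> J" for i j
  proof -
    let ?K = "{x - y | x y. x \<in> closure (D i) \<and> y \<in> closure (D j)}"
    let ?L = "{l \<in> \<Lambda>. i \<noteq> j \<or> l \<noteq> 0}"
    have K: "compact ?K" using ij by (intro compact_differences compact_closure_D)
    have L: "closed ?L" by (rule closed_subset_lattice[OF tau]) auto
    have KL: "?K \<inter> ?L = {}"
    proof (rule ccontr)
      assume "?K \<inter> ?L \<noteq> {}"
      then obtain x y l where *: "x \<in> closure (D i)" "y \<in> closure (D j)" "x - y = l" "l \<in> \<Lambda>" "i \<noteq> j \<or> l \<noteq> 0" by blast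
      have "x = y + l" using *(3) by (simp add: algebra_simps)
      hence "x \<in> (\<lambda>z. z + l) ` closure (D j)" using *(2) by (rule image_eqI)
      moreover have "closure (D i) \<inter> (\<lambda>z. z + l) ` closure (D j) = {}"
        using disj ij *(4,5) unfolding disjoint_closures_def by blast
      ultimately show False using *(1) by blast
    qed
    obtain d where "d > 0" "\<forall>x\<in>?K. \<forall>y\<in>?L. d \<le> dist x y" using separate_compact_closed[OF K L KL] by blast
    thus ?thesis by (intro exI[of _ d]) (fastforce simp: dist_norm)
  qed
  have "\<forall>p\<in>J \<times> J. \<exists>d>0. \<forall>x\<in>closure (D (fst p)). \<forall>y\<in>closure (D (snd p)). \<forall>l\<in>\<Lambda>. fst p \<noteq> snd p \<or> l \<noteq> 0 \<longrightarrow> d \<le> norm (x - y - l)"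
    using pair by auto
  from bchoice[OF this] obtain d where d': "\<forall>p\<in>J \<times> J. d p > 0 \<and> (\<forall>x\<in>closure (D (fst p)). \<forall>y\<in>closure (D (snd p)). \<forall>l\<in>\<Lambda>. fst p \<noteq> snd p \<or> l \<noteq> 0 \<longrightarrow> d p \<le> norm (x - y - l))"
    by blast
  have d: "\<And>p. p \<in> J \<times> J \<Longrightarrow> d p > 0"
    "\<And>p x y l. p \<in> J \<times> J \<Longrightarrow> x \<in> closure (D (fst p)) \<Longrightarrow> y \<in> closure (D (snd p)) \<Longrightarrow> l \<in> \<Lambda> \<Longrightarrow> fst p \<noteq> snd p \<or> l \<noteq> 0 \<Longrightarrow> d p \<le> norm (x - y - l)"
    using d' by blast+
  \<comment> \<open>The inserted 1 keeps the minimum defined when there are no holes.\<close>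
  let ?m = "Min (insert 1 (d ` (J \<times> J)))"
  have "?m > 0" by (subst Min_gr_iff) (use d(1) in auto)
  moreover have "?m \<le> norm (x - y - l)"
    if "i \<in> J" "j \<in> J" "x \<in> closure (D i)" "y \<in> closure (D j)" "l \<in> \<Lambda>" "i \<noteq> j \<or> l \<noteq> 0" for i j x y l
  proof -
    have "?m \<le> d (i, j)" using that by (intro Min_le) auto
    also have "\<dots> \<le> norm (x - y - l)" using d(2)[of "(i, j)"] that by simp
    finally show ?thesis .
  qed
  ultimately show ?thesis by blast
qed

lemma closure_diff_lattice:
  assumes "i \<in> J" "j \<in> J" "x \<in> closure (D i)" "y \<in> closure (D j)" "x - y \<in> \<Lambda>"
  shows "i = j \<and> x = y"
proof -
  obtain d where d: "d > 0" "\<And>i j x y l. \<lbrakk>i \<in> J; j \<in> J; x \<in> closure (D i); y \<in> closure (D j); l \<in> \<Lambda>; i \<noteq> j \<or> l \<noteq> 0\<rbrakk> \<Longrightarrow> d \<le> norm (x - y - l)"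
    using separation by blast
  have "\<not> (i \<noteq> j \<or> x - y \<noteq> 0)" using d(2)[OF assms] d(1) by auto
  thus ?thesis by simp
qed

lemma curve_diff_lattice:
  assumes "i \<in> J" "j \<in> J" "\<gamma> i s - \<gamma> j t \<in> \<Lambda>"
  shows "i = j \<and> \<gamma> i s = \<gamma> j t"
  using closure_diff_lattice[OF assms(1,2) range_closure range_closure assms(3)] assms by auto

lemma in_Omega_iff: "z \<in> \<Omega> \<longleftrightarrow> (\<forall>j\<in>J. \<forall>y\<in>closure (D j). z - y \<notin> \<Lambda>)"
proof -
  have "z \<in> (\<lambda>z. z + l) ` closure (D j) \<longleftrightarrow> (\<exists>y\<in>closure (D j). z - y = l)" for j l
  proof -
    have "z = y + l \<longleftrightarrow> z - y = l" for y by (auto simp: algebra_simps)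
    thus ?thesis unfolding image_iff by simp
  qed
  thus ?thesis unfolding Omega_def by (simp only: Compl_iff UN_iff) blast
qed

lemma open_Omega: "open \<Omega>"
proof -
  have cl: "closed (\<Union>x\<in>closure (D j). \<Union>y\<in>\<Lambda>. {x + y})" if "j \<in> J" for j
    by (rule compact_closed_sums[OF compact_closure_D[OF that] closed_subset_lattice[OF tau order_refl]])
  have "\<Omega> = - (\<Union>j\<in>J. \<Union>x\<in>closure (D j). \<Union>y\<in>\<Lambda>. {x + y})"
    unfolding Omega_def by blast
  also have "open \<dots>" by (intro open_Compl closed_UN ballI cl) simp_all
  finally show ?thesis .
qed

lemma Omega_curve: "z \<in> \<Omega> \<Longrightarrow> j \<in> J \<Longrightarrow> z - \<gamma> j t \<notin> \<Lambda>"
  using range_closure in_Omega_iff by blast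

lemma hole_curve: "i \<in> J \<Longrightarrow> z \<in> D i \<Longrightarrow> j \<in> J \<Longrightarrow> z - \<gamma> j t \<notin> \<Lambda>"
proof
  assume *: "i \<in> J" "z \<in> D i" "j \<in> J" "z - \<gamma> j t \<in> \<Lambda>"
  hence "i = j \<and> z = \<gamma> j t" using closure_diff_lattice[of i j z "\<gamma> j t"] range_closure closure_subset by blast
  thus False using * c2_hole.closure_D(2)[OF hole[of j]] by blast
qed

text \<open>Closer to a curve than the separation distance, the only closed hole or translate that
  can be met is the hole bounded by that curve.\<close>

lemma near_curve_Omega:
  "\<exists>d>0. \<forall>j\<in>J. \<forall>s z. dist z (\<gamma> j s) < d \<longrightarrow> z \<notin> closure (D j) \<longrightarrow> z \<in> \<Omega>"
proof -
  obtain d where d: "d > 0" "\<And>i j x y l. \<lbrakk>i \<in> J; j \<in> J; x \<in> closure (D i); y \<in> closure (D j); l \<in> \<Lambda>; i \<noteq> j \<or> l \<noteq> 0\<rbrakk> \<Longrightarrow> d \<le> norm (x - y - l)"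
    using separation by blast
  have "z \<in> \<Omega>" if z: "j \<in> J" "dist z (\<gamma> j s) < d" "z \<notin> closure (D j)" for j s z
    unfolding in_Omega_iff
  proof (intro ballI notI)
    fix i y assume i: "i \<in> J" "y \<in> closure (D i)" "z - y \<in> \<Lambda>"
    have "\<not> (j \<noteq> i \<or> z - y \<noteq> 0)"
    proof
      assume "j \<noteq> i \<or> z - y \<noteq> 0"
      hence "d \<le> norm (\<gamma> j s - y - (z - y))" by (intro d(2)[OF z(1) i(1) range_closure[OF z(1)] i(2,3)])
      thus False using z(2) by (simp add: dist_norm norm_minus_commute)
    qed
    thus False using z(3) i(2) by simp
  qed
  thus ?thesis using d(1) by blast
qed

lemma eventually_Omega:
  assumes "j \<in> J" "\<kappa> > 0"
  shows "\<forall>\<^sub>F z in at (\<gamma> j s) within c2_curve.side_cone (\<gamma> j) (d\<gamma> j) (- sg j) \<kappa> s. z \<in> \<Omega>"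
proof -
  obtain d where d: "d > 0" "\<And>j s z. j \<in> J \<Longrightarrow> dist z (\<gamma> j s) < d \<Longrightarrow> z \<notin> closure (D j) \<Longrightarrow> z \<in> \<Omega>"
    using near_curve_Omega by blast
  let ?C = "c2_curve.side_cone (\<gamma> j) (d\<gamma> j) (- sg j) \<kappa> s"
  have "\<forall>\<^sub>F z in at (\<gamma> j s) within ?C. z \<notin> closure (D j)"
    using c2_hole.sides(2)[OF hole[OF assms(1)] assms(2), of s] by (simp only: orient_eq[OF assms(1)])
  moreover have "\<forall>\<^sub>F z in at (\<gamma> j s) within ?C. dist z (\<gamma> j s) < d"
    unfolding eventually_at using d(1) by blast
  ultimately show ?thesis by eventually_elim (use d(2) assms in blast)
qed

lemma curve_unique: "i \<in> J \<Longrightarrow> j \<in> J \<Longrightarrow> \<gamma> i t = \<gamma> j s \<Longrightarrow> i = j \<and> (\<exists>n::int. t = s + of_int n)"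
proof -
  assume *: "i \<in> J" "j \<in> J" "\<gamma> i t = \<gamma> j s"
  have ij: "i = j" using curve_diff_lattice[OF *(1,2), of t s] * by simp
  hence "t - s \<in> \<int>" using c2_curve.eq_iff[OF curve[OF *(2)]] * by simp
  then obtain n where "t - s = of_int n" by (elim Ints_cases)
  hence "t = s + of_int n" by simp
  thus ?thesis using ij by blast
qed

section \<open>The unit normal and tangent balls of the domain\<close>

lemma orthogonal_eq:
  fixes g n w :: complex
  assumes "w \<bullet> g = 0" "n \<bullet> g = 0" "norm n = 1" "g \<noteq> 0"
  shows "w = of_real (w \<bullet> n) * n"
proof -
  have w: "Re w * Re g + Im w * Im g = 0" and n: "Re n * Re g + Im n * Im g = 0"
    using assms by (simp_all add: inner_complex_def)
  have n1: "(Re n)\<^sup>2 + (Im n)\<^sup>2 = 1" using assms(3) by (simp add: cmod_def)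
  have "(Re w * Im n - Im w * Re n) * Re g = Im n * (Re w * Re g + Im w * Im g) - Im w * (Re n * Re g + Im n * Im g)"
       "(Re w * Im n - Im w * Re n) * Im g = Re w * (Re n * Re g + Im n * Im g) - Re n * (Re w * Re g + Im w * Im g)"
    by (simp_all add: algebra_simps)
  hence "(Re w * Im n - Im w * Re n) * Re g = 0" "(Re w * Im n - Im w * Re n) * Im g = 0" using w n by simp_all
  hence c: "Re w * Im n = Im w * Re n" using assms(4) by (auto simp: complex_eq_iff)
  have "Re w * ((Re n)\<^sup>2 + (Im n)\<^sup>2) = (Re w * Re n + Im w * Im n) * Re n + Im n * (Re w * Im n - Im w * Re n)"
    "Im w * ((Re n)\<^sup>2 + (Im n)\<^sup>2) = (Re w * Re n + Im w * Im n) * Im n - Re n * (Re w * Im n - Im w * Re n)"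
    by (simp_all add: power2_eq_square algebra_simps)
  hence "Re w = (Re w * Re n + Im w * Im n) * Re n" "Im w = (Re w * Re n + Im w * Im n) * Im n"
    using c n1 by simp_all
  thus ?thesis by (simp add: complex_eq_iff inner_complex_def)
qed

text \<open>Orthogonality to the tangent leaves two opposite unit vectors. The one pointing away
  from \<open>D j\<close> leads into \<Omega>, as no other hole comes close, and therefore misses
  the union of the holes.\<close>

lemma unit_normal_eq:
  assumes j: "j \<in> J"
  shows "unit_normal M D \<gamma> (\<gamma> j s) = nrm j s"
  unfolding unit_normal_def
proof (rule the_equality)
  interpret h: c2_hole "\<gamma> j" "d\<gamma> j" "dd\<gamma> j" "D j" by (rule hole[OF j])
  have n: "h.normal = nrm j" using normal_eq[OF j] by auto
  have g: "d\<gamma> i t = d\<gamma> j s" if "i \<in> J" "\<gamma> i t = \<gamma> j s" for i t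
    using curve_unique[OF that(1) j that(2)] h.per_int(2) by auto
  show "norm (nrm j s) = 1 \<and> (\<forall>i\<in>J. \<forall>t. \<gamma> i t = \<gamma> j s \<longrightarrow> nrm j s \<bullet> vector_derivative (\<gamma> i) (at t) = 0) \<and>
    (\<forall>\<^sub>F x in at_right 0. \<gamma> j s + of_real x * nrm j s \<in> (\<Union>j\<in>J. D j))"
  proof (intro conjI ballI allI impI)
    show "norm (nrm j s) = 1" by (rule norm_nrm[OF j])
    show "nrm j s \<bullet> vector_derivative (\<gamma> i) (at t) = 0" if "i \<in> J" "\<gamma> i t = \<gamma> j s" for i t
      using g[OF that] h.normal_orthogonal[of s] by (simp add: n flip: d\<gamma>_def)
    show "\<forall>\<^sub>F x in at_right 0. \<gamma> j s + of_real x * nrm j s \<in> (\<Union>j\<in>J. D j)"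
      using h.eventually_normal_D[of s] unfolding n by eventually_elim (use j in blast)
  qed
  fix v assume v: "norm v = 1 \<and> (\<forall>i\<in>J. \<forall>t. \<gamma> i t = \<gamma> j s \<longrightarrow> v \<bullet> vector_derivative (\<gamma> i) (at t) = 0) \<and>
    (\<forall>\<^sub>F x in at_right 0. \<gamma> j s + of_real x * v \<in> (\<Union>j\<in>J. D j))"
  hence "v \<bullet> d\<gamma> j s = 0" using j by (simp add: d\<gamma>_def)
  hence veq: "v = of_real (v \<bullet> nrm j s) * nrm j s"
    using h.normal_orthogonal[of s] h.regular[of s] norm_nrm[OF j] by (intro orthogonal_eq[of _ "d\<gamma> j s"]) (auto simp: n)
  define c where "c = v \<bullet> nrm j s"
  have v_c: "v = of_real c * nrm j s" using veq by (simp add: c_def)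
  hence "\<bar>c\<bar> = 1" using v norm_nrm[OF j, of s] by (metis norm_mult norm_of_real mult.right_neutral)
  hence "c = 1 \<or> c = -1" by linarith
  moreover have "c \<noteq> -1"
  proof
    assume "c = -1"
    hence "v = - nrm j s" using v_c by simp
    hence ev: "\<forall>\<^sub>F x in at_right 0. \<gamma> j s - of_real x * nrm j s \<in> (\<Union>j\<in>J. D j)" using v by simp
    have "\<forall>\<^sub>F x in at_right 0. \<gamma> j s - of_real x * nrm j s \<notin> closure (D j)"
      using h.eventually_normal_outside[of s] by (simp add: n)
    obtain d where d: "d > 0" "\<And>j s z. j \<in> J \<Longrightarrow> dist z (\<gamma> j s) < d \<Longrightarrow> z \<notin> closure (D j) \<Longrightarrow> z \<in> \<Omega>"
      using near_curve_Omega by blast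
    have "\<forall>\<^sub>F x in at_right 0. x \<in> {0<..<d}" using d(1) by (rule eventually_at_right_real)
    hence "\<forall>\<^sub>F x::real in at_right 0. False"
      using ev \<open>\<forall>\<^sub>F x in at_right 0. \<gamma> j s - of_real x * nrm j s \<notin> closure (D j)\<close>
    proof eventually_elim
      case (elim x)
      hence "\<gamma> j s - of_real x * nrm j s \<in> \<Omega>"
        using norm_nrm[OF j, of s] by (intro d(2)[OF j, of _ s]) (auto simp: dist_norm norm_mult)
      moreover obtain i where i: "i \<in> J" "\<gamma> j s - of_real x * nrm j s \<in> D i" using elim by blast
      ultimately show False using in_Omega_iff closure_subset[of "D i"] lattice_0[of \<tau>] by (metis diff_self subsetD)
    qed
    thus False by (simp add: trivial_limit_def[symmetric])
  qed
  ultimately show "v = nrm j s" using v_c by auto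
qed

lemma exterior_balls:
  "\<exists>R>0. \<forall>j\<in>J. \<forall>s. ball (\<gamma> j s + of_real R * nrm j s) R \<subseteq> D j \<and> ball (\<gamma> j s - of_real R * nrm j s) R \<subseteq> \<Omega>"
proof -
  obtain d where d: "d > 0" "\<And>j s z. j \<in> J \<Longrightarrow> dist z (\<gamma> j s) < d \<Longrightarrow> z \<notin> closure (D j) \<Longrightarrow> z \<in> \<Omega>"
    using near_curve_Omega by blast
  have "\<forall>j\<in>J. \<exists>R>0. \<forall>s r. 0 < r \<and> r \<le> R \<longrightarrow> ball (\<gamma> j s + of_real r * nrm j s) r \<subseteq> D j \<and> ball (\<gamma> j s - of_real r * nrm j s) r \<inter> closure (D j) = {}"
    using c2_hole.balls[OF hole] by (simp add: normal_eq)
  from bchoice[OF this] obtain R where R': "\<forall>j\<in>J. R j > 0 \<and> (\<forall>s r. 0 < r \<and> r \<le> R j \<longrightarrow> ball (\<gamma> j s + of_real r * nrm j s) r \<subseteq> D j \<and> ball (\<gamma> j s - of_real r * nrm j s) r \<inter> closure (D j) = {})"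
    by blast
  have R: "\<And>j. j \<in> J \<Longrightarrow> R j > 0"
    "\<And>j s r. j \<in> J \<Longrightarrow> 0 < r \<Longrightarrow> r \<le> R j \<Longrightarrow> ball (\<gamma> j s + of_real r * nrm j s) r \<subseteq> D j \<and> ball (\<gamma> j s - of_real r * nrm j s) r \<inter> closure (D j) = {}"
    using R' by blast+
  \<comment> \<open>Points of a ball of radius \<open>r\<close> touching the curve at
    \<open>\<gamma> j s\<close> are within \<open>2 * r\<close> of that point, hence the bound
    \<open>d / 2\<close>.\<close>
  obtain r where r: "r > 0" "\<And>j. j \<in> J \<Longrightarrow> r \<le> R j" "r \<le> d / 2"
  proof (rule that)
    show "Min (insert (d / 2) (R ` J)) > 0" by (subst Min_gr_iff) (use d(1) R(1) in auto)
    show "Min (insert (d / 2) (R ` J)) \<le> R j" if "j \<in> J" for j using that by (intro Min_le) auto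
    show "Min (insert (d / 2) (R ` J)) \<le> d / 2" by (intro Min_le) auto
  qed
  have "ball (\<gamma> j s + of_real r * nrm j s) r \<subseteq> D j \<and> ball (\<gamma> j s - of_real r * nrm j s) r \<subseteq> \<Omega>" if j: "j \<in> J" for j s
  proof
    show "ball (\<gamma> j s + of_real r * nrm j s) r \<subseteq> D j" using R(2)[OF j r(1) r(2)[OF j]] by blast
    show "ball (\<gamma> j s - of_real r * nrm j s) r \<subseteq> \<Omega>"
    proof
      fix z assume z: "z \<in> ball (\<gamma> j s - of_real r * nrm j s) r"
      hence nc: "z \<notin> closure (D j)" using R(2)[OF j r(1) r(2)[OF j]] by blast
      have "dist z (\<gamma> j s) \<le> dist z (\<gamma> j s - of_real r * nrm j s) + dist (\<gamma> j s - of_real r * nrm j s) (\<gamma> j s)"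
        by (rule dist_triangle)
      also have "dist (\<gamma> j s - of_real r * nrm j s) (\<gamma> j s) = r"
        using norm_nrm[OF j, of s] r(1) by (simp add: dist_norm norm_mult)
      also have "dist z (\<gamma> j s - of_real r * nrm j s) < r" using z by (simp add: dist_commute)
      finally show "z \<in> \<Omega>" using r(3) by (intro d(2)[OF j _ nc, of s]) linarith
    qed
  qed
  thus ?thesis using r(1) by blast
qed

text \<open>A nearest point of the curve is reached along the normal.\<close>

lemma near_curve_ball:
  assumes j: "j \<in> J" and R: "R > 0" "\<And>s. ball (\<gamma> j s + of_real R * nrm j s) R \<subseteq> D j"
    and z: "z \<in> \<Omega>" "dist z (\<gamma> j s) < R"
  shows "\<exists>s. z \<in> ball (\<gamma> j s - of_real R * nrm j s) R"
proof -
  interpret h: c2_hole "\<gamma> j" "d\<gamma> j" "dd\<gamma> j" "D j" by (rule hole[OF j])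
  have n: "h.normal = nrm j" using normal_eq[OF j] by auto
  have "\<exists>x\<in>{0..1}. \<forall>y\<in>{0..1}. dist z (\<gamma> j x) \<le> dist z (\<gamma> j y)"
    by (rule continuous_attains_inf) (auto intro!: continuous_intros h.cont)
  then obtain s0 where s0: "\<And>y. y \<in> {0..1} \<Longrightarrow> dist z (\<gamma> j s0) \<le> dist z (\<gamma> j y)" by blast
  have min: "dist z (\<gamma> j s0) \<le> dist z (\<gamma> j y)" for y
  proof -
    obtain k :: int where k: "y + of_int k \<in> {0..<1}" using real_reduce by blast
    thus ?thesis using s0[of "y + of_int k"] by (simp add: h.per_int)
  qed
  let ?w = "z - \<gamma> j s0"
  have der: "((\<lambda>t. (z - \<gamma> j t) \<bullet> (z - \<gamma> j t)) has_real_derivative - 2 * (?w \<bullet> d\<gamma> j s0)) (at s0)"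
  proof -
    have "((\<lambda>t. z - \<gamma> j t) has_derivative (\<lambda>h. - (h *\<^sub>R d\<gamma> j s0))) (at s0)"
      using h.deriv[of s0] by (auto intro!: derivative_eq_intros simp: has_vector_derivative_def)
    from has_derivative_inner[OF this this] show ?thesis
      unfolding has_field_derivative_def
      by (rule has_derivative_eq_rhs) (auto simp: fun_eq_iff inner_commute algebra_simps)
  qed
  have "- 2 * (?w \<bullet> d\<gamma> j s0) = 0"
  proof (rule DERIV_local_min[OF der zero_less_one], intro allI impI)
    fix y
    have "(dist z (\<gamma> j s0))\<^sup>2 \<le> (dist z (\<gamma> j y))\<^sup>2" using min by (intro power_mono) auto
    thus "(z - \<gamma> j s0) \<bullet> (z - \<gamma> j s0) \<le> (z - \<gamma> j y) \<bullet> (z - \<gamma> j y)" by (simp add: dist_norm power2_norm_eq_inner)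
  qed
  hence "?w \<bullet> d\<gamma> j s0 = 0" by simp
  hence weq: "?w = of_real (?w \<bullet> nrm j s0) * nrm j s0"
    using h.normal_orthogonal[of s0] h.regular[of s0] norm_nrm[OF j] by (intro orthogonal_eq[of _ "d\<gamma> j s0"]) (auto simp: n)
  define c where "c = ?w \<bullet> nrm j s0"
  have zc: "z = \<gamma> j s0 + of_real c * nrm j s0" using weq by (simp add: c_def algebra_simps)
  have c_norm: "\<bar>c\<bar> = dist z (\<gamma> j s0)" using norm_nrm[OF j, of s0] by (simp add: zc dist_norm norm_mult)
  hence cR: "\<bar>c\<bar> < R" using min[of s] z(2) by linarith
  \<comment> \<open>The sign of \<open>c\<close> tells the side: a positive value would place
    \<open>z\<close> in the tangent ball inside the hole.\<close>
  have "c \<noteq> 0" using Omega_curve[OF z(1) j, of s0] lattice_0[of \<tau>] zc by auto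
  moreover have "\<not> c > 0"
  proof
    assume "c > 0"
    have "z - (\<gamma> j s0 + of_real R * nrm j s0) = of_real (c - R) * nrm j s0" by (simp add: zc algebra_simps)
    hence "dist z (\<gamma> j s0 + of_real R * nrm j s0) = \<bar>c - R\<bar>" using norm_nrm[OF j] by (simp add: dist_norm norm_mult del: of_real_diff)
    hence "z \<in> ball (\<gamma> j s0 + of_real R * nrm j s0) R" using cR \<open>c > 0\<close> by (simp add: dist_commute)
    hence "z \<in> closure (D j)" using R(2) closure_subset by blast
    thus False using z(1) j in_Omega_iff lattice_0[of \<tau>] by (metis diff_self)
  qed
  ultimately have "c < 0" by linarith
  have "z - (\<gamma> j s0 - of_real R * nrm j s0) = of_real (c + R) * nrm j s0" by (simp add: zc algebra_simps)
  hence "dist z (\<gamma> j s0 - of_real R * nrm j s0) = \<bar>c + R\<bar>" using norm_nrm[OF j] by (simp add: dist_norm norm_mult del: of_real_add)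
  hence "z \<in> ball (\<gamma> j s0 - of_real R * nrm j s0) R" using cR \<open>c < 0\<close> by (simp add: dist_commute)
  thus ?thesis by blast
qed

section \<open>Non-tangential approach regions\<close>

definition approach :: "nat \<Rightarrow> real \<Rightarrow> real \<Rightarrow> complex set" where
  "approach j s c = {z \<in> \<Omega>. c * dist z (\<gamma> j s) \<le> nrm j s \<bullet> (\<gamma> j s - z)}"

lemma approach_eq:
  assumes j: "j \<in> J"
  shows "approach j s c = \<Omega> \<inter> c2_curve.side_cone (\<gamma> j) (d\<gamma> j) (- sg j) (c / norm (d\<gamma> j s)) s"
  using c2_hole.normal_cone[OF hole[OF j], of c s] unfolding approach_def normal_eq[OF j] orient_eq[OF j] by blast

text \<open>On the normal ray the right-hand side of the cone condition equals the distance to the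
  vertex, so the ray runs in the cone for \<open>c \<le> 1\<close>. For larger \<open>c\<close> the
  Cauchy-Schwarz inequality leaves nothing but the vertex.\<close>

lemma normal_approach:
  assumes j: "j \<in> J" and c: "0 < c" "c \<le> 1"
  shows "filterlim (\<lambda>\<epsilon>. \<gamma> j s - of_real \<epsilon> * nrm j s) (at (\<gamma> j s) within approach j s c) (at_right 0)"
proof -
  interpret h: c2_hole "\<gamma> j" "d\<gamma> j" "dd\<gamma> j" "D j" by (rule hole[OF j])
  have n: "h.normal = nrm j" using normal_eq[OF j] by auto
  let ?\<kappa> = "c / norm (d\<gamma> j s)"
  have k: "?\<kappa> > 0" "?\<kappa> * norm (d\<gamma> j s) \<le> 1" using h.regular[of s] c by auto
  have o': "- sg j = 1 \<or> - sg j = -1" using sg_cases by auto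
  have fl: "filterlim (\<lambda>\<epsilon>. \<gamma> j s - of_real \<epsilon> * nrm j s) (at (\<gamma> j s) within h.side_cone (- sg j) ?\<kappa> s) (at_right 0)"
  proof -
    have "h.normal_ray (- sg j) s = (\<lambda>\<epsilon>. \<gamma> j s - of_real \<epsilon> * nrm j s)"
      using h.normal_ray_normal[of "-1" s] by (auto simp: n orient_eq[OF j])
    thus ?thesis using h.normal_ray_filterlim[OF o' k(2)] by simp
  qed
  have "\<forall>\<^sub>F \<epsilon> in at_right 0. \<gamma> j s - of_real \<epsilon> * nrm j s \<in> \<Omega>"
    using eventually_compose_filterlim[OF eventually_Omega[OF j k(1)] fl] .
  thus ?thesis
    using fl unfolding approach_eq[OF j] filterlim_at by (auto elim: eventually_elim2)
qed

lemma approach_nontrivial: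
  assumes "j \<in> J" "0 < c" "c \<le> 1"
  shows "at (\<gamma> j s) within approach j s c \<noteq> bot"
  using normal_approach[OF assms, of s]
  by (metis bot.extremum_uniqueI filterlim_def filtermap_bot_iff trivial_limit_at_right_real)

lemma has_normal_deriv_eq:
  assumes "j \<in> J"
  shows "has_normal_deriv \<tau> M D \<gamma> u (\<gamma> j s) d \<longleftrightarrow>
    (\<forall>c>0. ((\<lambda>z. nrm j s \<bullet> grad u z) \<longlongrightarrow> d) (at (\<gamma> j s) within approach j s c))"
  unfolding has_normal_deriv_def unit_normal_eq[OF assms] approach_def ..

lemma normal_deriv_eq:
  assumes j: "j \<in> J" and h: "has_normal_deriv \<tau> M D \<gamma> u (\<gamma> j s) d"
  shows "normal_deriv \<tau> M D \<gamma> u (\<gamma> j s) = d"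
  unfolding normal_deriv_def
proof (rule the_equality[where P = "has_normal_deriv \<tau> M D \<gamma> u (\<gamma> j s)", OF h])
  fix d' assume h': "has_normal_deriv \<tau> M D \<gamma> u (\<gamma> j s) d'"
  show "d' = d"
  proof (rule tendsto_unique[OF approach_nontrivial[OF j, of 1 s]])
    show "((\<lambda>z. nrm j s \<bullet> grad u z) \<longlongrightarrow> d') (at (\<gamma> j s) within approach j s 1)"
      using h' unfolding has_normal_deriv_eq[OF j] by simp
    show "((\<lambda>z. nrm j s \<bullet> grad u z) \<longlongrightarrow> d) (at (\<gamma> j s) within approach j s 1)"
      using h unfolding has_normal_deriv_eq[OF j] by simp
  qed simp_all
qed

end

subsection \<open>Integral operators on bounded continuous functions\<close>

lemma continuous_on_curry:
  assumes "continuous_on UNIV (\<lambda>x. f (fst x) (snd x))"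
  shows "continuous_on A (\<lambda>t. f p t)" "continuous_on B (\<lambda>s. f s q)"
proof -
  have "continuous_on A (\<lambda>t. f (fst (p, t)) (snd (p, t)))" "continuous_on B (\<lambda>s. f (fst (s, q)) (snd (s, q)))"
    by (rule continuous_on_compose2[OF assms]; auto intro!: continuous_intros)+
  thus "continuous_on A (\<lambda>t. f p t)" "continuous_on B (\<lambda>s. f s q)" by simp_all
qed

instance bcontfun :: (metric_space, banach) banach ..

text \<open>The functions live on the whole space, which is not compact. The retraction
  \<open>r\<close> folds every point into the compact set \<open>S\<close> without changing the
  kernels, so that compactness arguments on \<open>S\<close> give statements in the global sup norm.
  \<open>e j\<close> embeds the \<open>j\<close>-th curve parameter into the space.\<close>

locale integral_operator =
  fixes J :: "nat set" and \<kappa> :: "nat \<Rightarrow> 'a::euclidean_space \<Rightarrow> real \<Rightarrow> real" and e :: "nat \<Rightarrow> real \<Rightarrow> 'a"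
    and S :: "'a set" and r :: "'a \<Rightarrow> 'a"
  assumes fin: "finite J"
    and cont: "j \<in> J \<Longrightarrow> continuous_on UNIV (\<lambda>x. \<kappa> j (fst x) (snd x))"
    and cont_e: "j \<in> J \<Longrightarrow> continuous_on UNIV (e j)"
    and compact_S: "compact S"
    and r: "r p \<in> S" "j \<in> J \<Longrightarrow> \<kappa> j (r p) t = \<kappa> j p t"
begin

definition op_fun :: "('a \<Rightarrow> real) \<Rightarrow> 'a \<Rightarrow> real" where
  "op_fun f p = (\<Sum>j\<in>J. integral {0..1} (\<lambda>t. \<kappa> j p t * f (e j t)))"

lemma op_fun_continuous:
  assumes "continuous_on UNIV f"
  shows "continuous_on UNIV (op_fun f)"
proof -
  have "continuous_on UNIV (\<lambda>p. integral {0..1} (\<lambda>t. \<kappa> j p t * f (e j t)))" if j: "j \<in> J" for j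
  proof -
    have "continuous_on (UNIV \<times> cbox 0 1) (\<lambda>(p, t). \<kappa> j p t * f (e j t))"
      unfolding case_prod_unfold
      by (intro continuous_intros continuous_on_subset[OF cont[OF j]] continuous_on_compose2[OF assms]
          continuous_on_compose2[OF cont_e[OF j]]) auto
    from integral_continuous_on_param[OF this] show ?thesis by simp
  qed
  thus ?thesis unfolding op_fun_def by (intro continuous_on_sum) auto
qed

lemma kernel_bounded: "\<exists>B>0. \<forall>j\<in>J. \<forall>p. \<forall>t\<in>{0..1}. \<bar>\<kappa> j p t\<bar> \<le> B"
proof -
  have "\<exists>B. \<forall>p. \<forall>t\<in>{0..1}. \<bar>\<kappa> j p t\<bar> \<le> B" if j: "j \<in> J" for j
  proof -
    have "bounded ((\<lambda>x. \<kappa> j (fst x) (snd x)) ` (S \<times> {0..1}))"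
      by (intro compact_imp_bounded compact_continuous_image continuous_on_subset[OF cont[OF j]] compact_Times compact_S) auto
    then obtain B where B: "\<And>x. x \<in> S \<times> {0..1} \<Longrightarrow> \<bar>\<kappa> j (fst x) (snd x)\<bar> \<le> B"
      unfolding bounded_iff real_norm_def by blast
    have "\<bar>\<kappa> j p t\<bar> \<le> B" if "t \<in> {0..1}" for p t
      using B[of "(r p, t)"] r that j by simp
    thus ?thesis by blast
  qed
  then obtain B where B: "\<And>j p t. j \<in> J \<Longrightarrow> t \<in> {0..1} \<Longrightarrow> \<bar>\<kappa> j p t\<bar> \<le> B j" by metis
  have "\<bar>\<kappa> j p t\<bar> \<le> (\<Sum>j\<in>J. \<bar>B j\<bar>) + 1" if "j \<in> J" "t \<in> {0..1}" for j p t
  proof -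
    have "\<bar>\<kappa> j p t\<bar> \<le> \<bar>B j\<bar>" using B[OF that] by (meson abs_ge_self order_trans)
    also have "\<dots> \<le> (\<Sum>j\<in>J. \<bar>B j\<bar>)" by (rule member_le_sum) (use that fin in auto)
    finally show ?thesis by simp
  qed
  moreover have "(\<Sum>j\<in>J. \<bar>B j\<bar>) + 1 > 0" by (intro add_nonneg_pos sum_nonneg) auto
  ultimately show ?thesis by blast
qed

lemma op_fun_integrable:
  assumes "continuous_on UNIV f" "j \<in> J"
  shows "(\<lambda>t. \<kappa> j p t * f (e j t)) integrable_on {0..1}"
proof (rule integrable_continuous_real)
  have "continuous_on {0..1} (\<lambda>t. \<kappa> j p t)"
    by (rule continuous_on_curry(1)[OF cont[OF assms(2)]])
  thus "continuous_on {0..1} (\<lambda>t. \<kappa> j p t * f (e j t))"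
    by (intro continuous_intros continuous_on_compose2[OF assms(1)] continuous_on_subset[OF cont_e[OF assms(2)]]) auto
qed

lemma op_fun_bound:
  assumes "continuous_on UNIV f" "\<And>p. \<bar>f p\<bar> \<le> N"
    and "\<And>j t. j \<in> J \<Longrightarrow> t \<in> {0..1} \<Longrightarrow> \<bar>\<kappa> j p t\<bar> \<le> B"
  shows "\<bar>op_fun f p\<bar> \<le> real (card J) * (B * N)"
proof -
  have "\<bar>integral {0..1} (\<lambda>t. \<kappa> j p t * f (e j t))\<bar> \<le> B * N" if j: "j \<in> J" for j
  proof -
    have "norm (integral {0..1} (\<lambda>t. \<kappa> j p t * f (e j t))) \<le> integral {0..1} (\<lambda>t::real. B * N)"
    proof (rule integral_norm_bound_integral[OF op_fun_integrable[OF assms(1) j]])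
      fix t :: real assume t: "t \<in> {0..1}"
      have "B \<ge> 0" using assms(3)[OF j t] by linarith
      thus "norm (\<kappa> j p t * f (e j t)) \<le> B * N"
        unfolding real_norm_def abs_mult by (intro mult_mono assms(2) assms(3)[OF j t]) auto
    qed (rule integrable_const_ivl)
    thus ?thesis by simp
  qed
  hence "(\<Sum>j\<in>J. \<bar>integral {0..1} (\<lambda>t. \<kappa> j p t * f (e j t))\<bar>) \<le> real (card J) * (B * N)"
    by (rule sum_bounded_above)
  thus ?thesis unfolding op_fun_def by (rule order_trans[OF sum_abs])
qed

lemma op_fun_bcontfun: "op_fun (apply_bcontfun f) \<in> bcontfun"
proof -
  obtain B where B: "\<And>j p t. j \<in> J \<Longrightarrow> t \<in> {0..1} \<Longrightarrow> \<bar>\<kappa> j p t\<bar> \<le> B" using kernel_bounded by blast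
  have "\<bar>op_fun f p\<bar> \<le> real (card J) * (B * norm f)" for p
    by (rule op_fun_bound) (use B norm_bounded[of f] in auto)
  thus ?thesis unfolding bcontfun_def bounded_iff by (auto intro: op_fun_continuous)
qed

definition opr :: "('a \<Rightarrow>\<^sub>C real) \<Rightarrow> ('a \<Rightarrow>\<^sub>C real)" where
  "opr f = Bcontfun (op_fun f)"

lemma opr_apply: "apply_bcontfun (opr f) p = op_fun f p"
  unfolding opr_def by (simp add: Bcontfun_inverse op_fun_bcontfun)

lemma bounded_linear_opr: "bounded_linear opr"
proof -
  obtain B where B: "\<And>j p t. j \<in> J \<Longrightarrow> t \<in> {0..1} \<Longrightarrow> \<bar>\<kappa> j p t\<bar> \<le> B" using kernel_bounded by blast
  show ?thesis
  proof (rule bounded_linear_intro[where K = "real (card J) * B"])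
    fix f g :: "'a \<Rightarrow>\<^sub>C real" and c :: real
    show "opr (f + g) = opr f + opr g"
    proof (rule bcontfun_eqI)
      fix p
      have "integral {0..1} (\<lambda>t. \<kappa> j p t * (f + g) (e j t)) = integral {0..1} (\<lambda>t. \<kappa> j p t * f (e j t)) + integral {0..1} (\<lambda>t. \<kappa> j p t * g (e j t))" if "j \<in> J" for j
        by (subst integral_add[symmetric]) (auto intro!: op_fun_integrable that simp: plus_bcontfun.rep_eq distrib_left)
      thus "opr (f + g) p = (opr f + opr g) p"
        by (simp add: opr_apply op_fun_def plus_bcontfun.rep_eq sum.distrib cong: sum.cong)
    qed
    show "opr (c *\<^sub>R f) = c *\<^sub>R opr f"
      by (rule bcontfun_eqI)
         (simp add: opr_apply op_fun_def scaleR_bcontfun.rep_eq sum_distrib_left mult.left_commute[of _ c])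
    show "norm (opr f) \<le> norm f * (real (card J) * B)"
    proof (rule norm_bound)
      fix p
      have "\<bar>op_fun f p\<bar> \<le> real (card J) * (B * norm f)"
        by (rule op_fun_bound) (use B norm_bounded[of f] in auto)
      thus "norm (apply_bcontfun (opr f) p) \<le> norm f * (real (card J) * B)" by (simp add: opr_apply mult_ac)
    qed
  qed
qed

text \<open>Uniform continuity of the kernels on \<open>S \<times> {0..1}\<close> makes the images
  equicontinuous there, and Arzela-Ascoli applies. The images are invariant under \<open>r\<close>,
  hence uniform convergence on \<open>S\<close> is convergence in norm.\<close>

lemma opr_compact:
  fixes f :: "nat \<Rightarrow> ('a \<Rightarrow>\<^sub>C real)"
  assumes f: "\<And>n. norm (f n) \<le> 1"
  shows "\<exists>k l. strict_mono (k :: nat \<Rightarrow> nat) \<and> (\<lambda>n. opr (f (k n))) \<longlonglongrightarrow> l"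
proof -
  obtain B where B: "B > 0" "\<And>j p t. j \<in> J \<Longrightarrow> t \<in> {0..1} \<Longrightarrow> \<bar>\<kappa> j p t\<bar> \<le> B" using kernel_bounded by blast
  have f1: "\<bar>f n p\<bar> \<le> 1" for n p using norm_bounded[of "f n" p] f[of n] by simp
  have equi: "\<exists>d>0. \<forall>n y. y \<in> S \<and> norm (x - y) < d \<longrightarrow> norm (op_fun (f n) x - op_fun (f n) y) < \<epsilon>"
    if x: "x \<in> S" and \<epsilon>: "\<epsilon> > 0" for x \<epsilon>
  proof -
    \<comment> \<open>One more than the number of kernels, so that the sum of the errors stays
      strictly below \<epsilon>, also for empty \<open>J\<close>.\<close>
    define \<epsilon>' where "\<epsilon>' = \<epsilon> / (real (card J) + 1)"
    have \<epsilon>': "\<epsilon>' > 0" using \<epsilon> by (simp add: \<epsilon>'_def)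
    have "\<exists>d>0. \<forall>y\<in>S. norm (x - y) < d \<longrightarrow> (\<forall>t\<in>{0..1}. \<bar>\<kappa> j x t - \<kappa> j y t\<bar> < \<epsilon>')" if j: "j \<in> J" for j
    proof -
      have "uniformly_continuous_on (S \<times> {0..1}) (\<lambda>x. \<kappa> j (fst x) (snd x))"
        by (intro compact_uniformly_continuous compact_Times compact_S continuous_on_subset[OF cont[OF j]]) auto
      then obtain d where d: "d > 0" "\<And>p q. p \<in> S \<times> {0..1} \<Longrightarrow> q \<in> S \<times> {0..1} \<Longrightarrow> dist q p < d \<Longrightarrow>
          dist (\<kappa> j (fst q) (snd q)) (\<kappa> j (fst p) (snd p)) < \<epsilon>'"
        using \<epsilon>' unfolding uniformly_continuous_on_def by metis
      have "\<bar>\<kappa> j x t - \<kappa> j y t\<bar> < \<epsilon>'" if "y \<in> S" "norm (x - y) < d" "t \<in> {0..1}" for y t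
        using d(2)[of "(y, t)" "(x, t)"] that x by (simp add: dist_Pair_Pair dist_norm)
      thus ?thesis using d(1) by blast
    qed
    then obtain d where d: "\<And>j. j \<in> J \<Longrightarrow> d j > 0"
      "\<And>j y t. j \<in> J \<Longrightarrow> y \<in> S \<Longrightarrow> norm (x - y) < d j \<Longrightarrow> t \<in> {0..1} \<Longrightarrow> \<bar>\<kappa> j x t - \<kappa> j y t\<bar> < \<epsilon>'"
      by metis
    define d0 where "d0 = Min (insert 1 (d ` J))"
    have d0: "d0 > 0" unfolding d0_def using d(1) fin by (subst Min_gr_iff) auto
    have d0_le: "d0 \<le> d j" if "j \<in> J" for j unfolding d0_def using that fin by (intro Min_le) auto
    have "norm (op_fun (f n) x - op_fun (f n) y) < \<epsilon>" if y: "y \<in> S" "norm (x - y) < d0" for n y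
    proof -
      have "\<bar>integral {0..1} (\<lambda>t. \<kappa> j x t * f n (e j t)) - integral {0..1} (\<lambda>t. \<kappa> j y t * f n (e j t))\<bar> \<le> \<epsilon>'" if j: "j \<in> J" for j
      proof -
        have "integral {0..1} (\<lambda>t. \<kappa> j x t * f n (e j t)) - integral {0..1} (\<lambda>t. \<kappa> j y t * f n (e j t))
          = integral {0..1} (\<lambda>t. \<kappa> j x t * f n (e j t) - \<kappa> j y t * f n (e j t))"
          by (intro integral_diff[symmetric] op_fun_integrable j) auto
        also have "norm \<dots> \<le> integral {0..1} (\<lambda>t::real. \<epsilon>')"
        proof (rule integral_norm_bound_integral)
          fix t :: real assume t: "t \<in> {0..1}"
          have "norm (\<kappa> j x t * f n (e j t) - \<kappa> j y t * f n (e j t)) = \<bar>\<kappa> j x t - \<kappa> j y t\<bar> * \<bar>f n (e j t)\<bar>"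
            by (simp add: abs_mult flip: left_diff_distrib)
          also have "\<dots> \<le> \<epsilon>' * 1"
            using d(2)[OF j y(1) _ t] y(2) d0_le[OF j] \<epsilon>' by (intro mult_mono f1) auto
          finally show "norm (\<kappa> j x t * f n (e j t) - \<kappa> j y t * f n (e j t)) \<le> \<epsilon>'" by simp
        qed (intro integrable_diff op_fun_integrable j integrable_const_ivl; simp)+
        finally show ?thesis by simp
      qed
      hence "(\<Sum>j\<in>J. \<bar>integral {0..1} (\<lambda>t. \<kappa> j x t * f n (e j t)) - integral {0..1} (\<lambda>t. \<kappa> j y t * f n (e j t))\<bar>) \<le> real (card J) * \<epsilon>'"
        by (rule sum_bounded_above)
      hence "\<bar>op_fun (f n) x - op_fun (f n) y\<bar> \<le> real (card J) * \<epsilon>'"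
        unfolding op_fun_def sum_subtractf[symmetric] by (rule order_trans[OF sum_abs])
      also have "\<dots> < \<epsilon>" using \<epsilon> by (simp add: \<epsilon>'_def field_simps)
      finally show ?thesis by simp
    qed
    thus ?thesis using d0 by blast
  qed
  have bd: "norm (op_fun (f n) x) \<le> real (card J) * (B * 1)" for n x
    unfolding real_norm_def by (rule op_fun_bound) (use f1 B(2) in auto)
  obtain g and k :: "nat \<Rightarrow> nat" where k: "strict_mono k"
    and lim: "\<And>\<epsilon>. 0 < \<epsilon> \<Longrightarrow> \<exists>N. \<forall>n x. n \<ge> N \<and> x \<in> S \<longrightarrow> norm (op_fun (f (k n)) x - g x) < \<epsilon>"
    using Arzela_Ascoli[OF compact_S, of "\<lambda>n. op_fun (f n)" "real (card J) * (B * 1)"] bd equi by metis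
  have opr_r: "op_fun h (r p) = op_fun h p" for h p
    unfolding op_fun_def using r by (intro sum.cong refl) simp
  have "Cauchy (\<lambda>n. opr (f (k n)))"
  proof (rule CauchyI)
    fix \<epsilon> :: real assume \<epsilon>: "0 < \<epsilon>"
    obtain N where N: "\<And>n x. n \<ge> N \<Longrightarrow> x \<in> S \<Longrightarrow> norm (op_fun (f (k n)) x - g x) < \<epsilon> / 4"
      using lim[of "\<epsilon> / 4"] \<epsilon> by auto
    have "norm (opr (f (k m)) - opr (f (k n))) < \<epsilon>" if mn: "m \<ge> N" "n \<ge> N" for m n
    proof -
      have "norm (opr (f (k m)) - opr (f (k n))) \<le> \<epsilon> / 2"
      proof (rule norm_bound)
        fix p
        have "norm (op_fun (f (k m)) (r p) - op_fun (f (k n)) (r p)) \<le> norm (op_fun (f (k m)) (r p) - g (r p)) + norm (op_fun (f (k n)) (r p) - g (r p))"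
          using norm_triangle_ineq4[of "op_fun (f (k m)) (r p) - g (r p)" "op_fun (f (k n)) (r p) - g (r p)"] by simp
        also have "\<dots> \<le> \<epsilon> / 4 + \<epsilon> / 4" using N[OF mn(1) r(1)[of p]] N[OF mn(2) r(1)[of p]] by (intro add_mono) auto
        finally show "norm (apply_bcontfun (opr (f (k m)) - opr (f (k n))) p) \<le> \<epsilon> / 2"
          by (simp add: minus_bcontfun.rep_eq opr_apply opr_r)
      qed
      thus ?thesis using \<epsilon> by simp
    qed
    thus "\<exists>M. \<forall>m\<ge>M. \<forall>n\<ge>M. norm (opr (f (k m)) - opr (f (k n))) < \<epsilon>" by blast
  qed
  then obtain l where "(\<lambda>n. opr (f (k n))) \<longlonglongrightarrow> l" using Cauchy_convergent_iff convergent_def by blast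
  thus ?thesis using k by blast
qed

text \<open>Doubling the equation gives \<open>x - K x = y\<close> with \<open>K\<close> equal to
  \<open>-2\<close> times the operator, the form of the Fredholm alternative.\<close>

theorem second_kind_solvable:
  assumes inj: "\<And>f :: 'a \<Rightarrow>\<^sub>C real. (\<And>p. 1/2 * apply_bcontfun f p + op_fun (apply_bcontfun f) p = 0) \<Longrightarrow> f = 0"
  shows "\<exists>f :: 'a \<Rightarrow>\<^sub>C real. \<forall>p. 1/2 * apply_bcontfun f p + op_fun (apply_bcontfun f) p = apply_bcontfun g p"
proof -
  have "\<exists>x. x - (-2) *\<^sub>R opr x = 2 *\<^sub>R g"
  proof (rule fredholm_surjective[where K = "\<lambda>x. (-2) *\<^sub>R opr x"])
    show "bounded_linear (\<lambda>x. (-2) *\<^sub>R opr x)" by (rule bounded_linear_compose[OF bounded_linear_scaleR_right bounded_linear_opr])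
    fix f :: "nat \<Rightarrow> ('a \<Rightarrow>\<^sub>C real)" assume "\<And>n. norm (f n) \<le> 1"
    then obtain k l where "strict_mono (k :: nat \<Rightarrow> nat)" "(\<lambda>n. opr (f (k n))) \<longlonglongrightarrow> l" using opr_compact by metis
    thus "\<exists>r l. strict_mono (r :: nat \<Rightarrow> nat) \<and> (\<lambda>n. (-2) *\<^sub>R opr (f (r n))) \<longlonglongrightarrow> l"
      using tendsto_scaleR[OF tendsto_const] by blast
  next
    fix x assume "x - (-2) *\<^sub>R opr x = 0"
    hence "apply_bcontfun (x - (-2) *\<^sub>R opr x) p = apply_bcontfun 0 p" for p by simp
    hence "apply_bcontfun x p + 2 * op_fun (apply_bcontfun x) p = 0" for p by (simp add: minus_bcontfun.rep_eq scaleR_bcontfun.rep_eq opr_apply)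
    hence "1/2 * apply_bcontfun x p + op_fun (apply_bcontfun x) p = 0" for p by (simp add: field_simps)
    thus "x = 0" by (rule inj)
  qed
  then obtain x where x: "x - (-2) *\<^sub>R opr x = 2 *\<^sub>R g" by blast
  have "apply_bcontfun (x - (-2) *\<^sub>R opr x) p = 2 * apply_bcontfun g p" for p unfolding x by (simp add: scaleR_bcontfun.rep_eq)
  hence "apply_bcontfun x p + 2 * op_fun (apply_bcontfun x) p = 2 * apply_bcontfun g p" for p by (simp add: minus_bcontfun.rep_eq scaleR_bcontfun.rep_eq opr_apply)
  hence "1/2 * apply_bcontfun x p + op_fun (apply_bcontfun x) p = apply_bcontfun g p" for p by (simp add: field_simps)
  thus ?thesis by blast
qed

end

subsection \<open>The kernel of the adjoint double layer operator\<close>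

context torus_domain
begin

lemma curve_continuous [continuous_intros]:
  assumes "j \<in> J" "continuous_on A f"
  shows "continuous_on A (\<lambda>x. \<gamma> j (f x))" "continuous_on A (\<lambda>x. d\<gamma> j (f x))" "continuous_on A (\<lambda>x. dd\<gamma> j (f x))"
  using c2_curve.curve_cont[OF curve[OF assms(1)] assms(2)] by simp_all

lemma curve_periodic:
  assumes "j \<in> J"
  shows "\<gamma> j (t + 1) = \<gamma> j t" "d\<gamma> j (t + 1) = d\<gamma> j t" "dd\<gamma> j (t + 1) = dd\<gamma> j t"
  using c2_curve.per[OF curve[OF assms]] c2_curve.per1[OF curve[OF assms]] c2_curve.per2[OF curve[OF assms]] by auto

lemma d\<gamma>_nonzero: "j \<in> J \<Longrightarrow> d\<gamma> j t \<noteq> 0"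
  using c2_curve.regular[OF curve] .

text \<open>The normal derivative of Green's function in terms of parameters. On a single curve the
  pole of \<open>zeta\<close> is split off and its contribution continued by
  \<open>tangent_kernel\<close>, so that the kernel has its limit as value on the diagonal.\<close>

definition kern :: "nat \<Rightarrow> nat \<Rightarrow> real \<Rightarrow> real \<Rightarrow> real" where
  "kern i j s t = sg i / (2 * pi * norm (d\<gamma> i s)) *
      (if i = j then c2_curve.tangent_kernel (\<gamma> i) (d\<gamma> i) (dd\<gamma> i) s t + Im (d\<gamma> i s * zeta_reg \<tau> (\<gamma> i s - \<gamma> i t))
       else Im (d\<gamma> i s * zeta \<tau> (\<gamma> i s - \<gamma> j t)))
    + sg i * Re (d\<gamma> i s) * Im (\<gamma> i s - \<gamma> j t) / (norm (d\<gamma> i s) * Im \<tau>)"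

lemma open_compl_lattice: "open (- \<Lambda>)" and open_compl_punctured: "open (- punctured_lattice \<tau>)"
  by (intro open_Compl closed_subset_lattice[OF tau]; simp)+

lemma continuous_on_zeta:
  "continuous_on A f \<Longrightarrow> (\<And>x. x \<in> A \<Longrightarrow> f x \<notin> \<Lambda>) \<Longrightarrow> continuous_on A (\<lambda>x. zeta \<tau> (f x))"
  by (rule continuous_on_compose2[OF holomorphic_on_imp_continuous_on[OF zeta_holomorphic[OF tau]]]) auto

lemma continuous_on_zeta_reg:
  "continuous_on A f \<Longrightarrow> (\<And>x. x \<in> A \<Longrightarrow> f x \<notin> punctured_lattice \<tau>) \<Longrightarrow> continuous_on A (\<lambda>x. zeta_reg \<tau> (f x))"
  by (rule continuous_on_compose2[OF holomorphic_on_imp_continuous_on[OF zeta_reg_holomorphic[OF tau]]]) blast+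

lemma same_curve_not_punctured: "i \<in> J \<Longrightarrow> \<gamma> i s - \<gamma> i t \<notin> punctured_lattice \<tau>"
  using curve_diff_lattice[of i i s t] by auto

lemma kern_continuous:
  assumes "i \<in> J" "j \<in> J"
  shows "continuous_on UNIV (\<lambda>x. kern i j (fst x) (snd x))"
proof -
  have n: "norm (d\<gamma> i s) \<noteq> 0" for s using d\<gamma>_nonzero[OF assms(1)] by simp
  show ?thesis
  proof (cases "i = j")
    case True
    have 1: "continuous_on UNIV (\<lambda>x. zeta_reg \<tau> (\<gamma> i (fst x) - \<gamma> i (snd x)))"
      by (intro continuous_on_zeta_reg continuous_intros assms(1) same_curve_not_punctured)
    show ?thesis
      unfolding kern_def if_P[OF True]
      by (intro continuous_intros 1 assms c2_curve.tangent_kernel_continuous[OF curve[OF assms(1)]]) (use n tau in auto)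
  next
    case False
    have 1: "continuous_on UNIV (\<lambda>x. zeta \<tau> (\<gamma> i (fst x) - \<gamma> j (snd x)))"
      using curve_diff_lattice[OF assms] False by (intro continuous_on_zeta continuous_intros assms) blast
    show ?thesis
      unfolding kern_def if_not_P[OF False]
      by (intro continuous_intros 1 assms) (use n tau in auto)
  qed
qed

lemma kern_periodic:
  assumes "i \<in> J" "j \<in> J"
  shows "kern i j (s + 1) t = kern i j s t" "kern i j s (t + 1) = kern i j s t"
  using c2_curve.tangent_kernel_periodic(1)[OF curve[OF assms(1)], of s t 1]
    c2_curve.tangent_kernel_periodic(2)[OF curve[OF assms(1)], of s 1 t]
  by (cases "i = j"; simp add: kern_def curve_periodic[OF assms(1)] curve_periodic[OF assms(2)])+

lemma dir_deriv_Green: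
  assumes "z - \<xi> \<notin> \<Lambda>"
  shows "dir_deriv v (\<lambda>z. Green \<tau> (z - \<xi>)) z = - Re (v * zeta \<tau> (z - \<xi>)) / (2 * pi) + Im (z - \<xi>) * Im v / Im \<tau>"
proof -
  have "((\<lambda>z. z - \<xi>) has_derivative (\<lambda>v. v)) (at z)" by (auto intro!: derivative_eq_intros)
  from has_derivative_compose[OF this Green_has_derivative[OF tau assms]]
  show ?thesis by (rule has_derivative_dir_deriv(2))
qed

text \<open>Ties the regularised kernel to the actual derivative off the diagonal: the normal is a
  real multiple of \<open>\<i> * d\<gamma> i s\<close>, and
  \<open>Re (\<i> * w) = - Im w\<close>.\<close>

lemma kern_eq:
  assumes "i \<in> J" "j \<in> J" "\<gamma> i s \<noteq> \<gamma> j t"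
  shows "kern i j s t = - Re (nrm i s * zeta \<tau> (\<gamma> i s - \<gamma> j t)) / (2 * pi) + Im (\<gamma> i s - \<gamma> j t) * Im (nrm i s) / Im \<tau>"
proof -
  have nl: "\<gamma> i s - \<gamma> j t \<notin> \<Lambda>" using curve_diff_lattice[OF assms(1,2)] assms(3) by blast
  have A: "(if i = j then c2_curve.tangent_kernel (\<gamma> i) (d\<gamma> i) (dd\<gamma> i) s t + Im (d\<gamma> i s * zeta_reg \<tau> (\<gamma> i s - \<gamma> i t))
       else Im (d\<gamma> i s * zeta \<tau> (\<gamma> i s - \<gamma> j t))) = Im (d\<gamma> i s * zeta \<tau> (\<gamma> i s - \<gamma> j t))"
  proof (cases "i = j")
    case True
    have "t - s \<notin> \<int>" using c2_curve.eq_iff[OF curve[OF assms(1)], of t s] assms(3) True by metis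
    hence "c2_curve.tangent_kernel (\<gamma> i) (d\<gamma> i) (dd\<gamma> i) s t = Im (d\<gamma> i s / (\<gamma> i s - \<gamma> i t))"
      by (simp add: c2_curve.tangent_kernel_def[OF curve[OF assms(1)]])
    moreover have "d\<gamma> i s * zeta \<tau> (\<gamma> i s - \<gamma> j t) = d\<gamma> i s / (\<gamma> i s - \<gamma> j t) + d\<gamma> i s * zeta_reg \<tau> (\<gamma> i s - \<gamma> j t)"
      by (simp add: zeta_eq[OF tau nl] distrib_left)
    ultimately show ?thesis using True by simp
  qed simp
  have B: "Re (nrm i s * Z) = - sg i / norm (d\<gamma> i s) * Im (d\<gamma> i s * Z)" for Z
  proof -
    have "nrm i s * Z = (sg i / norm (d\<gamma> i s)) *\<^sub>R (\<i> * (d\<gamma> i s * Z))" by (simp add: nrm_def scaleR_conv_of_real)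
    hence "Re (nrm i s * Z) = sg i / norm (d\<gamma> i s) * Re (\<i> * (d\<gamma> i s * Z))"
      by (simp only: scaleR_complex.sel)
    thus ?thesis by (simp only: Re_i_times)
  qed
  have C: "Im (nrm i s) = sg i * Re (d\<gamma> i s) / norm (d\<gamma> i s)"
    by (simp add: nrm_def)
  show ?thesis unfolding kern_def A B C by (simp del: times_complex.sel add: mult_ac)
qed

lemma dir_deriv_Green_kern:
  assumes "i \<in> J" "j \<in> J" "\<gamma> i s \<noteq> \<gamma> j t"
  shows "dir_deriv (nrm i s) (\<lambda>z. Green \<tau> (z - \<gamma> j t)) (\<gamma> i s) = kern i j s t"
proof -
  have nl: "\<gamma> i s - \<gamma> j t \<notin> \<Lambda>" using curve_diff_lattice[OF assms(1,2)] assms(3) by blast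
  show ?thesis unfolding dir_deriv_Green[OF nl] kern_eq[OF assms] ..
qed

subsection \<open>The principal value\<close>

text \<open>For a continuous integrand the principal value is the ordinary integral: by dominated
  convergence it does no harm to cut out sets shrinking to a null set. In the application
  \<open>g\<close> is the distance to the singular point.\<close>

lemma truncated_integral_tendsto:
  fixes F g :: "real \<Rightarrow> real"
  assumes F: "continuous_on {0..1} F" and g: "continuous_on UNIV g" and g0: "\<And>t. g t \<ge> 0"
    and neg: "negligible {t. g t = 0}"
  shows "((\<lambda>\<epsilon>. integral {0..1} (\<lambda>t. if \<epsilon> < g t then F t else 0)) \<longlongrightarrow> integral {0..1} F) (at_right 0)"
  unfolding tendsto_at_iff_sequentially
proof (intro allI impI)
  fix X :: "nat \<Rightarrow> real" assume X: "\<forall>i. X i \<in> {0<..} - {0}" "X \<longlonglongrightarrow> 0"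
  let ?F = "\<lambda>t. if 0 < g t then F t else 0"
  have "(\<lambda>n. integral {0..1} (\<lambda>t. if X n < g t then F t else 0)) \<longlonglongrightarrow> integral {0..1} ?F"
  proof (rule dominated_convergence[where h = "\<lambda>t. \<bar>F t\<bar>"])
    fix n
    have "open {t. X n < g t}" by (intro open_Collect_less continuous_intros g)
    hence "{t. X n < g t} \<inter> {0..1} \<in> sets lebesgue" by (intro sets.Int) auto
    hence "F absolutely_integrable_on {t. X n < g t} \<inter> {0..1}"
      by (intro set_integrable_subset[OF absolutely_integrable_continuous_real[OF F]]) auto
    hence "F integrable_on {t. X n < g t} \<inter> {0..1}" by (rule set_lebesgue_integral_eq_integral(1))
    thus "(\<lambda>t. if X n < g t then F t else 0) integrable_on {0..1}"
      by (subst (asm) integrable_restrict_Int[symmetric]) simp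
  next
    show "(\<lambda>t. \<bar>F t\<bar>) integrable_on {0..1}" by (intro integrable_continuous_real continuous_intros F)
    show "norm (if X n < g t then F t else 0) \<le> \<bar>F t\<bar>" for n t by simp
    fix t
    show "(\<lambda>n. if X n < g t then F t else 0) \<longlonglongrightarrow> ?F t"
    proof (cases "0 < g t")
      case True
      have "\<forall>\<^sub>F n in sequentially. X n < g t" using X(2) True by (rule order_tendstoD(2))
      hence "\<forall>\<^sub>F n in sequentially. (if X n < g t then F t else 0) = ?F t" by eventually_elim (simp add: True)
      thus ?thesis by (rule tendsto_eventually)
    next
      case False
      hence "g t = 0" using g0[of t] by linarith
      moreover have "\<not> X n < 0" for n using X(1) by (metis DiffD1 greaterThan_iff not_less_iff_gr_or_eq)
      ultimately show ?thesis by simp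
    qed
  qed
  moreover have "integral {0..1} ?F = integral {0..1} F"
    by (rule integral_spike[OF neg]) (use g0 less_eq_real_def in auto)
  ultimately show "((\<lambda>\<epsilon>. integral {0..1} (\<lambda>t. if \<epsilon> < g t then F t else 0)) \<circ> X) \<longlonglongrightarrow> integral {0..1} F"
    by (simp add: o_def)
qed

lemma negligible_curve_point:
  assumes "j \<in> J"
  shows "negligible {t. \<gamma> j t = z}"
proof (cases "\<exists>s. \<gamma> j s = z")
  case True
  then obtain s where s: "\<gamma> j s = z" by blast
  have "{t. \<gamma> j t = z} \<subseteq> range (\<lambda>n::int. s + of_int n)"
  proof
    fix t assume "t \<in> {t. \<gamma> j t = z}"
    thus "t \<in> range (\<lambda>n::int. s + of_int n)" using curve_unique[OF assms assms, of t s] s by auto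
  qed
  moreover have "countable (range (\<lambda>n::int. s + of_int n))" by simp
  ultimately have "countable {t. \<gamma> j t = z}" by (rule countable_subset)
  thus ?thesis by (simp add: negligible_iff_null_sets null_sets_completionI countable_imp_null_set_lborel)
qed simp

lemma boundary_continuous:
  assumes "continuous_on (boundary M D) \<phi>" "j \<in> J" "continuous_on A f"
  shows "continuous_on A (\<lambda>x. \<phi> (\<gamma> j (f x)))"
  by (rule continuous_on_compose2[OF assms(1)]) (use assms in \<open>auto intro!: continuous_intros simp: boundary_eq\<close>)

definition Kint :: "(complex \<Rightarrow> real) \<Rightarrow> nat \<Rightarrow> real \<Rightarrow> real" where
  "Kint \<phi> i s = (\<Sum>j\<in>J. integral {0..1} (\<lambda>t. kern i j s t * (\<phi> (\<gamma> j t) * norm (d\<gamma> j t))))"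

lemma Kstar_truncated_tendsto:
  assumes \<phi>: "continuous_on (boundary M D) \<phi>" and i: "i \<in> J"
  shows "(Kstar_truncated \<tau> M D \<gamma> \<phi> (\<gamma> i s) \<longlongrightarrow> Kint \<phi> i s) (at_right 0)"
proof -
  have "((\<lambda>\<epsilon>. integral {0..1} (\<lambda>t. if \<epsilon> < dist (\<gamma> j t) (\<gamma> i s) then kern i j s t * (\<phi> (\<gamma> j t) * norm (d\<gamma> j t)) else 0))
     \<longlongrightarrow> integral {0..1} (\<lambda>t. kern i j s t * (\<phi> (\<gamma> j t) * norm (d\<gamma> j t)))) (at_right 0)" if j: "j \<in> J" for j
  proof (rule truncated_integral_tendsto)
    have "continuous_on {0..1} (\<lambda>t. kern i j s t)"
      by (rule continuous_on_curry(1)[OF kern_continuous[OF i j]])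
    thus "continuous_on {0..1} (\<lambda>t. kern i j s t * (\<phi> (\<gamma> j t) * norm (d\<gamma> j t)))"
      by (intro continuous_intros boundary_continuous[OF \<phi> j] j)
    show "continuous_on UNIV (\<lambda>t. dist (\<gamma> j t) (\<gamma> i s))" by (intro continuous_intros j)
    show "negligible {t. dist (\<gamma> j t) (\<gamma> i s) = 0}" using negligible_curve_point[OF j, of "\<gamma> i s"] by simp
  qed simp
  hence "((\<lambda>\<epsilon>. \<Sum>j\<in>J. integral {0..1} (\<lambda>t. if \<epsilon> < dist (\<gamma> j t) (\<gamma> i s) then kern i j s t * (\<phi> (\<gamma> j t) * norm (d\<gamma> j t)) else 0))
     \<longlongrightarrow> Kint \<phi> i s) (at_right 0)"
    unfolding Kint_def by (intro tendsto_sum)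
  moreover have "\<forall>\<^sub>F \<epsilon> in at_right 0. (\<Sum>j\<in>J. integral {0..1} (\<lambda>t. if \<epsilon> < dist (\<gamma> j t) (\<gamma> i s) then kern i j s t * (\<phi> (\<gamma> j t) * norm (d\<gamma> j t)) else 0))
     = Kstar_truncated \<tau> M D \<gamma> \<phi> (\<gamma> i s) \<epsilon>"
    unfolding eventually_at_right_field
  proof (intro exI[of _ 1] conjI allI impI)
    fix \<epsilon> :: real assume "0 < \<epsilon>"
    \<comment> \<open>The truncation keeps only points at positive distance, where
      \<open>kern\<close> is the true normal derivative; the diagonal value never enters.\<close>
    have "(if \<epsilon> < dist (\<gamma> j t) (\<gamma> i s) then dir_deriv (nrm i s) (\<lambda>z. Green \<tau> (z - \<gamma> j t)) (\<gamma> i s) * \<phi> (\<gamma> j t) else 0) * norm (vector_derivative (\<gamma> j) (at t))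
      = (if \<epsilon> < dist (\<gamma> j t) (\<gamma> i s) then kern i j s t * (\<phi> (\<gamma> j t) * norm (d\<gamma> j t)) else 0)" if "j \<in> J" for j t
    proof (cases "\<epsilon> < dist (\<gamma> j t) (\<gamma> i s)")
      case True
      hence "\<gamma> i s \<noteq> \<gamma> j t" using \<open>0 < \<epsilon>\<close> by auto
      thus ?thesis using dir_deriv_Green_kern[OF i that] by (simp add: d\<gamma>_def)
    qed simp
    thus "(\<Sum>j\<in>J. integral {0..1} (\<lambda>t. if \<epsilon> < dist (\<gamma> j t) (\<gamma> i s) then kern i j s t * (\<phi> (\<gamma> j t) * norm (d\<gamma> j t)) else 0))
     = Kstar_truncated \<tau> M D \<gamma> \<phi> (\<gamma> i s) \<epsilon>"
      unfolding Kstar_truncated_def boundary_integral_def arc_integral_def unit_normal_eq[OF i]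
      by (intro sum.cong refl) simp
  qed simp
  ultimately show ?thesis by (rule Lim_transform_eventually)
qed

lemma Kstar_converges: "continuous_on (boundary M D) \<phi> \<Longrightarrow> i \<in> J \<Longrightarrow> Kstar_converges \<tau> M D \<gamma> \<phi> (\<gamma> i s)"
  unfolding Kstar_converges_def using Kstar_truncated_tendsto by blast

lemma Kstar_eq: "continuous_on (boundary M D) \<phi> \<Longrightarrow> i \<in> J \<Longrightarrow> Kstar \<tau> M D \<gamma> \<phi> (\<gamma> i s) = Kint \<phi> i s"
  unfolding Kstar_def by (intro tendsto_Lim Kstar_truncated_tendsto) simp_all

subsection \<open>Conservation of flux\<close>

text \<open>The poles of the shifted \<open>zeta\<close> all lie in the unbounded component of the
  complement of the curve, so Cauchy's theorem in its global form applies.\<close>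

lemma zeta_integral_outside:
  assumes i: "i \<in> J" and w: "\<And>y. y \<in> closure (D i) \<Longrightarrow> y - w \<notin> \<Lambda>"
  shows "((\<lambda>s. zeta \<tau> (\<gamma> i s - w) * d\<gamma> i s) has_integral 0) {0..1}"
proof -
  interpret h: c2_hole "\<gamma> i" "d\<gamma> i" "dd\<gamma> i" "D i" by (rule hole[OF i])
  let ?S = "(\<lambda>z. z - w) -` (- \<Lambda>)"
  have "((\<lambda>z. zeta \<tau> (z - w)) has_contour_integral 0) (\<gamma> i)"
  proof (rule Cauchy_theorem_global_outside[where S = ?S])
    show "open ?S" by (intro open_vimage open_compl_lattice continuous_intros)
    have "(zeta \<tau> \<circ> (\<lambda>z. z - w)) holomorphic_on ?S"
      by (rule holomorphic_on_compose_gen[OF _ zeta_holomorphic[OF tau]]) (auto intro!: holomorphic_intros)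
    thus "(\<lambda>z. zeta \<tau> (z - w)) holomorphic_on ?S" by (simp add: o_def)
    show "valid_path (\<gamma> i)" by (rule h.valid_path)
    show "pathfinish (\<gamma> i) = pathstart (\<gamma> i)" by (rule h.path_loop)
    show "path_image (\<gamma> i) \<subseteq> ?S" using w range_closure[OF i] by (auto simp: h.path_image_eq)
    show "z \<in> outside (path_image (\<gamma> i))" if "z \<notin> ?S" for z
      using that w h.compl_closure_D by (metis ComplI vimageI)
  qed
  thus ?thesis by (simp add: has_contour_integral h.vector_derivative_eq)
qed

lemma Im_integral:
  fixes f :: "real \<Rightarrow> complex"
  assumes "continuous_on {a..b} f"
  shows "integral {a..b} (\<lambda>s. Im (f s)) = Im (integral {a..b} f)" "integral {a..b} (\<lambda>s. Re (f s)) = Re (integral {a..b} f)"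
  using integral_linear[OF integrable_continuous_real[OF assms] bounded_linear_Im]
    integral_linear[OF integrable_continuous_real[OF assms] bounded_linear_Re] by (simp_all add: o_def)

lemma zeta_flux_other:
  assumes "i \<in> J" "j \<in> J" "i \<noteq> j"
  shows "integral {0..1} (\<lambda>s. Im (d\<gamma> i s * zeta \<tau> (\<gamma> i s - \<gamma> j t))) = 0"
proof -
  have nl: "y - \<gamma> j t \<notin> \<Lambda>" if "y \<in> closure (D i)" for y
    using closure_diff_lattice[OF assms(1,2) that range_closure[OF assms(2)]] assms(3) by blast
  have c: "continuous_on {0..1} (\<lambda>s. d\<gamma> i s * zeta \<tau> (\<gamma> i s - \<gamma> j t))"
    using nl[OF range_closure[OF assms(1)]] by (intro continuous_intros continuous_on_zeta assms)
  have "integral {0..1} (\<lambda>s. d\<gamma> i s * zeta \<tau> (\<gamma> i s - \<gamma> j t)) = 0"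
    using zeta_integral_outside[OF assms(1) nl] by (simp add: mult.commute integral_unique)
  thus ?thesis unfolding Im_integral(1)[OF c] by simp
qed

text \<open>
  For a base point on the curve itself, Cauchy's theorem applies to nearby points of the
  domain, and the jump relation transfers it to the boundary.
\<close>

lemma zeta_flux_same:
  assumes i: "i \<in> J"
  shows "integral {0..1} (\<lambda>s. c2_curve.tangent_kernel (\<gamma> i) (d\<gamma> i) (dd\<gamma> i) s t + Im (d\<gamma> i s * zeta_reg \<tau> (\<gamma> i s - \<gamma> i t))) = sg i * pi"
proof -
  interpret h: c2_hole "\<gamma> i" "d\<gamma> i" "dd\<gamma> i" "D i" by (rule hole[OF i])
  obtain d where d: "d > 0" "\<And>i j x y l. \<lbrakk>i \<in> J; j \<in> J; x \<in> closure (D i); y \<in> closure (D j); l \<in> \<Lambda>; i \<noteq> j \<or> l \<noteq> 0\<rbrakk> \<Longrightarrow> d \<le> norm (x - y - l)"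
    using separation by blast
  \<comment> \<open>The contribution of the regular part of \<open>zeta\<close>. It is continuous
    across the curve, so only the pole produces a jump.\<close>
  define H where "H z = integral {0..1} (\<lambda>s. Re (\<i> * d\<gamma> i s * zeta_reg \<tau> (\<gamma> i s - z)))" for z
  have np: "\<gamma> i s - z \<notin> punctured_lattice \<tau>" if z: "z \<in> ball (\<gamma> i t) d" for s z
  proof
    assume *: "\<gamma> i s - z \<in> punctured_lattice \<tau>"
    hence "d \<le> norm (\<gamma> i s - \<gamma> i t - (\<gamma> i s - z))" by (intro d(2)[OF i i range_closure[OF i] range_closure[OF i]]) auto
    thus False using z by (simp add: dist_norm norm_minus_commute)
  qed
  have ch: "continuous_on (ball (\<gamma> i t) d \<times> {0..1}) (\<lambda>(z, s). Re (\<i> * d\<gamma> i s * zeta_reg \<tau> (\<gamma> i s - z)))"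
    unfolding case_prod_unfold using np by (intro continuous_intros continuous_on_zeta_reg i) auto
  have "continuous_on (ball (\<gamma> i t) d) H"
    unfolding H_def using continuous_on_integral_snd[OF ch] .
  hence "isCont H (\<gamma> i t)" using d(1) by (simp add: continuous_on_eq_continuous_at)
  hence Hlim: "(H \<longlongrightarrow> H (\<gamma> i t)) (at (\<gamma> i t) within A)" for A
    unfolding isCont_def by (rule tendsto_within_subset) simp
  have o': "- sg i = 1 \<or> - sg i = -1" using sg_cases by auto
  obtain \<kappa> where \<kappa>: "\<kappa> > 0" "at (\<gamma> i t) within h.side_cone (- sg i) \<kappa> t \<noteq> bot"
    using h.cone_nontrivial[OF o'] by blast
  let ?F = "at (\<gamma> i t) within h.side_cone (- sg i) \<kappa> t"
  define V where "V = integral {-1/2..1/2} (\<lambda>r. Re (\<i> * d\<gamma> i (t + r) / (\<gamma> i (t + r) - \<gamma> i t)))"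
  have "((\<lambda>z. h.angle_integral z + H z) \<longlongrightarrow> (V - (- sg i) * pi) + H (\<gamma> i t)) ?F"
    unfolding V_def by (intro tendsto_add Hlim h.cauchy_jump_derivative \<kappa>(1) o')
  \<comment> \<open>In the domain the pole and the regular part add up to the real part of \<i>
    times the contour integral of \<open>zeta\<close>, which is 0 by Cauchy's theorem.\<close>
  moreover have "\<forall>\<^sub>F z in ?F. h.angle_integral z + H z = 0"
  proof -
    have "\<forall>\<^sub>F z in ?F. z \<in> \<Omega>" using eventually_Omega[OF i \<kappa>(1)] .
    moreover have "\<forall>\<^sub>F z in ?F. z \<in> ball (\<gamma> i t) d"
      unfolding eventually_at using d(1) by (auto simp: dist_commute)
    ultimately show ?thesis
    proof eventually_elim
      case (elim z)
      have nl: "y - z \<notin> \<Lambda>" if "y \<in> closure (D i)" for y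
        using elim(1) that i lattice_minus_iff[of "z - y" \<tau>] unfolding in_Omega_iff by auto
      hence nls: "\<gamma> i s - z \<notin> \<Lambda>" for s using range_closure[OF i] by blast
      hence nz: "\<gamma> i s - z \<noteq> 0" for s using lattice_0[of \<tau>] by metis
      have c1: "continuous_on {0..1} (\<lambda>s. Re (\<i> * d\<gamma> i s / (\<gamma> i s - z)))"
        by (intro continuous_intros i ballI nz)
      have c2: "continuous_on {0..1} (\<lambda>s. Re (\<i> * d\<gamma> i s * zeta_reg \<tau> (\<gamma> i s - z)))"
        by (intro continuous_intros continuous_on_zeta_reg i np[OF elim(2)])
      have "h.angle_integral z + H z = integral {0..1} (\<lambda>s. Re (\<i> * d\<gamma> i s / (\<gamma> i s - z)) + Re (\<i> * d\<gamma> i s * zeta_reg \<tau> (\<gamma> i s - z)))"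
        unfolding h.angle_integral_def H_def
        by (intro integral_add[symmetric] integrable_continuous_real c1 c2)
      also have "\<dots> = integral {0..1} (\<lambda>s. Re (\<i> * (zeta \<tau> (\<gamma> i s - z) * d\<gamma> i s)))"
        by (intro arg_cong[where f = "integral {0..1}"] ext) (simp add: zeta_eq[OF tau nls] algebra_simps)
      also have "\<dots> = Re (integral {0..1} (\<lambda>s. \<i> * (zeta \<tau> (\<gamma> i s - z) * d\<gamma> i s)))"
        by (intro Im_integral(2) continuous_intros continuous_on_zeta i nls)
      also have "\<dots> = 0" using zeta_integral_outside[OF i nl] by (simp add: integral_unique)
      finally show ?case .
    qed
  qed
  hence "((\<lambda>z. h.angle_integral z + H z) \<longlongrightarrow> 0) ?F" by (rule tendsto_eventually)
  ultimately have "(V - (- sg i) * pi) + H (\<gamma> i t) = 0" using tendsto_unique[OF \<kappa>(2)] by blast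
  hence VH: "V + H (\<gamma> i t) = - sg i * pi" by simp
  have ctk: "continuous_on A (\<lambda>s. h.tangent_kernel s t)" for A
    by (rule continuous_on_curry(2)[OF h.tangent_kernel_continuous])
  have "integral {0..1} (\<lambda>s. h.tangent_kernel s t) = integral {-1/2..1/2} (\<lambda>r. h.tangent_kernel (t + r) t)"
    by (rule periodic_integral_centred(1)[symmetric])
       (use h.tangent_kernel_periodic(2)[of _ 1] in \<open>auto intro!: integrable_continuous_real ctk\<close>)
  \<comment> \<open>The first argument of the kernel is here the variable of integration; by
    \<open>Re (\<i> * w) = - Im w\<close> the kernel is minus the integrand of \<open>V\<close>
    except at \<open>r = 0\<close>.\<close>
  also have "\<dots> = integral {-1/2..1/2} (\<lambda>r. - Re (\<i> * d\<gamma> i (t + r) / (\<gamma> i (t + r) - \<gamma> i t)))"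
  proof (rule integral_spike[of "{0}"])
    fix r :: real assume r: "r \<in> {-1/2..1/2} - {0}"
    have "t - (t + r) \<notin> \<int>" using r by (intro h.not_Ints_near) auto
    thus "- Re (\<i> * d\<gamma> i (t + r) / (\<gamma> i (t + r) - \<gamma> i t)) = h.tangent_kernel (t + r) t"
      by (simp only: h.tangent_kernel_def if_False times_divide_eq_right[symmetric] Re_i_times minus_minus)
  qed simp
  also have "\<dots> = - V" by (simp add: V_def)
  finally have T: "integral {0..1} (\<lambda>s. h.tangent_kernel s t) = - V" .
  have c2: "continuous_on {0..1} (\<lambda>s. Im (d\<gamma> i s * zeta_reg \<tau> (\<gamma> i s - \<gamma> i t)))"
    by (intro continuous_intros continuous_on_zeta_reg i same_curve_not_punctured)
  have "H (\<gamma> i t) = integral {0..1} (\<lambda>s. - Im (d\<gamma> i s * zeta_reg \<tau> (\<gamma> i s - \<gamma> i t)))"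
    unfolding H_def by (simp only: mult.assoc Re_i_times)
  also have "\<dots> = - integral {0..1} (\<lambda>s. Im (d\<gamma> i s * zeta_reg \<tau> (\<gamma> i s - \<gamma> i t)))" by (rule integral_neg)
  finally have Hi: "integral {0..1} (\<lambda>s. Im (d\<gamma> i s * zeta_reg \<tau> (\<gamma> i s - \<gamma> i t))) = - H (\<gamma> i t)" by (simp only: minus_minus)
  have "integral {0..1} (\<lambda>s. h.tangent_kernel s t + Im (d\<gamma> i s * zeta_reg \<tau> (\<gamma> i s - \<gamma> i t))) = - V - H (\<gamma> i t)"
    by (subst integral_add) (auto intro!: integrable_continuous_real ctk c2 simp only: T Hi)
  thus ?thesis using VH by simp
qed

text \<open>By Green's theorem this is minus the area of the \<open>i\<close>-th hole divided by
  \<open>Im \<tau>\<close>, for either orientation: the flux due to the constant background in the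
  Laplacian of Green's function.\<close>

definition flux_const :: "nat \<Rightarrow> real" where
  "flux_const i = sg i / Im \<tau> * integral {0..1} (\<lambda>s. Re (d\<gamma> i s) * Im (\<gamma> i s))"

text \<open>The 1/2 is the share of a point source lying on the curve itself. The quadratic term of
  Green's function adds \<open>flux_const i\<close> for every source point: the source only
  multiplies the integral of \<open>Re (d\<gamma> i s)\<close>, which is 0 for a closed
  curve.\<close>

lemma kern_flux:
  assumes "i \<in> J" "j \<in> J"
  shows "integral {0..1} (\<lambda>s. kern i j s t * norm (d\<gamma> i s)) = (if i = j then 1/2 else 0) + flux_const i"
proof -
  interpret h: c2_hole "\<gamma> i" "d\<gamma> i" "dd\<gamma> i" "D i" by (rule hole[OF assms(1)])
  let ?A = "\<lambda>s. if i = j then h.tangent_kernel s t + Im (d\<gamma> i s * zeta_reg \<tau> (\<gamma> i s - \<gamma> i t))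
       else Im (d\<gamma> i s * zeta \<tau> (\<gamma> i s - \<gamma> j t))"
  have n: "norm (d\<gamma> i s) \<noteq> 0" for s using d\<gamma>_nonzero[OF assms(1)] by simp
  have e: "kern i j s t * norm (d\<gamma> i s) = sg i / (2 * pi) * ?A s +
      (sg i / Im \<tau> * (Re (d\<gamma> i s) * Im (\<gamma> i s)) - sg i / Im \<tau> * Im (\<gamma> j t) * Re (d\<gamma> i s))" for s
  proof -
    have "kern i j s t * norm (d\<gamma> i s) = sg i / (2 * pi) * ?A s + sg i * Re (d\<gamma> i s) * Im (\<gamma> i s - \<gamma> j t) / Im \<tau>"
      unfolding kern_def using n[of s] by (simp add: distrib_right)
    also have "sg i * Re (d\<gamma> i s) * Im (\<gamma> i s - \<gamma> j t) / Im \<tau> = sg i / Im \<tau> * (Re (d\<gamma> i s) * Im (\<gamma> i s)) - sg i / Im \<tau> * Im (\<gamma> j t) * Re (d\<gamma> i s)"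
      by (simp add: algebra_simps diff_divide_distrib)
    finally show ?thesis .
  qed
  have ck: "continuous_on {0..1} (\<lambda>s. kern i j s t)"
    by (rule continuous_on_curry(2)[OF kern_continuous[OF assms]])
  have cB: "continuous_on {0..1} (\<lambda>s. sg i / Im \<tau> * (Re (d\<gamma> i s) * Im (\<gamma> i s)) - sg i / Im \<tau> * Im (\<gamma> j t) * Re (d\<gamma> i s))"
    by (intro continuous_intros assms)
  \<comment> \<open>Continuity of the case distinction \<open>?A\<close> is read off from that of
    \<open>kern\<close> by subtracting the elementary part.\<close>
  have "continuous_on {0..1} (\<lambda>s. kern i j s t * norm (d\<gamma> i s) - (sg i / Im \<tau> * (Re (d\<gamma> i s) * Im (\<gamma> i s)) - sg i / Im \<tau> * Im (\<gamma> j t) * Re (d\<gamma> i s)))"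
    by (intro continuous_on_diff cB continuous_intros ck assms)
  hence cA: "continuous_on {0..1} (\<lambda>s. sg i / (2 * pi) * ?A s)"
    by (simp only: e add_diff_cancel_right')
  have IA: "integral {0..1} ?A = (if i = j then sg i * pi else 0)"
  proof (cases "i = j")
    case True
    thus ?thesis using zeta_flux_same[OF assms(1), of t] by (simp only: if_True refl)
  next
    case False
    thus ?thesis using zeta_flux_other[OF assms False, of t] by (simp only: if_False)
  qed
  have "(d\<gamma> i has_integral (\<gamma> i 1 - \<gamma> i 0)) {0..1}"
    by (rule fundamental_theorem_of_calculus) (auto intro: has_vector_derivative_at_within h.deriv)
  hence "integral {0..1} (d\<gamma> i) = 0" using h.per[of 0] by (simp add: integral_unique)
  hence R: "integral {0..1} (\<lambda>s. Re (d\<gamma> i s)) = 0"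
    using Im_integral(2)[of 0 1 "d\<gamma> i"] by (simp add: h.cont1)
  have "integral {0..1} (\<lambda>s. kern i j s t * norm (d\<gamma> i s)) = integral {0..1} (\<lambda>s. sg i / (2 * pi) * ?A s) +
     integral {0..1} (\<lambda>s. sg i / Im \<tau> * (Re (d\<gamma> i s) * Im (\<gamma> i s)) - sg i / Im \<tau> * Im (\<gamma> j t) * Re (d\<gamma> i s))"
    unfolding e by (intro integral_add integrable_continuous_real cA cB)
  also have "integral {0..1} (\<lambda>s. sg i / Im \<tau> * (Re (d\<gamma> i s) * Im (\<gamma> i s)) - sg i / Im \<tau> * Im (\<gamma> j t) * Re (d\<gamma> i s))
    = integral {0..1} (\<lambda>s. sg i / Im \<tau> * (Re (d\<gamma> i s) * Im (\<gamma> i s))) - integral {0..1} (\<lambda>s. sg i / Im \<tau> * Im (\<gamma> j t) * Re (d\<gamma> i s))"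
    by (intro integral_diff integrable_continuous_real continuous_intros assms)
  also have "\<dots> = flux_const i" by (simp only: integral_mult_right R flux_const_def mult_zero_right diff_zero)
  also have "integral {0..1} (\<lambda>s. sg i / (2 * pi) * ?A s) = (if i = j then 1/2 else 0)"
    unfolding integral_mult_right IA using sg_cases[of i] by auto
  finally show ?thesis .
qed

lemma kern_integrable:
  assumes "i \<in> J" "j \<in> J" "continuous_on UNIV f"
  shows "continuous_on UNIV (\<lambda>s. integral {0..1} (\<lambda>t. kern i j s t * f t))"
proof -
  have "continuous_on (UNIV \<times> {0..1}) (\<lambda>(s, t). kern i j s t * f t)"
    unfolding case_prod_unfold
    by (intro continuous_intros continuous_on_subset[OF kern_continuous[OF assms(1,2)]] continuous_on_compose2[OF assms(3)]) auto
  from continuous_on_integral_snd[OF this] show ?thesis .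
qed

text \<open>Fubini and \<open>kern_flux\<close>. The densities are arbitrary here; the term with
  \<open>flux_const\<close> is proportional to the total mass and therefore drops out for mean-zero
  densities.\<close>

lemma flux_identity:
  assumes i: "i \<in> J" and f: "\<And>j. j \<in> J \<Longrightarrow> continuous_on UNIV (f j)"
  shows "integral {0..1} (\<lambda>s. (\<Sum>j\<in>J. integral {0..1} (\<lambda>t. kern i j s t * f j t)) * norm (d\<gamma> i s))
     = 1/2 * integral {0..1} (f i) + flux_const i * (\<Sum>j\<in>J. integral {0..1} (f j))"
proof -
  have one: "integral {0..1} (\<lambda>s. integral {0..1} (\<lambda>t. kern i j s t * f j t) * norm (d\<gamma> i s)) =
     ((if i = j then 1/2 else 0) + flux_const i) * integral {0..1} (f j)" if j: "j \<in> J" for j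
  proof -
    have "integral {0..1} (\<lambda>s. integral {0..1} (\<lambda>t. kern i j s t * f j t) * norm (d\<gamma> i s))
      = integral (cbox 0 1) (\<lambda>s. integral (cbox 0 1) (\<lambda>t. kern i j s t * f j t * norm (d\<gamma> i s)))"
      by (simp only: integral_mult_left box_real)
    also have "\<dots> = integral (cbox 0 1) (\<lambda>t. integral (cbox 0 1) (\<lambda>s. kern i j s t * f j t * norm (d\<gamma> i s)))"
    proof (rule integral_swap_continuous)
      show "continuous_on (cbox (0, 0) (1, 1)) (\<lambda>(s, t). kern i j s t * f j t * norm (d\<gamma> i s))"
        unfolding case_prod_unfold
        by (intro continuous_intros i continuous_on_subset[OF kern_continuous[OF i j]] continuous_on_compose2[OF f[OF j]]) auto
    qed
    also have "\<dots> = integral {0..1} (\<lambda>t. f j t * integral {0..1} (\<lambda>s. kern i j s t * norm (d\<gamma> i s)))"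
    proof -
      have "integral (cbox 0 1) (\<lambda>s. kern i j s t * f j t * norm (d\<gamma> i s)) = f j t * integral {0..1} (\<lambda>s. kern i j s t * norm (d\<gamma> i s))" for t
        unfolding integral_mult_right[symmetric] by (simp add: mult_ac)
      thus ?thesis by simp
    qed
    also have "\<dots> = ((if i = j then 1/2 else 0) + flux_const i) * integral {0..1} (f j)"
      unfolding kern_flux[OF i j] integral_mult_left by (rule mult.commute)
    finally show ?thesis .
  qed
  have "integral {0..1} (\<lambda>s. (\<Sum>j\<in>J. integral {0..1} (\<lambda>t. kern i j s t * f j t)) * norm (d\<gamma> i s))
    = (\<Sum>j\<in>J. integral {0..1} (\<lambda>s. integral {0..1} (\<lambda>t. kern i j s t * f j t) * norm (d\<gamma> i s)))"
    unfolding sum_distrib_right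
    by (intro integral_sum integrable_continuous_real continuous_intros i continuous_on_subset[OF kern_integrable[OF i _ f]]) auto
  also have "\<dots> = (\<Sum>j\<in>J. ((if i = j then 1/2 else 0) + flux_const i) * integral {0..1} (f j))"
    by (intro sum.cong refl one)
  also have "\<dots> = (\<Sum>j\<in>J. (if i = j then 1/2 * integral {0..1} (f j) else 0)) + flux_const i * (\<Sum>j\<in>J. integral {0..1} (f j))"
    by (simp add: distrib_right sum.distrib sum_distrib_left if_distrib[of "\<lambda>x. x * _"] cong: if_cong)
  also have "(\<Sum>j\<in>J. (if i = j then 1/2 * integral {0..1} (f j) else 0)) = 1/2 * integral {0..1} (f i)"
    using i by (subst sum.delta') auto
  finally show ?thesis .
qed

end

subsection \<open>The single layer potential off the boundary\<close>

locale layer = torus_domain +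
  fixes \<phi> :: "complex \<Rightarrow> real"
  assumes \<phi>: "continuous_on (boundary M D) \<phi>"
    and mean_zero: "boundary_integral M \<gamma> \<phi> = 0"
begin

definition den :: "nat \<Rightarrow> real \<Rightarrow> real" where
  "den j t = \<phi> (\<gamma> j t) * norm (d\<gamma> j t)"

lemma den_continuous: "j \<in> J \<Longrightarrow> continuous_on A f \<Longrightarrow> continuous_on A (\<lambda>x. den j (f x))"
  unfolding den_def by (intro continuous_intros boundary_continuous[OF \<phi>])

lemma den_cont: "j \<in> J \<Longrightarrow> continuous_on A (den j)"
  using den_continuous[of j A "\<lambda>x. x"] by (simp add: continuous_on_id)

lemma den_periodic: "j \<in> J \<Longrightarrow> den j (t + 1) = den j t"
  by (simp add: den_def curve_periodic)

lemma sum_den: "(\<Sum>j\<in>J. integral {0..1} (den j)) = 0"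
proof -
  have "arc_integral (\<gamma> j) \<phi> = integral {0..1} (den j)" for j
    unfolding arc_integral_def den_def[abs_def] d\<gamma>_def ..
  thus ?thesis using mean_zero by (simp only: boundary_integral_def)
qed

abbreviation U :: "complex \<Rightarrow> real" where "U \<equiv> single_layer \<tau> M \<gamma> \<phi>"

lemma U_eq: "U z = (\<Sum>j\<in>J. integral {0..1} (\<lambda>t. Green \<tau> (z - \<gamma> j t) * den j t))"
  by (simp add: single_layer_def boundary_integral_def arc_integral_def den_def d\<gamma>_def mult.assoc)

text \<open>Contains both sides of all curves and their translates, so that harmonicity of the
  potential is treated once for the domain and for the holes.\<close>

definition W :: "complex set" where
  "W = {z. \<forall>j\<in>J. \<forall>t. z - \<gamma> j t \<notin> \<Lambda>}"

lemma WD: "z \<in> W \<Longrightarrow> j \<in> J \<Longrightarrow> z - \<gamma> j t \<notin> \<Lambda>"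
  by (simp add: W_def)

lemma Omega_W: "\<Omega> \<subseteq> W" and hole_W: "i \<in> J \<Longrightarrow> D i \<subseteq> W"
  unfolding W_def using Omega_curve hole_curve by blast+

lemma open_W: "open W"
proof -
  have "compact (range (\<gamma> j))" if "j \<in> J" for j
    unfolding c2_curve.image_eq[OF curve[OF that]] by (intro compact_continuous_image curve_continuous[OF that] continuous_intros) auto
  hence cl: "closed (\<Union>x\<in>range (\<gamma> j). \<Union>y\<in>\<Lambda>. {x + y})" if "j \<in> J" for j
    using that by (intro compact_closed_sums closed_subset_lattice[OF tau order_refl])
  have "W = - (\<Union>j\<in>J. \<Union>x\<in>range (\<gamma> j). \<Union>y\<in>\<Lambda>. {x + y})"
  proof (intro set_eqI)
    fix z
    have a: "(\<exists>y\<in>\<Lambda>. z = \<gamma> j t + y) \<longleftrightarrow> z - \<gamma> j t \<in> \<Lambda>" for j t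
      by (metis add_diff_cancel_left' diff_add_cancel add.commute)
    have e: "(\<exists>x\<in>range (\<gamma> j). \<exists>y\<in>\<Lambda>. z = x + y) \<longleftrightarrow> (\<exists>t. z - \<gamma> j t \<in> \<Lambda>)" for j
      by (simp add: a)
    show "z \<in> W \<longleftrightarrow> z \<in> - (\<Union>j\<in>J. \<Union>x\<in>range (\<gamma> j). \<Union>y\<in>\<Lambda>. {x + y})"
      by (simp only: W_def mem_Collect_eq Compl_iff UN_iff singleton_iff e) blast
  qed
  also have "open \<dots>" by (intro open_Compl closed_UN ballI cl) simp_all
  finally show ?thesis .
qed

definition F :: "nat \<Rightarrow> complex \<Rightarrow> complex" where
  "F j z = integral {0..1} (\<lambda>t. zeta \<tau> (z - \<gamma> j t) * of_real (den j t))"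

text \<open>For a mean-zero density the integral of \<open>Im (z - \<xi>) * \<phi> \<xi>\<close>
  does not depend on \<open>z\<close> and equals \<open>- moment\<close>.\<close>

definition moment :: real where
  "moment = (\<Sum>j\<in>J. integral {0..1} (\<lambda>t. Im (\<gamma> j t) * den j t))"

text \<open>The gradient of the single layer potential is the conjugate of the holomorphic function \<open>G\<close>.\<close>

definition G :: "complex \<Rightarrow> complex" where
  "G z = - (\<Sum>j\<in>J. F j z) / (2 * of_real pi) + \<i> * of_real (moment / Im \<tau>)"

lemma F_holomorphic:
  assumes j: "j \<in> J" and B: "ball z r \<subseteq> W"
  shows "F j holomorphic_on ball z r"
proof -
  have nl: "x - \<gamma> j t \<notin> \<Lambda>" if "x \<in> ball z r" for x t using B that WD j by blast
  have zd: "deriv (zeta \<tau>) holomorphic_on - \<Lambda>"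
    by (rule holomorphic_deriv[OF zeta_holomorphic[OF tau] open_compl_lattice])
  have "(\<lambda>x. integral (cbox 0 1) (\<lambda>t. zeta \<tau> (x - \<gamma> j t) * of_real (den j t))) holomorphic_on ball z r"
  proof (rule leibniz_rule_holomorphic)
    fix x t assume x: "x \<in> ball z r"
    have "(zeta \<tau> has_field_derivative deriv (zeta \<tau>) (x - \<gamma> j t)) (at (x - \<gamma> j t))"
      using nl[OF x] by (intro holomorphic_derivI[OF zeta_holomorphic[OF tau] open_compl_lattice]) auto
    hence "((\<lambda>x. zeta \<tau> (x - \<gamma> j t)) has_field_derivative deriv (zeta \<tau>) (x - \<gamma> j t)) (at x)"
      using DERIV_shift[of "zeta \<tau>" _ x "- \<gamma> j t"] by simp
    from has_field_derivative_at_within[OF DERIV_cmult_right[OF this]]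
    show "((\<lambda>x. zeta \<tau> (x - \<gamma> j t) * of_real (den j t)) has_field_derivative deriv (zeta \<tau>) (x - \<gamma> j t) * of_real (den j t)) (at x within ball z r)" .
  next
    fix x assume x: "x \<in> ball z r"
    show "(\<lambda>t. zeta \<tau> (x - \<gamma> j t) * of_real (den j t)) integrable_on cbox 0 1"
      unfolding box_real
      by (intro integrable_continuous_real continuous_intros continuous_on_zeta j nl[OF x] den_continuous)
  next
    have "continuous_on (ball z r \<times> cbox 0 1) (\<lambda>x. deriv (zeta \<tau>) (fst x - \<gamma> j (snd x)))"
      by (rule continuous_on_compose2[OF holomorphic_on_imp_continuous_on[OF zd]])
         (use nl in \<open>auto intro!: continuous_intros j\<close>)
    thus "continuous_on (ball z r \<times> cbox 0 1) (\<lambda>(x, t). deriv (zeta \<tau>) (x - \<gamma> j t) * of_real (den j t))"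
      unfolding case_prod_unfold by (intro continuous_intros den_continuous j)
  qed simp
  thus ?thesis by (simp add: F_def[abs_def])
qed

lemma G_holomorphic: "ball z r \<subseteq> W \<Longrightarrow> G holomorphic_on ball z r"
  unfolding G_def by (intro holomorphic_intros F_holomorphic) auto

lemma Green_integrable:
  assumes "z \<in> W" "j \<in> J"
  shows "continuous_on A (\<lambda>t. Green \<tau> (z - \<gamma> j t))"
proof (rule continuous_on_compose2[of "- \<Lambda>" "Green \<tau>"])
  show "continuous_on (- \<Lambda>) (Green \<tau>)"
    using Green_has_derivative[OF tau] has_derivative_continuous
    by (intro continuous_at_imp_continuous_on) blast
qed (use assms WD in \<open>auto intro!: continuous_intros\<close>)

text \<open>The term proportional to \<open>Im z\<close> carries the total mass as a factor and
  vanishes. What the quadratic correction leaves is a constant, so the directional derivatives are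
  real parts of a holomorphic function; this is where mean zero enters harmonicity.\<close>

lemma gradient_integral:
  assumes z: "z \<in> W"
  shows "(\<Sum>j\<in>J. integral {0..1} (\<lambda>t. (- Re (v * zeta \<tau> (z - \<gamma> j t)) / (2 * pi) + Im (z - \<gamma> j t) * Im v / Im \<tau>) * den j t)) = Re (v * G z)"
proof -
  have one: "integral {0..1} (\<lambda>t. (- Re (v * zeta \<tau> (z - \<gamma> j t)) / (2 * pi) + Im (z - \<gamma> j t) * Im v / Im \<tau>) * den j t)
    = - Re (v * F j z) / (2 * pi) + Im v / Im \<tau> * (Im z * integral {0..1} (den j)) - Im v / Im \<tau> * integral {0..1} (\<lambda>t. Im (\<gamma> j t) * den j t)"
    if j: "j \<in> J" for j
  proof -
    have c1: "continuous_on {0..1} (\<lambda>t. v * (zeta \<tau> (z - \<gamma> j t) * of_real (den j t)))"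
      by (intro continuous_intros continuous_on_zeta j WD[OF z j] den_continuous)
    have "integral {0..1} (\<lambda>t. Re (v * (zeta \<tau> (z - \<gamma> j t) * of_real (den j t)))) = Re (integral {0..1} (\<lambda>t. v * (zeta \<tau> (z - \<gamma> j t) * of_real (den j t))))"
      by (rule Im_integral(2)[OF c1])
    also have "\<dots> = Re (v * F j z)" by (simp only: integral_mult_right F_def)
    finally have e1: "integral {0..1} (\<lambda>t. Re (v * (zeta \<tau> (z - \<gamma> j t) * of_real (den j t)))) = Re (v * F j z)" .
    have "integral {0..1} (\<lambda>t. (- Re (v * zeta \<tau> (z - \<gamma> j t)) / (2 * pi) + Im (z - \<gamma> j t) * Im v / Im \<tau>) * den j t)
      = integral {0..1} (\<lambda>t. (- 1 / (2 * pi)) * Re (v * (zeta \<tau> (z - \<gamma> j t) * of_real (den j t))) +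
          ((Im v / Im \<tau> * Im z) * den j t - Im v / Im \<tau> * (Im (\<gamma> j t) * den j t)))"
      by (intro arg_cong[where f = "integral {0..1}"] ext) (simp add: algebra_simps diff_divide_distrib add_divide_distrib)
    also have "\<dots> = integral {0..1} (\<lambda>t. (- 1 / (2 * pi)) * Re (v * (zeta \<tau> (z - \<gamma> j t) * of_real (den j t)))) +
      integral {0..1} (\<lambda>t. (Im v / Im \<tau> * Im z) * den j t - Im v / Im \<tau> * (Im (\<gamma> j t) * den j t))"
      by (intro integral_add integrable_continuous_real continuous_intros c1 j den_cont)
    also have "integral {0..1} (\<lambda>t. (Im v / Im \<tau> * Im z) * den j t - Im v / Im \<tau> * (Im (\<gamma> j t) * den j t)) =
      integral {0..1} (\<lambda>t. (Im v / Im \<tau> * Im z) * den j t) - integral {0..1} (\<lambda>t. Im v / Im \<tau> * (Im (\<gamma> j t) * den j t))"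
      by (intro integral_diff integrable_continuous_real continuous_intros j den_cont)
    finally have "integral {0..1} (\<lambda>t. (- Re (v * zeta \<tau> (z - \<gamma> j t)) / (2 * pi) + Im (z - \<gamma> j t) * Im v / Im \<tau>) * den j t)
      = (- 1 / (2 * pi)) * Re (v * F j z) + ((Im v / Im \<tau> * Im z) * integral {0..1} (den j) - Im v / Im \<tau> * integral {0..1} (\<lambda>t. Im (\<gamma> j t) * den j t))"
      unfolding integral_mult_right e1 .
    thus ?thesis by (simp only: mult.assoc minus_divide_left[symmetric] mult_minus_left mult_1_left times_divide_eq_left add_diff_eq)
  qed
  have "(\<Sum>j\<in>J. integral {0..1} (\<lambda>t. (- Re (v * zeta \<tau> (z - \<gamma> j t)) / (2 * pi) + Im (z - \<gamma> j t) * Im v / Im \<tau>) * den j t))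
    = (\<Sum>j\<in>J. - Re (v * F j z) / (2 * pi) + Im v / Im \<tau> * (Im z * integral {0..1} (den j)) - Im v / Im \<tau> * integral {0..1} (\<lambda>t. Im (\<gamma> j t) * den j t))"
    by (intro sum.cong refl one)
  also have "\<dots> = - (\<Sum>j\<in>J. Re (v * F j z)) / (2 * pi) + Im v / Im \<tau> * (Im z * (\<Sum>j\<in>J. integral {0..1} (den j))) - Im v / Im \<tau> * moment"
    by (simp only: sum_subtractf sum.distrib sum_distrib_left[symmetric] sum_divide_distrib[symmetric] sum_negf moment_def)
  also have "\<dots> = - (\<Sum>j\<in>J. Re (v * F j z)) / (2 * pi) - Im v / Im \<tau> * moment" by (simp only: sum_den mult_zero_right add_0_right)
  also have "(\<Sum>j\<in>J. Re (v * F j z)) = Re (v * (\<Sum>j\<in>J. F j z))" by (simp only: sum_distrib_left Re_sum)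
  also have "- Re (v * (\<Sum>j\<in>J. F j z)) / (2 * pi) - Im v / Im \<tau> * moment = Re (v * G z)"
  proof -
    have "v * G z = (- 1 / (2 * pi)) *\<^sub>R (v * (\<Sum>j\<in>J. F j z)) + (moment / Im \<tau>) *\<^sub>R (\<i> * v)"
      by (simp add: G_def scaleR_conv_of_real algebra_simps)
    hence "Re (v * G z) = (- 1 / (2 * pi)) * Re (v * (\<Sum>j\<in>J. F j z)) + (moment / Im \<tau>) * Re (\<i> * v)"
      by (simp only: plus_complex.sel scaleR_complex.sel)
    thus ?thesis unfolding Re_i_times by (simp del: times_complex.sel add: mult.commute)
  qed
  finally show ?thesis .
qed

text \<open>Differentiation under the integral along a segment, with one real parameter; this
  suffices to compare \<open>U\<close> with a primitive of \<open>G\<close>.\<close>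

lemma U_line_derivative:
  assumes "\<And>s. s \<in> {0..1} \<Longrightarrow> z + of_real s * v \<in> W" "s \<in> {0..1}"
  shows "((\<lambda>s. U (z + of_real s * v)) has_vector_derivative Re (v * G (z + of_real s * v))) (at s within {0..1})"
proof -
  let ?p = "\<lambda>s::real. z + of_real s * v"
  let ?g = "\<lambda>j s t. (- Re (v * zeta \<tau> (?p s - \<gamma> j t)) / (2 * pi) + Im (?p s - \<gamma> j t) * Im v / Im \<tau>) * den j t"
  have "((\<lambda>s. integral (cbox 0 1) (\<lambda>t. Green \<tau> (?p s - \<gamma> j t) * den j t)) has_vector_derivative integral (cbox 0 1) (?g j s)) (at s within {0..1})"
    if j: "j \<in> J" for j
  proof (rule leibniz_rule_vector_derivative)
    fix s t :: real assume s: "s \<in> {0..1}"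
    have "((\<lambda>s. ?p s - \<gamma> j t) has_derivative (\<lambda>h. of_real h * v)) (at s)"
      by (auto intro!: derivative_eq_intros)
    from has_derivative_compose[OF this Green_has_derivative[OF tau WD[OF assms(1)[OF s] j]]]
    have "((\<lambda>s. Green \<tau> (?p s - \<gamma> j t)) has_derivative (\<lambda>h. - Re (of_real h * v * zeta \<tau> (?p s - \<gamma> j t)) / (2 * pi) + Im (?p s - \<gamma> j t) * Im (of_real h * v) / Im \<tau>)) (at s)" .
    hence "((\<lambda>s. Green \<tau> (?p s - \<gamma> j t)) has_vector_derivative (- Re (v * zeta \<tau> (?p s - \<gamma> j t)) / (2 * pi) + Im (?p s - \<gamma> j t) * Im v / Im \<tau>)) (at s)"
      unfolding has_vector_derivative_def
      by (rule has_derivative_eq_rhs) (auto simp: fun_eq_iff algebra_simps diff_divide_distrib add_divide_distrib)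
    hence "((\<lambda>s. Green \<tau> (?p s - \<gamma> j t)) has_real_derivative (- Re (v * zeta \<tau> (?p s - \<gamma> j t)) / (2 * pi) + Im (?p s - \<gamma> j t) * Im v / Im \<tau>)) (at s within {0..1})"
      by (simp only: has_real_derivative_iff_has_vector_derivative[symmetric] has_field_derivative_at_within)
    from DERIV_cmult_right[OF this, of "den j t"]
    show "((\<lambda>s. Green \<tau> (?p s - \<gamma> j t) * den j t) has_vector_derivative ?g j s t) (at s within {0..1})"
      by (simp only: has_real_derivative_iff_has_vector_derivative)
  next
    fix s :: real assume s: "s \<in> {0..1}"
    show "(\<lambda>t. Green \<tau> (?p s - \<gamma> j t) * den j t) integrable_on cbox 0 1"
      unfolding box_real by (intro integrable_continuous_real continuous_on_mult Green_integrable assms(1)[OF s] j den_cont)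
  next
    have "continuous_on ({0..1} \<times> cbox 0 1) (\<lambda>x. zeta \<tau> (?p (fst x) - \<gamma> j (snd x)))"
      using WD[OF assms(1) j] by (intro continuous_on_zeta continuous_intros j) auto
    thus "continuous_on ({0..1} \<times> cbox 0 1) (\<lambda>(s, t). ?g j s t)"
      unfolding case_prod_unfold using tau by (intro continuous_intros den_continuous j) auto
  qed (use assms(2) in auto)
  hence "((\<lambda>s. \<Sum>j\<in>J. integral {0..1} (\<lambda>t. Green \<tau> (?p s - \<gamma> j t) * den j t)) has_vector_derivative (\<Sum>j\<in>J. integral {0..1} (?g j s))) (at s within {0..1})"
    by (intro has_vector_derivative_sum) simp
  thus ?thesis
    unfolding U_eq[symmetric] gradient_integral[OF assms(1)[OF assms(2)]] .
qed

text \<open>\<open>G\<close> has a primitive on the disc. \<open>U\<close> minus its real part has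
  derivative 0 along every radius, and the remaining constant is absorbed in the primitive.\<close>

lemma U_local_primitive:
  assumes r: "r > 0" "ball z r \<subseteq> W"
  obtains f where "\<And>w. w \<in> ball z r \<Longrightarrow> (f has_field_derivative G w) (at w)" "\<And>w. w \<in> ball z r \<Longrightarrow> U w = Re (f w)"
proof -
  obtain f where f': "\<And>w. w \<in> ball z r \<Longrightarrow> (f has_field_derivative G w) (at w within ball z r)"
    using holomorphic_convex_primitive'[OF convex_ball open_ball G_holomorphic[OF r(2)]] by blast
  have f: "(f has_field_derivative G w) (at w)" if "w \<in> ball z r" for w
    using f'[OF that] unfolding at_within_open[OF that open_ball] .
  have "U w - Re (f w) = U z - Re (f z)" if w: "w \<in> ball z r" for w
  proof -
    let ?v = "w - z"
    let ?p = "\<lambda>s::real. z + of_real s * ?v"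
    have pb: "?p s \<in> ball z r" if "s \<in> {0..1}" for s
    proof -
      have "norm (of_real s * ?v) \<le> norm ?v" using that by (simp add: norm_mult mult_left_le_one_le)
      also have "\<dots> < r" using w by (simp add: dist_norm norm_minus_commute)
      finally show ?thesis by (simp add: dist_norm)
    qed
    have pW: "?p s \<in> W" if "s \<in> {0..1}" for s using pb[OF that] r(2) by blast
    have "((\<lambda>s. U (?p s) - Re (f (?p s))) has_vector_derivative 0) (at s within {0..1})" if s: "s \<in> {0..1}" for s
    proof -
      have "((\<lambda>s. ?p s) has_vector_derivative ?v) (at s within {0..1})"
        unfolding has_vector_derivative_def by (auto intro!: derivative_eq_intros simp: scaleR_conv_of_real)
      from field_vector_diff_chain_within[OF this has_field_derivative_at_within[OF f[OF pb[OF s]]]]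
      have "((\<lambda>s. f (?p s)) has_vector_derivative ?v * G (?p s)) (at s within {0..1})" by (simp add: o_def)
      from bounded_linear.has_vector_derivative[OF bounded_linear_Re this]
      have "((\<lambda>s. Re (f (?p s))) has_vector_derivative Re (?v * G (?p s))) (at s within {0..1})" .
      from has_vector_derivative_diff[OF U_line_derivative[OF pW s] this] show ?thesis by simp
    qed
    hence "((\<lambda>s. U (?p s) - Re (f (?p s))) has_derivative (\<lambda>h. 0)) (at s within {0..1})" if "s \<in> {0..1}" for s
      using that by (simp add: has_vector_derivative_def)
    from has_derivative_zero_unique[OF _ this, of 0 1] have "U (?p 0) - Re (f (?p 0)) = U (?p 1) - Re (f (?p 1))" by simp
    thus ?thesis by simp
  qed
  hence "U w = Re (f w + of_real (U z - Re (f z)))" if "w \<in> ball z r" for w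
    using that by (simp add: algebra_simps)
  moreover have "((\<lambda>w. f w + of_real (U z - Re (f z))) has_field_derivative G w) (at w)" if "w \<in> ball z r" for w
    using f[OF that] by (auto intro!: derivative_eq_intros)
  ultimately show ?thesis using that by blast
qed

lemma U_locally_Re: "locally_Re W U"
  unfolding locally_Re_def
proof
  fix z assume "z \<in> W"
  then obtain r where r: "r > 0" "ball z r \<subseteq> W" using open_W open_contains_ball by blast
  obtain f where f: "\<And>w. w \<in> ball z r \<Longrightarrow> (f has_field_derivative G w) (at w)" "\<And>w. w \<in> ball z r \<Longrightarrow> U w = Re (f w)"
    using U_local_primitive[OF r] by blast
  have "f holomorphic_on ball z r" unfolding holomorphic_on_open[OF open_ball] using f(1) by blast
  thus "\<exists>r>0. \<exists>f. ball z r \<subseteq> W \<and> f holomorphic_on ball z r \<and> (\<forall>w\<in>ball z r. U w = Re (f w))"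
    using r f(2) by blast
qed

lemma U_has_derivative:
  assumes "z \<in> W"
  shows "(U has_derivative (\<lambda>v. Re (v * G z))) (at z)"
proof -
  obtain r where r: "r > 0" "ball z r \<subseteq> W" using assms open_W open_contains_ball by blast
  obtain f where f: "\<And>w. w \<in> ball z r \<Longrightarrow> (f has_field_derivative G w) (at w)" "\<And>w. w \<in> ball z r \<Longrightarrow> U w = Re (f w)"
    using U_local_primitive[OF r] by blast
  have "f holomorphic_on ball z r" unfolding holomorphic_on_open[OF open_ball] using f(1) by blast
  from has_derivative_Re_holomorphic[OF this, of z U] f r DERIV_imp_deriv[OF f(1)[of z]]
  show ?thesis by simp
qed

lemma grad_U: "z \<in> W \<Longrightarrow> n \<bullet> grad U z = Re (n * G z)"
  by (rule grad_eq[OF U_has_derivative])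

text \<open>Holds for every \<open>z\<close>, on the curves as well: the parameters at which
  \<open>Green\<close> is evaluated on the lattice form a null set.\<close>

lemma U_lattice:
  assumes "l \<in> \<Lambda>"
  shows "U (z + l) = U z"
  unfolding U_eq
proof (intro sum.cong refl)
  fix j assume j: "j \<in> J"
  show "integral {0..1} (\<lambda>t. Green \<tau> (z + l - \<gamma> j t) * den j t) = integral {0..1} (\<lambda>t. Green \<tau> (z - \<gamma> j t) * den j t)"
  proof (rule integral_spike[of "{t. z - \<gamma> j t \<in> \<Lambda>}"])
    show "negligible {t. z - \<gamma> j t \<in> \<Lambda>}"
    proof (cases "\<exists>t. z - \<gamma> j t \<in> \<Lambda>")
      case True
      then obtain t0 where t0: "z - \<gamma> j t0 \<in> \<Lambda>" by blast
      have "{t. z - \<gamma> j t \<in> \<Lambda>} \<subseteq> {t. \<gamma> j t = \<gamma> j t0}"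
      proof
        fix t assume "t \<in> {t. z - \<gamma> j t \<in> \<Lambda>}"
        hence "(z - \<gamma> j t0) - (z - \<gamma> j t) \<in> \<Lambda>" using lattice_diff[OF t0] by blast
        hence "\<gamma> j t - \<gamma> j t0 \<in> \<Lambda>" by simp
        thus "t \<in> {t. \<gamma> j t = \<gamma> j t0}" using curve_diff_lattice[OF j j] by blast
      qed
      thus ?thesis using negligible_curve_point[OF j] negligible_subset by blast
    qed simp
    fix t assume "t \<in> {0..1} - {t. z - \<gamma> j t \<in> \<Lambda>}"
    hence "z - \<gamma> j t \<notin> \<Lambda>" by blast
    from Green_lattice[OF tau this assms] show "Green \<tau> (z - \<gamma> j t) * den j t = Green \<tau> (z + l - \<gamma> j t) * den j t"
      by (simp add: algebra_simps)
  qed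
qed

end

subsection \<open>Weakly singular integrals along a curve\<close>

text \<open>An integrable majorant for logarithmic singularities; the inverse square root is simpler
  to dominate with than the logarithm itself.\<close>

lemma inverse_sqrt_integrable: "(\<lambda>r. 1 / sqrt \<bar>r\<bar>) integrable_on {-1/2..1/2::real}"
proof -
  have "((\<lambda>r. 1 / sqrt \<bar>r\<bar>) has_integral (2 * sqrt (1/2) - 2 * sqrt 0)) {0..1/2::real}"
  proof (rule fundamental_theorem_of_calculus_interior)
    fix x :: real assume x: "x \<in> {0<..<1/2}"
    have "((\<lambda>r. 2 * sqrt r) has_real_derivative 2 * (inverse (sqrt x) / 2)) (at x)"
      using x by (intro DERIV_cmult DERIV_real_sqrt) auto
    thus "((\<lambda>r. 2 * sqrt r) has_vector_derivative 1 / sqrt \<bar>x\<bar>) (at x)"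
      using x by (simp add: has_real_derivative_iff_has_vector_derivative inverse_eq_divide)
  qed (auto intro!: continuous_intros)
  hence r: "(\<lambda>r. 1 / sqrt \<bar>r\<bar>) integrable_on {0..1/2::real}" by blast
  hence l: "(\<lambda>r. 1 / sqrt \<bar>r\<bar>) integrable_on {-1/2..0::real}"
    using Henstock_Kurzweil_Integration.integrable_reflect_real[where f = "\<lambda>r. 1 / sqrt \<bar>r\<bar>" and a = 0 and b = "1/2"] by simp
  show ?thesis by (rule Henstock_Kurzweil_Integration.integrable_combine[OF _ _ l r]) auto
qed

text \<open>The converse transfer: for a singular integrand, integrability is available in the
  centred window and has to be carried back to the period.\<close>

lemma periodic_integral_back:
  fixes f :: "real \<Rightarrow> 'a::banach"
  assumes per: "\<And>t. f (t + 1) = f t" and int: "(\<lambda>r. f (s + r)) integrable_on {-1/2..1/2}"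
  shows "f integrable_on {0..1}" "integral {0..1} f = integral {-1/2..1/2} (\<lambda>r. f (s + r))"
proof -
  define I where "I = integral {-1/2..1/2} (\<lambda>r. f (s + r))"
  have "((f \<circ> (+) s) has_integral I) {-1/2..1/2}"
    using integrable_integral[OF int] by (simp add: o_def I_def)
  hence "(f has_integral I) {-1/2 + s..1/2 + s}" by (simp only: has_integral_shift_Icc_real)
  hence "(f has_integral I) {0 + (s - 1/2)..1 + (s - 1/2)}" by (simp add: algebra_simps)
  hence 1: "((f \<circ> (+) (s - 1/2)) has_integral I) {0..1}" by (simp only: has_integral_shift_Icc_real)
  have "((f \<circ> (+) (s - 1/2)) has_integral I) {1/2 - s..1/2 - s + 1}"
  proof (rule periodic_integral[OF _ 1])
    show "(f \<circ> (+) (s - 1/2)) (t + 1) = (f \<circ> (+) (s - 1/2)) t" for t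
      using per[of "s - 1/2 + t"] by (simp add: add.assoc)
  qed
  hence "(f has_integral I) {(1/2 - s) + (s - 1/2)..(1/2 - s + 1) + (s - 1/2)}"
    by (simp only: has_integral_shift_Icc_real)
  hence "(f has_integral I) {0..1}" by simp
  thus "f integrable_on {0..1}" "integral {0..1} f = integral {-1/2..1/2} (\<lambda>r. f (s + r))"
    by (auto simp: I_def integral_unique)
qed

context c2_curve
begin

text \<open>
  Centring the parameter at a nearest point of the curve makes the singularity stationary,
  so that dominated convergence applies.
\<close>

lemma weakly_singular_isCont:
  fixes g :: "complex \<Rightarrow> real" and f :: "real \<Rightarrow> real"
  assumes d: "d > 0" and gc: "continuous_on {w. w \<noteq> 0 \<and> (\<exists>z\<in>ball (\<gamma> s) d. \<exists>t. w = z - \<gamma> t)} g"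
    and gb: "\<And>z t. z \<in> ball (\<gamma> s) d \<Longrightarrow> z \<noteq> \<gamma> t \<Longrightarrow> \<bar>g (z - \<gamma> t)\<bar> \<le> A + B / sqrt (norm (z - \<gamma> t))"
    and B: "B \<ge> 0" and f: "continuous_on UNIV f" and fper: "\<And>t. f (t + 1) = f t"
  shows "isCont (\<lambda>z. integral {0..1} (\<lambda>t. g (z - \<gamma> t) * f t)) (\<gamma> s)"
  unfolding continuous_at_sequentially
proof (intro allI impI)
  let ?I = "{-1/2..1/2::real}"
  let ?S = "?I - {0}"
  let ?L = "\<lambda>z. integral {0..1} (\<lambda>t. g (z - \<gamma> t) * f t)"
  fix X0 :: "nat \<Rightarrow> complex" assume X0: "X0 \<longlonglongrightarrow> \<gamma> s"
  obtain m where m: "m > 0" "\<And>s t. \<bar>t - s\<bar> \<le> 1/2 \<Longrightarrow> m * \<bar>t - s\<bar> \<le> norm (\<gamma> t - \<gamma> s)" using chord_arc by blast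
  have "\<forall>\<^sub>F n in sequentially. dist (X0 n) (\<gamma> s) < d" using tendstoD[OF X0 d] .
  then obtain N where N: "\<And>n. n \<ge> N \<Longrightarrow> dist (X0 n) (\<gamma> s) < d" unfolding eventually_sequentially by blast
  define X where "X n = X0 (n + N)" for n
  have X: "X \<longlonglongrightarrow> \<gamma> s" unfolding X_def by (rule LIMSEQ_ignore_initial_segment[OF X0])
  have Xb: "X n \<in> ball (\<gamma> s) d" for n using N[of "n + N"] by (simp add: X_def dist_commute)
  have "\<exists>t. \<bar>t - s\<bar> \<le> 1/2 \<and> (\<forall>u. norm (z - \<gamma> t) \<le> norm (z - \<gamma> u))" for z
  proof -
    have "\<exists>x\<in>{s - 1/2..s + 1/2}. \<forall>y\<in>{s - 1/2..s + 1/2}. norm (z - \<gamma> x) \<le> norm (z - \<gamma> y)"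
      by (rule continuous_attains_inf) (auto intro!: continuous_intros)
    then obtain t where t: "t \<in> {s - 1/2..s + 1/2}" "\<And>y. y \<in> {s - 1/2..s + 1/2} \<Longrightarrow> norm (z - \<gamma> t) \<le> norm (z - \<gamma> y)" by blast
    have "norm (z - \<gamma> t) \<le> norm (z - \<gamma> u)" for u
    proof -
      obtain k :: int where k: "\<bar>u + of_int k - s\<bar> \<le> 1/2" using real_reduce_near by blast
      hence "u + of_int k \<in> {s - 1/2..s + 1/2}" unfolding atLeastAtMost_iff abs_le_iff by linarith
      from t(2)[OF this] show ?thesis by (simp add: per_int)
    qed
    moreover have "\<bar>t - s\<bar> \<le> 1/2" using t(1) unfolding atLeastAtMost_iff abs_le_iff by linarith
    ultimately show ?thesis by blast
  qed
  \<comment> \<open>\<open>T z\<close> is a parameter of a nearest point of the curve. Choosing it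
    within half a period of \<open>s\<close> makes it converge to \<open>s\<close>, not merely to an
    integer translate.\<close>
  then obtain T where T: "\<And>z. \<bar>T z - s\<bar> \<le> 1/2" "\<And>z u. norm (z - \<gamma> (T z)) \<le> norm (z - \<gamma> u)" by metis
  have Tlim: "(\<lambda>n. T (X n)) \<longlonglongrightarrow> s"
  proof -
    have "norm (T (X n) - s) \<le> 2 / m * norm (X n - \<gamma> s)" for n
    proof -
      have "m * \<bar>T (X n) - s\<bar> \<le> norm (\<gamma> (T (X n)) - \<gamma> s)" by (rule m(2)[OF T(1)])
      also have "\<dots> \<le> norm (X n - \<gamma> (T (X n))) + norm (X n - \<gamma> s)"
        using norm_triangle_ineq4[of "X n - \<gamma> s" "X n - \<gamma> (T (X n))"] by simp
      also have "\<dots> \<le> 2 * norm (X n - \<gamma> s)" using T(2)[of "X n" s] by simp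
      finally show ?thesis using m(1) by (simp add: field_simps)
    qed
    moreover have "(\<lambda>n. 2 / m * norm (X n - \<gamma> s)) \<longlonglongrightarrow> 2 / m * norm (\<gamma> s - \<gamma> s)"
      by (intro tendsto_intros X)
    hence "(\<lambda>n. 2 / m * norm (X n - \<gamma> s)) \<longlonglongrightarrow> 0" by simp
    ultimately have "(\<lambda>n. T (X n) - s) \<longlonglongrightarrow> 0"
      by (intro Lim_null_comparison[of "\<lambda>n. T (X n) - s"]) (auto intro!: always_eventually)
    thus ?thesis by (simp add: LIM_zero_iff)
  qed
  \<comment> \<open>As \<open>\<gamma> (T z)\<close> is nearest to \<open>z\<close>, the chord from
    it to \<open>\<gamma> (T z + r)\<close> is at most twice the distance from \<open>z\<close> to
    \<open>\<gamma> (T z + r)\<close>. The singularity is thus controlled by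
    \<open>\<bar>r\<bar>\<close> alone, uniformly in \<open>z\<close>.\<close>
  have far: "(m / 2) * \<bar>r\<bar> \<le> norm (z - \<gamma> (T z + r))" if "r \<in> ?I" for z r
  proof -
    have "m * \<bar>T z + r - T z\<bar> \<le> norm (\<gamma> (T z + r) - \<gamma> (T z))"
      using that abs_leI[of r "1/2"] by (intro m(2)) simp
    also have "\<dots> \<le> norm (z - \<gamma> (T z)) + norm (z - \<gamma> (T z + r))"
      using norm_triangle_ineq4[of "z - \<gamma> (T z)" "z - \<gamma> (T z + r)"] by simp
    also have "\<dots> \<le> 2 * norm (z - \<gamma> (T z + r))" using T(2)[of z "T z + r"] by simp
    finally show ?thesis by simp
  qed
  have ne: "z \<noteq> \<gamma> (T z + r)" if "r \<in> ?S" for z r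
  proof
    assume "z = \<gamma> (T z + r)"
    hence "(m / 2) * \<bar>r\<bar> \<le> 0" using far[of r z] that by simp
    thus False using m(1) that by (simp add: mult_le_0_iff)
  qed
  obtain Q where Q: "\<And>t. \<bar>f t\<bar> \<le> Q" "Q \<ge> 0"
  proof -
    have "bounded (f ` {0..1})" by (intro compact_imp_bounded compact_continuous_image continuous_on_subset[OF f]) auto
    then obtain Q where Q: "\<forall>x\<in>f ` {0..1}. norm x \<le> Q" unfolding bounded_iff by blast
    have le: "\<bar>f t\<bar> \<le> Q" for t
    proof -
      obtain k :: int where k: "t + of_int k \<in> {0..<1}" using real_reduce by blast
      have "f (t + of_int k) = f t" by (rule periodic_of_int) (rule fper)
      thus ?thesis using Q k by (metis atLeastAtMost_iff atLeastLessThan_iff image_eqI less_imp_le real_norm_def)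
    qed
    show ?thesis by (rule that[OF le]) (use le[of 0] in linarith)
  qed
  define H where "H r = (A + (B / sqrt (m / 2)) * (1 / sqrt \<bar>r\<bar>)) * Q" for r
  have Hint: "H integrable_on ?S"
  proof -
    have "H integrable_on ?I"
      unfolding H_def by (intro integrable_on_mult_left integrable_add integrable_on_mult_right inverse_sqrt_integrable integrable_const_ivl)
    thus ?thesis by (rule integrable_spike_set) (rule negligible_subset[of "{0}"], simp, force)+
  qed
  have \<Phi>b: "\<bar>g (z - \<gamma> (T z + r)) * f (T z + r)\<bar> \<le> H r" if z: "z \<in> ball (\<gamma> s) d" and r: "r \<in> ?S" for z r
  proof -
    have pos: "(m/2) * \<bar>r\<bar> > 0" using m(1) r by auto
    have rI: "r \<in> ?I" using r by blast
    have "\<bar>g (z - \<gamma> (T z + r))\<bar> \<le> A + B / sqrt (norm (z - \<gamma> (T z + r)))" by (rule gb[OF z ne[OF r]])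
    also have "B / sqrt (norm (z - \<gamma> (T z + r))) \<le> B / sqrt ((m / 2) * \<bar>r\<bar>)"
      using far[OF rI, of z] pos B by (intro divide_left_mono real_sqrt_le_mono mult_pos_pos) auto
    also have "\<dots> = (B / sqrt (m / 2)) * (1 / sqrt \<bar>r\<bar>)" unfolding real_sqrt_mult by simp
    finally have "\<bar>g (z - \<gamma> (T z + r))\<bar> \<le> A + (B / sqrt (m / 2)) * (1 / sqrt \<bar>r\<bar>)" by simp
    thus ?thesis unfolding H_def abs_mult by (intro mult_mono Q) auto
  qed
  have \<Phi>int: "(\<lambda>r. g (z - \<gamma> (T z + r)) * f (T z + r)) integrable_on ?S" if z: "z \<in> ball (\<gamma> s) d" for z
  proof (rule measurable_bounded_by_integrable_imp_integrable[where g = H])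
    have "continuous_on ?S (\<lambda>r. g (z - \<gamma> (T z + r)))"
      by (rule continuous_on_compose2[OF gc]) (use ne z in \<open>auto intro!: continuous_intros\<close>)
    hence "continuous_on ?S (\<lambda>r. g (z - \<gamma> (T z + r)) * f (T z + r))"
      by (intro continuous_intros continuous_on_compose2[OF f]) auto
    thus "(\<lambda>r. g (z - \<gamma> (T z + r)) * f (T z + r)) \<in> borel_measurable (lebesgue_on ?S)"
      by (rule continuous_imp_measurable_on_sets_lebesgue) auto
  qed (use \<Phi>b[OF z] Hint in auto)
  \<comment> \<open>At \<open>r = 0\<close> the point \<open>z\<close> may lie on the curve; this
    single parameter is left out of the window throughout.\<close>
  have eqS: "f integrable_on ?S \<longleftrightarrow> f integrable_on ?I" "integral ?S f = integral ?I f" for f :: "real \<Rightarrow> real"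
    by (rule integrable_spike_set_eq, rule negligible_subset[of "{0}"], simp, force)
       (rule integral_spike_set; rule negligible_subset[of "{0}"]; force)
  have L: "?L z = integral ?S (\<lambda>r. g (z - \<gamma> (T z + r)) * f (T z + r))" if z: "z \<in> ball (\<gamma> s) d" for z
    unfolding eqS
  proof (rule periodic_integral_back(2))
    show "g (z - \<gamma> (t + 1)) * f (t + 1) = g (z - \<gamma> t) * f t" for t by (simp only: per fper)
    show "(\<lambda>r. g (z - \<gamma> (T z + r)) * f (T z + r)) integrable_on ?I" using \<Phi>int[OF z] unfolding eqS .
  qed
  have Ts: "\<gamma> (T (\<gamma> s)) = \<gamma> s" using T(2)[of "\<gamma> s" s] by simp
  have Ts_eq: "T (\<gamma> s) = s"
  proof -
    have "m * \<bar>T (\<gamma> s) - s\<bar> \<le> 0" using m(2)[OF T(1)[of "\<gamma> s"]] Ts by simp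
    thus ?thesis using m(1) by (simp add: mult_le_0_iff)
  qed
  have "(\<lambda>n. integral ?S (\<lambda>r. g (X n - \<gamma> (T (X n) + r)) * f (T (X n) + r))) \<longlonglongrightarrow>
      integral ?S (\<lambda>r. g (\<gamma> s - \<gamma> (s + r)) * f (s + r))"
  proof (rule dominated_convergence[where h = H])
    show "norm (g (X n - \<gamma> (T (X n) + r)) * f (T (X n) + r)) \<le> H r" if "r \<in> ?S" for n r
      using \<Phi>b[OF Xb that] by simp
    fix r assume r: "r \<in> ?S"
    have sd: "\<gamma> s \<in> ball (\<gamma> s) d" using d by simp
    have w0: "\<gamma> s - \<gamma> (s + r) \<noteq> 0" using ne[OF r, of "\<gamma> s"] by (simp add: Ts_eq)
    have \<gamma>lim: "(\<lambda>n. \<gamma> (T (X n) + r)) \<longlonglongrightarrow> \<gamma> (s + r)"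
      by (rule isCont_tendsto_compose[OF has_vector_derivative_continuous[OF deriv]]) (intro tendsto_intros Tlim)
    have flim: "(\<lambda>n. f (T (X n) + r)) \<longlonglongrightarrow> f (s + r)"
    proof (rule isCont_tendsto_compose[where g = f])
      show "isCont f (s + r)" using f by (simp add: continuous_on_eq_continuous_at)
    qed (intro tendsto_intros Tlim)
    have "(\<lambda>n. g (X n - \<gamma> (T (X n) + r))) \<longlonglongrightarrow> g (\<gamma> s - \<gamma> (s + r))"
    proof (rule continuous_on_tendsto_compose[OF gc])
      show "(\<lambda>n. X n - \<gamma> (T (X n) + r)) \<longlonglongrightarrow> \<gamma> s - \<gamma> (s + r)" by (intro tendsto_intros X \<gamma>lim)
      show "\<gamma> s - \<gamma> (s + r) \<in> {w. w \<noteq> 0 \<and> (\<exists>z\<in>ball (\<gamma> s) d. \<exists>t. w = z - \<gamma> t)}" using w0 sd by blast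
      show "\<forall>\<^sub>F n in sequentially. X n - \<gamma> (T (X n) + r) \<in> {w. w \<noteq> 0 \<and> (\<exists>z\<in>ball (\<gamma> s) d. \<exists>t. w = z - \<gamma> t)}"
      proof (intro always_eventually allI CollectI conjI)
        show "X n - \<gamma> (T (X n) + r) \<noteq> 0" for n using ne[OF r, of "X n"] by simp
      qed (use Xb in blast)
    qed
    thus "(\<lambda>n. g (X n - \<gamma> (T (X n) + r)) * f (T (X n) + r)) \<longlonglongrightarrow> g (\<gamma> s - \<gamma> (s + r)) * f (s + r)"
      by (rule tendsto_mult[OF _ flim])
  qed (use \<Phi>int[OF Xb] Hint in auto)
  hence "(\<lambda>n. ?L (X n)) \<longlonglongrightarrow> ?L (\<gamma> s)"
    using L[OF Xb] L[of "\<gamma> s"] d by (simp add: Ts_eq)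
  hence "(\<lambda>n. ?L (X0 (n + N))) \<longlonglongrightarrow> ?L (\<gamma> s)" by (simp add: X_def)
  thus "(?L \<circ> X0) \<longlonglongrightarrow> ?L (\<gamma> s)" unfolding o_def by (rule LIMSEQ_offset)
qed

end

text \<open>The inequality \<open>ln y \<le> y - 1\<close>, taken at \<open>y = x\<close> from above
  and at \<open>y = 1 / sqrt x\<close> from below.\<close>

lemma abs_ln_le: "x > 0 \<Longrightarrow> \<bar>ln x\<bar> \<le> x + 2 / sqrt x" for x :: real
proof -
  assume x: "x > 0"
  have "ln x \<le> x" using ln_le_minus_one[OF x] by simp
  moreover have "- ln x \<le> 2 / sqrt x"
  proof -
    have "ln (1 / sqrt x) \<le> 1 / sqrt x" using ln_le_minus_one[of "1 / sqrt x"] x by simp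
    moreover have "ln (1 / sqrt x) = - ln x / 2" using x by (simp add: ln_div ln_sqrt)
    ultimately show ?thesis by simp
  qed
  moreover have "2 / sqrt x > 0" using x by simp
  ultimately show ?thesis using x by linarith
qed

subsection \<open>Boundary behaviour of the single layer potential\<close>

context layer
begin

lemma Green_decomp:
  assumes "w \<noteq> 0" "w \<notin> \<Lambda>"
  shows "Green \<tau> w = - 1 / (2 * pi) * ln (norm w) + (- 1 / (2 * pi) * ln (norm (div_id (theta1 \<tau>) w)) + 1 / (2 * Im \<tau>) * (Im w)\<^sup>2)"
proof -
  have "theta1 \<tau> w = w * div_id (theta1 \<tau>) w" by (rule div_id_mult[of "theta1 \<tau>", OF theta1_0])
  moreover have "div_id (theta1 \<tau>) w \<noteq> 0" using assms by (simp add: div_theta1_eq_0_iff[OF tau])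
  ultimately have "ln (norm (theta1 \<tau> w)) = ln (norm w) + ln (norm (div_id (theta1 \<tau>) w))"
    using assms by (simp add: norm_mult ln_mult)
  thus ?thesis by (simp add: Green_def algebra_simps add_divide_distrib)
qed

lemma near_separated:
  assumes i: "i \<in> J"
  obtains d where "d > 0" "\<And>z t. z \<in> ball (\<gamma> i s) d \<Longrightarrow> z - \<gamma> i t \<notin> punctured_lattice \<tau>"
    "\<And>z j t. z \<in> ball (\<gamma> i s) d \<Longrightarrow> j \<in> J \<Longrightarrow> j \<noteq> i \<Longrightarrow> z - \<gamma> j t \<notin> \<Lambda>"
proof -
  obtain d where d: "d > 0" "\<And>i j x y l. \<lbrakk>i \<in> J; j \<in> J; x \<in> closure (D i); y \<in> closure (D j); l \<in> \<Lambda>; i \<noteq> j \<or> l \<noteq> 0\<rbrakk> \<Longrightarrow> d \<le> norm (x - y - l)"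
    using separation by blast
  have *: "z - \<gamma> j t \<notin> \<Lambda> \<or> (i = j \<and> z - \<gamma> j t = 0)" if "z \<in> ball (\<gamma> i s) d" "j \<in> J" for z j t
  proof (rule ccontr)
    assume "\<not> ?thesis"
    hence "d \<le> norm (\<gamma> i s - \<gamma> j t - (z - \<gamma> j t))"
      by (intro d(2)[OF i that(2) range_closure[OF i] range_closure[OF that(2)]]) auto
    thus False using that(1) by (simp add: dist_norm)
  qed
  show ?thesis
  proof (rule that[OF d(1)])
    show "z - \<gamma> i t \<notin> punctured_lattice \<tau>" if "z \<in> ball (\<gamma> i s) d" for z t using *[OF that i, of t] by blast
    show "z - \<gamma> j t \<notin> \<Lambda>" if "z \<in> ball (\<gamma> i s) d" "j \<in> J" "j \<noteq> i" for z j t using *[OF that(1,2), of t] that(3) by blast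
  qed
qed

lemma continuous_on_Green: "continuous_on A f \<Longrightarrow> (\<And>x. x \<in> A \<Longrightarrow> f x \<notin> \<Lambda>) \<Longrightarrow> continuous_on A (\<lambda>x. Green \<tau> (f x))"
proof (rule continuous_on_compose2[of "- \<Lambda>" "Green \<tau>"])
  show "continuous_on (- \<Lambda>) (Green \<tau>)"
    using Green_has_derivative[OF tau] has_derivative_continuous
    by (intro continuous_at_imp_continuous_on) blast
qed auto

text \<open>Only the integral over the curve through the point is singular. There Green's function
  is a logarithm plus a part bounded on a compact set of differences, which meets the growth
  condition for weakly singular kernels; the other curves give integrals of continuous
  functions.\<close>

lemma U_isCont_boundary:
  assumes i: "i \<in> J"
  shows "isCont U (\<gamma> i s)"
proof -
  obtain d where d: "d > 0" "\<And>z t. z \<in> ball (\<gamma> i s) d \<Longrightarrow> z - \<gamma> i t \<notin> punctured_lattice \<tau>"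
    "\<And>z j t. z \<in> ball (\<gamma> i s) d \<Longrightarrow> j \<in> J \<Longrightarrow> j \<noteq> i \<Longrightarrow> z - \<gamma> j t \<notin> \<Lambda>"
    using near_separated[OF i] by blast
  have other: "isCont (\<lambda>z. integral {0..1} (\<lambda>t. Green \<tau> (z - \<gamma> j t) * den j t)) (\<gamma> i s)" if j: "j \<in> J" "j \<noteq> i" for j
  proof -
    have "continuous_on (ball (\<gamma> i s) d \<times> {0..1}) (\<lambda>(z, t). Green \<tau> (z - \<gamma> j t) * den j t)"
      unfolding case_prod_unfold
      by (intro continuous_on_mult continuous_on_Green den_continuous[OF j(1)] continuous_intros j(1)) (use d(3) j in auto)
    from continuous_on_integral_snd[OF this] show ?thesis
      using d(1) by (simp add: continuous_on_eq_continuous_at)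
  qed
  let ?k = "div_id (theta1 \<tau>)"
  let ?P = "\<lambda>w. - 1 / (2 * pi) * ln (norm (?k w)) + 1 / (2 * Im \<tau>) * (Im w)\<^sup>2"
  let ?K = "(\<lambda>x. fst x - \<gamma> i (snd x)) ` (cball (\<gamma> i s) (d/2) \<times> {0..1})"
  have sub: "z \<in> cball (\<gamma> i s) (d/2) \<Longrightarrow> z \<in> ball (\<gamma> i s) d" for z using d(1) by auto
  have K: "compact ?K" by (intro compact_continuous_image compact_Times continuous_intros i) auto
  have Kp: "w \<notin> punctured_lattice \<tau>" if "w \<in> ?K" for w using that d(2) sub by auto
  have "continuous_on ?K ?P"
    using Kp tau by (intro continuous_intros holomorphic_on_imp_continuous_on[OF div_theta1_holomorphic[OF tau]])
      (auto simp: div_theta1_eq_0_iff[OF tau])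
  hence "bounded (?P ` ?K)" by (rule compact_imp_bounded[OF compact_continuous_image[OF _ K]])
  then obtain A0 where A0': "\<forall>y\<in>?P ` ?K. norm y \<le> A0" unfolding bounded_iff by blast
  have A0: "\<bar>?P w\<bar> \<le> A0" if "w \<in> ?K" for w
    using A0'[rule_format, OF imageI[OF that]] by (simp only: real_norm_def)
  obtain A1 where A1: "\<And>w. w \<in> ?K \<Longrightarrow> norm w \<le> A1" using compact_imp_bounded[OF K] unfolding bounded_iff by blast
  have "isCont (\<lambda>z. integral {0..1} (\<lambda>t. Green \<tau> (z - \<gamma> i t) * den i t)) (\<gamma> i s)"
  proof (rule c2_curve.weakly_singular_isCont[OF curve[OF i], where d = "d/2" and A = "A0 + A1" and B = 2])
    show "continuous_on {w. w \<noteq> 0 \<and> (\<exists>z\<in>ball (\<gamma> i s) (d/2). \<exists>t. w = z - \<gamma> i t)} (Green \<tau>)"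
    proof (rule continuous_on_Green[of _ "\<lambda>x. x", OF continuous_on_id])
      fix x assume "x \<in> {w. w \<noteq> 0 \<and> (\<exists>z\<in>ball (\<gamma> i s) (d/2). \<exists>t. w = z - \<gamma> i t)}"
      then obtain z t where "x \<noteq> 0" "z \<in> ball (\<gamma> i s) (d/2)" "x = z - \<gamma> i t" by blast
      moreover from this have "z \<in> ball (\<gamma> i s) d" using d(1) by auto
      ultimately show "x \<notin> \<Lambda>" using d(2)[of z t] by blast
    qed
    fix z t assume z: "z \<in> ball (\<gamma> i s) (d/2)" "z \<noteq> \<gamma> i t"
    let ?w = "z - \<gamma> i t"
    obtain k :: int where k: "t + of_int k \<in> {0..<1}" using real_reduce by blast
    have "\<gamma> i (t + of_int k) = \<gamma> i t" by (rule periodic_of_int) (rule curve_periodic(1)[OF i])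
    hence wK: "?w \<in> ?K" using k z(1) by (intro image_eqI[of _ _ "(z, t + of_int k)"]) auto
    have w0: "?w \<noteq> 0" using z(2) by simp
    have "?w \<notin> \<Lambda>" using Kp[OF wK] w0 by blast
    hence "Green \<tau> ?w = - 1 / (2 * pi) * ln (norm ?w) + ?P ?w" using Green_decomp[OF w0] by blast
    hence "\<bar>Green \<tau> ?w\<bar> \<le> \<bar>- 1 / (2 * pi) * ln (norm ?w)\<bar> + \<bar>?P ?w\<bar>" by (metis abs_triangle_ineq)
    also have "\<bar>- 1 / (2 * pi) * ln (norm ?w)\<bar> = (1 / (2 * pi)) * \<bar>ln (norm ?w)\<bar>" unfolding abs_mult by simp
    also have "\<dots> \<le> 1 * \<bar>ln (norm ?w)\<bar>" using pi_ge_two by (intro mult_right_mono) (auto simp: divide_le_eq)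
    also have "1 * \<bar>ln (norm ?w)\<bar> \<le> norm ?w + 2 / sqrt (norm ?w)" using abs_ln_le[of "norm ?w"] w0 by simp
    also have "norm ?w + 2 / sqrt (norm ?w) \<le> A1 + 2 / sqrt (norm ?w)" using A1[OF wK] by simp
    also have "\<bar>?P ?w\<bar> \<le> A0" by (rule A0[OF wK])
    finally show "\<bar>Green \<tau> ?w\<bar> \<le> A0 + A1 + 2 / sqrt (norm ?w)" by simp
  qed (use d(1) den_cont[OF i] den_periodic[OF i] in auto)
  note diag = this
  have "\<forall>j\<in>J. isCont (\<lambda>z. integral {0..1} (\<lambda>t. Green \<tau> (z - \<gamma> j t) * den j t)) (\<gamma> i s)"
  proof
    fix j assume "j \<in> J"
    then show "isCont (\<lambda>z. integral {0..1} (\<lambda>t. Green \<tau> (z - \<gamma> j t) * den j t)) (\<gamma> i s)"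
      using other[of j] diag by (cases "j = i") blast+
  qed
  hence "isCont (\<lambda>z. \<Sum>j\<in>J. integral {0..1} (\<lambda>t. Green \<tau> (z - \<gamma> j t) * den j t)) (\<gamma> i s)"
    by (intro continuous_sum) auto
  thus ?thesis by (simp only: U_eq[symmetric])
qed

lemma not_W:
  assumes "z \<notin> W"
  obtains j t l where "j \<in> J" "l \<in> \<Lambda>" "z = \<gamma> j t + l"
proof -
  obtain j t where "j \<in> J" "z - \<gamma> j t \<in> \<Lambda>" using assms unfolding W_def by blast
  thus ?thesis using that[of j "z - \<gamma> j t" t] by simp
qed

lemma U_isCont: "isCont U z"
proof (cases "z \<in> W")
  case True
  thus ?thesis using has_derivative_continuous[OF U_has_derivative] by blast
next
  case False
  then obtain j t l where jtl: "j \<in> J" "l \<in> \<Lambda>" "z = \<gamma> j t + l" by (rule not_W)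
  have "isCont (\<lambda>x. U (x - l)) z"
    by (rule isCont_o2[where g = U]) (use U_isCont_boundary[OF jtl(1), of t] jtl(3) in \<open>auto intro!: continuous_intros\<close>)
  moreover have "(\<lambda>x. U (x - l)) = U" using U_lattice[OF lattice_minus[OF jtl(2)]] by auto
  ultimately show ?thesis by simp
qed

text \<open>Splitting \<open>zeta\<close> at its pole, the regular part and the other curves form
  \<open>E\<close>, which is continuous across the curve; the pole part is a Cauchy-type integral
  that jumps. Its numerator contains the normal at the fixed parameter \<open>s\<close>, so it is
  exactly \<i> times the tangent times a real density, with error constant 0.\<close>

lemma normal_jump:
  assumes i: "i \<in> J" and \<kappa>: "\<kappa> > 0" and \<sigma>: "\<sigma> = 1 \<or> \<sigma> = -1"
  shows "((\<lambda>z. Re (nrm i s * G z)) \<longlongrightarrow> Kint \<phi> i s - \<sigma> * sg i * \<phi> (\<gamma> i s) / 2)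
     (at (\<gamma> i s) within c2_curve.side_cone (\<gamma> i) (d\<gamma> i) \<sigma> \<kappa> s)"
proof -
  interpret h: c2_hole "\<gamma> i" "d\<gamma> i" "dd\<gamma> i" "D i" by (rule hole[OF i])
  let ?\<nu> = "nrm i s"
  let ?C = "at (\<gamma> i s) within h.side_cone \<sigma> \<kappa> s"
  obtain d where d: "d > 0" "\<And>z t. z \<in> ball (\<gamma> i s) d \<Longrightarrow> z - \<gamma> i t \<notin> punctured_lattice \<tau>"
    "\<And>z j t. z \<in> ball (\<gamma> i s) d \<Longrightarrow> j \<in> J \<Longrightarrow> j \<noteq> i \<Longrightarrow> z - \<gamma> j t \<notin> \<Lambda>"
    using near_separated[OF i] by blast
  have split: "(- (X + Y) / (2 * pi) + C) * x = (- Y / (2 * pi) + C) * x + 1 / (2 * pi) * (- x * X)" for X Y C x :: real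
    by (simp add: field_simps)
  let ?q = "\<lambda>j z t. - Re (?\<nu> * (if j = i then zeta_reg \<tau> (z - \<gamma> j t) else zeta \<tau> (z - \<gamma> j t))) / (2 * pi) + Im (z - \<gamma> j t) * Im ?\<nu> / Im \<tau>"
  have qc: "continuous_on (ball (\<gamma> i s) d \<times> A) (\<lambda>x. ?q j (fst x) (snd x))" if j: "j \<in> J" for j A
  proof (cases "j = i")
    case True
    have "continuous_on (ball (\<gamma> i s) d \<times> A) (\<lambda>x. zeta_reg \<tau> (fst x - \<gamma> j (snd x)))"
      using d(2) True by (intro continuous_on_zeta_reg continuous_intros j) auto
    thus ?thesis unfolding if_P[OF True] using tau by (intro continuous_intros j) auto
  next
    case False
    have "continuous_on (ball (\<gamma> i s) d \<times> A) (\<lambda>x. zeta \<tau> (fst x - \<gamma> j (snd x)))"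
      using d(3) False j by (intro continuous_on_zeta continuous_intros j) auto
    thus ?thesis unfolding if_not_P[OF False] using tau by (intro continuous_intros j) auto
  qed
  have qc1: "continuous_on A (\<lambda>t. ?q j z t)" if "j \<in> J" "z \<in> ball (\<gamma> i s) d" for j z and A :: "real set"
  proof -
    have "continuous_on A (\<lambda>t. ?q j (fst (z, t)) (snd (z, t)))"
      by (rule continuous_on_compose2[OF qc[OF that(1), of UNIV]]) (use that(2) in \<open>auto intro!: continuous_intros\<close>)
    thus ?thesis by (simp only: fst_conv snd_conv)
  qed
  define E where "E z = (\<Sum>j\<in>J. integral {0..1} (\<lambda>t. ?q j z t * den j t))" for z
  have "continuous_on (ball (\<gamma> i s) d) E"
    unfolding E_def
  proof (rule continuous_on_sum)
    fix j assume j: "j \<in> J"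
    have "continuous_on (ball (\<gamma> i s) d \<times> {0..1}) (\<lambda>(z, t). ?q j z t * den j t)"
      unfolding case_prod_unfold by (intro continuous_on_mult qc den_continuous j continuous_intros)
    thus "continuous_on (ball (\<gamma> i s) d) (\<lambda>z. integral {0..1} (\<lambda>t. ?q j z t * den j t))"
      by (rule continuous_on_integral_snd)
  qed
  hence "isCont E (\<gamma> i s)" using d(1) by (simp add: continuous_on_eq_continuous_at)
  hence Elim: "(E \<longlongrightarrow> E (\<gamma> i s)) ?C" unfolding isCont_def by (rule tendsto_within_subset) simp
  define V where "V = integral {-1/2..1/2} (\<lambda>r. Re (?\<nu> * of_real (den i (s + r)) / (\<gamma> i (s + r) - \<gamma> i s)))"
  have "((\<lambda>z. integral {0..1} (\<lambda>t. Re (?\<nu> * of_real (den i t) / (\<gamma> i t - z)))) \<longlongrightarrow> V - \<sigma> * pi * (sg i * den i s / norm (d\<gamma> i s))) ?C"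
    unfolding V_def
  proof (rule h.cauchy_jump[where \<rho> = "\<lambda>t. ?\<nu> * of_real (den i t)" and \<psi> = "\<lambda>t. sg i * den i t / norm (d\<gamma> i s)" and C' = 0])
    show "continuous_on UNIV (\<lambda>t. ?\<nu> * of_real (den i t))" by (intro continuous_intros den_cont i)
    show "continuous_on UNIV (\<lambda>t. sg i * den i t / norm (d\<gamma> i s))"
      by (intro continuous_intros den_cont i) (use d\<gamma>_nonzero[OF i] in auto)
    show "?\<nu> * of_real (den i (t + 1)) = ?\<nu> * of_real (den i t)" for t by (simp add: den_periodic[OF i])
    show "norm (?\<nu> * of_real (den i t) - \<i> * d\<gamma> i s * of_real (sg i * den i t / norm (d\<gamma> i s))) \<le> 0 * \<bar>t - s\<bar>" for t
      by (simp add: nrm_def)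
  qed (use \<kappa> \<sigma> in auto)
  hence jump: "((\<lambda>z. integral {0..1} (\<lambda>t. Re (?\<nu> * of_real (den i t) / (\<gamma> i t - z)))) \<longlongrightarrow> V - \<sigma> * pi * (sg i * \<phi> (\<gamma> i s))) ?C"
    using d\<gamma>_nonzero[OF i, of s] by (simp add: den_def)
  have "((\<lambda>z. E z + 1 / (2 * pi) * integral {0..1} (\<lambda>t. Re (?\<nu> * of_real (den i t) / (\<gamma> i t - z)))) \<longlongrightarrow>
      E (\<gamma> i s) + 1 / (2 * pi) * (V - \<sigma> * pi * (sg i * \<phi> (\<gamma> i s)))) ?C"
    by (intro tendsto_add Elim tendsto_mult_left jump)
  moreover have "\<forall>\<^sub>F z in ?C. E z + 1 / (2 * pi) * integral {0..1} (\<lambda>t. Re (?\<nu> * of_real (den i t) / (\<gamma> i t - z))) = Re (?\<nu> * G z)"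
  proof -
    have "\<forall>\<^sub>F z in ?C. z \<in> W"
    proof (cases "\<sigma> = sg i")
      case True
      have "\<forall>\<^sub>F z in ?C. z \<in> D i" using h.sides(1)[OF \<kappa>, of s] unfolding orient_eq[OF i] True .
      thus ?thesis by eventually_elim (use hole_W[OF i] in blast)
    next
      case False
      hence "\<sigma> = - sg i" using \<sigma> sg_cases[of i] by auto
      hence "\<forall>\<^sub>F z in ?C. z \<in> \<Omega>" using eventually_Omega[OF i \<kappa>, of s] by simp
      thus ?thesis by eventually_elim (use Omega_W in blast)
    qed
    moreover have "\<forall>\<^sub>F z in ?C. z \<in> ball (\<gamma> i s) d"
      unfolding eventually_at using d(1) by (auto simp: dist_commute)
    ultimately show ?thesis
    proof eventually_elim
      case (elim z)
      let ?p = "\<lambda>j t. - Re (?\<nu> * zeta \<tau> (z - \<gamma> j t)) / (2 * pi) + Im (z - \<gamma> j t) * Im ?\<nu> / Im \<tau>"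
      have nl: "z - \<gamma> i t \<notin> \<Lambda>" for t using WD[OF elim(1) i] .
      hence nz: "\<gamma> i t - z \<noteq> 0" for t using lattice_0[of \<tau>] by (metis diff_self eq_iff_diff_eq_0)
      have cs: "continuous_on {0..1} (\<lambda>t. Re (?\<nu> * of_real (den i t) / (\<gamma> i t - z)))"
        by (intro continuous_intros den_cont i ballI nz)
      have e: "?p i t * den i t = ?q i z t * den i t + 1 / (2 * pi) * Re (?\<nu> * of_real (den i t) / (\<gamma> i t - z))" for t
      proof -
        have "?\<nu> * of_real (den i t) / (\<gamma> i t - z) = den i t *\<^sub>R (- (?\<nu> * (1 / (z - \<gamma> i t))))"
          using nz[of t] by (simp add: scaleR_conv_of_real field_simps)
        hence "Re (?\<nu> * of_real (den i t) / (\<gamma> i t - z)) = - den i t * Re (?\<nu> * (1 / (z - \<gamma> i t)))"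
          by (simp only: scaleR_complex.sel uminus_complex.sel)
        moreover have "Re (?\<nu> * zeta \<tau> (z - \<gamma> i t)) = Re (?\<nu> * (1 / (z - \<gamma> i t))) + Re (?\<nu> * zeta_reg \<tau> (z - \<gamma> i t))"
          unfolding zeta_eq[OF tau nl] distrib_left by (simp only: plus_complex.sel)
        ultimately show ?thesis by (simp only: if_P[OF refl] split)
      qed
      have "Re (?\<nu> * G z) = (\<Sum>j\<in>J. integral {0..1} (\<lambda>t. ?p j t * den j t))"
        by (rule gradient_integral[OF elim(1), symmetric])
      also have "\<dots> = (\<Sum>j\<in>J. integral {0..1} (\<lambda>t. ?q j z t * den j t) + (if j = i then 1 / (2 * pi) * integral {0..1} (\<lambda>t. Re (?\<nu> * of_real (den i t) / (\<gamma> i t - z))) else 0))"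
      proof (rule sum.cong[OF refl])
        fix j assume j: "j \<in> J"
        show "integral {0..1} (\<lambda>t. ?p j t * den j t) = integral {0..1} (\<lambda>t. ?q j z t * den j t) + (if j = i then 1 / (2 * pi) * integral {0..1} (\<lambda>t. Re (?\<nu> * of_real (den i t) / (\<gamma> i t - z))) else 0)"
        proof (cases "j = i")
          case True
          have "integral {0..1} (\<lambda>t. ?p i t * den i t) = integral {0..1} (\<lambda>t. ?q i z t * den i t) + integral {0..1} (\<lambda>t. 1 / (2 * pi) * Re (?\<nu> * of_real (den i t) / (\<gamma> i t - z)))"
            unfolding e
            by (intro integral_add integrable_continuous_real continuous_on_mult qc1 i elim(2) den_cont continuous_on_const cs)
          thus ?thesis unfolding True by (simp only: integral_mult_right if_P[OF refl])
        qed simp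
      qed
      also have "\<dots> = E z + 1 / (2 * pi) * integral {0..1} (\<lambda>t. Re (?\<nu> * of_real (den i t) / (\<gamma> i t - z)))"
        unfolding E_def sum.distrib using i by simp
      finally show ?case by simp
    qed
  qed
  ultimately have lim: "((\<lambda>z. Re (?\<nu> * G z)) \<longlongrightarrow> E (\<gamma> i s) + 1 / (2 * pi) * (V - \<sigma> * pi * (sg i * \<phi> (\<gamma> i s)))) ?C"
    by (rule Lim_transform_eventually)
  have gd: "\<gamma> i s \<in> ball (\<gamma> i s) d" using d(1) by simp
  \<comment> \<open>Recognises the part of the limit without jump as the boundary operator. On the
    curve itself the comparison is made in the window centred at \<open>s\<close>, where the two
    integrands agree except at \<open>r = 0\<close>.\<close>
  have "Kint \<phi> i s = E (\<gamma> i s) + 1 / (2 * pi) * V"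
  proof -
    have ck: "continuous_on A (\<lambda>t. kern i j s t)" if "j \<in> J" for j A
      by (rule continuous_on_curry(1)[OF kern_continuous[OF i that]])
    have other: "integral {0..1} (\<lambda>t. kern i j s t * den j t) = integral {0..1} (\<lambda>t. ?q j (\<gamma> i s) t * den j t)" if j: "j \<in> J" "j \<noteq> i" for j
    proof -
      have "\<gamma> i s \<noteq> \<gamma> j t" for t using d(3)[OF gd j, of t] lattice_0[of \<tau>] by auto
      hence "kern i j s t = ?q j (\<gamma> i s) t" for t using kern_eq[OF i j(1)] j(2) by simp
      thus ?thesis by simp
    qed
    let ?f = "\<lambda>t. kern i i s t * den i t - ?q i (\<gamma> i s) t * den i t"
    have fc: "continuous_on A ?f" for A by (intro continuous_on_diff continuous_on_mult ck qc1 i gd den_cont)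
    have "integral {0..1} ?f = integral {-1/2..1/2} (\<lambda>r. ?f (s + r))"
    proof (rule periodic_integral_centred(1)[symmetric])
      show "?f (t + 1) = ?f t" for t by (simp add: kern_periodic[OF i i] den_periodic[OF i] curve_periodic[OF i])
      show "?f integrable_on {0..1}" by (rule integrable_continuous_real[OF fc])
    qed
    also have "\<dots> = integral {-1/2..1/2} (\<lambda>r. 1 / (2 * pi) * Re (?\<nu> * of_real (den i (s + r)) / (\<gamma> i (s + r) - \<gamma> i s)))"
    proof (rule integral_spike[of "{0}"])
      fix r :: real assume r: "r \<in> {-1/2..1/2} - {0}"
      let ?t = "s + r"
      have "?t - s \<notin> \<int>" using r by (intro h.not_Ints_near) (auto simp: abs_less_iff)
      hence ne: "\<gamma> i s \<noteq> \<gamma> i ?t" using h.eq_iff by metis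
      hence nl: "\<gamma> i s - \<gamma> i ?t \<notin> \<Lambda>" using curve_diff_lattice[OF i i] by blast
      have nz: "\<gamma> i ?t - \<gamma> i s \<noteq> 0" using ne by simp
      have "?\<nu> * of_real (den i ?t) / (\<gamma> i ?t - \<gamma> i s) = den i ?t *\<^sub>R (- (?\<nu> * (1 / (\<gamma> i s - \<gamma> i ?t))))"
        using nz ne by (simp add: scaleR_conv_of_real field_simps)
      hence a: "Re (?\<nu> * of_real (den i ?t) / (\<gamma> i ?t - \<gamma> i s)) = - den i ?t * Re (?\<nu> * (1 / (\<gamma> i s - \<gamma> i ?t)))"
        by (simp only: scaleR_complex.sel uminus_complex.sel)
      have b: "Re (?\<nu> * zeta \<tau> (\<gamma> i s - \<gamma> i ?t)) = Re (?\<nu> * (1 / (\<gamma> i s - \<gamma> i ?t))) + Re (?\<nu> * zeta_reg \<tau> (\<gamma> i s - \<gamma> i ?t))"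
        unfolding zeta_eq[OF tau nl] distrib_left by (simp only: plus_complex.sel)
      show "1 / (2 * pi) * Re (?\<nu> * of_real (den i ?t) / (\<gamma> i ?t - \<gamma> i s)) = ?f ?t"
        unfolding a kern_eq[OF i i ne] b if_P[OF refl] split by simp
    qed simp
    also have "\<dots> = 1 / (2 * pi) * V" unfolding V_def by (rule integral_mult_right)
    finally have "integral {0..1} ?f = 1 / (2 * pi) * V" .
    moreover have "integral {0..1} ?f = integral {0..1} (\<lambda>t. kern i i s t * den i t) - integral {0..1} (\<lambda>t. ?q i (\<gamma> i s) t * den i t)"
      by (intro integral_diff integrable_continuous_real continuous_on_mult ck qc1 i gd den_cont)
    ultimately have same: "integral {0..1} (\<lambda>t. kern i i s t * den i t) = integral {0..1} (\<lambda>t. ?q i (\<gamma> i s) t * den i t) + 1 / (2 * pi) * V"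
      by linarith
    have "Kint \<phi> i s = (\<Sum>j\<in>J. integral {0..1} (\<lambda>t. kern i j s t * den j t))" by (simp add: Kint_def den_def)
    also have "\<dots> = (\<Sum>j\<in>J. integral {0..1} (\<lambda>t. ?q j (\<gamma> i s) t * den j t) + (if j = i then 1 / (2 * pi) * V else 0))"
    proof (rule sum.cong[OF refl])
      fix j assume j: "j \<in> J"
      show "integral {0..1} (\<lambda>t. kern i j s t * den j t) = integral {0..1} (\<lambda>t. ?q j (\<gamma> i s) t * den j t) + (if j = i then 1 / (2 * pi) * V else 0)"
      proof (cases "j = i")
        case True
        show ?thesis unfolding True using same by (simp only: if_P[OF refl])
      next
        case False
        show ?thesis using other[OF j False] False by simp
      qed
    qed
    also have "\<dots> = E (\<gamma> i s) + 1 / (2 * pi) * V" unfolding E_def sum.distrib using i by simp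
    finally show ?thesis .
  qed
  hence "E (\<gamma> i s) + 1 / (2 * pi) * (V - \<sigma> * pi * (sg i * \<phi> (\<gamma> i s))) = Kint \<phi> i s - \<sigma> * sg i * \<phi> (\<gamma> i s) / 2"
    by (simp add: right_diff_distrib)
  thus ?thesis using lim by simp
qed

end

subsection \<open>Uniqueness\<close>

context layer
begin

lemma U_attains_max: "\<exists>p. \<forall>z. U z \<le> U p"
proof -
  have "\<exists>p\<in>cball 0 (1 + norm \<tau>). \<forall>z\<in>cball 0 (1 + norm \<tau>). U z \<le> U p"
    using norm_ge_zero[of \<tau>]
    by (intro continuous_attains_sup) (auto intro!: continuous_at_imp_continuous_on U_isCont simp del: norm_ge_zero)
  then obtain p where p: "\<And>z. z \<in> cball 0 (1 + norm \<tau>) \<Longrightarrow> U z \<le> U p" by blast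
  have "U z \<le> U p" for z
  proof -
    obtain l where l: "l \<in> \<Lambda>" "norm (z - l) \<le> 1 + norm \<tau>" using lattice_reduce[OF tau] by blast
    have "U z = U (z - l)" using U_lattice[OF l(1), of "z - l"] by simp
    thus ?thesis using p[of "z - l"] l(2) by simp
  qed
  thus ?thesis by blast
qed

lemma nrm_continuous: "j \<in> J \<Longrightarrow> continuous_on A (nrm j)"
  unfolding nrm_def[abs_def] by (intro continuous_intros) (auto simp: d\<gamma>_nonzero)

lemma exterior_normal_limit:
  assumes i: "i \<in> J" and R: "R > 0" "\<And>s. ball (\<gamma> i s - of_real R * nrm i s) R \<subseteq> \<Omega>"
  shows "((\<lambda>\<epsilon>::real. nrm i s \<bullet> grad U (\<gamma> i s - of_real \<epsilon> * nrm i s)) \<longlongrightarrow> 1/2 * \<phi> (\<gamma> i s) + Kint \<phi> i s) (at_right 0)"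
proof -
  interpret h: c2_hole "\<gamma> i" "d\<gamma> i" "dd\<gamma> i" "D i" by (rule hole[OF i])
  have "((\<lambda>z. Re (nrm i s * G z)) \<longlongrightarrow> Kint \<phi> i s - (- sg i) * sg i * \<phi> (\<gamma> i s) / 2)
      (at (\<gamma> i s) within h.side_cone (- sg i) (1 / norm (d\<gamma> i s)) s)"
    by (rule normal_jump[OF i]) (use d\<gamma>_nonzero[OF i] sg_cases[of i] in auto)
  hence "((\<lambda>z. Re (nrm i s * G z)) \<longlongrightarrow> Kint \<phi> i s - (- sg i) * sg i * \<phi> (\<gamma> i s) / 2)
      (at (\<gamma> i s) within approach i s 1)"
    by (rule tendsto_within_subset) (simp add: approach_eq[OF i])
  moreover have "Kint \<phi> i s - (- sg i) * sg i * \<phi> (\<gamma> i s) / 2 = 1/2 * \<phi> (\<gamma> i s) + Kint \<phi> i s"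
    using sg_cases[of i] by auto
  ultimately have "((\<lambda>\<epsilon>. Re (nrm i s * G (\<gamma> i s - of_real \<epsilon> * nrm i s))) \<longlongrightarrow> 1/2 * \<phi> (\<gamma> i s) + Kint \<phi> i s) (at_right 0)"
    using filterlim_compose[OF _ normal_approach[OF i zero_less_one order_refl]] by (simp only:)
  moreover have "\<forall>\<^sub>F \<epsilon> in at_right (0::real). Re (nrm i s * G (\<gamma> i s - of_real \<epsilon> * nrm i s)) = nrm i s \<bullet> grad U (\<gamma> i s - of_real \<epsilon> * nrm i s)"
  proof -
    have "\<forall>\<^sub>F \<epsilon> in at_right (0::real). \<epsilon> \<in> {0<..<R}" using R(1) by (rule eventually_at_right_real)
    thus ?thesis
    proof eventually_elim
      case (elim \<epsilon>)
      have "norm (of_real (\<epsilon> - R) * nrm i s) < R" using elim by (simp add: norm_mult norm_nrm[OF i] del: of_real_diff)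
      moreover have "\<gamma> i s - of_real R * nrm i s - (\<gamma> i s - of_real \<epsilon> * nrm i s) = of_real (\<epsilon> - R) * nrm i s" by (simp add: algebra_simps)
      ultimately have "\<gamma> i s - of_real \<epsilon> * nrm i s \<in> ball (\<gamma> i s - of_real R * nrm i s) R"
        unfolding mem_ball dist_norm by simp
      thus ?case using R(2) Omega_W by (intro grad_U[symmetric]) blast
    qed
  qed
  ultimately show ?thesis by (rule Lim_transform_eventually)
qed

text \<open>If the maximum is attained at a curve point, Hopf's lemma forbids strict inequality in
  the exterior tangent ball, since the normal derivative is 0; by the strong maximum principle
  \<open>U\<close> is then constant in that ball. Neighbouring balls overlap, so the set of maximal
  parameters is open as well as closed.\<close>

lemma maximum_on_curve:
  assumes N: "\<And>s. 1/2 * \<phi> (\<gamma> j s) + Kint \<phi> j s = 0" and m: "\<And>z. U z \<le> m" and j: "j \<in> J"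
    and R: "R > 0" "\<And>s. ball (\<gamma> j s - of_real R * nrm j s) R \<subseteq> \<Omega>" and p: "U (\<gamma> j s) = m"
  shows "U (\<gamma> j t) = m" "z \<in> ball (\<gamma> j t - of_real R * nrm j t) R \<Longrightarrow> U z = m"
proof -
  let ?c = "\<lambda>t. \<gamma> j t - of_real R * nrm j t"
  have re: "locally_Re (ball (?c t) R) U" for t
    using R(2) Omega_W by (intro locally_Re_subset[OF U_locally_Re]) auto
  have spread: "U w = m" if "z \<in> ball (?c t) R" "U z = m" "w \<in> ball (?c t) R" for z w t
    using locally_Re_strong_max[OF re connected_ball that(1) _ that(3)] m that(2) by simp
  have touch: "\<exists>z\<in>ball (?c t) R. U z = m" if "U (\<gamma> j t) = m" for t
  proof (rule ccontr)
    assume "\<not> ?thesis"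
    hence less: "U z < m" if "z \<in> ball (?c t) R" for z using m[of z] that by force
    show False
    proof (rule hopf[OF re _ R(1) less norm_nrm[OF j]])
      show "continuous_on (cball (?c t) R) U" by (intro continuous_at_imp_continuous_on ballI U_isCont)
      show "U (?c t + of_real R * nrm j t) = m" using that by simp
      show "((\<lambda>s. nrm j t \<bullet> grad U (?c t + of_real (R - s) * nrm j t)) \<longlongrightarrow> 0) (at_right 0)"
        using exterior_normal_limit[OF j R, of t] unfolding N by (simp add: algebra_simps)
    qed
  qed
  have attained: "U (\<gamma> j t) = m" if "\<And>z. z \<in> ball (?c t) R \<Longrightarrow> U z = m" for t
  proof (rule continuous_constant_on_closure[of "ball (?c t) R" U])
    show "continuous_on (closure (ball (?c t) R)) U" by (intro continuous_at_imp_continuous_on ballI U_isCont)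
    show "\<gamma> j t \<in> closure (ball (?c t) R)" using R(1) by (simp add: dist_norm norm_mult norm_nrm[OF j])
  qed (rule that)
  let ?T = "{t. U (\<gamma> j t) = m}"
  have "closed ?T"
    using continuous_closed_preimage_constant[of UNIV "\<lambda>t. U (\<gamma> j t)" m]
      continuous_on_compose2[of UNIV U UNIV "\<gamma> j"] U_isCont curve_continuous(1)[OF j continuous_on_id, of UNIV]
    by (simp add: continuous_at_imp_continuous_on)
  moreover have "open ?T"
    unfolding open_contains_ball
  proof
    fix t assume t: "t \<in> ?T"
    have "isCont ?c t"
      using continuous_on_eq_continuous_at[OF open_UNIV, of ?c]
        continuous_on_diff[OF curve_continuous(1)[OF j continuous_on_id] continuous_on_mult[OF continuous_on_const nrm_continuous[OF j]]]
      by simp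
    hence "\<forall>\<^sub>F u in at t. dist (?c u) (?c t) < R" unfolding isCont_def by (rule tendstoD) (rule R(1))
    then obtain d where d: "d > 0" "\<And>u. u \<noteq> t \<Longrightarrow> dist u t < d \<Longrightarrow> dist (?c u) (?c t) < R"
      unfolding eventually_at by auto
    have "u \<in> ?T" if "u \<in> ball t d" for u
    proof (cases "u = t")
      case False
      \<comment> \<open>The centre of the neighbouring ball already lies in the present one, which
        passes the maximal value on to it.\<close>
      hence c: "?c u \<in> ball (?c t) R" using d(2)[OF False] that by (simp add: dist_commute)
      obtain z where "z \<in> ball (?c t) R" "U z = m" using touch t by blast
      hence "U (?c u) = m" using spread c by blast
      hence "U z = m" if "z \<in> ball (?c u) R" for z using spread[of "?c u" u z] R(1) that by simp
      thus ?thesis using attained by blast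
    qed (use t in simp)
    thus "\<exists>d>0. ball t d \<subseteq> ?T" using d(1) by blast
  qed
  ultimately have "?T = UNIV" using clopen[of ?T] p by blast
  thus *: "U (\<gamma> j t) = m" for t by blast
  show "U z = m" if "z \<in> ball (?c t) R" for z using touch[OF *[of t]] spread that by blast
qed

text \<open>The maximum set is closed and open in the plane. The delicate case is a curve point: the
  maximal value spreads along the whole curve, from there into all exterior tangent balls, and into
  the hole because the whole frontier carries it. Balls on the other translates are handled by
  periodicity.\<close>

lemma constant_potential:
  assumes N: "\<And>j s. j \<in> J \<Longrightarrow> 1/2 * \<phi> (\<gamma> j s) + Kint \<phi> j s = 0"
  shows "\<exists>m. \<forall>z. U z = m"
proof -
  obtain p where p: "\<And>z. U z \<le> U p" using U_attains_max by blast
  define m where "m = U p"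
  have m: "U z \<le> m" for z using p by (simp add: m_def)
  obtain R where R: "R > 0" "\<And>j s. j \<in> J \<Longrightarrow> ball (\<gamma> j s + of_real R * nrm j s) R \<subseteq> D j"
      "\<And>j s. j \<in> J \<Longrightarrow> ball (\<gamma> j s - of_real R * nrm j s) R \<subseteq> \<Omega>"
    using exterior_balls by blast
  obtain d where d: "d > 0" "\<And>j s z. j \<in> J \<Longrightarrow> dist z (\<gamma> j s) < d \<Longrightarrow> z \<notin> closure (D j) \<Longrightarrow> z \<in> \<Omega>"
    using near_curve_Omega by blast
  have near: "U z = m" if j: "j \<in> J" and s: "U (\<gamma> j s) = m" and z: "dist z (\<gamma> j s) < min d R" for j s z
  proof -
    note mc = maximum_on_curve[OF N[OF j] m j R(1) R(3)[OF j] s]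
    interpret h: c2_hole "\<gamma> j" "d\<gamma> j" "dd\<gamma> j" "D j" by (rule hole[OF j])
    have Dj: "U z = m" if z: "z \<in> D j" for z
    proof -
      \<comment> \<open>A minimum principle in the hole, as the weak maximum principle for
        \<open>- U\<close>.\<close>
      have "- 1 * U z \<le> - m"
      proof (rule locally_Re_weak_max[OF locally_Re_cmult _ bounded_hole[OF j] _ z])
        show "locally_Re (D j) U" by (rule locally_Re_subset[OF U_locally_Re hole_W[OF j] h.open_D])
        show "continuous_on (closure (D j)) (\<lambda>z. - 1 * U z)"
          by (intro continuous_intros continuous_at_imp_continuous_on ballI U_isCont)
        show "- 1 * U z \<le> - m" if "z \<in> frontier (D j)" for z
          using that mc(1) unfolding frontier_D[OF j] by force
      qed
      thus ?thesis using m[of z] by simp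
    qed
    show ?thesis
    proof (cases "z \<in> closure (D j)")
      case True
      thus ?thesis using Dj mc(1) unfolding h.closure_D by blast
    next
      case False
      hence "z \<in> \<Omega>" using d(2)[OF j _ False, of s] z by simp
      then obtain t where "z \<in> ball (\<gamma> j t - of_real R * nrm j t) R"
        using near_curve_ball[OF j R(1) R(2)[OF j]] z by auto
      thus ?thesis by (rule mc(2))
    qed
  qed
  let ?A = "{z. U z = m}"
  have "closed ?A"
    using continuous_closed_preimage_constant[of UNIV U m] U_isCont by (simp add: continuous_at_imp_continuous_on)
  moreover have "open ?A"
    unfolding open_contains_ball
  proof
    fix z assume z: "z \<in> ?A"
    show "\<exists>e>0. ball z e \<subseteq> ?A"
    proof (cases "z \<in> W")
      case True
      have "U w \<le> U z" for w using m[of w] z by simp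
      then obtain r where r: "r > 0" "\<forall>w\<in>ball z r. U w = U z" using locally_Re_local_max[OF U_locally_Re True] by blast
      have "ball z r \<subseteq> ?A"
      proof
        fix w assume "w \<in> ball z r"
        hence "U w = U z" using r by blast
        thus "w \<in> ?A" using z by (simp only: mem_Collect_eq)
      qed
      thus ?thesis using r(1) by blast
    next
      case False
      then obtain j t l where jtl: "j \<in> J" "l \<in> \<Lambda>" "z = \<gamma> j t + l" by (rule not_W)
      have U1: "U (w - l) = U w" for w using U_lattice[OF jtl(2), of "w - l"] by simp
      have s: "U (\<gamma> j t) = m" using U1[of z] z jtl(3) by simp
      have "w \<in> ?A" if "w \<in> ball z (min d R)" for w
      proof -
        have "dist (w - l) (\<gamma> j t) = norm (- (w - l - \<gamma> j t))" unfolding norm_minus_cancel dist_norm ..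
        also have "- (w - l - \<gamma> j t) = \<gamma> j t + l - w" by simp
        finally have "dist (w - l) (\<gamma> j t) = dist z w" unfolding dist_norm jtl(3) .
        hence "U (w - l) = m" using that by (intro near[OF jtl(1) s]) (simp only: mem_ball)
        thus ?thesis using U1 by simp
      qed
      thus ?thesis using d(1) R(1) by (intro exI[of _ "min d R"]) auto
    qed
  qed
  moreover have "p \<in> ?A" by (simp only: m_def mem_Collect_eq)
  ultimately have "?A = UNIV" using clopen[of ?A] by blast
  thus ?thesis by blast
qed

lemma injective:
  assumes N: "\<And>j s. j \<in> J \<Longrightarrow> 1/2 * \<phi> (\<gamma> j s) + Kint \<phi> j s = 0" and i: "i \<in> J"
  shows "\<phi> (\<gamma> i s) = 0"
proof -
  interpret h: c2_hole "\<gamma> i" "d\<gamma> i" "dd\<gamma> i" "D i" by (rule hole[OF i])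
  obtain m where "\<And>z. U z = m" using constant_potential[OF N] by blast
  hence "U = (\<lambda>z. m)" by blast
  hence grad0: "grad U z = 0" for z by (simp add: grad_def dir_deriv_def complex_eq_iff)
  obtain \<kappa> where \<kappa>: "\<kappa> > 0" "at (\<gamma> i s) within h.side_cone (sg i) \<kappa> s \<noteq> bot"
    using h.cone_nontrivial sg_cases[of i] by blast
  have "\<forall>\<^sub>F z in at (\<gamma> i s) within h.side_cone (sg i) \<kappa> s. Re (nrm i s * G z) = 0"
    using h.sides(1)[OF \<kappa>(1), of s] unfolding orient_eq[OF i]
  proof eventually_elim
    case (elim z)
    hence "z \<in> W" using hole_W[OF i] by blast
    from grad_U[OF this, of "nrm i s"] show ?case by (simp add: grad0)
  qed
  hence "((\<lambda>z. Re (nrm i s * G z)) \<longlongrightarrow> 0) (at (\<gamma> i s) within h.side_cone (sg i) \<kappa> s)"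
    by (rule tendsto_eventually)
  moreover have "((\<lambda>z. Re (nrm i s * G z)) \<longlongrightarrow> Kint \<phi> i s - sg i * sg i * \<phi> (\<gamma> i s) / 2) (at (\<gamma> i s) within h.side_cone (sg i) \<kappa> s)"
    by (rule normal_jump[OF i \<kappa>(1)]) (rule sg_cases)
  ultimately have "Kint \<phi> i s - sg i * sg i * \<phi> (\<gamma> i s) / 2 = 0" using tendsto_unique[OF \<kappa>(2)] by blast
  thus ?thesis using N[OF i, of s] sg_cases[of i] by auto
qed

end

subsection \<open>Existence\<close>

context torus_domain
begin

lemma arc_integral_eq: "arc_integral (\<gamma> j) f = integral {0..1} (\<lambda>t. f (\<gamma> j t) * norm (d\<gamma> j t))"
  by (simp add: arc_integral_def d\<gamma>_def)

lemma arc_integral_cong: "(\<And>t. f (\<gamma> j t) = g (\<gamma> j t)) \<Longrightarrow> arc_integral (\<gamma> j) f = arc_integral (\<gamma> j) g"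
  by (simp add: arc_integral_def)

text \<open>A closed set of values pulls back to a finite union of images of compact parameter sets.
  Continuity thus descends from the parameters to the boundary, as for a quotient map.\<close>

lemma boundary_function:
  fixes F :: "nat \<Rightarrow> real \<Rightarrow> real"
  assumes F: "\<And>j. j \<in> J \<Longrightarrow> continuous_on UNIV (F j)" "\<And>j t. j \<in> J \<Longrightarrow> F j (t + 1) = F j t"
  obtains \<phi> where "continuous_on (boundary M D) \<phi>" "\<And>j t. j \<in> J \<Longrightarrow> \<phi> (\<gamma> j t) = F j t"
proof -
  define \<phi> where "\<phi> z = (SOME y. \<exists>j\<in>J. \<exists>t. z = \<gamma> j t \<and> y = F j t)" for z
  have Fint: "F j (t + of_int k) = F j t" if "j \<in> J" for j t k
    by (rule periodic_of_int) (rule F(2)[OF that])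
  have \<phi>: "\<phi> (\<gamma> j t) = F j t" if j: "j \<in> J" for j t
    unfolding \<phi>_def
  proof (rule some_equality)
    show "\<exists>i\<in>J. \<exists>s. \<gamma> j t = \<gamma> i s \<and> F j t = F i s" using j by blast
  next
    fix y assume "\<exists>i\<in>J. \<exists>s. \<gamma> j t = \<gamma> i s \<and> y = F i s"
    then obtain i s where ijs: "i \<in> J" "\<gamma> j t = \<gamma> i s" "y = F i s" by blast
    obtain n :: int where "i = j" "s = t + of_int n" using curve_unique[OF ijs(1) j ijs(2)[symmetric]] by blast
    thus "y = F j t" using ijs(3) Fint[OF j] by simp
  qed
  have "continuous_on (boundary M D) \<phi>"
    unfolding continuous_on_closed_invariant
  proof (intro allI impI)
    fix B :: "real set" assume B: "closed B"
    let ?A = "\<Union>j\<in>J. \<gamma> j ` ({0..1} \<inter> F j -` B)"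
    have "closed ?A"
    proof (intro closed_UN ballI compact_imp_closed compact_continuous_image)
      fix j assume j: "j \<in> J"
      show "continuous_on ({0..1} \<inter> F j -` B) (\<gamma> j)" by (rule curve_continuous(1)[OF j continuous_on_id])
      have "closed (F j -` B)" using continuous_closed_vimage[OF B, of "F j"] F(1)[OF j]
        by (simp add: continuous_on_eq_continuous_at)
      thus "compact ({0..1} \<inter> F j -` B)" by (intro compact_Int_closed) auto
    qed simp
    moreover have "?A \<inter> boundary M D = \<phi> -` B \<inter> boundary M D"
    proof
      show "?A \<inter> boundary M D \<subseteq> \<phi> -` B \<inter> boundary M D" using \<phi> by auto
      show "\<phi> -` B \<inter> boundary M D \<subseteq> ?A \<inter> boundary M D"
      proof
        fix z assume z: "z \<in> \<phi> -` B \<inter> boundary M D"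
        then obtain j t where jt: "j \<in> J" "z = \<gamma> j t" unfolding boundary_eq by blast
        obtain k :: int where k: "t + of_int k \<in> {0..<1}" using real_reduce by blast
        have "\<gamma> j (t + of_int k) = \<gamma> j t" by (rule periodic_of_int) (rule curve_periodic(1)[OF jt(1)])
        hence "z = \<gamma> j (t + of_int k)" using jt(2) by simp
        moreover have "t + of_int k \<in> {0..1} \<inter> F j -` B"
          using z k \<phi>[OF jt(1), of t] Fint[OF jt(1), of t k] jt(2) by simp
        ultimately have "z \<in> \<gamma> j ` ({0..1} \<inter> F j -` B)" by (rule image_eqI)
        thus "z \<in> ?A \<inter> boundary M D" using jt(1) z by blast
      qed
    qed
    ultimately show "\<exists>A. closed A \<and> A \<inter> boundary M D = \<phi> -` B \<inter> boundary M D" by blast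
  qed
  thus ?thesis using that \<phi> by blast
qed

text \<open>
  The correction makes the integral equation preserve total mass, so that every solution with a
  mean-zero right-hand side has mean zero; the correction then acts as zero on it.
\<close>

definition corrected_kern :: "nat \<Rightarrow> nat \<Rightarrow> real \<Rightarrow> real \<Rightarrow> real" where
  "corrected_kern i j s t = kern i j s t - flux_const i / norm (d\<gamma> i s)"

lemma corrected_integral:
  assumes i: "i \<in> J" and f: "\<And>j. j \<in> J \<Longrightarrow> continuous_on UNIV (f j)"
  shows "(\<Sum>j\<in>J. integral {0..1} (\<lambda>t. corrected_kern i j s t * f j t)) =
    (\<Sum>j\<in>J. integral {0..1} (\<lambda>t. kern i j s t * f j t)) - flux_const i / norm (d\<gamma> i s) * (\<Sum>j\<in>J. integral {0..1} (f j))"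
proof -
  have "integral {0..1} (\<lambda>t. corrected_kern i j s t * f j t) =
      integral {0..1} (\<lambda>t. kern i j s t * f j t) - flux_const i / norm (d\<gamma> i s) * integral {0..1} (f j)" if j: "j \<in> J" for j
  proof -
    have c: "continuous_on {0..1} (\<lambda>t. kern i j s t * f j t)" "continuous_on {0..1} (f j)"
      by (intro continuous_on_mult continuous_on_curry(1)[OF kern_continuous[OF i j]] continuous_on_subset[OF f[OF j]] subset_UNIV)+
    have "integral {0..1} (\<lambda>t. corrected_kern i j s t * f j t) =
        integral {0..1} (\<lambda>t. kern i j s t * f j t - flux_const i / norm (d\<gamma> i s) * f j t)"
      by (simp add: corrected_kern_def left_diff_distrib)
    also have "\<dots> = integral {0..1} (\<lambda>t. kern i j s t * f j t) - integral {0..1} (\<lambda>t. flux_const i / norm (d\<gamma> i s) * f j t)"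
      by (intro integral_diff integrable_continuous_real c continuous_on_mult continuous_on_const)
    finally show ?thesis by simp
  qed
  thus ?thesis by (simp add: sum_subtractf sum_distrib_left)
qed

text \<open>The mass-dependent term of \<open>flux_identity\<close> is cancelled by the correction,
  which times the speed is constant over the period. The identity holds for any total mass; this is
  what allows mean zero to be deduced for a solution.\<close>

lemma corrected_mass:
  assumes i: "i \<in> J" and F: "\<And>j. j \<in> J \<Longrightarrow> continuous_on UNIV (F j)"
  shows "integral {0..1} (\<lambda>s. (1/2 * F i s + (\<Sum>j\<in>J. integral {0..1} (\<lambda>t. corrected_kern i j s t * (F j t * norm (d\<gamma> j t))))) * norm (d\<gamma> i s))
    = integral {0..1} (\<lambda>t. F i t * norm (d\<gamma> i t))"
proof -
  let ?f = "\<lambda>j t. F j t * norm (d\<gamma> j t)"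
  have f: "continuous_on UNIV (?f j)" if "j \<in> J" for j
    by (intro continuous_intros F that)
  let ?L = "\<Sum>j\<in>J. integral {0..1} (?f j)"
  let ?k = "\<lambda>s. (\<Sum>j\<in>J. integral {0..1} (\<lambda>t. kern i j s t * ?f j t)) * norm (d\<gamma> i s)"
  have "(1/2 * F i s + (\<Sum>j\<in>J. integral {0..1} (\<lambda>t. corrected_kern i j s t * ?f j t))) * norm (d\<gamma> i s) =
      1/2 * ?f i s + ?k s - flux_const i * ?L" for s
  proof -
    have "norm (d\<gamma> i s) \<noteq> 0" using d\<gamma>_nonzero[OF i] by simp
    hence alg: "(1/2 * x + (k - flux_const i / norm (d\<gamma> i s) * L)) * norm (d\<gamma> i s) =
        1/2 * (x * norm (d\<gamma> i s)) + k * norm (d\<gamma> i s) - flux_const i * L" for x k L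
      by (simp add: field_simps)
    have "(\<Sum>j\<in>J. integral {0..1} (\<lambda>t. corrected_kern i j s t * ?f j t)) =
        (\<Sum>j\<in>J. integral {0..1} (\<lambda>t. kern i j s t * ?f j t)) - flux_const i / norm (d\<gamma> i s) * ?L"
      by (rule corrected_integral[OF i f])
    thus ?thesis by (simp only: alg)
  qed
  hence "integral {0..1} (\<lambda>s. (1/2 * F i s + (\<Sum>j\<in>J. integral {0..1} (\<lambda>t. corrected_kern i j s t * ?f j t))) * norm (d\<gamma> i s))
      = integral {0..1} (\<lambda>s. 1/2 * ?f i s + ?k s - flux_const i * ?L)" by (simp only:)
  also have "\<dots> = integral {0..1} (\<lambda>s. 1/2 * ?f i s) + integral {0..1} ?k - integral {0..1} (\<lambda>s::real. flux_const i * ?L)"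
  proof -
    have "continuous_on {0..1} ?k"
      by (intro continuous_on_mult continuous_on_sum continuous_on_subset[OF kern_integrable[OF i _ f]] continuous_intros i) auto
    hence k: "?k integrable_on {0..1}" by (rule integrable_continuous_real)
    have f2: "(\<lambda>s. 1/2 * ?f i s) integrable_on {0..1}"
      by (intro integrable_continuous_real continuous_on_mult continuous_on_const continuous_on_subset[OF f[OF i]] subset_UNIV)
    show ?thesis
      unfolding integral_diff[OF integrable_add[OF f2 k] integrable_const_ivl] integral_add[OF f2 k] ..
  qed
  also have "integral {0..1} ?k = 1/2 * integral {0..1} (?f i) + flux_const i * ?L" by (rule flux_identity[OF i f])
  also have "integral {0..1} (\<lambda>s. 1/2 * ?f i s) = 1/2 * integral {0..1} (?f i)" by (rule integral_mult_right)
  also have "integral {0..1} (\<lambda>s::real. flux_const i * ?L) = flux_const i * ?L" by simp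
  finally show ?thesis by (simp only:)
qed

text \<open>
  Functions on the disjoint union of the boundary curves are encoded as functions on the plane;
  tent functions interpolate between the lines \<open>{i} \<times> \<real>\<close>.
\<close>

definition tent :: "nat \<Rightarrow> real \<Rightarrow> real" where
  "tent i x = max 0 (1 - \<bar>x - real i\<bar>)"

lemma tent_sum: "i \<in> J \<Longrightarrow> (\<Sum>k\<in>J. tent k (real i) * h k) = h i"
proof -
  assume i: "i \<in> J"
  have "tent k (real i) = (if k = i then 1 else 0)" for k by (auto simp: tent_def max_def)
  thus ?thesis using i by (simp add: if_distrib[of "\<lambda>x. x * _"] cong: if_cong)
qed

text \<open>Plays the part of \<open>r\<close> in \<open>integral_operator\<close>. Outside
  \<open>{0..real M + 1}\<close> all tents with index in \<open>J\<close> vanish, as they do at 0,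
  so the first coordinate may be sent there; the second is reduced modulo the period.\<close>

definition strip_reduce :: "real \<times> real \<Rightarrow> real \<times> real" where
  "strip_reduce p = (if fst p \<in> {0..real M + 1} then fst p else 0, frac (snd p))"

definition strip_kern :: "nat \<Rightarrow> real \<times> real \<Rightarrow> real \<Rightarrow> real" where
  "strip_kern j p t = (\<Sum>i\<in>J. tent i (fst p) * (corrected_kern i j (snd p) t * norm (d\<gamma> j t)))"

lemma tent_reduce: "i \<in> J \<Longrightarrow> tent i (fst (strip_reduce p)) = tent i (fst p)"
  by (auto simp: strip_reduce_def tent_def)

lemma strip_reduce_mem: "strip_reduce p \<in> {0..real M + 1} \<times> {0..1}"
  using frac_lt_1[of "snd p"] by (auto simp: strip_reduce_def less_imp_le)

lemma periodic_reduce: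
  assumes "\<And>s. f (s + 1) = f s"
  shows "f (snd (strip_reduce p)) = f (snd p)"
proof -
  have "f (snd p + of_int (- \<lfloor>snd p\<rfloor>)) = f (snd p)" by (rule periodic_of_int) (rule assms)
  thus ?thesis by (simp add: strip_reduce_def frac_def)
qed

lemma corrected_kern_periodic: "i \<in> J \<Longrightarrow> j \<in> J \<Longrightarrow> corrected_kern i j (s + 1) t = corrected_kern i j s t"
  by (simp add: corrected_kern_def kern_periodic curve_periodic)

lemma corrected_kern_continuous:
  assumes i: "i \<in> J" and j: "j \<in> J" and c: "continuous_on A f" "continuous_on A g"
  shows "continuous_on A (\<lambda>x. corrected_kern i j (f x) (g x))"
proof -
  have "continuous_on A (\<lambda>x. kern i j (fst (f x, g x)) (snd (f x, g x)))"
    by (rule continuous_on_compose2[OF kern_continuous[OF i j]]) (intro continuous_intros c, simp)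
  hence "continuous_on A (\<lambda>x. kern i j (f x) (g x))" by (simp only: fst_conv snd_conv)
  thus ?thesis unfolding corrected_kern_def using d\<gamma>_nonzero[OF i] by (intro continuous_intros i c) auto
qed

lemma tent_continuous: "continuous_on A f \<Longrightarrow> continuous_on A (\<lambda>x. tent i (f x))"
  unfolding tent_def by (intro continuous_intros)

lemma strip_operator:
  "integral_operator J strip_kern (\<lambda>j t. (real j, t)) ({0..real M + 1} \<times> {0..1}) strip_reduce"
proof
  fix j p t assume j: "j \<in> J"
  show "continuous_on UNIV (\<lambda>x. strip_kern j (fst x) (snd x))"
    unfolding strip_kern_def
    by (intro continuous_on_sum continuous_on_mult tent_continuous corrected_kern_continuous j continuous_intros)
  show "strip_kern j (strip_reduce p) t = strip_kern j p t"
    unfolding strip_kern_def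
  proof (rule sum.cong[OF refl])
    fix i assume i: "i \<in> J"
    have "corrected_kern i j (snd (strip_reduce p)) t = corrected_kern i j (snd p) t"
      by (rule periodic_reduce[where f = "\<lambda>s. corrected_kern i j s t"]) (rule corrected_kern_periodic[OF i j])
    thus "tent i (fst (strip_reduce p)) * (corrected_kern i j (snd (strip_reduce p)) t * norm (d\<gamma> j t)) =
        tent i (fst p) * (corrected_kern i j (snd p) t * norm (d\<gamma> j t))" by (simp only: tent_reduce[OF i])
  qed
qed (auto intro!: compact_Times continuous_intros strip_reduce_mem)

abbreviation strip_op :: "(real \<times> real \<Rightarrow> real) \<Rightarrow> real \<times> real \<Rightarrow> real" where
  "strip_op \<equiv> integral_operator.op_fun J strip_kern (\<lambda>j t. (real j, t))"

lemmas strip_op_def = integral_operator.op_fun_def[OF strip_operator]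

lemma strip_op_curve:
  assumes i: "i \<in> J"
  shows "strip_op f (real i, s) = (\<Sum>j\<in>J. integral {0..1} (\<lambda>t. corrected_kern i j s t * (f (real j, t) * norm (d\<gamma> j t))))"
proof -
  have "strip_kern j (real i, s) t = corrected_kern i j s t * norm (d\<gamma> j t)" for j t
    unfolding strip_kern_def fst_conv snd_conv by (rule tent_sum[OF i])
  hence "strip_kern j (real i, s) t * f (real j, t) = corrected_kern i j s t * (f (real j, t) * norm (d\<gamma> j t))" for j t
    by (simp only: mult.assoc mult.commute mult.left_commute)
  thus ?thesis by (simp only: strip_op_def)
qed

text \<open>Reads a solution of the encoded equation back as a density on the boundary, where the
  corrected and the original equation coincide.\<close>

lemma mean_zero_density:
  fixes f :: "(real \<times> real) \<Rightarrow>\<^sub>C real"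
  assumes eq: "\<And>i s. i \<in> J \<Longrightarrow> 1/2 * f (real i, s) + strip_op f (real i, s) = g (\<gamma> i s)"
    and g: "boundary_integral M \<gamma> g = 0"
  obtains \<phi> where "\<phi> \<in> mean_zero_functions M D \<gamma>" "\<And>i s. i \<in> J \<Longrightarrow> \<phi> (\<gamma> i s) = f (real i, s)"
    "\<And>i s. i \<in> J \<Longrightarrow> 1/2 * \<phi> (\<gamma> i s) + Kint \<phi> i s = g (\<gamma> i s)"
proof -
  have fc: "continuous_on UNIV (\<lambda>t. f (real j, t))" for j
    by (rule continuous_on_compose2[OF continuous_on_apply_bcontfun[of UNIV f]]) (intro continuous_on_Pair continuous_on_const continuous_on_id, simp)
  \<comment> \<open>Periodicity in the parameter is a consequence of the equation: the right-hand
    side and the operator term are periodic, hence so is \<open>f\<close>.\<close>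
  have per: "f (real j, t + 1) = f (real j, t)" if j: "j \<in> J" for j t
  proof -
    have "strip_op f (real j, t + 1) = strip_op f (real j, t)"
      unfolding strip_op_curve[OF j]
    proof (rule sum.cong[OF refl])
      fix k assume "k \<in> J"
      from corrected_kern_periodic[OF j this]
      show "integral {0..1} (\<lambda>u. corrected_kern j k (t + 1) u * (f (real k, u) * norm (d\<gamma> k u))) =
          integral {0..1} (\<lambda>u. corrected_kern j k t u * (f (real k, u) * norm (d\<gamma> k u)))" by (simp only:)
    qed
    thus ?thesis using eq[OF j, of t] eq[OF j, of "t + 1"] curve_periodic(1)[OF j, of t] by simp
  qed
  obtain \<phi> where \<phi>: "continuous_on (boundary M D) \<phi>" "\<And>j t. j \<in> J \<Longrightarrow> \<phi> (\<gamma> j t) = f (real j, t)"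
    using boundary_function[of "\<lambda>j t. f (real j, t)"] fc per by blast
  have arc: "arc_integral (\<gamma> i) \<phi> = arc_integral (\<gamma> i) g" if i: "i \<in> J" for i
  proof -
    have "arc_integral (\<gamma> i) g = integral {0..1} (\<lambda>s. (1/2 * f (real i, s) + strip_op f (real i, s)) * norm (d\<gamma> i s))"
      by (simp only: arc_integral_eq eq[OF i])
    also have "\<dots> = integral {0..1} (\<lambda>t. f (real i, t) * norm (d\<gamma> i t))"
      unfolding strip_op_curve[OF i] by (rule corrected_mass[OF i fc])
    finally show ?thesis by (simp add: arc_integral_eq \<phi>(2)[OF i])
  qed
  hence mz: "boundary_integral M \<gamma> \<phi> = 0" using g by (simp add: boundary_integral_def)
  \<comment> \<open>With total mass 0 the correction acts as zero, and the corrected kernel may be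
    exchanged for \<open>kern\<close>.\<close>
  have L: "(\<Sum>j\<in>J. integral {0..1} (\<lambda>t. f (real j, t) * norm (d\<gamma> j t))) = 0"
  proof -
    have "(\<Sum>j\<in>J. integral {0..1} (\<lambda>t. f (real j, t) * norm (d\<gamma> j t))) = boundary_integral M \<gamma> \<phi>"
      unfolding boundary_integral_def by (intro sum.cong refl) (simp add: arc_integral_eq \<phi>(2))
    thus ?thesis using mz by simp
  qed
  have K: "1/2 * \<phi> (\<gamma> i s) + Kint \<phi> i s = g (\<gamma> i s)" if i: "i \<in> J" for i s
  proof -
    have "strip_op f (real i, s) = (\<Sum>j\<in>J. integral {0..1} (\<lambda>t. kern i j s t * (f (real j, t) * norm (d\<gamma> j t))))"
    proof -
      have "continuous_on UNIV (\<lambda>t. f (real j, t) * norm (d\<gamma> j t))" if "j \<in> J" for j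
        by (rule continuous_on_mult[OF fc]) (intro continuous_intros that)
      thus ?thesis unfolding strip_op_curve[OF i] using corrected_integral[OF i, of "\<lambda>j t. f (real j, t) * norm (d\<gamma> j t)" s] L by simp
    qed
    also have "\<dots> = Kint \<phi> i s" unfolding Kint_def by (intro sum.cong refl) (simp add: \<phi>(2))
    finally show ?thesis using eq[OF i, of s] \<phi>(2)[OF i] by simp
  qed
  show ?thesis by (rule that[OF _ \<phi>(2) K]) (use \<phi>(1) mz in \<open>auto simp: mean_zero_functions_def\<close>)
qed

lemma mean_zero_layer: "\<phi> \<in> mean_zero_functions M D \<gamma> \<Longrightarrow> layer \<tau> M D \<gamma> \<phi>"
  by unfold_locales (auto simp: mean_zero_functions_def)

theorem integral_equation_solvable:
  assumes g: "g \<in> mean_zero_functions M D \<gamma>"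
  obtains \<phi> where "\<phi> \<in> mean_zero_functions M D \<gamma>" "\<And>i s. i \<in> J \<Longrightarrow> 1/2 * \<phi> (\<gamma> i s) + Kint \<phi> i s = g (\<gamma> i s)"
proof -
  \<comment> \<open>The right-hand side interpolated over the plane by the tents. Its invariance
    under \<open>strip_reduce\<close> makes it bounded.\<close>
  let ?h = "\<lambda>p. \<Sum>i\<in>J. tent i (fst p) * g (\<gamma> i (snd p))"
  have gc: "continuous_on (boundary M D) g" and g0: "boundary_integral M \<gamma> g = 0" using g by (auto simp: mean_zero_functions_def)
  have hc: "continuous_on A ?h" for A
    by (intro continuous_on_sum continuous_on_mult tent_continuous boundary_continuous[OF gc] continuous_intros)
  have hr: "?h (strip_reduce p) = ?h p" for p
  proof (rule sum.cong[OF refl])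
    fix i assume i: "i \<in> J"
    have "g (\<gamma> i (snd (strip_reduce p))) = g (\<gamma> i (snd p))"
      by (rule periodic_reduce[where f = "\<lambda>s. g (\<gamma> i s)"]) (simp only: curve_periodic(1)[OF i])
    thus "tent i (fst (strip_reduce p)) * g (\<gamma> i (snd (strip_reduce p))) = tent i (fst p) * g (\<gamma> i (snd p))"
      by (simp only: tent_reduce[OF i])
  qed
  have "bounded (?h ` ({0..real M + 1} \<times> {0..1}))"
    by (rule compact_imp_bounded[OF compact_continuous_image[OF hc]]) (intro compact_Times compact_Icc)
  moreover have "range ?h \<subseteq> ?h ` ({0..real M + 1} \<times> {0..1})"
  proof (rule image_subsetI)
    fix p show "?h p \<in> ?h ` ({0..real M + 1} \<times> {0..1})" by (rule image_eqI[of _ _ "strip_reduce p"], rule hr[symmetric], rule strip_reduce_mem)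
  qed
  ultimately have "bounded (range ?h)" by (rule bounded_subset)
  hence "?h \<in> bcontfun" using hc[of UNIV] by (simp add: bcontfun_def)
  from Bcontfun_inverse[OF this] obtain h where "apply_bcontfun h = ?h" by blast
  hence h: "apply_bcontfun h p = ?h p" for p by (simp only:)
  have "\<exists>f. \<forall>p. 1/2 * apply_bcontfun f p + strip_op (apply_bcontfun f) p = apply_bcontfun h p"
  proof (rule integral_operator.second_kind_solvable[OF strip_operator])
    fix f :: "(real \<times> real) \<Rightarrow>\<^sub>C real"
    assume f: "\<And>p. 1/2 * apply_bcontfun f p + strip_op (apply_bcontfun f) p = 0"
    obtain \<phi> where \<phi>: "\<phi> \<in> mean_zero_functions M D \<gamma>" "\<And>i s. i \<in> J \<Longrightarrow> \<phi> (\<gamma> i s) = f (real i, s)"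
      "\<And>i s. i \<in> J \<Longrightarrow> 1/2 * \<phi> (\<gamma> i s) + Kint \<phi> i s = 0"
      by (rule mean_zero_density[of f "\<lambda>z. 0"]) (use f in \<open>auto simp: boundary_integral_def arc_integral_def\<close>)
    have "f (real i, s) = 0" if "i \<in> J" for i s
      using layer.injective[OF mean_zero_layer[OF \<phi>(1)] \<phi>(3) that] \<phi>(2)[OF that] by simp
    \<comment> \<open>The operator sees \<open>f\<close> only on the lines. Once \<open>f\<close>
      vanishes there, the operator term is 0 at every point of the plane, and the equation gives
      \<open>f = 0\<close> between the lines too.\<close>
    hence "strip_op f p = 0" for p unfolding strip_op_def by simp
    hence "f p = 0" for p using f[of p] by simp
    thus "f = 0" by (intro bcontfun_eqI) simp
  qed
  then obtain f where f: "\<And>p. 1/2 * apply_bcontfun f p + strip_op (apply_bcontfun f) p = apply_bcontfun h p" by blast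
  show ?thesis
  proof (rule mean_zero_density[OF _ g0])
    show "1/2 * f (real i, s) + strip_op f (real i, s) = g (\<gamma> i s)" if "i \<in> J" for i s
      unfolding f h fst_conv snd_conv by (rule tent_sum[OF that])
  qed (rule that)
qed

lemma integral_equation_unique:
  assumes \<phi>: "\<phi> \<in> mean_zero_functions M D \<gamma>" and \<psi>: "\<psi> \<in> mean_zero_functions M D \<gamma>"
    and eq: "\<And>i s. i \<in> J \<Longrightarrow> 1/2 * \<phi> (\<gamma> i s) + Kint \<phi> i s = 1/2 * \<psi> (\<gamma> i s) + Kint \<psi> i s" and i: "i \<in> J"
  shows "\<psi> (\<gamma> i s) = \<phi> (\<gamma> i s)"
proof -
  have \<phi>c: "continuous_on (boundary M D) \<phi>" and \<psi>c: "continuous_on (boundary M D) \<psi>"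
    using \<phi> \<psi> by (auto simp: mean_zero_functions_def)
  have int: "integral {0..1} (\<lambda>t. k t * ((\<psi> (\<gamma> j t) - \<phi> (\<gamma> j t)) * norm (d\<gamma> j t))) =
      integral {0..1} (\<lambda>t. k t * (\<psi> (\<gamma> j t) * norm (d\<gamma> j t))) - integral {0..1} (\<lambda>t. k t * (\<phi> (\<gamma> j t) * norm (d\<gamma> j t)))"
    if "j \<in> J" "continuous_on {0..1} k" for j k
  proof -
    have "continuous_on {0..1} (\<lambda>t. k t * (\<psi> (\<gamma> j t) * norm (d\<gamma> j t)))" "continuous_on {0..1} (\<lambda>t. k t * (\<phi> (\<gamma> j t) * norm (d\<gamma> j t)))"
      by (intro continuous_intros boundary_continuous[OF \<psi>c] boundary_continuous[OF \<phi>c] that)+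
    from integral_diff[OF this[THEN integrable_continuous_real]] show ?thesis by (simp add: algebra_simps)
  qed
  let ?d = "\<lambda>z. \<psi> z - \<phi> z"
  have "?d \<in> mean_zero_functions M D \<gamma>"
  proof -
    have "arc_integral (\<gamma> j) ?d = arc_integral (\<gamma> j) \<psi> - arc_integral (\<gamma> j) \<phi>" if "j \<in> J" for j
      using int[OF that, of "\<lambda>t. 1"] by (simp add: arc_integral_eq)
    hence "boundary_integral M \<gamma> ?d = boundary_integral M \<gamma> \<psi> - boundary_integral M \<gamma> \<phi>"
      by (simp add: boundary_integral_def sum_subtractf)
    thus ?thesis using \<phi> \<psi> by (auto simp: mean_zero_functions_def intro: continuous_on_diff)
  qed
  moreover have "1/2 * ?d (\<gamma> i s) + Kint ?d i s = 0" if i: "i \<in> J" for i s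
  proof -
    have "Kint ?d i s = Kint \<psi> i s - Kint \<phi> i s"
      unfolding Kint_def sum_subtractf[symmetric]
      by (intro sum.cong refl int) (auto intro: continuous_on_curry(1)[OF kern_continuous[OF i]])
    thus ?thesis using eq[OF i, of s] by (simp add: diff_divide_distrib)
  qed
  ultimately have "?d (\<gamma> i s) = 0" using layer.injective[OF mean_zero_layer _ i, of ?d s] by simp
  thus ?thesis by simp
qed

end

context layer
begin

text \<open>Integrating the equation over one curve, half of the mass comes from the term
  \<open>1/2 * \<phi>\<close> and half from the kernel; the background term is multiplied by the
  total mass 0.\<close>

lemma layer_flux:
  assumes eq: "\<And>i s. i \<in> J \<Longrightarrow> 1/2 * \<phi> (\<gamma> i s) + Kint \<phi> i s = g (\<gamma> i s)" and i: "i \<in> J"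
  shows "arc_integral (\<gamma> i) g = arc_integral (\<gamma> i) \<phi>"
proof -
  let ?k = "\<lambda>s. (\<Sum>j\<in>J. integral {0..1} (\<lambda>t. kern i j s t * den j t)) * norm (d\<gamma> i s)"
  have "continuous_on {0..1} ?k"
    by (intro continuous_on_mult continuous_on_sum continuous_on_subset[OF kern_integrable[OF i _ den_cont]] continuous_intros i) auto
  hence k: "?k integrable_on {0..1}" by (rule integrable_continuous_real)
  have d: "(\<lambda>s. 1/2 * den i s) integrable_on {0..1}"
    by (intro integrable_continuous_real continuous_on_mult continuous_on_const den_cont i)
  have "g (\<gamma> i s) * norm (d\<gamma> i s) = 1/2 * den i s + ?k s" for s
    unfolding eq[OF i, symmetric] Kint_def den_def by (simp add: algebra_simps)
  hence "arc_integral (\<gamma> i) g = integral {0..1} (\<lambda>s. 1/2 * den i s + ?k s)" by (simp only: arc_integral_eq)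
  also have "\<dots> = integral {0..1} (\<lambda>s. 1/2 * den i s) + integral {0..1} ?k" by (rule integral_add[OF d k])
  also have "integral {0..1} ?k = 1/2 * integral {0..1} (den i) + flux_const i * (\<Sum>j\<in>J. integral {0..1} (den j))"
    by (rule flux_identity[OF i den_cont])
  also have "integral {0..1} (\<lambda>s. 1/2 * den i s) = 1/2 * integral {0..1} (den i)" by (rule integral_mult_right)
  finally have "arc_integral (\<gamma> i) g = integral {0..1} (den i)" unfolding sum_den by simp
  thus ?thesis by (simp add: arc_integral_eq den_def[abs_def])
qed

lemma layer_neumann:
  assumes eq: "\<And>i s. i \<in> J \<Longrightarrow> 1/2 * \<phi> (\<gamma> i s) + Kint \<phi> i s = g (\<gamma> i s)"
  shows "neumann_solution \<tau> M D \<gamma> g (\<lambda>z. U z + C)"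
proof -
  have re: "locally_Re \<Omega> (\<lambda>z. U z + C)"
    by (intro locally_Re_add locally_Re_const open_Omega locally_Re_subset[OF U_locally_Re Omega_W])
  have nd: "has_normal_deriv \<tau> M D \<gamma> (\<lambda>z. U z + C) (\<gamma> i s) (g (\<gamma> i s))" if i: "i \<in> J" for i s
    unfolding has_normal_deriv_eq[OF i]
  proof (intro allI impI)
    fix c :: real assume c: "c > 0"
    have "((\<lambda>z. Re (nrm i s * G z)) \<longlongrightarrow> Kint \<phi> i s - (- sg i) * sg i * \<phi> (\<gamma> i s) / 2)
        (at (\<gamma> i s) within c2_curve.side_cone (\<gamma> i) (d\<gamma> i) (- sg i) (c / norm (d\<gamma> i s)) s)"
      by (rule normal_jump[OF i]) (use d\<gamma>_nonzero[OF i] sg_cases[of i] c in auto)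
    hence "((\<lambda>z. Re (nrm i s * G z)) \<longlongrightarrow> Kint \<phi> i s - (- sg i) * sg i * \<phi> (\<gamma> i s) / 2) (at (\<gamma> i s) within approach i s c)"
      by (rule tendsto_within_subset) (simp add: approach_eq[OF i])
    moreover have "Kint \<phi> i s - (- sg i) * sg i * \<phi> (\<gamma> i s) / 2 = g (\<gamma> i s)"
      using sg_cases[of i] eq[OF i, of s] by auto
    ultimately have "((\<lambda>z. Re (nrm i s * G z)) \<longlongrightarrow> g (\<gamma> i s)) (at (\<gamma> i s) within approach i s c)"
      by (simp only:)
    moreover have "\<forall>\<^sub>F z in at (\<gamma> i s) within approach i s c. Re (nrm i s * G z) = nrm i s \<bullet> grad (\<lambda>z. U z + C) z"
      unfolding eventually_at_filter
    proof (intro always_eventually allI impI)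
      fix z assume "z \<in> approach i s c"
      hence "z \<in> W" using Omega_W by (auto simp: approach_def)
      from has_derivative_add[OF U_has_derivative[OF this] has_derivative_const[of C]]
      have "((\<lambda>z. U z + C) has_derivative (\<lambda>v. Re (v * G z))) (at z)" by (simp only: add_0_right)
      thus "Re (nrm i s * G z) = nrm i s \<bullet> grad (\<lambda>z. U z + C) z" by (rule grad_eq[symmetric])
    qed
    ultimately show "((\<lambda>z. nrm i s \<bullet> grad (\<lambda>z. U z + C) z) \<longlongrightarrow> g (\<gamma> i s)) (at (\<gamma> i s) within approach i s c)"
      by (rule Lim_transform_eventually)
  qed
  show ?thesis
    unfolding neumann_solution_def
  proof (intro conjI ballI)
    show "doubly_periodic_on \<Omega> \<tau> (\<lambda>z. U z + C)"
      by (simp add: doubly_periodic_on_def U_lattice[OF lattice_1] U_lattice[OF lattice_tau])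
    show "C2_on \<Omega> (\<lambda>z. U z + C)" by (rule locally_Re_C2_on[OF re])
    show "laplacian (\<lambda>z. U z + C) z = 0" if "z \<in> \<Omega>" for z by (rule locally_Re_laplacian[OF re that])
    show "has_normal_deriv \<tau> M D \<gamma> (\<lambda>z. U z + C) z (g z)" if "z \<in> boundary M D" for z
      using that nd unfolding boundary_eq by blast
  qed
qed

end

text \<open>Boundary functions are encoded as total functions on the plane, so uniqueness is a
  statement about their values on the boundary. The flux is computed from the normal derivative of
  the potential itself and is thereby tied to both integrals.\<close>

theorem theorem1p5:
  fixes \<tau> :: complex and M :: nat
    and D :: "nat \<Rightarrow> complex set" and \<gamma> :: "nat \<Rightarrow> real \<Rightarrow> complex"
    and g :: "complex \<Rightarrow> real"
  assumes "Im \<tau> > 0"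
    and "\<forall>j\<in>{1..M}. open (D j) \<and> simply_connected (D j) \<and> C2_boundary (D j) (\<gamma> j)"
    and "disjoint_closures \<tau> M D"
    and "g \<in> mean_zero_functions M D \<gamma>"
  shows "\<exists>\<phi>\<in>mean_zero_functions M D \<gamma>.
      (\<forall>z\<^sub>0\<in>boundary M D. Kstar_converges \<tau> M D \<gamma> \<phi> z\<^sub>0 \<and>
         1/2 * \<phi> z\<^sub>0 + Kstar \<tau> M D \<gamma> \<phi> z\<^sub>0 = g z\<^sub>0) \<and>
      (\<forall>\<psi>\<in>mean_zero_functions M D \<gamma>.
         (\<forall>z\<^sub>0\<in>boundary M D. 1/2 * \<psi> z\<^sub>0 + Kstar \<tau> M D \<gamma> \<psi> z\<^sub>0 = g z\<^sub>0) \<longrightarrow>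
         (\<forall>z\<^sub>0\<in>boundary M D. \<psi> z\<^sub>0 = \<phi> z\<^sub>0)) \<and>
      (\<forall>C. neumann_solution \<tau> M D \<gamma> g (\<lambda>z. single_layer \<tau> M \<gamma> \<phi> z + C)) \<and>
      (\<forall>j\<in>{1..M}. arc_integral (\<gamma> j) g = arc_integral (\<gamma> j) \<phi> \<and>
         (\<forall>C. flux \<tau> M D \<gamma> (\<lambda>z. single_layer \<tau> M \<gamma> \<phi> z + C) j = arc_integral (\<gamma> j) g))"
proof -
  interpret torus_domain \<tau> M D \<gamma> using assms(1-3) by unfold_locales
  obtain \<phi> where mz: "\<phi> \<in> mean_zero_functions M D \<gamma>" and
      eq: "\<And>i s. i \<in> J \<Longrightarrow> 1/2 * \<phi> (\<gamma> i s) + Kint \<phi> i s = g (\<gamma> i s)"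
    using integral_equation_solvable[OF assms(4)] by blast
  interpret layer \<tau> M D \<gamma> \<phi> by (rule mean_zero_layer[OF mz])
  have neumann: "neumann_solution \<tau> M D \<gamma> g (\<lambda>z. U z + C)" for C by (rule layer_neumann[OF eq])
  show ?thesis
  proof (intro bexI[OF _ mz] conjI ballI allI impI)
    fix z assume "z \<in> boundary M D"
    then obtain i s where ijs: "i \<in> J" "z = \<gamma> i s" unfolding boundary_eq by blast
    show "Kstar_converges \<tau> M D \<gamma> \<phi> z" unfolding ijs(2) by (rule Kstar_converges[OF \<phi> ijs(1)])
    show "1/2 * \<phi> z + Kstar \<tau> M D \<gamma> \<phi> z = g z"
      unfolding ijs(2) Kstar_eq[OF \<phi> ijs(1)] by (rule eq[OF ijs(1)])
  next
    fix \<psi> z assume \<psi>: "\<psi> \<in> mean_zero_functions M D \<gamma>" "\<forall>z\<in>boundary M D. 1/2 * \<psi> z + Kstar \<tau> M D \<gamma> \<psi> z = g z"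
      and "z \<in> boundary M D"
    then obtain i s where ijs: "i \<in> J" "z = \<gamma> i s" unfolding boundary_eq by blast
    \<comment> \<open>Continuity of the competitor gives convergence of its principal value, so that
      \<open>Kstar\<close> is the integral \<open>Kint\<close> for it as well.\<close>
    have \<psi>c: "continuous_on (boundary M D) \<psi>" using \<psi>(1) by (simp add: mean_zero_functions_def)
    have "1/2 * \<psi> (\<gamma> i s) + Kint \<psi> i s = g (\<gamma> i s)" if i: "i \<in> J" for i s
    proof -
      have "\<gamma> i s \<in> boundary M D" unfolding boundary_eq using i by blast
      from \<psi>(2)[rule_format, OF this] show ?thesis unfolding Kstar_eq[OF \<psi>c i] .
    qed
    hence "1/2 * \<phi> (\<gamma> i s) + Kint \<phi> i s = 1/2 * \<psi> (\<gamma> i s) + Kint \<psi> i s" if "i \<in> J" for i s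
      using that eq by simp
    from integral_equation_unique[OF mz \<psi>(1) this ijs(1)] show "\<psi> z = \<phi> z" unfolding ijs(2) .
  next
    fix C show "neumann_solution \<tau> M D \<gamma> g (\<lambda>z. U z + C)" by (rule neumann)
  next
    fix j assume j: "j \<in> J"
    show "arc_integral (\<gamma> j) g = arc_integral (\<gamma> j) \<phi>" by (rule layer_flux[OF eq j])
    fix C
    show "flux \<tau> M D \<gamma> (\<lambda>z. U z + C) j = arc_integral (\<gamma> j) g"
      unfolding flux_def
    proof (rule arc_integral_cong)
      fix t
      have "\<gamma> j t \<in> boundary M D" unfolding boundary_eq using j by blast
      \<comment> \<open>The normal derivative is a definite description; uniqueness of limits in the
        cone identifies it with the boundary datum at every point of the curve.\<close>
      thus "normal_deriv \<tau> M D \<gamma> (\<lambda>z. U z + C) (\<gamma> j t) = g (\<gamma> j t)"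
        using neumann[of C] by (intro normal_deriv_eq[OF j]) (simp add: neumann_solution_def)
    qed
  qed
qed



end
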